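(* Consider the network of $m$ control loops described in the context. Suppose that the schedulers of all control loops are admissible and that, for a given loop $i$, the scheduler follows the combined event-triggered transmission (CETT) policy with a given set of average triggering probabilities $\mathbf{P}^i=\{p^i_k\mid k\in\mathbb{N}_0\}$. Then the control policy $u^i_k=K_i\bar x^i_{k|k}$, where $$K_i=-(B_i^{\intercal}P_iB_i+R_i)^{-1}B_i^{\intercal}P_iA_i,\qquad P_i=A_i^{\intercal}P_iA_i+Q_i-K_i^{\intercal}(B_i^{\intercal}P_iB_i+R_i)K_i,$$ and $\bar x^i_{k|k}$ ($=\mathsf{E}[x^i_k\mid\mathsf{H}^i_k]$) is generated by $$\bar x^i_{k+1|k}=A_i\bar x^i_{k|k}+B_iu^i_k,\qquad \bar x^i_{k|k}=\begin{cases}\hat x^i_{k|k},&\sigma^i_k=1,\\ \bar x^i_{k|k-1},&\text{otherwise},\end{cases}$$ is optimal in the sense that it minimizes $$J^i=\limsup_{T\to\infty}\frac1T\,\mathsf{E}\Big[\sum_{k=0}^{T-1}x_k^{i\intercal}Q_ix_k^i+u_k^{i\intercal}R_iu_k^i\Big]$$ over control policies for loop $i$ in which $u^i_k$ is a function of $\mathsf{H}^i_k$.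
   Context: Systems. For $i\in\{1,\dots,m\}$, subsystem $i$ is $x^i_{k+1}=A_ix^i_k+B_iu^i_k+w^i_k$, $y^i_k=C_ix^i_k+v^i_k$, $k\in\mathbb{N}_0$, with $x^i_k\in\mathbb{R}^{n_i}$, $u^i_k\in\mathbb{R}^{m_i}$, $y^i_k\in\mathbb{R}^{o_i}$. The sequences $(w^i_k)_k$ and $(v^i_k)_k$ are i.i.d. zero-mean Gaussian with positive definite covariances $W_i$ and $V_i$. $(A_i,B_i)$ is controllable, $(A_i,C_i)$ is observable, $Q_i\succeq0$, $R_i\succ0$, and $(A_i,Q_i^{1/2})$ is observable. The random variables $x^i_0$, $w^i_k$, $v^i_k$ ($k\in\mathbb{N}_0$), together with the random variables $a^i_k\in\mathbb{R}^{r_i}$ internally generated by scheduler $i$, are called the primitive random variables of loop $i$; they are independent of each other, and the $a^i_k$ are independent of states, inputs and noises of all loops. Different loops are independent. $P_i$ denotes the positive definite solution of the displayed algebraic Riccati equation. Network. $\delta^i_k\in\{0,1\}$ equals 1 iff scheduler $i$ attempts a transmission at time $k$. The network is available to user $i$ iff no other user attempts: $\rho^i_k=\prod_{j\ne i}(1-\delta^j_k)$. The attempt succeeds iff $\sigma^i_k:=\rho^i_k\delta^i_k=1$; otherwise the data are lost, with no retransmission (an attempt with $\rho^i_k=0$ is a collision). There are no transmission delays. Information. The scheduler of loop $i$ knows $\mathsf{L}^i_k=\{\delta^i_\ell,y^i_\ell:0\le\ell\le k-1\}\cup\{\rho^i_\ell:\delta^i_\ell=1,\,0\le\ell\le k-1\}\cup\{y^i_k\}$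 and runs the stationary Kalman filter $\hat x^i_{k+1|k}=A_i\hat x^i_{k|k}+B_iu^i_k$, $\hat x^i_{k|k}=\hat x^i_{k|k-1}+L_i(y^i_k-C_i\hat x^i_{k|k-1})$, where $L_i=\bar\Theta_iC_i^{\intercal}(C_i\bar\Theta_iC_i^{\intercal}+V_i)^{-1}$, $\bar\Theta_i=A_i\Theta_iA_i^{\intercal}+W_i$, $\Theta_i=\bar\Theta_i-L_i(C_i\bar\Theta_iC_i^{\intercal}+V_i)L_i^{\intercal}$. The initial state $x^i_0$ is zero-mean Gaussian, with $\hat x^i_{0|-1}=\bar x^i_{0|-1}=0$, such that $\mathsf{E}[(x^i_0-\hat x^i_{0|0})(x^i_0-\hat x^i_{0|0})^{\intercal}\mid\mathsf{L}^i_0]=\Theta_i$ (so $\hat x^i_{k|k}=\mathsf{E}[x^i_k|\mathsf{L}^i_k]$ with error covariance $\Theta_i$ for all $k$). If $\delta^i_k=1$, scheduler $i$ sends $\hat x^i_{k|k}$. The controller of loop $i$ has the information $\mathsf{H}^i_k=\{\hat x^i_{\ell|\ell}:\sigma^i_\ell=1,\,0\le\ell\le k\}\cup\{\sigma^i_\ell:0\le\ell\le k\}$. Also $\mathsf{T}^i_k=\{\delta^i_\ell:0\le\ell\le k-1\}\cup\{\rho^i_\ell:\delta^i_\ell=1,\,0\le\ell\le k-1\}$. Admissible scheduler. A scheduler is admissible if $\delta^i_k$ depends only on the primitive random variables of its own loop, $\delta^i_k=g(x_0^i,w^i_{0:k-1},v^i_{0:k},a^i_{0:k})$ with $g$ $\{0,1\}$-valued.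 The CETT scheduler below, which in addition uses the past availabilities $\rho^i_\ell$, $\ell<k$, of its own loop, is counted as admissible. Purely stochastic transmission (PST): $\delta^{i,ps}_k$ is Bernoulli with success probability $p^i_k$, internally generated independently of everything else. Stochastic threshold event-triggered transmission (STETT): with $e^i_{k|k-1}=\hat x^i_{k|k}-\bar x^i_{k|k-1}$ and $\Psi^i_{k|k-1}=\mathsf{E}[e^i_{k|k-1}e^{i\intercal}_{k|k-1}\mid\mathsf{T}^i_k]$ (the rule presupposes that this is invertible), $\delta^{i,st}_k=1$ if $\tfrac12e^{i\intercal}_{k|k-1}(\Psi^i_{k|k-1})^{-1}e^i_{k|k-1}>r^i_k$ and $\delta^{i,st}_k=0$ otherwise, where $r^i_k$ is an internally generated independent exponential threshold with rate $\lambda^i_k\ge0$, i.e. $\mathsf{Pr}(r^i_k>s)=e^{-\lambda^i_ks}$ for $s\ge0$. CETT policy with probabilities $p^i_k$: let $\bar\ell^i_k=\max\{\ell<k:\sigma^i_\ell=1\}$ be the last successful transmission time before $k$ (with $\bar\ell^i_k=-1$ if there is none). Then $\delta^{i,\mu}_k=\delta^{i,st}_k$ with $\lambda^i_k=(1-p^i_k)^{-2/n_i}-1$ if $k=\bar\ell^i_k+1$ or $(\delta^{i,st}_{\bar\ell^i_k+1},\dots,\delta^{i,st}_{k-1})=(0,\dots,0)$, and $\delta^{i,\mu}_k=\delta^{i,ps}_k$ otherwise. That is, STETT is used after each successful transmission until the first collision, and PST afterwards until the next success. *)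

theory Defs
  imports
    "HOL-Probability.Probability"
    "Jordan_Normal_Form.Matrix"
    "Jordan_Normal_Form.Gauss_Jordan_Elimination"
begin

unbundle no vec_syntax
no_notation inner (infix "\<bullet>" 70)
hide_type (open) Finite_Cartesian_Product.vec
hide_const (open) Finite_Cartesian_Product.vec

text \<open>
  The dimensions vary from loop to loop, so vectors and matrices are the explicitly dimensioned
  ones of \<^theory>\<open>Jordan_Normal_Form.Matrix\<close>. Loops are numbered \<open>1, \<dots>, m\<close>.
\<close>

section \<open>Linear algebra\<close>

definition sym_mat :: "nat \<Rightarrow> real mat \<Rightarrow> bool" where
  "sym_mat n A \<longleftrightarrow> A \<in> carrier_mat n n \<and> transpose_mat A = A"

definition psd_mat :: "nat \<Rightarrow> real mat \<Rightarrow> bool" where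
  "psd_mat n A \<longleftrightarrow> sym_mat n A \<and> (\<forall>v\<in>carrier_vec n. 0 \<le> v \<bullet> (A *\<^sub>v v))"

definition pd_mat :: "nat \<Rightarrow> real mat \<Rightarrow> bool" where
  "pd_mat n A \<longleftrightarrow> sym_mat n A \<and> (\<forall>v\<in>carrier_vec n. v \<noteq> 0\<^sub>v n \<longrightarrow> 0 < v \<bullet> (A *\<^sub>v v))"

text \<open>Only meaningful for invertible square matrices.\<close>

definition mat_inv :: "real mat \<Rightarrow> real mat" where
  "mat_inv A = the (mat_inverse A)"

primrec lin_traj :: "real mat \<Rightarrow> real mat \<Rightarrow> real vec \<Rightarrow> (nat \<Rightarrow> real vec) \<Rightarrow> nat \<Rightarrow> real vec" where
  "lin_traj A B s u 0 = s"
| "lin_traj A B s u (Suc k) = A *\<^sub>v lin_traj A B s u k + B *\<^sub>v u k"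

definition controllable :: "nat \<Rightarrow> nat \<Rightarrow> real mat \<Rightarrow> real mat \<Rightarrow> bool" where
  "controllable n d A B \<longleftrightarrow>
     (\<forall>s\<in>carrier_vec n. \<forall>t\<in>carrier_vec n.
        \<exists>N u. (\<forall>k. u k \<in> carrier_vec d) \<and> lin_traj A B s u N = t)"

definition observable :: "nat \<Rightarrow> real mat \<Rightarrow> real mat \<Rightarrow> bool" where
  "observable n A C \<longleftrightarrow>
     (\<forall>s\<in>carrier_vec n. \<forall>t\<in>carrier_vec n.
        (\<forall>k. C *\<^sub>v ((A ^\<^sub>m k) *\<^sub>v s) = C *\<^sub>v ((A ^\<^sub>m k) *\<^sub>v t)) \<longrightarrow> s = t)"

section \<open>Random vectors\<close>

definition vec_borel :: "nat \<Rightarrow> real vec measure" where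
  "vec_borel n =
     vimage_algebra (carrier_vec n) (\<lambda>v. \<lambda>a\<in>{..<n}. v $ a) (Pi\<^sub>M {..<n} (\<lambda>_. borel))"

definition normal_law :: "real \<Rightarrow> real measure" where
  "normal_law v = (if v = 0 then return borel 0 else density lborel (normal_density 0 (sqrt v)))"

text \<open>Zero-mean Gaussian vectors: every linear functional is centred normal, possibly degenerate.\<close>

definition gaussian_vec :: "'w measure \<Rightarrow> nat \<Rightarrow> real mat \<Rightarrow> ('w \<Rightarrow> real vec) \<Rightarrow> bool" where
  "gaussian_vec M n \<Sigma> X \<longleftrightarrow>
     psd_mat n \<Sigma> \<and> X \<in> measurable M (vec_borel n) \<and>
     (\<forall>c\<in>carrier_vec n. distr M borel (\<lambda>\<omega>. c \<bullet> X \<omega>) = normal_law (c \<bullet> (\<Sigma> *\<^sub>v c)))"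

definition cond_second_moment ::
  "'w measure \<Rightarrow> 'w measure \<Rightarrow> nat \<Rightarrow> ('w \<Rightarrow> real vec) \<Rightarrow> 'w \<Rightarrow> real mat" where
  "cond_second_moment M F n X \<omega> =
     mat n n (\<lambda>(a, b). real_cond_exp M F (\<lambda>\<omega>'. X \<omega>' $ a * X \<omega>' $ b) \<omega>)"

definition is_cond_mean ::
  "'w measure \<Rightarrow> 'w measure \<Rightarrow> nat \<Rightarrow> ('w \<Rightarrow> real vec) \<Rightarrow> ('w \<Rightarrow> real vec) \<Rightarrow> bool" where
  "is_cond_mean M F n X Y \<longleftrightarrow>
     (\<forall>a<n. integrable M (\<lambda>\<omega>. X \<omega> $ a) \<and>
            (AE \<omega> in M. Y \<omega> $ a = real_cond_exp M F (\<lambda>\<omega>'. X \<omega>' $ a) \<omega>))"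

section \<open>Subsystems\<close>

record subsystem =
  dim_x :: nat
  dim_u :: nat
  dim_y :: nat
  dim_a :: nat
  mA :: "real mat"
  mB :: "real mat"
  mC :: "real mat"
  mW :: "real mat"
  mV :: "real mat"
  mQ :: "real mat"
  mR :: "real mat"
  mP :: "real mat"
  mTheta :: "real mat"

definition control_gain :: "subsystem \<Rightarrow> real mat" where
  "control_gain S =
     - (mat_inv (transpose_mat (mB S) * mP S * mB S + mR S) * (transpose_mat (mB S) * mP S * mA S))"

definition mTheta_bar :: "subsystem \<Rightarrow> real mat" where
  "mTheta_bar S = mA S * mTheta S * transpose_mat (mA S) + mW S"

definition innov_cov :: "subsystem \<Rightarrow> real mat" where
  "innov_cov S = mC S * mTheta_bar S * transpose_mat (mC S) + mV S"

definition kalman_gain :: "subsystem \<Rightarrow> real mat" where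
  "kalman_gain S = mTheta_bar S * transpose_mat (mC S) * mat_inv (innov_cov S)"

text \<open>The square root \<open>Q\<^sup>1\<^sup>/\<^sup>2\<close> is the (unique) positive semidefinite one.\<close>

definition subsystem_ok :: "subsystem \<Rightarrow> bool" where
  "subsystem_ok S \<longleftrightarrow>
     1 \<le> dim_x S \<and> 1 \<le> dim_u S \<and> 1 \<le> dim_y S \<and>
     mA S \<in> carrier_mat (dim_x S) (dim_x S) \<and>
     mB S \<in> carrier_mat (dim_x S) (dim_u S) \<and>
     mC S \<in> carrier_mat (dim_y S) (dim_x S) \<and>
     pd_mat (dim_x S) (mW S) \<and> pd_mat (dim_y S) (mV S) \<and>
     psd_mat (dim_x S) (mQ S) \<and> pd_mat (dim_u S) (mR S) \<and>
     controllable (dim_x S) (dim_u S) (mA S) (mB S) \<and>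
     observable (dim_x S) (mA S) (mC S) \<and>
     (\<exists>Qh. psd_mat (dim_x S) Qh \<and> Qh * Qh = mQ S \<and> observable (dim_x S) (mA S) Qh) \<and>
     pd_mat (dim_x S) (mP S) \<and>
     mP S = transpose_mat (mA S) * mP S * mA S + mQ S
        - transpose_mat (control_gain S) * (transpose_mat (mB S) * mP S * mB S + mR S)
            * control_gain S \<and>
     psd_mat (dim_x S) (mTheta S) \<and>
     mTheta S = mTheta_bar S - kalman_gain S * innov_cov S * transpose_mat (kalman_gain S)"

section \<open>Primitive random variables\<close>

datatype prim =
    Init nat
  | Proc_Noise nat nat
  | Meas_Noise nat nat
  | Internal nat nat

text \<open>The first argument is the loop, the second one the time.\<close>

primrec prim_loop :: "prim \<Rightarrow> nat" where
  "prim_loop (Init i) = i"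
| "prim_loop (Proc_Noise i k) = i"
| "prim_loop (Meas_Noise i k) = i"
| "prim_loop (Internal i k) = i"

primrec prim_dim :: "(nat \<Rightarrow> subsystem) \<Rightarrow> prim \<Rightarrow> nat" where
  "prim_dim S (Init i) = dim_x (S i)"
| "prim_dim S (Proc_Noise i k) = dim_x (S i)"
| "prim_dim S (Meas_Noise i k) = dim_y (S i)"
| "prim_dim S (Internal i k) = dim_a (S i)"

text \<open>
  The last conjunct is \<open>E[(x\<^sub>0 - xhat\<^sub>0\<^sub>|\<^sub>0)(x\<^sub>0 - xhat\<^sub>0\<^sub>|\<^sub>0)\<^sup>T | y\<^sub>0] = \<Theta>\<close>, where
  \<open>y\<^sub>0 = C x\<^sub>0 + v\<^sub>0\<close> and \<open>xhat\<^sub>0\<^sub>|\<^sub>0 = L y\<^sub>0\<close> because the initial prediction is \<open>0\<close>.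
\<close>

definition primitives_ok ::
  "'w measure \<Rightarrow> nat \<Rightarrow> (nat \<Rightarrow> subsystem) \<Rightarrow> (prim \<Rightarrow> 'w \<Rightarrow> real vec) \<Rightarrow> bool" where
  "primitives_ok M m S \<xi> \<longleftrightarrow>
     prob_space.indep_vars M (\<lambda>q. vec_borel (prim_dim S q)) \<xi> {q. prim_loop q \<in> {1..m}} \<and>
     (\<forall>i\<in>{1..m}.
        (\<forall>k. gaussian_vec M (dim_x (S i)) (mW (S i)) (\<xi> (Proc_Noise i k))) \<and>
        (\<forall>k. gaussian_vec M (dim_y (S i)) (mV (S i)) (\<xi> (Meas_Noise i k))) \<and>
        (\<exists>\<Sigma>. gaussian_vec M (dim_x (S i)) \<Sigma> (\<xi> (Init i))) \<and>
        (let y0 = (\<lambda>\<omega>. mC (S i) *\<^sub>v \<xi> (Init i) \<omega> + \<xi> (Meas_Noise i 0) \<omega>);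
             err = (\<lambda>\<omega>. \<xi> (Init i) \<omega> - kalman_gain (S i) *\<^sub>v y0 \<omega>)
         in AE \<omega> in M.
              cond_second_moment M (vimage_algebra (space M) y0 (vec_borel (dim_y (S i))))
                (dim_x (S i)) err \<omega> = mTheta (S i)))"

section \<open>Trajectories of the network\<close>

text \<open>
  All fields take a loop, a time and an outcome. \<open>kf_pred\<close> and \<open>kf_est\<close> are
  \<open>xhat\<^sub>k\<^sub>|\<^sub>k\<^sub>-\<^sub>1\<close> and \<open>xhat\<^sub>k\<^sub>|\<^sub>k\<close> (scheduler side); \<open>bar_pred\<close> and
  \<open>bar_est\<close> are \<open>xbar\<^sub>k\<^sub>|\<^sub>k\<^sub>-\<^sub>1\<close> and \<open>xbar\<^sub>k\<^sub>|\<^sub>k\<close> (controller side); \<open>attempt\<close> is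
  \<open>\<delta>\<^sub>k\<close>.
\<close>

record 'w trajectory =
  state :: "nat \<Rightarrow> nat \<Rightarrow> 'w \<Rightarrow> real vec"
  control :: "nat \<Rightarrow> nat \<Rightarrow> 'w \<Rightarrow> real vec"
  outp :: "nat \<Rightarrow> nat \<Rightarrow> 'w \<Rightarrow> real vec"
  kf_pred :: "nat \<Rightarrow> nat \<Rightarrow> 'w \<Rightarrow> real vec"
  kf_est :: "nat \<Rightarrow> nat \<Rightarrow> 'w \<Rightarrow> real vec"
  bar_pred :: "nat \<Rightarrow> nat \<Rightarrow> 'w \<Rightarrow> real vec"
  bar_est :: "nat \<Rightarrow> nat \<Rightarrow> 'w \<Rightarrow> real vec"
  attempt :: "nat \<Rightarrow> nat \<Rightarrow> 'w \<Rightarrow> bool"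

definition avail :: "nat \<Rightarrow> 'w trajectory \<Rightarrow> nat \<Rightarrow> nat \<Rightarrow> 'w \<Rightarrow> bool" where
  "avail m z i k \<omega> \<longleftrightarrow> (\<forall>j\<in>{1..m} - {i}. \<not> attempt z j k \<omega>)"

definition success :: "nat \<Rightarrow> 'w trajectory \<Rightarrow> nat \<Rightarrow> nat \<Rightarrow> 'w \<Rightarrow> bool" where
  "success m z i k \<omega> \<longleftrightarrow> avail m z i k \<omega> \<and> attempt z i k \<omega>"

definition last_success :: "nat \<Rightarrow> 'w trajectory \<Rightarrow> nat \<Rightarrow> nat \<Rightarrow> 'w \<Rightarrow> int" where
  "last_success m z i k \<omega> =
     (if \<exists>l<k. success m z i l \<omega> then int (Max {l. l < k \<and> success m z i l \<omega>}) else -1)"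

text \<open>
  The information \<open>H\<^sub>k\<close> of the controller, with the estimate masked by \<open>0\<close> at times without
  successful transmission, and the sigma-algebra it generates.
\<close>

definition hist ::
  "nat \<Rightarrow> (nat \<Rightarrow> subsystem) \<Rightarrow> 'w trajectory \<Rightarrow> nat \<Rightarrow> nat \<Rightarrow> 'w \<Rightarrow> (nat \<Rightarrow> bool \<times> real vec)" where
  "hist m S z i k \<omega> =
     (\<lambda>l\<in>{..k}. (success m z i l \<omega>,
                  if success m z i l \<omega> then kf_est z i l \<omega> else 0\<^sub>v (dim_x (S i))))"

definition hist_space :: "subsystem \<Rightarrow> nat \<Rightarrow> (nat \<Rightarrow> bool \<times> real vec) measure" where
  "hist_space S k = Pi\<^sub>M {..k} (\<lambda>_. count_space UNIV \<Otimes>\<^sub>M vec_borel (dim_x S))"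

definition H_alg ::
  "'w measure \<Rightarrow> nat \<Rightarrow> (nat \<Rightarrow> subsystem) \<Rightarrow> 'w trajectory \<Rightarrow> nat \<Rightarrow> nat \<Rightarrow> 'w measure" where
  "H_alg M m S z i k = vimage_algebra (space M) (hist m S z i k) (hist_space (S i) k)"

text \<open>
  The sigma-algebra generated by \<open>T\<^sub>k\<close>; \<open>\<rho>\<^sub>l\<close> is known only where \<open>\<delta>\<^sub>l = 1\<close>.
\<close>

definition T_alg :: "'w measure \<Rightarrow> nat \<Rightarrow> 'w trajectory \<Rightarrow> nat \<Rightarrow> nat \<Rightarrow> 'w measure" where
  "T_alg M m z i k =
     vimage_algebra (space M)
       (\<lambda>\<omega>. \<lambda>l\<in>{..<k}. (attempt z i l \<omega>,
                          if attempt z i l \<omega> then Some (avail m z i l \<omega>) else None))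
       (Pi\<^sub>M {..<k} (\<lambda>_. count_space UNIV))"

section \<open>Schedulers\<close>

text \<open>
  \<open>Open_Loop g\<close> attempts by a rule \<open>g\<close> in the primitive random variables of its own loop.
  \<open>CETT p \<beta> r\<close> is combined event-triggered transmission with triggering probabilities \<open>p\<close>;
  its Bernoulli variable and its threshold at time \<open>k\<close> are the functions \<open>\<beta> k\<close> and \<open>r k\<close> of the
  internal random vector \<open>a\<^sub>k\<close>.
\<close>

datatype scheduler =
    Open_Loop "nat \<Rightarrow> (prim \<Rightarrow> real vec) \<Rightarrow> bool"
  | CETT "nat \<Rightarrow> real" "nat \<Rightarrow> real vec \<Rightarrow> bool" "nat \<Rightarrow> real vec \<Rightarrow> ennreal"

definition own_prims :: "nat \<Rightarrow> nat \<Rightarrow> prim set" where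
  "own_prims i k = {Init i} \<union> Proc_Noise i ` {..<k} \<union> Meas_Noise i ` {..k} \<union> Internal i ` {..k}"

definition cett_rate :: "nat \<Rightarrow> real \<Rightarrow> real" where
  "cett_rate n p = (1 - p) powr (- 2 / real n) - 1"

text \<open>
  Tail \<open>Pr(r > s)\<close> of the exponential threshold. Rate \<open>0\<close> (for \<open>p = 0\<close>) is the constant threshold
  \<open>\<infinity>\<close>; for \<open>p = 1\<close> the rate formula diverges and the limiting law, the constant threshold \<open>0\<close>, is used.
\<close>

definition threshold_tail :: "nat \<Rightarrow> real \<Rightarrow> real \<Rightarrow> real" where
  "threshold_tail n p s = (if p = 1 then 0 else exp (- cett_rate n p * s))"

primrec admissible_scheduler ::
  "'w measure \<Rightarrow> (nat \<Rightarrow> subsystem) \<Rightarrow> (prim \<Rightarrow> 'w \<Rightarrow> real vec) \<Rightarrow> nat \<Rightarrow> scheduler \<Rightarrow> bool" where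
  "admissible_scheduler M S \<xi> i (Open_Loop g) \<longleftrightarrow>
     (\<forall>k. g k \<in> measurable (Pi\<^sub>M (own_prims i k) (\<lambda>q. vec_borel (prim_dim S q))) (count_space UNIV))"
| "admissible_scheduler M S \<xi> i (CETT p \<beta> r) \<longleftrightarrow>
     (\<forall>k. p k \<in> {0..1} \<and>
          \<beta> k \<in> measurable (vec_borel (dim_a (S i))) (count_space UNIV) \<and>
          r k \<in> borel_measurable (vec_borel (dim_a (S i))) \<and>
          measure M {\<omega> \<in> space M. \<beta> k (\<xi> (Internal i k) \<omega>)} = p k \<and>
          (\<forall>s\<ge>0. measure M {\<omega> \<in> space M. r k (\<xi> (Internal i k) \<omega>) > ennreal s}
                    = threshold_tail (dim_x (S i)) (p k) s) \<and>
          prob_space.indep_set M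
            (sets (vimage_algebra (space M) (\<lambda>\<omega>. \<beta> k (\<xi> (Internal i k) \<omega>)) (count_space UNIV)))
            (sets (vimage_algebra (space M) (\<lambda>\<omega>. r k (\<xi> (Internal i k) \<omega>)) borel)))"

definition est_gap :: "'w trajectory \<Rightarrow> nat \<Rightarrow> nat \<Rightarrow> 'w \<Rightarrow> real vec" where
  "est_gap z i k \<omega> = kf_est z i k \<omega> - bar_pred z i k \<omega>"

definition Psi ::
  "'w measure \<Rightarrow> nat \<Rightarrow> (nat \<Rightarrow> subsystem) \<Rightarrow> 'w trajectory \<Rightarrow> nat \<Rightarrow> nat \<Rightarrow> 'w \<Rightarrow> real mat" where
  "Psi M m S z i k = cond_second_moment M (T_alg M m z i k) (dim_x (S i)) (est_gap z i k)"

definition stett_attempt ::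
  "'w measure \<Rightarrow> nat \<Rightarrow> (nat \<Rightarrow> subsystem) \<Rightarrow> (prim \<Rightarrow> 'w \<Rightarrow> real vec) \<Rightarrow> 'w trajectory \<Rightarrow>
   (nat \<Rightarrow> real vec \<Rightarrow> ennreal) \<Rightarrow> nat \<Rightarrow> nat \<Rightarrow> 'w \<Rightarrow> bool" where
  "stett_attempt M m S \<xi> z r i k \<omega> \<longleftrightarrow>
     ennreal (1/2 * (est_gap z i k \<omega> \<bullet> (mat_inv (Psi M m S z i k \<omega>) *\<^sub>v est_gap z i k \<omega>)))
       > r k (\<xi> (Internal i k) \<omega>)"

text \<open>The times at which CETT applies the threshold rule.\<close>

definition stett_phase ::
  "'w measure \<Rightarrow> nat \<Rightarrow> (nat \<Rightarrow> subsystem) \<Rightarrow> (prim \<Rightarrow> 'w \<Rightarrow> real vec) \<Rightarrow> 'w trajectory \<Rightarrow>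
   (nat \<Rightarrow> real vec \<Rightarrow> ennreal) \<Rightarrow> nat \<Rightarrow> nat \<Rightarrow> 'w \<Rightarrow> bool" where
  "stett_phase M m S \<xi> z r i k \<omega> \<longleftrightarrow>
     int k = last_success m z i k \<omega> + 1 \<or>
     (\<forall>l<k. last_success m z i k \<omega> < int l \<longrightarrow> \<not> stett_attempt M m S \<xi> z r i l \<omega>)"

primrec follows_scheduler ::
  "'w measure \<Rightarrow> nat \<Rightarrow> (nat \<Rightarrow> subsystem) \<Rightarrow> (prim \<Rightarrow> 'w \<Rightarrow> real vec) \<Rightarrow> 'w trajectory \<Rightarrow>
   nat \<Rightarrow> scheduler \<Rightarrow> bool" where
  "follows_scheduler M m S \<xi> z i (Open_Loop g) \<longleftrightarrow>
     (\<forall>k. \<forall>\<omega>\<in>space M. attempt z i k \<omega> \<longleftrightarrow> g k (\<lambda>q\<in>own_prims i k. \<xi> q \<omega>))"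
| "follows_scheduler M m S \<xi> z i (CETT p \<beta> r) \<longleftrightarrow>
     (\<forall>k. \<forall>\<omega>\<in>space M. attempt z i k \<omega> \<longleftrightarrow>
        (if stett_phase M m S \<xi> z r i k \<omega> then stett_attempt M m S \<xi> z r i k \<omega>
         else \<beta> k (\<xi> (Internal i k) \<omega>)))"

text \<open>The threshold rule presupposes an invertible \<^const>\<open>Psi\<close> wherever it is applied.\<close>

primrec scheduler_well_posed ::
  "'w measure \<Rightarrow> nat \<Rightarrow> (nat \<Rightarrow> subsystem) \<Rightarrow> (prim \<Rightarrow> 'w \<Rightarrow> real vec) \<Rightarrow> 'w trajectory \<Rightarrow>
   nat \<Rightarrow> scheduler \<Rightarrow> bool" where
  "scheduler_well_posed M m S \<xi> z i (Open_Loop g) \<longleftrightarrow> True"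
| "scheduler_well_posed M m S \<xi> z i (CETT p \<beta> r) \<longleftrightarrow>
     (\<forall>k. AE \<omega> in M. stett_phase M m S \<xi> z r i k \<omega> \<longrightarrow> invertible_mat (Psi M m S z i k \<omega>))"

section \<open>Dynamics, control policies and cost\<close>

text \<open>
  Together with a control policy for every loop, these equations determine the trajectory
  recursively in time.
\<close>

definition network_dynamics ::
  "'w measure \<Rightarrow> nat \<Rightarrow> (nat \<Rightarrow> subsystem) \<Rightarrow> (prim \<Rightarrow> 'w \<Rightarrow> real vec) \<Rightarrow>
   (nat \<Rightarrow> scheduler) \<Rightarrow> 'w trajectory \<Rightarrow> bool" where
  "network_dynamics M m S \<xi> sched z \<longleftrightarrow>
     (\<forall>i\<in>{1..m}. \<forall>\<omega>\<in>space M.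
        state z i 0 \<omega> = \<xi> (Init i) \<omega> \<and>
        kf_pred z i 0 \<omega> = 0\<^sub>v (dim_x (S i)) \<and>
        bar_pred z i 0 \<omega> = 0\<^sub>v (dim_x (S i)) \<and>
        (\<forall>k.
          state z i (Suc k) \<omega>
            = mA (S i) *\<^sub>v state z i k \<omega> + mB (S i) *\<^sub>v control z i k \<omega> + \<xi> (Proc_Noise i k) \<omega> \<and>
          outp z i k \<omega> = mC (S i) *\<^sub>v state z i k \<omega> + \<xi> (Meas_Noise i k) \<omega> \<and>
          kf_est z i k \<omega>
            = kf_pred z i k \<omega>
              + kalman_gain (S i) *\<^sub>v (outp z i k \<omega> - mC (S i) *\<^sub>v kf_pred z i k \<omega>) \<and>
          kf_pred z i (Suc k) \<omega>
            = mA (S i) *\<^sub>v kf_est z i k \<omega> + mB (S i) *\<^sub>v control z i k \<omega> \<and>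
          bar_est z i k \<omega>
            = (if success m z i k \<omega> then kf_est z i k \<omega> else bar_pred z i k \<omega>) \<and>
          bar_pred z i (Suc k) \<omega>
            = mA (S i) *\<^sub>v bar_est z i k \<omega> + mB (S i) *\<^sub>v control z i k \<omega>)) \<and>
     (\<forall>i\<in>{1..m}. follows_scheduler M m S \<xi> z i (sched i))"

definition control_policies :: "subsystem \<Rightarrow> (nat \<Rightarrow> (nat \<Rightarrow> bool \<times> real vec) \<Rightarrow> real vec) set" where
  "control_policies S = {\<gamma>. \<forall>k. \<gamma> k \<in> measurable (hist_space S k) (vec_borel (dim_u S))}"

definition applies_policy ::
  "'w measure \<Rightarrow> nat \<Rightarrow> (nat \<Rightarrow> subsystem) \<Rightarrow> 'w trajectory \<Rightarrow> nat \<Rightarrow>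
   (nat \<Rightarrow> (nat \<Rightarrow> bool \<times> real vec) \<Rightarrow> real vec) \<Rightarrow> bool" where
  "applies_policy M m S z i \<gamma> \<longleftrightarrow>
     (\<forall>k. \<forall>\<omega>\<in>space M. control z i k \<omega> = \<gamma> k (hist m S z i k \<omega>))"

text \<open>The expected cost may be infinite, hence extended nonnegative reals.\<close>

definition lqg_cost ::
  "'w measure \<Rightarrow> (nat \<Rightarrow> subsystem) \<Rightarrow> 'w trajectory \<Rightarrow> nat \<Rightarrow> ennreal" where
  "lqg_cost M S z i =
     limsup (\<lambda>T. (\<integral>\<^sup>+ \<omega>. ennreal (\<Sum>k<T.
         state z i k \<omega> \<bullet> (mQ (S i) *\<^sub>v state z i k \<omega>)
         + control z i k \<omega> \<bullet> (mR (S i) *\<^sub>v control z i k \<omega>)) \<partial>M) / of_nat T)"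

end

theory Submission
  imports Defs "Jordan_Normal_Form.Determinant"
begin

text \<open>
  The estimation gap \<open>xhat\<^sub>k\<^sub>|\<^sub>k - xbar\<^sub>k\<^sub>|\<^sub>k\<^sub>-\<^sub>1\<close> obeys a recursion driven by the innovations of the Kalman
  filter, and neither involves the controls. Hence all transmission decisions are the same under every
  control policy. The innovations are independent centred Gaussian vectors, and the threshold rule is even
  in the gap. By induction, given the information of the controller the part of the gap that has not been
  transmitted has a symmetric law, so \<open>xbar\<^sub>k\<^sub>|\<^sub>k\<close> is the conditional mean and the estimation error is
  orthogonal to everything the controller can compute.

  Completing squares with the Riccati matrix \<open>P\<close> writes the cost up to time \<open>T\<close> as a term common to all
  policies, plus \<open>E (u\<^sub>k - K xbar\<^sub>k\<^sub>|\<^sub>k)\<^sup>T (B\<^sup>TPB + R) (u\<^sub>k - K xbar\<^sub>k\<^sub>|\<^sub>k)\<close> summed over \<open>k < T\<close>, minus the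
  terminal term \<open>E x\<^sub>T\<^sup>T P x\<^sub>T\<close>. The sum vanishes for the certainty equivalent controller. For a policy of
  finite average cost, observability through \<open>Q\<^sup>1\<^sup>/\<^sup>2\<close> bounds the time average of \<open>E |x\<^sub>k|\<^sup>2\<close>, which suffices to
  neglect the terminal term because the common term is nondecreasing in \<open>T\<close>.
\<close>

section \<open>Uniqueness of joint characteristic functions\<close>

text \<open>Collisions couple the loops: other CETT schedulers react to the attempts of loop
  \<open>i\<close>, so their later behaviour is not independent of its noise. What survives is a
  statement about a filtration: the information before time \<open>k\<close>, enlarged by all
  primitives other than the Gaussian noise of loop \<open>i\<close>, determines the attempts of the
  other loops at time \<open>k\<close>, and hence the availability, while the current gap is still
  conditionally symmetric. A vanishing conditional mean would not propagate, because the decision is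
  nonlinear in the gap; symmetry under a sign flip does. Evenness of the decision is delicate where
  \<open>Psi\<close> is singular, since \<open>mat_inv\<close> is then unspecified; well-posedness
  confines this to a null set. Under a general policy the state need not be Gaussian, so Gaussian
  arguments are made for linear combinations of primitives only. Equality of decisions across
  policies is proved at every outcome, not merely almost everywhere, so that trajectories can be
  compared directly.\<close>

lemma finite_measure_char_uniqueness:
  fixes X :: "'a \<Rightarrow> real" and Y :: "'b \<Rightarrow> real"
  assumes "finite_measure M" "finite_measure N"
    and X: "X \<in> borel_measurable M" and Y: "Y \<in> borel_measurable N"
    and eq: "\<And>s. (CLINT \<omega>|M. iexp (s * X \<omega>)) = (CLINT \<omega>|N. iexp (s * Y \<omega>))"
    and B: "B \<in> sets borel"
  shows "measure M {\<omega> \<in> space M. X \<omega> \<in> B} = measure N {\<omega> \<in> space N. Y \<omega> \<in> B}"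
proof -
  interpret M: finite_measure M by fact
  interpret N: finite_measure N by fact
  define c where "c = measure M (space M)"
  have cN: "c = measure N (space N)"
    using eq[of 0] by (simp add: c_def)
  show ?thesis
  proof (cases "c = 0")
    case True
    have "measure M {\<omega> \<in> space M. X \<omega> \<in> B} \<le> 0"
      using M.bounded_measure[of "{\<omega> \<in> space M. X \<omega> \<in> B}"] True by (simp add: c_def)
    moreover have "measure N {\<omega> \<in> space N. Y \<omega> \<in> B} \<le> 0"
      using N.bounded_measure[of "{\<omega> \<in> space N. Y \<omega> \<in> B}"] True by (simp add: cN)
    ultimately show ?thesis
      by (metis measure_nonneg order_antisym)
  next
    case False
    then have c: "c > 0"
      by (simp add: c_def order_less_le)
    \<comment> \<open>Levy uniqueness concerns probability laws. Dividing by the common mass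
      \<open>c\<close>, which is the transform at 0, reduces to them.\<close>
    have *: "real_distribution (distr (density L (\<lambda>_. ennreal (1/c))) borel Z) \<and>
        char (distr (density L (\<lambda>_. ennreal (1/c))) borel Z) = (\<lambda>t. (1/c) *\<^sub>R (CLINT \<omega>|L. iexp (t * Z \<omega>))) \<and>
        measure (distr (density L (\<lambda>_. ennreal (1/c))) borel Z) B = 1/c * measure L {\<omega> \<in> space L. Z \<omega> \<in> B}"
      if L: "finite_measure L" and Z[measurable]: "Z \<in> borel_measurable L" and cL: "c = measure L (space L)"
      for L :: "'d measure" and Z
    proof -
      interpret L: finite_measure L by fact
      have "emeasure (density L (\<lambda>_. ennreal (1/c))) (space L) = ennreal (1/c) * emeasure L (space L)"
        by (subst emeasure_density) (auto simp: nn_integral_cmult)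
      also have "\<dots> = ennreal (1/c * c)"
        using c by (subst ennreal_mult'') (auto simp: L.emeasure_eq_measure cL)
      finally have 1: "prob_space (density L (\<lambda>_. ennreal (1/c)))"
        using c by (intro prob_spaceI) simp
      have 2: "Z \<in> borel_measurable (density L (\<lambda>_. ennreal (1/c)))"
        by simp
      have "measure (distr (density L (\<lambda>_. ennreal (1/c))) borel Z) B
          = measure (density L (\<lambda>_. ennreal (1/c))) {\<omega> \<in> space L. Z \<omega> \<in> B}"
        using B by (subst measure_distr) (auto intro!: arg_cong2[where f=measure])
      also have "\<dots> = enn2real (ennreal (1/c) * emeasure L {\<omega> \<in> space L. Z \<omega> \<in> B})"
        using B unfolding measure_def by (subst emeasure_density) (auto simp: nn_integral_cmult)
      also have "\<dots> = 1/c * measure L {\<omega> \<in> space L. Z \<omega> \<in> B}"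
        using c by (simp add: enn2real_mult measure_def)
      finally have 3: "measure (distr (density L (\<lambda>_. ennreal (1/c))) borel Z) B
          = 1/c * measure L {\<omega> \<in> space L. Z \<omega> \<in> B}" .
      have "char (distr (density L (\<lambda>_. ennreal (1/c))) borel Z) = (\<lambda>t. (1/c) *\<^sub>R (CLINT \<omega>|L. iexp (t * Z \<omega>)))"
        unfolding char_def using c
        by (subst integral_distr; simp; subst integral_density) (auto simp: fun_eq_iff)
      with 1 2 3 show ?thesis
        by (auto intro: prob_space.real_distribution_distr)
    qed
    have "distr (density M (\<lambda>_. ennreal (1/c))) borel X = distr (density N (\<lambda>_. ennreal (1/c))) borel Y"
      using *[OF assms(1) X c_def] *[OF assms(2) Y cN] by (intro Levy_uniqueness) (simp_all only: eq)
    then have "1/c * measure M {\<omega> \<in> space M. X \<omega> \<in> B} = 1/c * measure N {\<omega> \<in> space N. Y \<omega> \<in> B}"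
      using *[OF assms(1) X c_def] *[OF assms(2) Y cN] by metis
    with c show ?thesis by simp
  qed
qed

text \<open>\<open>1 + cos\<close> is a nonnegative weight whose product with \<open>iexp u\<close>
  is a combination of \<open>iexp\<close> at \<open>u\<close>, \<open>u + s\<close> and
  \<open>u - s\<close>. Tilting a measure by it keeps its transform expressible through the joint
  characteristic function.\<close>

lemma iexp_times_one_plus_cos:
  "(1 + cos (s - \<phi>)) *\<^sub>R iexp u
    = iexp u + (iexp (- \<phi>) / 2) * iexp (u + s) + (iexp \<phi> / 2) * iexp (u - s)"
proof -
  have mult: "iexp a * iexp b = iexp (a + b)" for a b :: real
    by (simp add: exp_add[symmetric] distrib_left)
  have cos: "complex_of_real (cos x) = (iexp x + iexp (- x)) / 2" for x :: real
    by (subst cos_of_real[symmetric], subst cos_exp_eq) simp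
  have "(1 + cos (s - \<phi>)) *\<^sub>R iexp u = iexp u + (iexp (s - \<phi>) * iexp u + iexp (- (s - \<phi>)) * iexp u) / 2"
    by (simp only: scaleR_conv_of_real of_real_add of_real_1 cos distrib_right mult_1_left times_divide_eq_left)
  also have "\<dots> = iexp u + (iexp (- \<phi>) * iexp (u + s) + iexp \<phi> * iexp (u - s)) / 2"
  proof -
    have "s - \<phi> + u = - \<phi> + (u + s)" "- (s - \<phi>) + u = \<phi> + (u - s)"
      by simp_all
    then show ?thesis
      by (simp only: mult)
  qed
  finally show ?thesis
    by (simp only: add_divide_distrib times_divide_eq_left add.assoc)
qed

lemma (in finite_measure) integrable_iexp_fun:
  "f \<in> borel_measurable M \<Longrightarrow> complex_integrable M (\<lambda>\<omega>. iexp (f \<omega>))"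
  by (rule integrable_const_bound[where B=1]) auto

lemma (in finite_measure) finite_measure_density_bounded:
  assumes [measurable]: "f \<in> borel_measurable M" and "\<And>x. f x \<le> c"
  shows "finite_measure (density M (\<lambda>x. ennreal (f x)))"
proof (rule finite_measureI)
  have "emeasure (density M (\<lambda>x. ennreal (f x))) (space M) \<le> (\<integral>\<^sup>+ x. ennreal c \<partial>M)"
    by (subst emeasure_density) (auto intro!: nn_integral_mono simp: assms ennreal_leI simp del: nn_integral_const split: split_indicator)
  also have "\<dots> < \<infinity>"
    by (simp add: ennreal_mult_less_top emeasure_eq_measure)
  finally show "emeasure (density M (\<lambda>x. ennreal (f x))) (space (density M (\<lambda>x. ennreal (f x)))) \<noteq> \<infinity>"
    by simp
qed

text \<open>Frees one coordinate from the transform while \<open>S\<close> stays in it.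
  One-dimensional uniqueness is applied to \<open>X\<close> under the measures tilted by
  \<open>1 + cos (S - \<phi>)\<close>; letting \<open>\<phi>\<close> vary recovers the cosine and
  sine parts of \<open>iexp S\<close>.\<close>

lemma joint_char_split:
  fixes X S :: "'a \<Rightarrow> real" and Y S' :: "'b \<Rightarrow> real"
  assumes "finite_measure M" "finite_measure N"
    and [measurable]: "X \<in> borel_measurable M" "S \<in> borel_measurable M"
      "Y \<in> borel_measurable N" "S' \<in> borel_measurable N"
    and eq: "\<And>s u. (CLINT \<omega>|M. iexp (s * X \<omega> + u * S \<omega>)) = (CLINT \<omega>|N. iexp (s * Y \<omega> + u * S' \<omega>))"
    and B[measurable]: "B \<in> sets borel"
  shows "(CLINT \<omega>|M. indicator B (X \<omega>) *\<^sub>R iexp (S \<omega>)) = (CLINT \<omega>|N. indicator B (Y \<omega>) *\<^sub>R iexp (S' \<omega>))"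
proof -
  interpret M: finite_measure M by fact
  interpret N: finite_measure N by fact
  have transform: "(CLINT \<omega>|density L (\<lambda>\<omega>. ennreal (1 + cos (T \<omega> - \<phi>))). iexp (s * Z \<omega>))
     = (CLINT \<omega>|L. iexp (s * Z \<omega> + 0 * T \<omega>)) + (iexp (- \<phi>) / 2) * (CLINT \<omega>|L. iexp (s * Z \<omega> + 1 * T \<omega>))
       + (iexp \<phi> / 2) * (CLINT \<omega>|L. iexp (s * Z \<omega> + (-1) * T \<omega>))"
    if "finite_measure L" and [measurable]: "Z \<in> borel_measurable L" "T \<in> borel_measurable L"
    for L :: "'d measure" and Z T \<phi> s
  proof -
    interpret L: finite_measure L by fact
    have nn: "0 \<le> 1 + cos (x::real)" for x
      using cos_ge_minus_one[of x] by linarith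
    have "(CLINT \<omega>|density L (\<lambda>\<omega>. ennreal (1 + cos (T \<omega> - \<phi>))). iexp (s * Z \<omega>))
        = (CLINT \<omega>|L. (1 + cos (T \<omega> - \<phi>)) *\<^sub>R iexp (s * Z \<omega>))"
      by (subst integral_density) (auto simp: nn)
    also have "\<dots> = (CLINT \<omega>|L. iexp (s * Z \<omega>) + (iexp (- \<phi>) / 2) * iexp (s * Z \<omega> + T \<omega>)
           + (iexp \<phi> / 2) * iexp (s * Z \<omega> - T \<omega>))"
      unfolding iexp_times_one_plus_cos by simp
    also have "\<dots> = (CLINT \<omega>|L. iexp (s * Z \<omega>)) + (iexp (- \<phi>) / 2) * (CLINT \<omega>|L. iexp (s * Z \<omega> + T \<omega>))
           + (iexp \<phi> / 2) * (CLINT \<omega>|L. iexp (s * Z \<omega> - T \<omega>))"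
      using L.integrable_iexp_fun[of "\<lambda>\<omega>. s * Z \<omega>"] L.integrable_iexp_fun[of "\<lambda>\<omega>. s * Z \<omega> + T \<omega>"]
        L.integrable_iexp_fun[of "\<lambda>\<omega>. s * Z \<omega> - T \<omega>"]
      by (simp del: of_real_add of_real_diff of_real_mult)
    finally show ?thesis by simp
  qed
  have mass: "measure (density L (\<lambda>\<omega>. ennreal (1 + cos (T \<omega> - \<phi>)))) {\<omega> \<in> space L. Z \<omega> \<in> B}
      = (LINT \<omega>|L. indicator B (Z \<omega>)) + (LINT \<omega>|L. indicator B (Z \<omega>) * cos (T \<omega> - \<phi>))"
    if "finite_measure L" and [measurable]: "Z \<in> borel_measurable L" "T \<in> borel_measurable L"
    for L :: "'d measure" and Z T \<phi>
  proof -
    interpret L: finite_measure L by fact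
    have nn: "0 \<le> 1 + cos (x::real)" for x
      using cos_ge_minus_one[of x] by linarith
    have i1: "integrable L (\<lambda>\<omega>. indicator B (Z \<omega>) :: real)"
      by (rule L.integrable_const_bound[where B=1]) auto
    have i2: "integrable L (\<lambda>\<omega>. indicator B (Z \<omega>) * cos (T \<omega> - \<phi>))"
      by (rule L.integrable_const_bound[where B=1]) (auto simp: indicator_def)
    have "measure (density L (\<lambda>\<omega>. ennreal (1 + cos (T \<omega> - \<phi>)))) {\<omega> \<in> space L. Z \<omega> \<in> B}
        = enn2real (\<integral>\<^sup>+\<omega>. ennreal (indicator B (Z \<omega>) * (1 + cos (T \<omega> - \<phi>))) \<partial>L)"
      unfolding measure_def
      by (subst emeasure_density) (auto intro!: arg_cong[where f=enn2real] nn_integral_cong simp: indicator_def)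
    also have "\<dots> = (LINT \<omega>|L. indicator B (Z \<omega>) * (1 + cos (T \<omega> - \<phi>)))"
      by (subst integral_eq_nn_integral) (auto simp: nn)
    also have "\<dots> = (LINT \<omega>|L. indicator B (Z \<omega>) + indicator B (Z \<omega>) * cos (T \<omega> - \<phi>))"
      by (simp add: algebra_simps)
    finally show ?thesis using i1 i2 by simp
  qed
  have fin: "finite_measure (density L (\<lambda>\<omega>. ennreal (1 + cos (T \<omega> - \<phi>))))"
    if "finite_measure L" "T \<in> borel_measurable L" for L :: "'d measure" and T \<phi>
    using that by (intro finite_measure.finite_measure_density_bounded[where c=2]) (auto simp: algebra_simps)
  have e1: "measure (density M (\<lambda>\<omega>. ennreal (1 + cos (S \<omega> - \<phi>)))) {\<omega> \<in> space M. X \<omega> \<in> B}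
      = measure (density N (\<lambda>\<omega>. ennreal (1 + cos (S' \<omega> - \<phi>)))) {\<omega> \<in> space N. Y \<omega> \<in> B}" for \<phi>
    using finite_measure_char_uniqueness[OF fin[OF assms(1) assms(4), of \<phi>] fin[OF assms(2) assms(6), of \<phi>], of X Y B]
    by (simp only: transform[OF assms(1,3,4)] transform[OF assms(2,5,6)] eq) (simp add: assms)
  \<comment> \<open>The cosines for the phases 0 and \<open>pi\<close> cancel in the sum, which
    isolates the untilted mass.\<close>
  have e2: "(LINT \<omega>|M. indicator B (X \<omega>)) = (LINT \<omega>|N. indicator B (Y \<omega>) :: real)"
    using e1[of 0] e1[of pi] unfolding mass[OF assms(1,3,4)] mass[OF assms(2,5,6)] by simp
  have e3: "(LINT \<omega>|M. indicator B (X \<omega>) * cos (S \<omega> - \<phi>)) = (LINT \<omega>|N. indicator B (Y \<omega>) * cos (S' \<omega> - \<phi>))" for \<phi>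
    using e1[of \<phi>] e2 unfolding mass[OF assms(1,3,4)] mass[OF assms(2,5,6)] by simp
  \<comment> \<open>Phase 0 gives the real part, phase \<open>pi / 2\<close> the imaginary
    part.\<close>
  have e: "(CLINT \<omega>|L. indicator B (Z \<omega>) *\<^sub>R iexp (T \<omega>))
     = of_real (LINT \<omega>|L. indicator B (Z \<omega>) * cos (T \<omega> - 0)) + \<i> * of_real (LINT \<omega>|L. indicator B (Z \<omega>) * cos (T \<omega> - pi/2))"
    if "finite_measure L" and [measurable]: "Z \<in> borel_measurable L" "T \<in> borel_measurable L"
    for L :: "'d measure" and Z T
  proof -
    interpret L: finite_measure L by fact
    have i: "integrable L (\<lambda>\<omega>. indicator B (Z \<omega>) * cos (T \<omega> - \<phi>))" for \<phi>
      by (rule L.integrable_const_bound[where B=1]) (auto simp: indicator_def)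
    have "(CLINT \<omega>|L. indicator B (Z \<omega>) *\<^sub>R iexp (T \<omega>)) = (CLINT \<omega>|L. of_real (indicator B (Z \<omega>) * cos (T \<omega> - 0))
        + \<i> * of_real (indicator B (Z \<omega>) * cos (T \<omega> - pi/2)))"
      by (intro Bochner_Integration.integral_cong) (auto simp: complex_eq_iff Re_exp Im_exp cos_diff)
    also have "\<dots> = of_real (LINT \<omega>|L. indicator B (Z \<omega>) * cos (T \<omega> - 0))
      + \<i> * of_real (LINT \<omega>|L. indicator B (Z \<omega>) * cos (T \<omega> - pi/2))"
      using i[of 0] i[of "pi/2"]
      by (subst Bochner_Integration.integral_add) (auto intro!: integrable_mult_right integrable_of_real simp del: of_real_mult)
    finally show ?thesis .
  qed
  show ?thesis
    unfolding e[OF assms(1,3,4)] e[OF assms(2,5,6)] e3 ..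
qed

text \<open>Induction over the coordinates: the event for \<open>a\<close> is moved into the measure
  as an indicator density, and the remaining coordinates are treated under the restricted measure.
  Restriction changes the mass, hence finite instead of probability measures.\<close>

lemma joint_char_uniqueness:
  fixes X :: "'j \<Rightarrow> 'a \<Rightarrow> real" and Y :: "'j \<Rightarrow> 'b \<Rightarrow> real"
  assumes "finite J" "finite_measure M" "finite_measure N"
    and "\<And>j. j \<in> J \<Longrightarrow> X j \<in> borel_measurable M" "\<And>j. j \<in> J \<Longrightarrow> Y j \<in> borel_measurable N"
    and "\<And>t. (CLINT \<omega>|M. iexp (\<Sum>j\<in>J. t j * X j \<omega>)) = (CLINT \<omega>|N. iexp (\<Sum>j\<in>J. t j * Y j \<omega>))"
    and "\<And>j. j \<in> J \<Longrightarrow> B j \<in> sets borel"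
  shows "measure M {\<omega> \<in> space M. \<forall>j\<in>J. X j \<omega> \<in> B j} = measure N {\<omega> \<in> space N. \<forall>j\<in>J. Y j \<omega> \<in> B j}"
  using assms
proof (induction J arbitrary: M N rule: finite_induct)
  case empty
  from empty(5)[of "\<lambda>_. 0"] show ?case by simp
next
  case (insert a J)
  have [measurable]: "\<And>j. j \<in> J \<Longrightarrow> X j \<in> borel_measurable M" "X a \<in> borel_measurable M"
     "\<And>j. j \<in> J \<Longrightarrow> Y j \<in> borel_measurable N" "Y a \<in> borel_measurable N"
     "B a \<in> sets borel" "\<And>j. j \<in> J \<Longrightarrow> B j \<in> sets borel"
    using insert.prems by auto
  let ?M = "density M (\<lambda>\<omega>. ennreal (indicator (B a) (X a \<omega>)))"
  let ?N = "density N (\<lambda>\<omega>. ennreal (indicator (B a) (Y a \<omega>)))"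
  have fin: "finite_measure ?M" "finite_measure ?N"
    by (intro finite_measure.finite_measure_density_bounded[where c=1] insert.prems; simp add: indicator_def)+
  have split: "(CLINT \<omega>|M. indicator (B a) (X a \<omega>) *\<^sub>R iexp (\<Sum>j\<in>J. t j * X j \<omega>))
      = (CLINT \<omega>|N. indicator (B a) (Y a \<omega>) *\<^sub>R iexp (\<Sum>j\<in>J. t j * Y j \<omega>))" for t
  proof (rule joint_char_split[OF insert.prems(1,2)])
    fix s u :: real
    have sum: "(\<Sum>j\<in>insert a J. (if j = a then s else u * t j) * Z j \<omega>) = s * Z a \<omega> + u * (\<Sum>j\<in>J. t j * Z j \<omega>)"
      for Z :: "'j \<Rightarrow> 'c \<Rightarrow> real" and \<omega>
    proof -
      have "(\<Sum>j\<in>J. (if j = a then s else u * t j) * Z j \<omega>) = (\<Sum>j\<in>J. u * (t j * Z j \<omega>))"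
        using insert.hyps by (intro sum.cong) auto
      then show ?thesis using insert.hyps by (simp add: sum_distrib_left)
    qed
    show "(CLINT \<omega>|M. iexp (s * X a \<omega> + u * (\<Sum>j\<in>J. t j * X j \<omega>)))
        = (CLINT \<omega>|N. iexp (s * Y a \<omega> + u * (\<Sum>j\<in>J. t j * Y j \<omega>)))"
      using insert.prems(5)[of "\<lambda>j. if j = a then s else u * t j"] unfolding sum .
  qed measurable
  have step: "measure ?M {\<omega> \<in> space ?M. \<forall>j\<in>J. X j \<omega> \<in> B j} = measure ?N {\<omega> \<in> space ?N. \<forall>j\<in>J. Y j \<omega> \<in> B j}"
  proof (rule insert.IH[OF fin])
    fix t :: "'j \<Rightarrow> real"
    show "(CLINT \<omega>|?M. iexp (\<Sum>j\<in>J. t j * X j \<omega>)) = (CLINT \<omega>|?N. iexp (\<Sum>j\<in>J. t j * Y j \<omega>))"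
      using split[of t] by (subst (1 2) integral_density) auto
  qed auto
  have weight: "measure (density L (\<lambda>\<omega>. ennreal (indicator (B a) (Z a \<omega>)))) {\<omega> \<in> space L. \<forall>j\<in>J. Z j \<omega> \<in> B j}
      = measure L {\<omega> \<in> space L. \<forall>j\<in>insert a J. Z j \<omega> \<in> B j}"
    if [measurable]: "Z a \<in> borel_measurable L" "\<And>j. j \<in> J \<Longrightarrow> Z j \<in> borel_measurable L"
    for L :: "'d measure" and Z :: "'j \<Rightarrow> 'd \<Rightarrow> real"
  proof -
    note insert.hyps(1)[measurable]
    have "emeasure (density L (\<lambda>\<omega>. ennreal (indicator (B a) (Z a \<omega>)))) {\<omega> \<in> space L. \<forall>j\<in>J. Z j \<omega> \<in> B j}
        = (\<integral>\<^sup>+\<omega>. ennreal (indicator (B a) (Z a \<omega>)) * indicator {\<omega> \<in> space L. \<forall>j\<in>J. Z j \<omega> \<in> B j} \<omega> \<partial>L)"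
      by (rule emeasure_density) auto
    also have "\<dots> = (\<integral>\<^sup>+\<omega>. indicator {\<omega> \<in> space L. \<forall>j\<in>insert a J. Z j \<omega> \<in> B j} \<omega> \<partial>L)"
      by (rule nn_integral_cong) (simp add: indicator_def)
    also have "\<dots> = emeasure L {\<omega> \<in> space L. \<forall>j\<in>insert a J. Z j \<omega> \<in> B j}"
      by (subst nn_integral_indicator) auto
    finally show ?thesis by (simp add: measure_def)
  qed
  have "measure M {\<omega> \<in> space M. \<forall>j\<in>insert a J. X j \<omega> \<in> B j} = measure ?M {\<omega> \<in> space M. \<forall>j\<in>J. X j \<omega> \<in> B j}"
    by (rule weight[symmetric]) measurable
  also have "\<dots> = measure ?N {\<omega> \<in> space N. \<forall>j\<in>J. Y j \<omega> \<in> B j}"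
    using step by simp
  also have "\<dots> = measure N {\<omega> \<in> space N. \<forall>j\<in>insert a J. Y j \<omega> \<in> B j}"
    by (rule weight) measurable
  finally show ?case .
qed

section \<open>Gaussian spaces\<close>

lemma real_distribution_normal_law: "0 \<le> v \<Longrightarrow> real_distribution (normal_law v)"
proof (cases "v = 0")
  case True
  then show ?thesis
    by (auto simp: normal_law_def real_distribution_def real_distribution_axioms_def intro!: prob_space_return)
next
  case False
  assume "0 \<le> v"
  with False show ?thesis
    by (auto simp: normal_law_def real_distribution_def real_distribution_axioms_def intro!: prob_space_normal_density)
qed

lemma char_normal_law:
  assumes "0 \<le> v"
  shows "char (normal_law v) t = complex_of_real (exp (- v * t\<^sup>2 / 2))"
proof (cases "v = 0")
  case True
  then show ?thesis
    by (simp add: char_def normal_law_def integral_return)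
next
  case False
  then have v: "sqrt v > 0" using assms by simp
  interpret std: prob_space std_normal_distribution
    by (rule prob_space_normal_density) simp
  have "distributed std_normal_distribution lborel (\<lambda>x. x) std_normal_density"
    by (auto simp: distributed_def distr_id2 cong: distr_cong)
  from std.normal_density_affine[OF this, of "sqrt v" 0] v
  have "distributed std_normal_distribution lborel (\<lambda>x. sqrt v * x) (normal_density 0 (sqrt v))"
    by simp
  then have "distr std_normal_distribution lborel (\<lambda>x. sqrt v * x) = density lborel (normal_density 0 (sqrt v))"
    by (simp add: distributed_def)
  then have *: "normal_law v = distr std_normal_distribution borel (\<lambda>x. sqrt v * x)"
    using False by (simp add: normal_law_def cong: distr_cong)
  have "char (normal_law v) t = char std_normal_distribution (sqrt v * t)"
    unfolding char_def * by (subst integral_distr) (auto simp: mult_ac)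
  then show ?thesis
    using assms by (simp add: char_std_normal_distribution power_mult_distrib)
qed

text \<open>The fourth moment serves Isserlis' formula. For variance 0 the law is a point mass,
  which is treated apart from the density.\<close>

lemma normal_law_moments:
  assumes "0 \<le> v"
  shows "integrable (normal_law v) (\<lambda>x. x)" "integrable (normal_law v) (\<lambda>x. x\<^sup>2)"
    "integrable (normal_law v) (\<lambda>x. x ^ 4)" "(LINT x|normal_law v. x\<^sup>2) = v" "(LINT x|normal_law v. x) = 0"
    "(LINT x|normal_law v. x ^ 4) = 3 * v\<^sup>2"
proof -
  have *: "integrable (normal_law v) (\<lambda>x. x) \<and> integrable (normal_law v) (\<lambda>x. x\<^sup>2) \<and> integrable (normal_law v) (\<lambda>x. x ^ 4)
    \<and> (LINT x|normal_law v. x\<^sup>2) = v \<and> (LINT x|normal_law v. x) = 0 \<and> (LINT x|normal_law v. x ^ 4) = 3 * v\<^sup>2"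
  proof (cases "v = 0")
    case True
    have int: "integrable (return borel (0::real)) f" if "f \<in> borel_measurable borel" for f :: "real \<Rightarrow> real"
    proof (rule integrableI_bounded)
      show "(\<integral>\<^sup>+ x. ennreal (norm (f x)) \<partial>return borel 0) < \<infinity>"
        using that by (subst nn_integral_return) auto
    qed (use that in simp)
    have "normal_law v = return borel 0"
      using True by (simp add: normal_law_def)
    moreover have "integrable (return borel (0::real)) (\<lambda>x. x)" "integrable (return borel (0::real)) (\<lambda>x. x\<^sup>2)"
      "integrable (return borel (0::real)) (\<lambda>x. x ^ 4)"
      by (rule int, measurable)+
    moreover have "(LINT x|return borel (0::real). x\<^sup>2) = 0" "(LINT x|return borel (0::real). x) = 0"
      "(LINT x|return borel (0::real). x ^ 4) = 0"
      by (subst integral_return; simp)+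
    ultimately show ?thesis
      using True by simp
  next
    case False
    then have s: "sqrt v > 0" using assms by simp
    note m = integrable_normal_moment[OF s, of 0]
    have "integrable lborel (\<lambda>x. normal_density 0 (sqrt v) x * x)"
      "integrable lborel (\<lambda>x. normal_density 0 (sqrt v) x * x\<^sup>2)"
      "integrable lborel (\<lambda>x. normal_density 0 (sqrt v) x * x ^ 4)"
      using m[of 1] m[of 2] m[of 4] by simp_all
    moreover have "(LINT x|lborel. normal_density 0 (sqrt v) x * x) = 0"
      using integral_normal_moment_odd[OF s, of 0 0] by simp
    moreover have "(LINT x|lborel. normal_density 0 (sqrt v) x * x\<^sup>2) = v"
      using integral_normal_moment_even[OF s, of 0 1] assms by simp
    moreover have "(LINT x|lborel. normal_density 0 (sqrt v) x * x ^ 4) = 3 * v\<^sup>2"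
      using integral_normal_moment_even[OF s, of 0 2] assms False
      by (simp add: fact_numeral field_simps power2_eq_square)
    ultimately show ?thesis
      using False by (simp add: normal_law_def integrable_real_density integral_real_density)
  qed
  then show "integrable (normal_law v) (\<lambda>x. x)" "integrable (normal_law v) (\<lambda>x. x\<^sup>2)"
    "integrable (normal_law v) (\<lambda>x. x ^ 4)" "(LINT x|normal_law v. x\<^sup>2) = v" "(LINT x|normal_law v. x) = 0"
    "(LINT x|normal_law v. x ^ 4) = 3 * v\<^sup>2"
    by blast+
qed

lemma integrable_mult_of_squares:
  fixes f g :: "'a \<Rightarrow> real"
  assumes [measurable]: "f \<in> borel_measurable M" "g \<in> borel_measurable M"
    and sq: "integrable M (\<lambda>\<omega>. (f \<omega>)\<^sup>2)" "integrable M (\<lambda>\<omega>. (g \<omega>)\<^sup>2)"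
  shows "integrable M (\<lambda>\<omega>. f \<omega> * g \<omega>)"
proof (rule Bochner_Integration.integrable_bound)
  show "integrable M (\<lambda>\<omega>. (f \<omega>)\<^sup>2 + (g \<omega>)\<^sup>2)"
    using sq by simp
  show "(\<lambda>\<omega>. f \<omega> * g \<omega>) \<in> borel_measurable M" by measurable
  show "AE \<omega> in M. norm (f \<omega> * g \<omega>) \<le> norm ((f \<omega>)\<^sup>2 + (g \<omega>)\<^sup>2)"
  proof (rule AE_I2)
    fix \<omega>
    have "2 * \<bar>f \<omega>\<bar> * \<bar>g \<omega>\<bar> \<le> (f \<omega>)\<^sup>2 + (g \<omega>)\<^sup>2"
      using sum_squares_bound[of "\<bar>f \<omega>\<bar>" "\<bar>g \<omega>\<bar>"] by simp
    moreover have "0 \<le> \<bar>f \<omega>\<bar> * \<bar>g \<omega>\<bar>" by simp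
    ultimately have "\<bar>f \<omega>\<bar> * \<bar>g \<omega>\<bar> \<le> (f \<omega>)\<^sup>2 + (g \<omega>)\<^sup>2"
      by linarith
    then show "norm (f \<omega> * g \<omega>) \<le> norm ((f \<omega>)\<^sup>2 + (g \<omega>)\<^sup>2)"
      unfolding real_norm_def abs_mult[of "f \<omega>"] by linarith
  qed
qed

text \<open>Joint normality in the sense of Cramer and Wold: a linear space whose every element is
  centred normal. Neither densities nor covariance matrices occur, so degenerate families are
  included.\<close>

locale gaussian_space = prob_space M for M :: "'w measure" +
  fixes \<G> :: "('w \<Rightarrow> real) set"
  assumes gauss_zero: "(\<lambda>_. 0) \<in> \<G>"
    and gauss_add: "f \<in> \<G> \<Longrightarrow> g \<in> \<G> \<Longrightarrow> (\<lambda>\<omega>. f \<omega> + g \<omega>) \<in> \<G>"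
    and gauss_cmult: "f \<in> \<G> \<Longrightarrow> (\<lambda>\<omega>. c * f \<omega>) \<in> \<G>"
    and gauss_law: "f \<in> \<G> \<Longrightarrow> f \<in> borel_measurable M \<and> (\<exists>v\<ge>0. distr M borel f = normal_law v)"
begin

lemma gauss_sum: "(\<And>j. j \<in> J \<Longrightarrow> f j \<in> \<G>) \<Longrightarrow> (\<lambda>\<omega>. \<Sum>j\<in>J. f j \<omega>) \<in> \<G>"
  by (induction J rule: infinite_finite_induct) (simp_all add: gauss_zero gauss_add)

lemma gauss_measurable [measurable_dest]: "f \<in> \<G> \<Longrightarrow> f \<in> borel_measurable M"
  using gauss_law by blast

lemma gauss_moments:
  assumes f: "f \<in> \<G>"
  shows "integrable M f" "integrable M (\<lambda>\<omega>. (f \<omega>)\<^sup>2)" "integrable M (\<lambda>\<omega>. f \<omega> ^ 4)"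
    "(LINT \<omega>|M. f \<omega>) = 0" "(LINT \<omega>|M. f \<omega> ^ 4) = 3 * (LINT \<omega>|M. (f \<omega>)\<^sup>2)\<^sup>2"
    "distr M borel f = normal_law (LINT \<omega>|M. (f \<omega>)\<^sup>2)"
proof -
  note [measurable] = gauss_measurable[OF f]
  from gauss_law[OF f] obtain v where v: "v \<ge> 0" and law: "distr M borel f = normal_law v"
    by (elim conjE exE)
  note mom = normal_law_moments[OF v, folded law]
  have f': "f \<in> measurable M borel" by measurable
  show "integrable M f" "integrable M (\<lambda>\<omega>. (f \<omega>)\<^sup>2)" "integrable M (\<lambda>\<omega>. f \<omega> ^ 4)"
    by (rule integrable_distr[OF f' mom(1)] integrable_distr[OF f' mom(2)] integrable_distr[OF f' mom(3)])+
  have "(LINT \<omega>|M. f \<omega>) = (LINT x|distr M borel f. x)"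
    by (rule integral_distr[OF f', symmetric]) measurable
  also have "\<dots> = 0" by (rule mom(5))
  finally show "(LINT \<omega>|M. f \<omega>) = 0" .
  have "(LINT \<omega>|M. (f \<omega>)\<^sup>2) = (LINT x|distr M borel f. x\<^sup>2)"
    by (rule integral_distr[OF f', symmetric]) measurable
  then have 2: "(LINT \<omega>|M. (f \<omega>)\<^sup>2) = v"
    using mom(4) by (rule trans)
  have "(LINT \<omega>|M. f \<omega> ^ 4) = (LINT x|distr M borel f. x ^ 4)"
    by (rule integral_distr[OF f', symmetric]) measurable
  then have "(LINT \<omega>|M. f \<omega> ^ 4) = 3 * v\<^sup>2"
    using mom(6) by (rule trans)
  with 2 show "(LINT \<omega>|M. f \<omega> ^ 4) = 3 * (LINT \<omega>|M. (f \<omega>)\<^sup>2)\<^sup>2" "distr M borel f = normal_law (LINT \<omega>|M. (f \<omega>)\<^sup>2)"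
    by (simp_all only: law)
qed

lemma gauss_char:
  assumes f: "f \<in> \<G>"
  shows "(CLINT \<omega>|M. iexp (f \<omega>)) = complex_of_real (exp (- (LINT \<omega>|M. (f \<omega>)\<^sup>2) / 2))"
proof -
  note [measurable] = gauss_measurable[OF f]
  have "(CLINT \<omega>|M. iexp (f \<omega>)) = char (distr M borel f) 1"
    by (simp add: char_def integral_distr)
  also have "\<dots> = complex_of_real (exp (- (LINT \<omega>|M. (f \<omega>)\<^sup>2) / 2))"
    by (simp add: gauss_moments(6)[OF f] char_normal_law)
  finally show ?thesis .
qed

lemma gauss_mult_integrable:
  "f \<in> \<G> \<Longrightarrow> g \<in> \<G> \<Longrightarrow> integrable M (\<lambda>\<omega>. f \<omega> * g \<omega>)"
  by (intro integrable_mult_of_squares gauss_measurable gauss_moments(2))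

lemma gauss_square_add:
  assumes "f \<in> \<G>" "g \<in> \<G>"
  shows "(LINT \<omega>|M. (f \<omega> + c * g \<omega>)\<^sup>2)
    = (LINT \<omega>|M. (f \<omega>)\<^sup>2) + 2 * c * (LINT \<omega>|M. f \<omega> * g \<omega>) + c\<^sup>2 * (LINT \<omega>|M. (g \<omega>)\<^sup>2)"
proof -
  have "(LINT \<omega>|M. (f \<omega> + c * g \<omega>)\<^sup>2) = (LINT \<omega>|M. (f \<omega>)\<^sup>2 + 2 * c * (f \<omega> * g \<omega>) + c\<^sup>2 * (g \<omega>)\<^sup>2)"
    by (simp add: power2_sum power_mult_distrib mult_ac add_ac)
  also have "\<dots> = (LINT \<omega>|M. (f \<omega>)\<^sup>2) + 2 * c * (LINT \<omega>|M. f \<omega> * g \<omega>) + c\<^sup>2 * (LINT \<omega>|M. (g \<omega>)\<^sup>2)"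
    using assms gauss_moments(2) gauss_mult_integrable[OF assms] by simp
  finally show ?thesis .
qed

text \<open>Isserlis' formula, obtained by polarising the fourth moment.\<close>

lemma gauss_isserlis:
  assumes f: "f \<in> \<G>" and g: "g \<in> \<G>"
  shows "integrable M (\<lambda>\<omega>. (f \<omega>)\<^sup>2 * (g \<omega>)\<^sup>2)"
    and "(LINT \<omega>|M. (f \<omega>)\<^sup>2 * (g \<omega>)\<^sup>2)
      = (LINT \<omega>|M. (f \<omega>)\<^sup>2) * (LINT \<omega>|M. (g \<omega>)\<^sup>2) + 2 * (LINT \<omega>|M. f \<omega> * g \<omega>)\<^sup>2"
proof -
  \<comment> \<open>The factors 1 and -1 keep both terms in the shape of
    \<open>gauss_square_add\<close>.\<close>
  let ?p = "\<lambda>\<omega>. f \<omega> + 1 * g \<omega>" and ?m = "\<lambda>\<omega>. f \<omega> + (- 1) * g \<omega>"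
  have p: "?p \<in> \<G>" and m: "?m \<in> \<G>"
    using gauss_add[OF f gauss_cmult[OF g, of 1]] gauss_add[OF f gauss_cmult[OF g, of "-1"]] by auto
  have eq: "(f \<omega>)\<^sup>2 * (g \<omega>)\<^sup>2 = (1/12) * (?p \<omega> ^ 4 + ?m \<omega> ^ 4 - 2 * f \<omega> ^ 4 - 2 * g \<omega> ^ 4)" for \<omega>
    by (simp add: power4_eq_xxxx power2_eq_square algebra_simps)
  note ints = gauss_moments(3)[OF p] gauss_moments(3)[OF m] gauss_moments(3)[OF f] gauss_moments(3)[OF g]
  have int: "integrable M (\<lambda>\<omega>. (1/12) * (?p \<omega> ^ 4 + ?m \<omega> ^ 4 - 2 * f \<omega> ^ 4 - 2 * g \<omega> ^ 4))"
    by (intro integrable_mult_right Bochner_Integration.integrable_diff Bochner_Integration.integrable_add ints)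
  then show "integrable M (\<lambda>\<omega>. (f \<omega>)\<^sup>2 * (g \<omega>)\<^sup>2)"
    unfolding eq .
  have "(LINT \<omega>|M. (f \<omega>)\<^sup>2 * (g \<omega>)\<^sup>2)
      = (1/12) * ((LINT \<omega>|M. ?p \<omega> ^ 4) + (LINT \<omega>|M. ?m \<omega> ^ 4) - 2 * (LINT \<omega>|M. f \<omega> ^ 4) - 2 * (LINT \<omega>|M. g \<omega> ^ 4))"
    unfolding eq using ints by simp
  also have "\<dots> = (LINT \<omega>|M. (f \<omega>)\<^sup>2) * (LINT \<omega>|M. (g \<omega>)\<^sup>2) + 2 * (LINT \<omega>|M. f \<omega> * g \<omega>)\<^sup>2"
    unfolding gauss_moments(5)[OF p] gauss_moments(5)[OF m] gauss_moments(5)[OF f] gauss_moments(5)[OF g]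
      gauss_square_add[OF f g]
    by (simp add: power2_eq_square algebra_simps)
  finally show "(LINT \<omega>|M. (f \<omega>)\<^sup>2 * (g \<omega>)\<^sup>2)
      = (LINT \<omega>|M. (f \<omega>)\<^sup>2) * (LINT \<omega>|M. (g \<omega>)\<^sup>2) + 2 * (LINT \<omega>|M. f \<omega> * g \<omega>)\<^sup>2" .
qed

text \<open>A centred normal characteristic function depends on the variance only, and the variance
  of a linear combination does not notice a change of sign.\<close>

lemma gauss_symmetric:
  fixes X :: "'j \<Rightarrow> 'w \<Rightarrow> real"
  assumes "finite J" and X: "\<And>j. j \<in> J \<Longrightarrow> X j \<in> \<G>" and "\<And>j. j \<in> J \<Longrightarrow> B j \<in> sets borel"
  shows "prob {\<omega> \<in> space M. \<forall>j\<in>J. X j \<omega> \<in> B j} = prob {\<omega> \<in> space M. \<forall>j\<in>J. - X j \<omega> \<in> B j}"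
proof (rule joint_char_uniqueness[OF assms(1) finite_measure_axioms finite_measure_axioms])
  show "X j \<in> borel_measurable M" "(\<lambda>\<omega>. - X j \<omega>) \<in> borel_measurable M" if "j \<in> J" for j
    using gauss_measurable[OF X[OF that]] by auto
  fix t :: "'j \<Rightarrow> real"
  have s: "(\<lambda>\<omega>. \<Sum>j\<in>J. t j * X j \<omega>) \<in> \<G>"
    by (intro gauss_sum gauss_cmult X)
  from gauss_cmult[OF this, of "-1"] have "(\<lambda>\<omega>. \<Sum>j\<in>J. t j * - X j \<omega>) \<in> \<G>"
    by (simp add: sum_negf)
  from gauss_char[OF this] gauss_char[OF s]
  show "(CLINT \<omega>|M. iexp (\<Sum>j\<in>J. t j * X j \<omega>)) = (CLINT \<omega>|M. iexp (\<Sum>j\<in>J. t j * - X j \<omega>))"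
    by (simp add: sum_negf)
qed (use assms in auto)

text \<open>The joint law is compared with that of an independent copy on
  \<open>M \<Otimes>\<^sub>M M\<close>: \<open>Y\<close> reads the coordinates in \<open>I\<close>
  from the first component and the others from the second. Uncorrelatedness makes variances add, so
  both joint characteristic functions factor alike.\<close>

lemma gauss_uncorrelated_indep:
  fixes X :: "'j \<Rightarrow> 'w \<Rightarrow> real"
  assumes fin: "finite I" "finite J" and disj: "I \<inter> J = {}"
    and X: "\<And>j. j \<in> I \<union> J \<Longrightarrow> X j \<in> \<G>"
    and uncorrelated: "\<And>i j. i \<in> I \<Longrightarrow> j \<in> J \<Longrightarrow> (LINT \<omega>|M. X i \<omega> * X j \<omega>) = 0"
    and B: "\<And>j. j \<in> I \<union> J \<Longrightarrow> B j \<in> sets borel"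
  shows "prob {\<omega> \<in> space M. \<forall>j\<in>I \<union> J. X j \<omega> \<in> B j}
    = prob {\<omega> \<in> space M. \<forall>j\<in>I. X j \<omega> \<in> B j} * prob {\<omega> \<in> space M. \<forall>j\<in>J. X j \<omega> \<in> B j}"
proof -
  interpret MM: pair_prob_space M M ..
  define Y where "Y j p = (if j \<in> I then X j (fst p) else X j (snd p))" for j and p :: "'w \<times> 'w"
  have [measurable]: "\<And>j. j \<in> I \<union> J \<Longrightarrow> X j \<in> borel_measurable M"
    using X by (intro gauss_measurable)
  have sets[measurable]: "\<And>j. j \<in> I \<union> J \<Longrightarrow> B j \<in> sets borel" by fact
  note fin[measurable]
  have measY: "Y j \<in> borel_measurable (M \<Otimes>\<^sub>M M)" if "j \<in> I \<union> J" for j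
    using that unfolding Y_def by (cases "j \<in> I") simp_all
  have mI: "{\<omega> \<in> space M. \<forall>j\<in>I. X j \<omega> \<in> B j} \<in> events"
    by (intro sets.sets_Collect_finite_All fin) (use sets in \<open>auto intro!: measurable_sets_Collect\<close>)
  have mJ: "{\<omega> \<in> space M. \<forall>j\<in>J. X j \<omega> \<in> B j} \<in> events"
    by (intro sets.sets_Collect_finite_All fin) (use sets in \<open>auto intro!: measurable_sets_Collect\<close>)
  have "prob {\<omega> \<in> space M. \<forall>j\<in>I \<union> J. X j \<omega> \<in> B j}
      = measure (M \<Otimes>\<^sub>M M) {p \<in> space (M \<Otimes>\<^sub>M M). \<forall>j\<in>I \<union> J. Y j p \<in> B j}"
  proof (rule joint_char_uniqueness[OF _ finite_measure_axioms MM.P.finite_measure_axioms _ measY])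
    fix t :: "'j \<Rightarrow> real"
    let ?f = "\<lambda>\<omega>. \<Sum>j\<in>I. t j * X j \<omega>" and ?g = "\<lambda>\<omega>. \<Sum>j\<in>J. t j * X j \<omega>"
    have f: "?f \<in> \<G>" and g: "?g \<in> \<G>"
      by (auto intro!: gauss_sum gauss_cmult X)
    note [measurable] = f[THEN gauss_measurable] g[THEN gauss_measurable]
    have int: "integrable M (\<lambda>\<omega>. (t i * t j) * (X i \<omega> * X j \<omega>))" if "i \<in> I" "j \<in> J" for i j
      using that by (intro integrable_mult_right gauss_mult_integrable X) auto
    have "(LINT \<omega>|M. ?f \<omega> * ?g \<omega>) = (LINT \<omega>|M. (\<Sum>i\<in>I. (\<Sum>j\<in>J. (t i * t j) * (X i \<omega> * X j \<omega>))))"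
      unfolding sum_product by (simp only: mult.assoc mult.left_commute mult.commute)
    also have "\<dots> = (\<Sum>i\<in>I. (LINT \<omega>|M. (\<Sum>j\<in>J. (t i * t j) * (X i \<omega> * X j \<omega>))))"
      by (rule Bochner_Integration.integral_sum) (intro Bochner_Integration.integrable_sum int)
    also have "\<dots> = (\<Sum>i\<in>I. (\<Sum>j\<in>J. (LINT \<omega>|M. (t i * t j) * (X i \<omega> * X j \<omega>))))"
      by (intro sum.cong refl Bochner_Integration.integral_sum int)
    also have "\<dots> = 0"
      using uncorrelated by (intro sum.neutral ballI) simp
    finally have fg: "(LINT \<omega>|M. (?f \<omega> + 1 * ?g \<omega>)\<^sup>2) = (LINT \<omega>|M. (?f \<omega>)\<^sup>2) + (LINT \<omega>|M. (?g \<omega>)\<^sup>2)"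
      using gauss_square_add[OF f g, of 1] by simp
    have "(CLINT \<omega>|M. iexp (\<Sum>j\<in>I \<union> J. t j * X j \<omega>)) = (CLINT \<omega>|M. iexp (?f \<omega> + 1 * ?g \<omega>))"
      using fin disj by (simp add: sum.union_disjoint)
    also have "\<dots> = (CLINT \<omega>|M. iexp (?f \<omega>)) * (CLINT \<omega>|M. iexp (?g \<omega>))"
      using gauss_char[OF gauss_add[OF f gauss_cmult[OF g, of 1]]] gauss_char[OF f] gauss_char[OF g]
      by (simp only: fg) (simp add: exp_add[symmetric] add_divide_distrib diff_divide_distrib exp_of_real[symmetric])
    also have "\<dots> = (CLINT \<omega>|M. CLINT \<omega>'|M. iexp (?f \<omega>) * iexp (?g \<omega>'))"
      by simp
    also have "\<dots> = (CLINT p|M \<Otimes>\<^sub>M M. iexp (?f (fst p)) * iexp (?g (snd p)))"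
    proof (subst MM.integral_fst'[symmetric])
      show "complex_integrable (M \<Otimes>\<^sub>M M) (\<lambda>p. iexp (?f (fst p)) * iexp (?g (snd p)))"
        by (rule MM.P.integrable_const_bound[where B=1]) (auto simp: norm_mult)
    qed simp
    also have "\<dots> = (CLINT p|M \<Otimes>\<^sub>M M. iexp (\<Sum>j\<in>I \<union> J. t j * Y j p))"
    proof (rule Bochner_Integration.integral_cong)
      fix p
      have "(\<Sum>j\<in>I \<union> J. t j * Y j p) = (\<Sum>j\<in>I. t j * Y j p) + (\<Sum>j\<in>J. t j * Y j p)"
        using fin disj by (simp add: sum.union_disjoint)
      also have "\<dots> = ?f (fst p) + ?g (snd p)"
        using disj by (auto intro!: arg_cong2[where f="(+)"] sum.cong simp: Y_def)
      finally show "iexp (?f (fst p)) * iexp (?g (snd p)) = iexp (\<Sum>j\<in>I \<union> J. t j * Y j p)"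
        by (simp only: of_real_add distrib_left exp_add)
    qed simp
    finally show "(CLINT \<omega>|M. iexp (\<Sum>j\<in>I \<union> J. t j * X j \<omega>)) = (CLINT p|M \<Otimes>\<^sub>M M. iexp (\<Sum>j\<in>I \<union> J. t j * Y j p))" .
  qed (use fin sets X in \<open>auto intro: gauss_measurable\<close>)
  also have "{p \<in> space (M \<Otimes>\<^sub>M M). \<forall>j\<in>I \<union> J. Y j p \<in> B j}
      = {\<omega> \<in> space M. \<forall>j\<in>I. X j \<omega> \<in> B j} \<times> {\<omega> \<in> space M. \<forall>j\<in>J. X j \<omega> \<in> B j}"
    using disj by (auto simp: Y_def space_pair_measure)
  also have "measure (M \<Otimes>\<^sub>M M) \<dots> = prob {\<omega> \<in> space M. \<forall>j\<in>I. X j \<omega> \<in> B j} * prob {\<omega> \<in> space M. \<forall>j\<in>J. X j \<omega> \<in> B j}"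
    using mI mJ by (simp add: measure_def emeasure_pair_measure_Times enn2real_mult)
  finally show ?thesis .
qed

end

section \<open>Measurability of vectors\<close>

lemma space_vec_borel [simp]: "space (vec_borel n) = carrier_vec n"
  by (simp add: vec_borel_def)

lemma measurable_vec_borelI:
  assumes "\<And>\<omega>. \<omega> \<in> space M \<Longrightarrow> X \<omega> \<in> carrier_vec n"
    and "\<And>a. a < n \<Longrightarrow> (\<lambda>\<omega>. X \<omega> $ a) \<in> borel_measurable M"
  shows "X \<in> measurable M (vec_borel n)"
  unfolding vec_borel_def
proof (rule measurable_vimage_algebra2)
  show "X \<in> space M \<rightarrow> carrier_vec n"
    using assms(1) by (intro Pi_I)
  show "(\<lambda>\<omega>. \<lambda>a\<in>{..<n}. X \<omega> $ a) \<in> measurable M (Pi\<^sub>M {..<n} (\<lambda>_. borel))"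
    using assms(2) by (intro measurable_restrict) simp
qed

lemma measurable_vec_borel_carrier:
  "X \<in> measurable M (vec_borel n) \<Longrightarrow> \<omega> \<in> space M \<Longrightarrow> X \<omega> \<in> carrier_vec n"
  using measurable_space[of X M "vec_borel n"] by simp

text \<open>Out of range the index is undefined, but it is one and the same value for all vectors of
  a dimension. This makes the coordinate maps measurable at every index.\<close>

lemma vec_index_out_of_range:
  assumes "x \<in> carrier_vec n" "n \<le> a"
  shows "x $ a = undef_vec (a - n)"
proof -
  have "x $ a = undef_vec (a - dim_vec x)" if "dim_vec x \<le> a"
    using that by transfer (auto simp: mk_vec_def)
  then show ?thesis using assms by auto
qed

lemma measurable_vec_index [measurable]: "(\<lambda>x. x $ a) \<in> borel_measurable (vec_borel n)"
proof (cases "a < n")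
  case True
  have "(\<lambda>v. \<lambda>a\<in>{..<n}. v $ a) \<in> measurable (vec_borel n) (Pi\<^sub>M {..<n} (\<lambda>_. borel :: real measure))"
    unfolding vec_borel_def by (rule measurable_vimage_algebra1) (auto simp: space_PiM)
  from measurable_compose[OF this measurable_component_singleton[of a "{..<n}"]] True
  show ?thesis by simp
next
  case False
  then have "(\<lambda>x. x $ a) \<in> borel_measurable (vec_borel n) \<longleftrightarrow> (\<lambda>x. undef_vec (a - n) :: real) \<in> borel_measurable (vec_borel n)"
    by (intro measurable_cong vec_index_out_of_range) auto
  then show ?thesis by simp
qed

lemma mult_mat_vec_index:
  assumes "A \<in> carrier_mat m n" "x \<in> carrier_vec n" "a < m"
  shows "(A *\<^sub>v x) $ a = (\<Sum>b<n. A $$ (a, b) * x $ b)"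
  using assms by (auto simp: scalar_prod_def atLeast0LessThan intro!: sum.cong)

lemma scalar_prod_sum:
  assumes "y \<in> carrier_vec n"
  shows "x \<bullet> y = (\<Sum>a<n. x $ a * y $ a)"
  using assms by (auto simp: scalar_prod_def atLeast0LessThan)

lemma measurable_vec_add [measurable (raw)]:
  assumes [measurable]: "X \<in> measurable M (vec_borel n)" "Y \<in> measurable M (vec_borel n)"
  shows "(\<lambda>\<omega>. X \<omega> + Y \<omega>) \<in> measurable M (vec_borel n)"
proof (rule measurable_vec_borelI)
  have c: "X \<omega> \<in> carrier_vec n" "Y \<omega> \<in> carrier_vec n" if "\<omega> \<in> space M" for \<omega>
    using assms that by (blast intro: measurable_vec_borel_carrier)+
  then show "X \<omega> + Y \<omega> \<in> carrier_vec n" if "\<omega> \<in> space M" for \<omega>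
    using that by (blast intro: add_carrier_vec)
  fix a assume a: "a < n"
  have "(\<lambda>\<omega>. (X \<omega> + Y \<omega>) $ a) \<in> borel_measurable M \<longleftrightarrow> (\<lambda>\<omega>. X \<omega> $ a + Y \<omega> $ a) \<in> borel_measurable M"
    using c a by (intro measurable_cong index_add_vec) (auto simp: carrier_vecD[OF c(2)])
  then show "(\<lambda>\<omega>. (X \<omega> + Y \<omega>) $ a) \<in> borel_measurable M"
    by simp
qed

lemma measurable_mult_mat_vec [measurable (raw)]:
  assumes [measurable]: "X \<in> measurable M (vec_borel n)" and A: "A \<in> carrier_mat m n"
  shows "(\<lambda>\<omega>. A *\<^sub>v X \<omega>) \<in> measurable M (vec_borel m)"
proof (rule measurable_vec_borelI)
  have c: "X \<omega> \<in> carrier_vec n" if "\<omega> \<in> space M" for \<omega>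
    using assms that by (blast intro: measurable_vec_borel_carrier)
  then show "A *\<^sub>v X \<omega> \<in> carrier_vec m" if "\<omega> \<in> space M" for \<omega>
    using that A by (blast intro: mult_mat_vec_carrier)
  fix a assume a: "a < m"
  have "(\<lambda>\<omega>. (A *\<^sub>v X \<omega>) $ a) \<in> borel_measurable M \<longleftrightarrow> (\<lambda>\<omega>. \<Sum>b<n. A $$ (a, b) * X \<omega> $ b) \<in> borel_measurable M"
    using c a by (intro measurable_cong mult_mat_vec_index[OF A]) auto
  then show "(\<lambda>\<omega>. (A *\<^sub>v X \<omega>) $ a) \<in> borel_measurable M"
    by simp
qed

lemma measurable_vec_uminus [measurable (raw)]:
  assumes [measurable]: "X \<in> measurable M (vec_borel n)"
  shows "(\<lambda>\<omega>. - X \<omega>) \<in> measurable M (vec_borel n)"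
proof (rule measurable_vec_borelI)
  have c: "X \<omega> \<in> carrier_vec n" if "\<omega> \<in> space M" for \<omega>
    using assms that by (blast intro: measurable_vec_borel_carrier)
  then show "- X \<omega> \<in> carrier_vec n" if "\<omega> \<in> space M" for \<omega>
    using that by (blast intro: uminus_carrier_vec[THEN iffD2])
  fix a assume a: "a < n"
  have "(\<lambda>\<omega>. (- X \<omega>) $ a) \<in> borel_measurable M \<longleftrightarrow> (\<lambda>\<omega>. - (X \<omega> $ a)) \<in> borel_measurable M"
    using c a by (intro measurable_cong index_uminus_vec) (auto simp: carrier_vecD[OF c])
  then show "(\<lambda>\<omega>. (- X \<omega>) $ a) \<in> borel_measurable M"
    by simp
qed

lemma measurable_vec_minus [measurable (raw)]:
  assumes [measurable]: "X \<in> measurable M (vec_borel n)" "Y \<in> measurable M (vec_borel n)"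
  shows "(\<lambda>\<omega>. X \<omega> - Y \<omega>) \<in> measurable M (vec_borel n)"
proof (rule measurable_vec_borelI)
  have c: "X \<omega> \<in> carrier_vec n" "Y \<omega> \<in> carrier_vec n" if "\<omega> \<in> space M" for \<omega>
    using assms that by (blast intro: measurable_vec_borel_carrier)+
  then show "X \<omega> - Y \<omega> \<in> carrier_vec n" if "\<omega> \<in> space M" for \<omega>
    using that by (blast intro: minus_carrier_vec)
  fix a assume a: "a < n"
  have "(\<lambda>\<omega>. (X \<omega> - Y \<omega>) $ a) \<in> borel_measurable M \<longleftrightarrow> (\<lambda>\<omega>. X \<omega> $ a - Y \<omega> $ a) \<in> borel_measurable M"
    using c a by (intro measurable_cong index_minus_vec) (auto simp: carrier_vecD[OF c(2)])
  then show "(\<lambda>\<omega>. (X \<omega> - Y \<omega>) $ a) \<in> borel_measurable M"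
    by simp
qed

lemma measurable_vec_const [measurable]: "c \<in> carrier_vec n \<Longrightarrow> (\<lambda>\<omega>. c) \<in> measurable M (vec_borel n)"
  by (rule measurable_const) simp

lemma measurable_scalar_prod [measurable (raw)]:
  assumes [measurable]: "X \<in> measurable M (vec_borel n)" "Y \<in> measurable M (vec_borel n)"
  shows "(\<lambda>\<omega>. X \<omega> \<bullet> Y \<omega>) \<in> borel_measurable M"
proof -
  have "(\<lambda>\<omega>. X \<omega> \<bullet> Y \<omega>) \<in> borel_measurable M \<longleftrightarrow> (\<lambda>\<omega>. \<Sum>a<n. X \<omega> $ a * Y \<omega> $ a) \<in> borel_measurable M"
    using measurable_vec_borel_carrier[OF assms(2)] by (intro measurable_cong scalar_prod_sum)
  then show ?thesis by simp
qed

text \<open>\<open>A\<close> may have any dimensions here: \<^const>\<open>mat_inv\<close> of a singular matrix is unspecified.\<close>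

lemma measurable_quadratic_form:
  "(\<lambda>x. x \<bullet> (A *\<^sub>v x)) \<in> borel_measurable (vec_borel n)"
proof -
  have "x \<bullet> (A *\<^sub>v x) = (\<Sum>a<dim_row A. x $ a * (\<Sum>b<n. row A a $ b * x $ b))" if "x \<in> space (vec_borel n)" for x
    using that by (auto simp: scalar_prod_def atLeast0LessThan)
  then have "(\<lambda>x. x \<bullet> (A *\<^sub>v x)) \<in> borel_measurable (vec_borel n)
      \<longleftrightarrow> (\<lambda>x. \<Sum>a<dim_row A. x $ a * (\<Sum>b<n. row A a $ b * x $ b)) \<in> borel_measurable (vec_borel n)"
    by (rule measurable_cong)
  then show ?thesis by simp
qed

lemma measurable_vimageI:
  assumes "f \<in> measurable F N"
  shows "sets (vimage_algebra (space F) f N) \<subseteq> sets F"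
  using assms by (subst sets_vimage_algebra2) (auto dest: measurable_space)

lemma sets_vimage_algebra_measurable:
  "f \<in> measurable M N \<Longrightarrow> sets (vimage_algebra (space M) f N) = {f -` A \<inter> space M | A. A \<in> sets N}"
  by (rule sets_vimage_algebra2) (blast dest: measurable_space)

lemma measurable_mono_sets:
  assumes "f \<in> measurable F N" "sets F \<subseteq> sets G" "space F = space G"
  shows "f \<in> measurable G N"
  using assms unfolding measurable_def by auto

lemma Int_stable_vec_rectangles:
  "Int_stable {{x \<in> carrier_vec n. \<forall>a<n. x $ a \<in> B a} | B. \<forall>a. B a \<in> sets (borel :: real measure)}"
proof (rule Int_stableI)
  fix A D assume "A \<in> {{x \<in> carrier_vec n. \<forall>a<n. x $ a \<in> B a} | B. \<forall>a. B a \<in> sets (borel :: real measure)}"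
    "D \<in> {{x \<in> carrier_vec n. \<forall>a<n. x $ a \<in> B a} | B. \<forall>a. B a \<in> sets (borel :: real measure)}"
  then obtain B B' where B: "\<forall>a. B a \<in> sets (borel :: real measure)" "\<forall>a. B' a \<in> sets (borel :: real measure)"
    and AD: "A = {x \<in> carrier_vec n. \<forall>a<n. x $ a \<in> B a}" "D = {x \<in> carrier_vec n. \<forall>a<n. x $ a \<in> B' a}"
    by blast
  from B have "\<forall>a. B a \<inter> B' a \<in> sets borel" by blast
  moreover have "A \<inter> D = {x \<in> carrier_vec n. \<forall>a<n. x $ a \<in> B a \<inter> B' a}"
    unfolding AD by blast
  ultimately show "A \<inter> D \<in> {{x \<in> carrier_vec n. \<forall>a<n. x $ a \<in> B a} | B. \<forall>a. B a \<in> sets (borel :: real measure)}"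
    by (intro CollectI exI[of _ "\<lambda>a. B a \<inter> B' a"] conjI)
qed

text \<open>The coordinate rectangles are an intersection-stable generator; independence and
  symmetry of random vectors are checked on them.\<close>

lemma sets_vec_borel:
  "sets (vec_borel n)
    = sigma_sets (carrier_vec n) {{x \<in> carrier_vec n. \<forall>a<n. x $ a \<in> B a} | B. \<forall>a. B a \<in> sets (borel :: real measure)}"
    (is "_ = sigma_sets _ ?E")
proof
  let ?S = "sigma (carrier_vec n) ?E"
  have E: "?E \<subseteq> Pow (carrier_vec n)" by blast
  have "(\<lambda>v. v) \<in> measurable ?S (vec_borel n)"
  proof (rule measurable_vec_borelI)
    fix a assume a: "a < n"
    show "(\<lambda>v. v $ a) \<in> borel_measurable ?S"
    proof (rule measurableI)
      fix B :: "real set" assume B: "B \<in> sets borel"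
      have "(\<lambda>v. v $ a) -` B \<inter> space ?S = {x \<in> carrier_vec n. \<forall>b<n. x $ b \<in> (if b = a then B else UNIV)}"
        using a E by (auto simp: space_measure_of)
      also have "\<dots> \<in> sets ?S"
        using B E by (subst sets_measure_of) (auto intro!: sigma_sets.Basic exI[of _ "\<lambda>b. if b = a then B else UNIV"])
      finally show "(\<lambda>v. v $ a) -` B \<inter> space ?S \<in> sets ?S" .
    qed simp
  qed (use E in \<open>simp add: space_measure_of\<close>)
  then show "sets (vec_borel n) \<subseteq> sigma_sets (carrier_vec n) ?E"
  proof (intro subsetI)
    fix A assume "A \<in> sets (vec_borel n)"
    with \<open>(\<lambda>v. v) \<in> measurable ?S (vec_borel n)\<close> have "(\<lambda>v. v) -` A \<inter> space ?S \<in> sets ?S" and "A \<subseteq> carrier_vec n"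
      using sets.sets_into_space[of A "vec_borel n"] by (auto intro: measurable_sets)
    then show "A \<in> sigma_sets (carrier_vec n) ?E"
      using E by (simp add: space_measure_of sets_measure_of Int_absorb2)
  qed
next
  have "?E \<subseteq> sets (vec_borel n)"
  proof
    fix A assume "A \<in> ?E"
    then obtain B where [measurable]: "\<And>a. B a \<in> sets (borel :: real measure)"
      and A: "A = {x \<in> space (vec_borel n). \<forall>a\<in>{..<n}. x $ a \<in> B a}"
      by auto
    show "A \<in> sets (vec_borel n)"
      unfolding A by measurable
  qed
  then show "sigma_sets (carrier_vec n) ?E \<subseteq> sets (vec_borel n)"
    using sets.sigma_sets_subset[of ?E "vec_borel n"] by simp
qed

section \<open>Conditionally symmetric vectors\<close>

lemma (in prob_space) distr_pair_eqI:
  assumes f: "f \<in> measurable M A" "f' \<in> measurable M A" and g: "g \<in> measurable M B" "g' \<in> measurable M B"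
    and eq: "\<And>a b. a \<in> sets A \<Longrightarrow> b \<in> sets B \<Longrightarrow>
      prob {\<omega> \<in> space M. f \<omega> \<in> a \<and> g \<omega> \<in> b} = prob {\<omega> \<in> space M. f' \<omega> \<in> a \<and> g' \<omega> \<in> b}"
  shows "distr M (A \<Otimes>\<^sub>M B) (\<lambda>\<omega>. (f \<omega>, g \<omega>)) = distr M (A \<Otimes>\<^sub>M B) (\<lambda>\<omega>. (f' \<omega>, g' \<omega>))"
proof (rule measure_eqI_generator_eq[OF Int_stable_pair_measure_generator[of A B], where \<Omega>="space A \<times> space B"
      and A="\<lambda>_. space A \<times> space B"])
  note [measurable] = f g
  fix X assume "X \<in> {a \<times> b |a b. a \<in> sets A \<and> b \<in> sets B}"
  then obtain a b where X: "X = a \<times> b" and [measurable]: "a \<in> sets A" "b \<in> sets B" by blast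
  have "emeasure (distr M (A \<Otimes>\<^sub>M B) (\<lambda>\<omega>. (h \<omega>, k \<omega>))) X = prob {\<omega> \<in> space M. h \<omega> \<in> a \<and> k \<omega> \<in> b}"
    if [measurable]: "h \<in> measurable M A" "k \<in> measurable M B" for h k
  proof -
    have "emeasure (distr M (A \<Otimes>\<^sub>M B) (\<lambda>\<omega>. (h \<omega>, k \<omega>))) X = emeasure M ((\<lambda>\<omega>. (h \<omega>, k \<omega>)) -` X \<inter> space M)"
      unfolding X by (rule emeasure_distr) measurable
    also have "(\<lambda>\<omega>. (h \<omega>, k \<omega>)) -` X \<inter> space M = {\<omega> \<in> space M. h \<omega> \<in> a \<and> k \<omega> \<in> b}"
      unfolding X by blast
    finally show ?thesis by (simp add: emeasure_eq_measure)
  qed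
  with f g eq[of a b] show "emeasure (distr M (A \<Otimes>\<^sub>M B) (\<lambda>\<omega>. (f \<omega>, g \<omega>))) X
      = emeasure (distr M (A \<Otimes>\<^sub>M B) (\<lambda>\<omega>. (f' \<omega>, g' \<omega>))) X"
    by simp
next
  have "prob_space (distr M (A \<Otimes>\<^sub>M B) (\<lambda>\<omega>. (f \<omega>, g \<omega>)))"
    using f g by (intro prob_space_distr) measurable
  then show "emeasure (distr M (A \<Otimes>\<^sub>M B) (\<lambda>\<omega>. (f \<omega>, g \<omega>))) (space A \<times> space B) \<noteq> \<infinity>"
    using prob_space.emeasure_space_1[of "distr M (A \<Otimes>\<^sub>M B) (\<lambda>\<omega>. (f \<omega>, g \<omega>))"] by (simp add: space_pair_measure)
qed (use sets.space_closed[of A] sets.space_closed[of B] in \<open>auto simp: sets_pair_measure\<close>)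

text \<open>Conditional symmetry of \<open>X\<close> given \<open>F\<close> without regular
  conditional distributions: the identity map into \<open>F\<close> carries all information of
  \<open>F\<close>, so flipping the sign of \<open>X\<close> has to preserve the joint law.\<close>

definition sym_given :: "'w measure \<Rightarrow> 'w measure \<Rightarrow> nat \<Rightarrow> ('w \<Rightarrow> real vec) \<Rightarrow> bool" where
  "sym_given M F n X \<longleftrightarrow> X \<in> measurable M (vec_borel n) \<and>
     distr M (F \<Otimes>\<^sub>M vec_borel n) (\<lambda>\<omega>. (\<omega>, X \<omega>)) = distr M (F \<Otimes>\<^sub>M vec_borel n) (\<lambda>\<omega>. (\<omega>, - X \<omega>))"

definition indep_of_alg :: "'w measure \<Rightarrow> 'w measure \<Rightarrow> nat \<Rightarrow> ('w \<Rightarrow> real vec) \<Rightarrow> bool" where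
  "indep_of_alg M G n Z \<longleftrightarrow> Z \<in> measurable M (vec_borel n) \<and>
     (\<forall>A\<in>sets G. \<forall>B\<in>sets (vec_borel n).
        measure M (A \<inter> {\<omega> \<in> space M. Z \<omega> \<in> B}) = measure M A * measure M {\<omega> \<in> space M. Z \<omega> \<in> B})"

lemma indep_of_algD:
  "indep_of_alg M G n Z \<Longrightarrow> A \<in> sets G \<Longrightarrow> B \<in> sets (vec_borel n) \<Longrightarrow>
    measure M (A \<inter> {\<omega> \<in> space M. Z \<omega> \<in> B}) = measure M A * measure M {\<omega> \<in> space M. Z \<omega> \<in> B}"
  unfolding indep_of_alg_def by blast

definition symmetric_law :: "'w measure \<Rightarrow> nat \<Rightarrow> ('w \<Rightarrow> real vec) \<Rightarrow> bool" where
  "symmetric_law M n Z \<longleftrightarrow> Z \<in> measurable M (vec_borel n) \<and>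
     (\<forall>B\<in>sets (vec_borel n). measure M {\<omega> \<in> space M. Z \<omega> \<in> B} = measure M {\<omega> \<in> space M. - Z \<omega> \<in> B})"

locale sub_alg = prob_space M for M :: "'w measure" +
  fixes F :: "'w measure"
  assumes subalg: "subalgebra M F"
begin

lemma space_F [simp]: "space F = space M" and sets_F: "sets F \<subseteq> sets M"
  using subalg by (auto simp: subalgebra_def)

lemma measurable_ident_F [measurable]: "(\<lambda>\<omega>. \<omega>) \<in> measurable M F"
  using sets_F by (intro measurableI) (auto dest: sets.sets_into_space simp: Int_absorb2)

lemma measurable_F: "f \<in> measurable F N \<Longrightarrow> f \<in> measurable M N"
  by (rule measurable_mono_sets[OF _ sets_F space_F])

text \<open>Independence makes the joint law a product, whose second factor may be
  reflected.\<close>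

lemma sym_given_indep:
  assumes indep: "indep_of_alg M F n Z" and sym: "symmetric_law M n Z"
  shows "sym_given M F n Z"
  unfolding sym_given_def
proof
  show Z[measurable]: "Z \<in> measurable M (vec_borel n)"
    using indep by (simp add: indep_of_alg_def)
  show "distr M (F \<Otimes>\<^sub>M vec_borel n) (\<lambda>\<omega>. (\<omega>, Z \<omega>)) = distr M (F \<Otimes>\<^sub>M vec_borel n) (\<lambda>\<omega>. (\<omega>, - Z \<omega>))"
  proof (rule distr_pair_eqI)
    fix a b assume a: "a \<in> sets F" and b: "b \<in> sets (vec_borel n)"
    let ?nb = "{x \<in> space (vec_borel n). - x \<in> b}"
    have nb: "?nb \<in> sets (vec_borel n)"
      using b by measurable
    have aM: "a \<inter> space M = a"
      using a sets.sets_into_space[OF a] by auto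
    have 1: "{\<omega> \<in> space M. \<omega> \<in> a \<and> Z \<omega> \<in> b} = a \<inter> {\<omega> \<in> space M. Z \<omega> \<in> b}"
      using aM by blast
    have 2: "{\<omega> \<in> space M. \<omega> \<in> a \<and> - Z \<omega> \<in> b} = a \<inter> {\<omega> \<in> space M. Z \<omega> \<in> ?nb}"
      using aM measurable_space[OF Z] by blast
    have 3: "{\<omega> \<in> space M. Z \<omega> \<in> ?nb} = {\<omega> \<in> space M. - Z \<omega> \<in> b}"
      using measurable_space[OF Z] by blast
    have "prob (a \<inter> {\<omega> \<in> space M. Z \<omega> \<in> b}) = prob a * prob {\<omega> \<in> space M. Z \<omega> \<in> b}"
      by (rule indep_of_algD[OF indep a b])
    also have "\<dots> = prob a * prob {\<omega> \<in> space M. Z \<omega> \<in> ?nb}"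
      using sym b 3 by (simp add: symmetric_law_def)
    also have "\<dots> = prob (a \<inter> {\<omega> \<in> space M. Z \<omega> \<in> ?nb})"
      by (rule indep_of_algD[OF indep a nb, symmetric])
    finally show "prob {\<omega> \<in> space M. \<omega> \<in> a \<and> Z \<omega> \<in> b} = prob {\<omega> \<in> space M. \<omega> \<in> a \<and> - Z \<omega> \<in> b}"
      unfolding 1 2 .
  qed measurable
qed

text \<open>The flip preserves the joint law and changes the sign of the integrand, so the integral
  equals its own negative. A nonintegrable product is covered, as its Bochner integral is 0.\<close>

lemma sym_given_integral:
  assumes sym: "sym_given M F n X" and Y[measurable]: "Y \<in> borel_measurable F" and a: "a < n"
  shows "(LINT \<omega>|M. X \<omega> $ a * Y \<omega>) = 0"
proof -
  have X[measurable]: "X \<in> measurable M (vec_borel n)"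
    using sym by (simp add: sym_given_def)
  have f[measurable]: "(\<lambda>p. snd p $ a * Y (fst p)) \<in> borel_measurable (F \<Otimes>\<^sub>M vec_borel n)"
    by measurable
  have "(LINT \<omega>|M. X \<omega> $ a * Y \<omega>) = (LINT p|distr M (F \<Otimes>\<^sub>M vec_borel n) (\<lambda>\<omega>. (\<omega>, X \<omega>)). snd p $ a * Y (fst p))"
    by (subst integral_distr[OF _ f]) simp_all
  also have "\<dots> = (LINT p|distr M (F \<Otimes>\<^sub>M vec_borel n) (\<lambda>\<omega>. (\<omega>, - X \<omega>)). snd p $ a * Y (fst p))"
    using sym by (simp add: sym_given_def)
  also have "\<dots> = (LINT \<omega>|M. (- X \<omega>) $ a * Y \<omega>)"
    by (subst integral_distr[OF _ f]) simp_all
  also have "\<dots> = (LINT \<omega>|M. - (X \<omega> $ a * Y \<omega>))"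
    using a measurable_vec_borel_carrier[OF X] by (intro Bochner_Integration.integral_cong) (fastforce simp: carrier_vecD)+
  finally show ?thesis by simp
qed

text \<open>\<open>Z\<close> is independent of the larger \<open>G\<close>, which contains
  \<open>F\<close> and knows \<open>Y\<close>, so the signs of \<open>Y\<close> and \<open>Z\<close>
  can be flipped together without changing the joint law over \<open>F\<close>; linear maps commute
  with the flip. Given \<open>G\<close>, which determines \<open>Y\<close>, symmetry would force
  \<open>Y\<close> to vanish almost surely; hence the two sigma-algebras.\<close>

lemma sym_given_linear_update:
  assumes sym: "sym_given M F n Y" and G: "sub_alg M G" and FG: "sets F \<subseteq> sets G"
    and Y: "Y \<in> measurable G (vec_borel n)"
    and indep: "indep_of_alg M G l Z" and symZ: "symmetric_law M l Z"
    and A: "A \<in> carrier_mat n n" and L: "L \<in> carrier_mat n l"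
  shows "sym_given M F n (\<lambda>\<omega>. A *\<^sub>v Y \<omega> + L *\<^sub>v Z \<omega>)"
proof -
  interpret G: sub_alg M G by fact
  have YM[measurable]: "Y \<in> measurable M (vec_borel n)" and Z[measurable]: "Z \<in> measurable M (vec_borel l)"
    using sym indep by (auto simp: sym_given_def indep_of_alg_def)
  note [measurable (raw)] = measurable_mult_mat_vec[OF _ A] measurable_mult_mat_vec[OF _ L]
  let ?T = "\<lambda>p. (fst (fst p), A *\<^sub>v snd (fst p) + L *\<^sub>v snd p)"
  let ?FV = "F \<Otimes>\<^sub>M vec_borel n"
  have T: "?T \<in> measurable (?FV \<Otimes>\<^sub>M vec_borel l) ?FV"
    by measurable
  have idG: "(\<lambda>\<omega>. \<omega>) \<in> measurable G F"
    using FG by (intro measurableI) (auto dest: sets.sets_into_space simp: Int_absorb2)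
  have neg: "- (A *\<^sub>v Y \<omega> + L *\<^sub>v Z \<omega>) = A *\<^sub>v (- Y \<omega>) + L *\<^sub>v (- Z \<omega>)" if "\<omega> \<in> space M" for \<omega>
  proof -
    have "Y \<omega> \<in> carrier_vec n" "Z \<omega> \<in> carrier_vec l"
      using measurable_vec_borel_carrier[OF YM that] measurable_vec_borel_carrier[OF Z that] by auto
    then show ?thesis
      using A L by (intro eq_vecI) (auto simp: mult_mat_vec_index simp del: index_mult_mat_vec sum_negf
          intro!: simp: sum_negf[symmetric])
  qed
  have "distr M (?FV \<Otimes>\<^sub>M vec_borel l) (\<lambda>\<omega>. ((\<omega>, Y \<omega>), Z \<omega>)) = distr M (?FV \<Otimes>\<^sub>M vec_borel l) (\<lambda>\<omega>. ((\<omega>, - Y \<omega>), - Z \<omega>))"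
  proof (rule distr_pair_eqI)
    fix a b assume a[measurable]: "a \<in> sets ?FV" and b: "b \<in> sets (vec_borel l)"
    let ?nb = "{x \<in> space (vec_borel l). - x \<in> b}"
    have nb: "?nb \<in> sets (vec_borel l)"
      using b by measurable
    have 3: "{\<omega> \<in> space M. Z \<omega> \<in> ?nb} = {\<omega> \<in> space M. - Z \<omega> \<in> b}"
      using measurable_space[OF Z] by blast
    note [measurable] = Y idG
    have a1: "{\<omega> \<in> space G. (\<omega>, Y \<omega>) \<in> a} \<in> sets G" and a2: "{\<omega> \<in> space G. (\<omega>, - Y \<omega>) \<in> a} \<in> sets G"
      by measurable
    have "prob {\<omega> \<in> space M. (\<omega>, Y \<omega>) \<in> a} = prob {\<omega> \<in> space M. (\<omega>, - Y \<omega>) \<in> a}"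
    proof -
      have "measure (distr M ?FV (\<lambda>\<omega>. (\<omega>, Y \<omega>))) a = measure (distr M ?FV (\<lambda>\<omega>. (\<omega>, - Y \<omega>))) a"
        using sym by (simp add: sym_given_def)
      then show ?thesis
        by (subst (asm) (1 2) measure_distr) (auto simp: vimage_def Int_def conj_commute)
    qed
    moreover have "{\<omega> \<in> space M. (\<omega>, Y \<omega>) \<in> a \<and> Z \<omega> \<in> b} = {\<omega> \<in> space G. (\<omega>, Y \<omega>) \<in> a} \<inter> {\<omega> \<in> space M. Z \<omega> \<in> b}"
      "{\<omega> \<in> space M. (\<omega>, - Y \<omega>) \<in> a \<and> - Z \<omega> \<in> b} = {\<omega> \<in> space G. (\<omega>, - Y \<omega>) \<in> a} \<inter> {\<omega> \<in> space M. Z \<omega> \<in> ?nb}"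
      unfolding G.space_F using measurable_space[OF Z] by blast+
    moreover have "prob {\<omega> \<in> space M. Z \<omega> \<in> ?nb} = prob {\<omega> \<in> space M. Z \<omega> \<in> b}"
      using symZ b 3 by (simp add: symmetric_law_def)
    ultimately show "prob {\<omega> \<in> space M. (\<omega>, Y \<omega>) \<in> a \<and> Z \<omega> \<in> b} = prob {\<omega> \<in> space M. (\<omega>, - Y \<omega>) \<in> a \<and> - Z \<omega> \<in> b}"
      by (simp only: indep_of_algD[OF indep a1 b] indep_of_algD[OF indep a2 nb]) (simp only: G.space_F)
  qed measurable
  then have "distr (distr M (?FV \<Otimes>\<^sub>M vec_borel l) (\<lambda>\<omega>. ((\<omega>, Y \<omega>), Z \<omega>))) ?FV ?T
      = distr (distr M (?FV \<Otimes>\<^sub>M vec_borel l) (\<lambda>\<omega>. ((\<omega>, - Y \<omega>), - Z \<omega>))) ?FV ?T"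
    by simp
  then have "distr M ?FV (\<lambda>\<omega>. (\<omega>, A *\<^sub>v Y \<omega> + L *\<^sub>v Z \<omega>)) = distr M ?FV (\<lambda>\<omega>. (\<omega>, A *\<^sub>v (- Y \<omega>) + L *\<^sub>v (- Z \<omega>)))"
    by (subst (asm) (1 2) distr_distr[OF T]) (measurable, simp add: comp_def)
  also have "\<dots> = distr M ?FV (\<lambda>\<omega>. (\<omega>, - (A *\<^sub>v Y \<omega> + L *\<^sub>v Z \<omega>)))"
    by (intro distr_cong refl) (simp add: neg)
  finally show ?thesis
    by (simp add: sym_given_def)
qed

text \<open>
  Conditioning additionally on an even decision \<open>\<delta>\<close> about \<open>X\<close>, and on \<open>X\<close> itself where \<open>\<delta>\<close> and \<open>a\<close> hold,
  keeps what remains of \<open>X\<close> symmetric: on the complement the sign of \<open>X\<close> can still be flipped.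
\<close>

lemma sym_given_censored:
  assumes sym: "sym_given M F n X"
    and h[measurable]: "h \<in> measurable (F \<Otimes>\<^sub>M vec_borel n) (count_space UNIV)"
    and even: "\<And>\<omega> x. \<omega> \<in> space M \<Longrightarrow> x \<in> carrier_vec n \<Longrightarrow> h (\<omega>, - x) = h (\<omega>, x)"
    and \<delta>[measurable]: "\<delta> \<in> measurable M (count_space UNIV)" and AE: "AE \<omega> in M. \<delta> \<omega> = h (\<omega>, X \<omega>)"
    and a[measurable]: "a \<in> measurable F (count_space UNIV)"
  shows "sym_given M (vimage_algebra (space M) (\<lambda>\<omega>. (\<omega>, \<delta> \<omega>, if \<delta> \<omega> \<and> a \<omega> then X \<omega> else 0\<^sub>v n))
       (F \<Otimes>\<^sub>M count_space UNIV \<Otimes>\<^sub>M vec_borel n)) n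
     (\<lambda>\<omega>. if \<delta> \<omega> \<and> a \<omega> then 0\<^sub>v n else X \<omega>)"
proof -
  have X[measurable]: "X \<in> measurable M (vec_borel n)"
    using sym by (simp add: sym_given_def)
  have Xc: "X \<omega> \<in> carrier_vec n" if "\<omega> \<in> space M" for \<omega>
    by (rule measurable_vec_borel_carrier[OF X that])
  note [measurable] = measurable_F[OF a] measurable_vec_const[OF zero_carrier_vec]
  let ?V = "vec_borel n" and ?N = "F \<Otimes>\<^sub>M (count_space UNIV :: bool measure) \<Otimes>\<^sub>M vec_borel n"
  let ?\<phi> = "\<lambda>\<omega>. (\<omega>, \<delta> \<omega>, if \<delta> \<omega> \<and> a \<omega> then X \<omega> else 0\<^sub>v n)"
  let ?\<psi> = "\<lambda>\<omega>. if \<delta> \<omega> \<and> a \<omega> then 0\<^sub>v n else X \<omega>"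
  \<comment> \<open>\<open>\<phi>\<close> and \<open>\<psi>\<close> are the recorded data and the
    remainder as functions of an outcome and a vector, with the even rule \<open>h\<close> in place
    of \<open>\<delta>\<close>. Along \<open>X\<close> they agree with the actual ones almost
    everywhere.\<close>
  define \<phi> where "\<phi> p = (fst p, h p, if h p \<and> a (fst p) then snd p else 0\<^sub>v n)" for p
  define \<psi> where "\<psi> p = (if h p \<and> a (fst p) then 0\<^sub>v n else snd p)" for p
  have \<phi>[measurable]: "\<phi> \<in> measurable (F \<Otimes>\<^sub>M ?V) ?N"
    unfolding \<phi>_def by measurable
  have \<psi>[measurable]: "\<psi> \<in> measurable (F \<Otimes>\<^sub>M ?V) ?V"
    unfolding \<psi>_def by measurable
  let ?F' = "vimage_algebra (space M) ?\<phi> ?N"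
  have \<phi>M[measurable]: "?\<phi> \<in> measurable M ?N" by measurable
  have \<psi>M[measurable]: "?\<psi> \<in> measurable M ?V" by measurable
  have F': "subalgebra M ?F'"
    using measurable_vimageI[OF \<phi>M] by (simp add: subalgebra_def)
  interpret F': sub_alg M ?F' by (rule sub_alg.intro[OF prob_space_axioms]) (rule sub_alg_axioms.intro[OF F'])
  let ?\<mu> = "distr M (F \<Otimes>\<^sub>M ?V) (\<lambda>\<omega>. (\<omega>, X \<omega>))"
  have flip: "prob {\<omega> \<in> space M. (\<omega>, X \<omega>) \<in> D} = prob {\<omega> \<in> space M. (\<omega>, - X \<omega>) \<in> D}" if [measurable]: "D \<in> sets (F \<Otimes>\<^sub>M ?V)" for D
  proof -
    have "measure ?\<mu> D = measure (distr M (F \<Otimes>\<^sub>M ?V) (\<lambda>\<omega>. (\<omega>, - X \<omega>))) D"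
      using sym by (simp add: sym_given_def)
    then show ?thesis
      by (subst (asm) (1 2) measure_distr) (auto simp: vimage_def Int_def conj_commute)
  qed
  have "distr M (?F' \<Otimes>\<^sub>M ?V) (\<lambda>\<omega>. (\<omega>, ?\<psi> \<omega>)) = distr M (?F' \<Otimes>\<^sub>M ?V) (\<lambda>\<omega>. (\<omega>, - ?\<psi> \<omega>))"
  proof (rule distr_pair_eqI)
    fix I B assume "I \<in> sets ?F'" and B[measurable]: "B \<in> sets ?V"
    then obtain D where D[measurable]: "D \<in> sets ?N" and I: "I = ?\<phi> -` D \<inter> space M"
      by (auto simp: sets_vimage_algebra_measurable[OF \<phi>M])
    have meas: "{\<omega> \<in> space M. ?\<phi> \<omega> \<in> D \<and> ?\<psi> \<omega> \<in> B} \<in> sets M" "{\<omega> \<in> space M. ?\<phi> \<omega> \<in> D \<and> - ?\<psi> \<omega> \<in> B} \<in> sets M"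
      by measurable
    let ?Q = "{p \<in> space (F \<Otimes>\<^sub>M ?V). \<phi> p \<in> D \<and> \<psi> p \<in> B}" and ?Q' = "{p \<in> space (F \<Otimes>\<^sub>M ?V). \<phi> p \<in> D \<and> - \<psi> p \<in> B}"
    let ?s = "{p \<in> space (F \<Otimes>\<^sub>M ?V). h p \<and> a (fst p)}"
    have Q[measurable]: "?Q \<in> sets (F \<Otimes>\<^sub>M ?V)" "?Q' \<in> sets (F \<Otimes>\<^sub>M ?V)" "?s \<in> sets (F \<Otimes>\<^sub>M ?V)"
      by measurable
    have mQ: "{\<omega> \<in> space M. (\<omega>, X \<omega>) \<in> R} \<in> events" if [measurable]: "R \<in> sets (F \<Otimes>\<^sub>M ?V)" for R
      by measurable
    have z: "- 0\<^sub>v n = (0\<^sub>v n :: real vec)" by (intro eq_vecI) auto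
    \<comment> \<open>Where \<open>X\<close> is revealed the remainder is 0, which is its own
      negative.\<close>
    have on: "?Q \<inter> ?s = ?Q' \<inter> ?s"
      by (auto simp: \<psi>_def z)
    \<comment> \<open>Elsewhere only the even decision is recorded about \<open>X\<close>, so
      reflection keeps the data and negates the remainder.\<close>
    have off: "{\<omega> \<in> space M. (\<omega>, - X \<omega>) \<in> ?Q - ?s} = {\<omega> \<in> space M. (\<omega>, X \<omega>) \<in> ?Q' - ?s}"
      using Xc even by (auto simp: \<phi>_def \<psi>_def space_pair_measure)
    have split: "prob {\<omega> \<in> space M. (\<omega>, X \<omega>) \<in> R} = prob {\<omega> \<in> space M. (\<omega>, X \<omega>) \<in> R \<inter> ?s} + prob {\<omega> \<in> space M. (\<omega>, X \<omega>) \<in> R - ?s}"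
      if [measurable]: "R \<in> sets (F \<Otimes>\<^sub>M ?V)" for R
      by (subst finite_measure_Union[symmetric]) (auto intro!: arg_cong[where f=prob])
    have "prob {\<omega> \<in> space M. ?\<phi> \<omega> \<in> D \<and> ?\<psi> \<omega> \<in> B} = prob {\<omega> \<in> space M. (\<omega>, X \<omega>) \<in> ?Q}"
    proof (rule finite_measure_eq_AE[OF _ meas(1) mQ[OF Q(1)]])
      show "AE \<omega> in M. (\<omega> \<in> {\<omega> \<in> space M. ?\<phi> \<omega> \<in> D \<and> ?\<psi> \<omega> \<in> B}) = (\<omega> \<in> {\<omega> \<in> space M. (\<omega>, X \<omega>) \<in> ?Q})"
        using AE AE_space by eventually_elim (auto simp: \<phi>_def \<psi>_def space_pair_measure Xc)
    qed
    also have "\<dots> = prob {\<omega> \<in> space M. (\<omega>, X \<omega>) \<in> ?Q'}"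
      unfolding split[OF Q(1)] split[OF Q(2)] on flip[of "?Q - ?s", OF sets.Diff[OF Q(1) Q(3)]] off ..
    also have "\<dots> = prob {\<omega> \<in> space M. ?\<phi> \<omega> \<in> D \<and> - ?\<psi> \<omega> \<in> B}"
    proof (rule finite_measure_eq_AE[OF _ mQ[OF Q(2)] meas(2)])
      show "AE \<omega> in M. (\<omega> \<in> {\<omega> \<in> space M. (\<omega>, X \<omega>) \<in> ?Q'}) = (\<omega> \<in> {\<omega> \<in> space M. ?\<phi> \<omega> \<in> D \<and> - ?\<psi> \<omega> \<in> B})"
        using AE AE_space by eventually_elim (auto simp: \<phi>_def \<psi>_def space_pair_measure Xc)
    qed
    finally show "prob {\<omega> \<in> space M. \<omega> \<in> I \<and> ?\<psi> \<omega> \<in> B} = prob {\<omega> \<in> space M. \<omega> \<in> I \<and> - ?\<psi> \<omega> \<in> B}"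
      unfolding I by (simp add: conj_commute cong: conj_cong)
  qed measurable
  with \<psi>M show ?thesis
    by (simp add: sym_given_def)
qed

end

section \<open>Limit superior of averages\<close>

text \<open>
  The defect \<open>p * s T\<close> need not be small at every \<open>T\<close>. By the bound on its sum it is bounded at some
  time in \<open>[T, (1 + \<eta>) T]\<close>, and the monotonicity of \<open>a\<close> transports the estimate back to \<open>T\<close>.
\<close>

lemma limsup_average_le:
  fixes a b s :: "nat \<Rightarrow> real"
  assumes mono: "mono a" and b0: "\<And>T. 0 \<le> b T" and s0: "\<And>T. 0 \<le> s T" and p: "0 \<le> p" and C: "0 \<le> C"
    and ab: "\<And>T. a T \<le> b T + p * s T"
    and sum: "\<And>T. (\<Sum>k<T. s k) \<le> C * (b (T + N) + real T + 1)"
  shows "limsup (\<lambda>T. ennreal (a T) / of_nat T) \<le> limsup (\<lambda>T. ennreal (b T) / of_nat T)"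
proof (rule dense_ge)
  fix c' assume less: "limsup (\<lambda>T. ennreal (b T) / of_nat T) < c'"
  show "limsup (\<lambda>T. ennreal (a T) / of_nat T) \<le> c'"
  proof (cases "c' = \<infinity>")
    case False
    then obtain c where c: "c' = ennreal c" "0 \<le> c"
      by (metis ennreal_cases infinity_ennreal_def)
    have div: "ennreal x / of_nat T = ennreal (x / real T)" if "0 < T" for x T
      using that by (cases "0 \<le> x") (auto simp: ennreal_of_nat_eq_real_of_nat divide_ennreal ennreal_neg divide_nonpos_pos)
    have "eventually (\<lambda>T. ennreal (b T) / of_nat T < c') sequentially"
      using Limsup_lessD[OF less] .
    then obtain T0 where T0: "\<And>T. T \<ge> T0 \<Longrightarrow> ennreal (b T) / of_nat T < c'"
      by (auto simp: eventually_sequentially)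
    have bc: "b T \<le> c * real T" if "T \<ge> max T0 1" for T
    proof -
      have "ennreal (b T / real T) < ennreal c"
        using T0[of T] that div[of T "b T"] c by simp
      then have "b T / real T \<le> c"
        using b0[of T] by (metis c(2) ennreal_le_iff less_imp_le)
      then show ?thesis
        using that by (simp add: field_simps)
    qed
    have main: "limsup (\<lambda>T. ennreal (a T) / of_nat T) \<le> ennreal (c * (1 + \<eta>) + \<eta>)" if \<eta>: "0 < \<eta>" for \<eta> :: real
    proof -
      \<comment> \<open>\<open>K * T\<close> bounds the sum of \<open>s\<close> over all times up to
        the end of the window: \<open>b\<close> is at most \<open>c\<close> times its argument, and
        1 and \<open>N\<close> are absorbed into multiples of \<open>T \<ge> 1\<close>.\<close>
      define K where "K = C * (c * (2 + \<eta> + real N) + (2 + \<eta>) + 1)"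
      have K: "0 \<le> K" using C c \<eta> by (simp add: K_def)
      have aT: "a T \<le> c * (1 + \<eta>) * real T + p * (K / \<eta>)" if T: "T \<ge> max T0 1" for T
      proof -
        define H where "H = nat \<lfloor>\<eta> * real T\<rfloor>"
        have T1: "1 \<le> real T" using T by simp
        have H: "real H \<le> \<eta> * real T" "\<eta> * real T \<le> real H + 1"
          using \<eta> T by (auto simp: H_def)
        \<comment> \<open>Pigeonhole: the window has \<open>H + 1 \<ge> \<eta> * T\<close> times, so
          values above \<open>K / \<eta>\<close> throughout would sum to more than
          \<open>K * T\<close>.\<close>
        have "\<exists>k\<in>{T..T + H}. s k \<le> K / \<eta>"
        proof (rule ccontr)
          assume "\<not> (\<exists>k\<in>{T..T + H}. s k \<le> K / \<eta>)"
          then have gt: "s k > K / \<eta>" if "k \<in> {T..T + H}" for k using that by force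
          have "K * real T = (K / \<eta>) * (\<eta> * real T)" using \<eta> by simp
          also have "\<dots> \<le> (K / \<eta>) * (real H + 1)" using H K \<eta> by (intro mult_left_mono) auto
          also have "\<dots> = (\<Sum>k\<in>{T..T + H}. K / \<eta>)" by (simp add: algebra_simps)
          also have "\<dots> < (\<Sum>k\<in>{T..T + H}. s k)" using gt by (intro sum_strict_mono) auto
          also have "\<dots> \<le> (\<Sum>k<T + H + 1. s k)" using s0 by (intro sum_mono2) auto
          also have "\<dots> \<le> C * (b (T + H + 1 + N) + real (T + H + 1) + 1)" by (rule sum)
          also have "\<dots> \<le> C * (c * real (T + H + 1 + N) + real (T + H + 1) + 1)"
            using C T bc[of "T + H + 1 + N"] by (intro mult_left_mono) auto
          also have "\<dots> \<le> C * (c * ((2 + \<eta> + real N) * real T) + (2 + \<eta>) * real T + real T)"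
          proof -
            have 1: "real (T + H + 1 + N) \<le> (2 + \<eta> + real N) * real T"
              using H(1) T1 mult_right_mono[OF T1, of "real N"] by (simp add: algebra_simps)
            have 2: "real (T + H + 1) \<le> (2 + \<eta>) * real T"
              using H(1) T1 by (simp add: algebra_simps)
            show ?thesis
              using 1 2 T1 C c by (intro mult_left_mono add_mono) auto
          qed
          also have "\<dots> = K * real T" by (simp add: K_def algebra_simps)
          finally show False by simp
        qed
        then obtain k where k: "T \<le> k" "k \<le> T + H" "s k \<le> K / \<eta>" by auto
        have "a T \<le> a k" using mono k by (simp add: monoD)
        also have "\<dots> \<le> b k + p * s k" by (rule ab)
        also have "\<dots> \<le> c * real k + p * (K / \<eta>)"
          using bc[of k] k T p by (intro add_mono mult_left_mono) auto
        also have "c * real k \<le> c * ((1 + \<eta>) * real T)"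
          using k H c by (intro mult_left_mono) (auto simp: algebra_simps)
        finally show ?thesis by (simp add: mult_ac)
      qed
      \<comment> \<open>The constant \<open>p * (K / \<eta>)\<close> is absorbed by
        \<open>\<eta> * T\<close> once \<open>T\<close> is large.\<close>
      have "eventually (\<lambda>T. ennreal (a T) / of_nat T \<le> ennreal (c * (1 + \<eta>) + \<eta>)) sequentially"
      proof -
        obtain T1 :: nat where T1: "real T1 \<ge> p * (K / \<eta>) / \<eta>" using real_arch_simple by blast
        show ?thesis
          unfolding eventually_sequentially
        proof (intro exI allI impI)
          fix T assume T: "max (max T0 1) T1 \<le> T"
          then have pos: "0 < real T" by simp
          have "p * (K / \<eta>) / \<eta> \<le> real T" using T T1 by (meson max.boundedE of_nat_le_iff order_trans)
          then have "p * (K / \<eta>) \<le> \<eta> * real T" using \<eta> by (simp add: pos_divide_le_eq algebra_simps)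
          then have "a T \<le> (c * (1 + \<eta>) + \<eta>) * real T"
            using aT[of T] T by (simp add: distrib_right)
          then have "a T / real T \<le> c * (1 + \<eta>) + \<eta>"
            using pos by (simp add: pos_divide_le_eq)
          then show "ennreal (a T) / of_nat T \<le> ennreal (c * (1 + \<eta>) + \<eta>)"
            using T by (simp add: div ennreal_leI)
        qed
      qed
      then show ?thesis by (rule Limsup_bounded)
    qed
    have "limsup (\<lambda>T. ennreal (a T) / of_nat T) \<le> ennreal (c + e)" if e: "0 < e" for e :: real
    proof -
      define \<eta> where "\<eta> = e / (c + 1)"
      have "\<eta> * (c + 1) = e"
        using c by (simp add: \<eta>_def)
      then have "c * (1 + \<eta>) + \<eta> = c + e"
        by (simp add: algebra_simps)
      moreover have "0 < \<eta>"
        using e c by (simp add: \<eta>_def)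
      ultimately show ?thesis using main[of \<eta>] by simp
    qed
    then have eps: "limsup (\<lambda>T. ennreal (a T) / of_nat T) \<le> ennreal c + ennreal e" if "0 < e" for e :: real
      using that c by (simp add: ennreal_plus[symmetric] del: ennreal_plus)
    show ?thesis
      unfolding c(1) by (rule ennreal_le_epsilon) (rule eps)
  qed simp
qed

section \<open>Quadratic forms\<close>

text \<open>Bolzano-Weierstrass one coordinate at a time: each coordinate thins out the subsequence
  found for the previous ones.\<close>

lemma bounded_coordinates_convergent_subseq:
  fixes f :: "nat \<Rightarrow> nat \<Rightarrow> real"
  assumes "\<And>k a. a < n \<Longrightarrow> \<bar>f k a\<bar> \<le> 1"
  shows "\<exists>r l. strict_mono (r :: nat \<Rightarrow> nat) \<and> (\<forall>a<n. (\<lambda>k. f (r k) a) \<longlonglongrightarrow> l a)"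
  using assms
proof (induction n)
  case 0
  show ?case by (intro exI[of _ "\<lambda>k. k"]) (auto simp: strict_mono_def)
next
  case (Suc n)
  then obtain r l where r: "strict_mono (r :: nat \<Rightarrow> nat)" and l: "\<And>a. a < n \<Longrightarrow> (\<lambda>k. f (r k) a) \<longlonglongrightarrow> l a"
    by (meson less_SucI)
  have "f (r k) n \<in> {-1..1}" for k
    using Suc.prems[of n "r k"] by (auto simp: abs_le_iff)
  then obtain x r' where r': "strict_mono (r' :: nat \<Rightarrow> nat)" and x: "((\<lambda>k. f (r k) n) \<circ> r') \<longlonglongrightarrow> x"
    using compact_Icc[of "-1::real" 1] unfolding compact_def by meson
  have "(\<lambda>k. f ((r \<circ> r') k) a) \<longlonglongrightarrow> (l(n := x)) a" if "a < Suc n" for a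
    using LIMSEQ_subseq_LIMSEQ[OF l[of a] r'] x that by (cases "a = n") (auto simp: comp_def)
  moreover have "strict_mono (r \<circ> r')"
    using r r' by (rule strict_mono_o)
  ultimately show ?case by blast
qed

lemma quadratic_form_sum:
  fixes G :: "real mat"
  assumes "G \<in> carrier_mat n n" "x \<in> carrier_vec n"
  shows "x \<bullet> (G *\<^sub>v x) = (\<Sum>a<n. \<Sum>b<n. G $$ (a, b) * x $ a * x $ b)"
proof -
  have "x \<bullet> (G *\<^sub>v x) = (\<Sum>a<n. x $ a * (G *\<^sub>v x) $ a)"
    using assms by (intro scalar_prod_sum mult_mat_vec_carrier)
  also have "\<dots> = (\<Sum>a<n. \<Sum>b<n. G $$ (a, b) * x $ a * x $ b)"
  proof (rule sum.cong[OF refl])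
    fix a assume "a \<in> {..<n}"
    then have "x $ a * (G *\<^sub>v x) $ a = (\<Sum>b<n. x $ a * (G $$ (a, b) * x $ b))"
      using assms by (simp add: mult_mat_vec_index sum_distrib_left del: index_mult_mat_vec)
    also have "\<dots> = (\<Sum>b<n. G $$ (a, b) * x $ a * x $ b)"
      by (rule sum.cong[OF refl]) (simp only: mult.assoc mult.left_commute)
    finally show "x $ a * (G *\<^sub>v x) $ a = (\<Sum>b<n. G $$ (a, b) * x $ a * x $ b)" .
  qed
  finally show ?thesis .
qed

lemma nsq_sum: "x \<in> carrier_vec n \<Longrightarrow> x \<bullet> x = (\<Sum>a<n. (x $ a)\<^sup>2)" for x :: "real vec"
  by (simp add: scalar_prod_sum power2_eq_square)

lemma nsq_nonneg [simp]: "0 \<le> x \<bullet> (x :: real vec)"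
  using nsq_sum[of x "dim_vec x"] by (simp add: sum_nonneg)

lemma nsq_eq_0: "x \<in> carrier_vec n \<Longrightarrow> x \<bullet> x = 0 \<Longrightarrow> x = 0\<^sub>v n" for x :: "real vec"
  by (intro eq_vecI) (auto simp: nsq_sum sum_nonneg_eq_0_iff)

lemma index_sq_le_nsq: "x \<in> carrier_vec n \<Longrightarrow> a < n \<Longrightarrow> (x $ a)\<^sup>2 \<le> x \<bullet> x" for x :: "real vec"
  unfolding nsq_sum by (rule member_le_sum) auto

text \<open>Compactness of the unit sphere: if no finite number of forms controlled the norm,
  normalised counterexamples would accumulate at a unit vector on which all forms vanish. For the
  observability forms this takes the place of Cayley-Hamilton.\<close>

lemma coercive_sum_quadratic_forms:
  fixes G :: "nat \<Rightarrow> real mat"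
  assumes G: "\<And>j. G j \<in> carrier_mat n n"
    and nonneg: "\<And>j x. x \<in> carrier_vec n \<Longrightarrow> 0 \<le> x \<bullet> (G j *\<^sub>v x)"
    and definite: "\<And>x. x \<in> carrier_vec n \<Longrightarrow> (\<And>j. x \<bullet> (G j *\<^sub>v x) = 0) \<Longrightarrow> x = 0\<^sub>v n"
  shows "\<exists>N. \<exists>c>0. \<forall>x\<in>carrier_vec n. x \<bullet> x \<le> c * (\<Sum>j<N. x \<bullet> (G j *\<^sub>v x))"
proof (rule ccontr)
  assume "\<not> ?thesis"
  \<comment> \<open>The failure is used with \<open>N\<close> forms and the constant
    \<open>N + 1\<close>, so that both grow along the sequence.\<close>
  then have "\<exists>x\<in>carrier_vec n. real (Suc N) * (\<Sum>j<N. x \<bullet> (G j *\<^sub>v x)) < x \<bullet> x" for N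
    by (meson not_le of_nat_0_less_iff zero_less_Suc)
  then obtain y where y: "\<And>N. y N \<in> carrier_vec n" "\<And>N. real (Suc N) * (\<Sum>j<N. y N \<bullet> (G j *\<^sub>v y N)) < y N \<bullet> y N"
    by metis
  define x where "x N = (1 / sqrt (y N \<bullet> y N)) \<cdot>\<^sub>v y N" for N
  have ypos: "0 < y N \<bullet> y N" for N
  proof -
    have "0 \<le> real (Suc N) * (\<Sum>j<N. y N \<bullet> (G j *\<^sub>v y N))"
      using nonneg[OF y(1)] by (intro mult_nonneg_nonneg sum_nonneg) auto
    then show ?thesis using y(2)[of N] by linarith
  qed
  have x: "x N \<in> carrier_vec n" for N
    using y(1) by (simp add: x_def)
  have scale: "x N \<bullet> (H *\<^sub>v x N) = (y N \<bullet> (H *\<^sub>v y N)) / (y N \<bullet> y N)" if H: "H \<in> carrier_mat n n" for H N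
    using H y(1)[of N] ypos[of N]
    by (auto simp: x_def mult_mat_vec[OF H y(1)] field_simps power2_eq_square[symmetric] simp del: index_mult_mat_vec)
  have x1: "x N \<bullet> x N = 1" for N
    using scale[of "1\<^sub>m n" N] x y(1) ypos[of N] by auto
  have small: "x N \<bullet> (G j *\<^sub>v x N) \<le> 1 / real (Suc N)" if "j < N" for j N
  proof -
    have "y N \<bullet> (G j *\<^sub>v y N) \<le> (\<Sum>j<N. y N \<bullet> (G j *\<^sub>v y N))"
      using that nonneg[OF y(1)] by (intro member_le_sum) auto
    also have "\<dots> \<le> (y N \<bullet> y N) / real (Suc N)"
      using y(2)[of N] by (simp add: pos_le_divide_eq mult.commute)
    finally show ?thesis
      unfolding scale[OF G] using ypos[of N] by (simp add: field_simps)
  qed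
  have "\<bar>x N $ a\<bar> \<le> 1" if "a < n" for N a
    using index_sq_le_nsq[OF x that, of N] x1[of N] by (simp add: abs_square_le_1)
  from bounded_coordinates_convergent_subseq[of n "\<lambda>N a. x N $ a", OF this] obtain r l where r: "strict_mono (r :: nat \<Rightarrow> nat)"
    and l: "\<And>a. a < n \<Longrightarrow> (\<lambda>k. x (r k) $ a) \<longlonglongrightarrow> l a" by blast
  define z where "z = vec n l"
  have z: "z \<in> carrier_vec n" by (simp add: z_def)
  have conv: "(\<lambda>k. x (r k) \<bullet> (H *\<^sub>v x (r k))) \<longlonglongrightarrow> z \<bullet> (H *\<^sub>v z)" if H: "H \<in> carrier_mat n n" for H
    unfolding quadratic_form_sum[OF H x] quadratic_form_sum[OF H z]
    by (intro tendsto_sum tendsto_mult tendsto_const) (auto simp: z_def l)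
  have "z \<bullet> (G j *\<^sub>v z) = 0" for j
  proof (rule antisym)
    have "(\<lambda>k. 1 / real (Suc (r k))) \<longlonglongrightarrow> 0"
      using LIMSEQ_subseq_LIMSEQ[OF LIMSEQ_inverse_real_of_nat r] by (simp add: comp_def inverse_eq_divide)
    moreover have "eventually (\<lambda>k. x (r k) \<bullet> (G j *\<^sub>v x (r k)) \<le> 1 / real (Suc (r k))) sequentially"
      using eventually_gt_at_top[of j]
    proof eventually_elim
      case (elim k)
      \<comment> \<open>\<open>r k \<ge> k\<close>, so a fixed \<open>j\<close> is eventually among
        the first \<open>r k\<close> forms.\<close>
      then show ?case using seq_suble[OF r, of k] by (intro small) linarith
    qed
    ultimately show "z \<bullet> (G j *\<^sub>v z) \<le> 0"
      using tendsto_le[OF sequentially_bot _ conv[OF G]] by blast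
  qed (rule nonneg[OF z])
  then have "z = 0\<^sub>v n" by (rule definite[OF z])
  \<comment> \<open>The identity matrix, taken as one more form, shows that the limit keeps norm
    1.\<close>
  moreover have "z \<bullet> z = 1"
    using LIMSEQ_unique[OF conv[of "1\<^sub>m n"]] x x1 z by auto
  ultimately show False by simp
qed

section \<open>Bounds and algebra of a single quadratic form\<close>

lemma quadratic_form_bound:
  assumes G: "(G :: real mat) \<in> carrier_mat n n"
  shows "\<exists>c\<ge>0. \<forall>x\<in>carrier_vec n. x \<bullet> (G *\<^sub>v x) \<le> c * (x \<bullet> x)"
proof (intro exI[of _ "\<Sum>a<n. \<Sum>b<n. \<bar>G $$ (a, b)\<bar>"] conjI ballI)
  fix x :: "real vec" assume x: "x \<in> carrier_vec n"
  have "G $$ (a, b) * x $ a * x $ b \<le> \<bar>G $$ (a, b)\<bar> * (x \<bullet> x)" if "a < n" "b < n" for a b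
  proof -
    have "2 * (\<bar>x $ a\<bar> * \<bar>x $ b\<bar>) \<le> (x $ a)\<^sup>2 + (x $ b)\<^sup>2"
      using sum_squares_bound[of "\<bar>x $ a\<bar>" "\<bar>x $ b\<bar>"] by simp
    then have "\<bar>x $ a * x $ b\<bar> \<le> x \<bullet> x"
      unfolding abs_mult using index_sq_le_nsq[OF x that(1)] index_sq_le_nsq[OF x that(2)] by linarith
    then have "\<bar>G $$ (a, b) * (x $ a * x $ b)\<bar> \<le> \<bar>G $$ (a, b)\<bar> * (x \<bullet> x)"
      unfolding abs_mult[of "G $$ (a, b)"] by (rule mult_left_mono) simp
    then show ?thesis
      unfolding mult.assoc by linarith
  qed
  then show "x \<bullet> (G *\<^sub>v x) \<le> (\<Sum>a<n. \<Sum>b<n. \<bar>G $$ (a, b)\<bar>) * (x \<bullet> x)"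
    unfolding quadratic_form_sum[OF G x] sum_distrib_right by (intro sum_mono) auto
qed (simp add: sum_nonneg)

lemma scalar_prod_mult_mat_vec:
  fixes A :: "real mat"
  assumes "A \<in> carrier_mat m n" "x \<in> carrier_vec n" "y \<in> carrier_vec m"
  shows "(A *\<^sub>v x) \<bullet> y = x \<bullet> (transpose_mat A *\<^sub>v y)"
  using transpose_vec_mult_scalar[OF assms] assms
  by (metis comm_scalar_prod mult_mat_vec_carrier transpose_carrier_mat)

lemma nsq_mult_mat_vec_bound:
  assumes A: "(A :: real mat) \<in> carrier_mat m n"
  shows "\<exists>c\<ge>0. \<forall>x\<in>carrier_vec n. (A *\<^sub>v x) \<bullet> (A *\<^sub>v x) \<le> c * (x \<bullet> x)"
proof -
  have "(A *\<^sub>v x) \<bullet> (A *\<^sub>v x) = x \<bullet> ((transpose_mat A * A) *\<^sub>v x)" if "x \<in> carrier_vec n" for x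
    using A that by (subst scalar_prod_mult_mat_vec[OF A that]) auto
  with quadratic_form_bound[of "transpose_mat A * A" n] A show ?thesis
    by auto
qed

lemma quadratic_form_add:
  assumes "sym_mat n G" and x: "x \<in> carrier_vec n" and y: "y \<in> carrier_vec n"
  shows "(x + y) \<bullet> (G *\<^sub>v (x + y)) = x \<bullet> (G *\<^sub>v x) + 2 * (y \<bullet> (G *\<^sub>v x)) + y \<bullet> (G *\<^sub>v y)"
proof -
  have G: "G \<in> carrier_mat n n" "transpose_mat G = G" using assms by (auto simp: sym_mat_def)
  have c: "G *\<^sub>v x \<in> carrier_vec n" "G *\<^sub>v y \<in> carrier_vec n" using G x y by auto
  have "x \<bullet> (G *\<^sub>v y) = y \<bullet> (G *\<^sub>v x)"
    using scalar_prod_mult_mat_vec[OF G(1) y x] G(2) comm_scalar_prod[OF x c(2)] by simp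
  moreover have "(x + y) \<bullet> (G *\<^sub>v (x + y)) = (x + y) \<bullet> (G *\<^sub>v x) + (x + y) \<bullet> (G *\<^sub>v y)"
    using G x y c by (simp add: mult_add_distrib_mat_vec[OF G(1)] scalar_prod_add_distrib[where n=n])
  ultimately show ?thesis
    using add_scalar_prod_distrib[OF x y c(1)] add_scalar_prod_distrib[OF x y c(2)] by simp
qed

lemma quadratic_form_uminus:
  assumes "G \<in> carrier_mat n n" and y: "y \<in> carrier_vec n"
  shows "(- y) \<bullet> (G *\<^sub>v (- y)) = y \<bullet> (G *\<^sub>v (y :: real vec))"
  using assms by (simp add: quadratic_form_sum)

lemma psd_quadratic_form_add_le:
  assumes G: "psd_mat n G" and x: "x \<in> carrier_vec n" and y: "y \<in> carrier_vec n"
  shows "(x + y) \<bullet> (G *\<^sub>v (x + y)) \<le> 2 * (x \<bullet> (G *\<^sub>v x)) + 2 * (y \<bullet> (G *\<^sub>v y))"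
proof -
  have s: "sym_mat n G" "G \<in> carrier_mat n n" using G by (auto simp: psd_mat_def sym_mat_def)
  have my: "- y \<in> carrier_vec n" using y by simp
  have "(- y) \<bullet> (G *\<^sub>v x) = - (y \<bullet> (G *\<^sub>v x))"
    using s x y by (intro scalar_prod_uminus_left) auto
  moreover have "0 \<le> (x + - y) \<bullet> (G *\<^sub>v (x + - y))"
    using G x my by (simp add: psd_mat_def)
  ultimately show ?thesis
    unfolding quadratic_form_add[OF s(1) x y] quadratic_form_add[OF s(1) x my] quadratic_form_uminus[OF s(2) y] by linarith
qed

lemma psd_one: "psd_mat n (1\<^sub>m n)"
  by (auto simp: psd_mat_def sym_mat_def)

lemma nsq_add_le:
  fixes x y :: "real vec"
  assumes "x \<in> carrier_vec n" "y \<in> carrier_vec n"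
  shows "(x + y) \<bullet> (x + y) \<le> 2 * (x \<bullet> x) + 2 * (y \<bullet> y)"
  using psd_quadratic_form_add_le[OF psd_one assms] assms by simp

section \<open>Inverses and definite matrices\<close>

lemma mat_inv_correct:
  assumes A: "(A :: real mat) \<in> carrier_mat n n" and inv: "det A \<noteq> 0"
  shows "A * mat_inv A = 1\<^sub>m n" "mat_inv A * A = 1\<^sub>m n" "mat_inv A \<in> carrier_mat n n"
proof -
  from det_non_zero_imp_unit[OF A inv, of "()"] mat_inverse(1)[OF A, of "()"]
  obtain B where "mat_inverse A = Some B" by (cases "mat_inverse A") auto
  with mat_inverse(2)[OF A this] show "A * mat_inv A = 1\<^sub>m n" "mat_inv A * A = 1\<^sub>m n" "mat_inv A \<in> carrier_mat n n"
    by (auto simp: mat_inv_def)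
qed

lemma pd_mat_det:
  assumes "pd_mat n A"
  shows "det A \<noteq> 0"
proof
  assume "det A = 0"
  moreover have A: "A \<in> carrier_mat n n" using assms by (simp add: pd_mat_def sym_mat_def)
  ultimately obtain v where "v \<in> carrier_vec n" "v \<noteq> 0\<^sub>v n" "A *\<^sub>v v = 0\<^sub>v n"
    using det_0_iff_vec_prod_zero_field[OF A] by blast
  with assms show False by (force simp: pd_mat_def)
qed

text \<open>Well-posedness speaks of \<open>invertible_mat\<close>, the threshold rule of
  \<open>mat_inv\<close>. What is drawn from it is the dimension of the inverse, which makes the
  quadratic form even.\<close>

lemma invertible_mat_inv_dim:
  assumes A: "(A :: real mat) \<in> carrier_mat n n" and "invertible_mat A"
  shows "mat_inv A \<in> carrier_mat n n"
proof -
  from assms(2) obtain B where B: "A * B = 1\<^sub>m (dim_row A)" "B * A = 1\<^sub>m (dim_row B)"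
    by (auto simp: invertible_mat_def inverts_mat_def)
  have dB: "B \<in> carrier_mat n n"
    using A arg_cong[OF B(1), of dim_col] arg_cong[OF B(2), of dim_col] by auto
  have "det A * det B = 1"
    using B(1) A det_mult[OF A dB] by simp
  then have "det A \<noteq> 0" by auto
  then show ?thesis by (rule mat_inv_correct(3)[OF A])
qed

lemma psd_congruence:
  assumes A: "A \<in> carrier_mat m n" and G: "psd_mat n G"
  shows "psd_mat m (A * G * transpose_mat A)"
proof -
  have Gc: "G \<in> carrier_mat n n" "transpose_mat G = G" using G by (auto simp: psd_mat_def sym_mat_def)
  have "transpose_mat (A * G * transpose_mat A) = A * G * transpose_mat A"
  proof -
    have AG: "A * G \<in> carrier_mat m n" and At: "transpose_mat A \<in> carrier_mat n m" using A Gc by auto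
    have "transpose_mat (A * G * transpose_mat A) = A * (G * transpose_mat A)"
      using transpose_mult[OF AG At] transpose_mult[OF A Gc(1)] Gc(2) by simp
    then show ?thesis using assoc_mult_mat[OF A Gc(1) At] by simp
  qed
  moreover have "0 \<le> v \<bullet> ((A * G * transpose_mat A) *\<^sub>v v)" if v: "v \<in> carrier_vec m" for v
  proof -
    have tv: "transpose_mat A *\<^sub>v v \<in> carrier_vec n" using A v by auto
    have "(A * G * transpose_mat A) *\<^sub>v v = A *\<^sub>v (G *\<^sub>v (transpose_mat A *\<^sub>v v))"
      using A Gc v tv by (subst assoc_mult_mat_vec[where n\<^sub>2=n]) auto
    then have "v \<bullet> ((A * G * transpose_mat A) *\<^sub>v v) = (transpose_mat A *\<^sub>v v) \<bullet> (G *\<^sub>v (transpose_mat A *\<^sub>v v))"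
      using scalar_prod_mult_mat_vec[of "transpose_mat A" n m v "G *\<^sub>v (transpose_mat A *\<^sub>v v)"] A Gc v tv by auto
    then show ?thesis using G tv by (simp add: psd_mat_def)
  qed
  ultimately show ?thesis
    using A Gc by (auto simp: psd_mat_def sym_mat_def)
qed

lemma psd_add_pd:
  assumes "psd_mat n G" "pd_mat n H"
  shows "pd_mat n (G + H)"
proof -
  have c: "G \<in> carrier_mat n n" "H \<in> carrier_mat n n" "transpose_mat G = G" "transpose_mat H = H"
    using assms by (auto simp: psd_mat_def pd_mat_def sym_mat_def)
  have "0 < v \<bullet> ((G + H) *\<^sub>v v)" if "v \<in> carrier_vec n" "v \<noteq> 0\<^sub>v n" for v
  proof -
    have "v \<bullet> ((G + H) *\<^sub>v v) = v \<bullet> (G *\<^sub>v v) + v \<bullet> (H *\<^sub>v v)"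
      using c that by (simp add: add_mult_distrib_mat_vec[OF c(1,2)] scalar_prod_add_distrib[where n=n])
    then show ?thesis using assms that by (simp add: psd_mat_def pd_mat_def add_nonneg_pos)
  qed
  then show ?thesis
    using c by (auto simp: pd_mat_def sym_mat_def transpose_add[OF c(1,2)])
qed

lemma pd_imp_psd:
  assumes "pd_mat n G"
  shows "psd_mat n G"
proof -
  have "0 \<le> v \<bullet> (G *\<^sub>v v)" if v: "v \<in> carrier_vec n" for v
  proof (cases "v = 0\<^sub>v n")
    case True
    have "G \<in> carrier_mat n n" using assms by (simp add: pd_mat_def sym_mat_def)
    then have "G *\<^sub>v v \<in> carrier_vec n" using v by simp
    then show ?thesis using True by simp
  next
    case False
    then show ?thesis using assms v unfolding pd_mat_def by (intro less_imp_le) blast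
  qed
  then show ?thesis using assms by (simp add: psd_mat_def pd_mat_def)
qed

text \<open>The compactness argument for a constant family of forms.\<close>

lemma pd_coercive:
  assumes G: "pd_mat n G"
  shows "\<exists>c>0. \<forall>x\<in>carrier_vec n. x \<bullet> x \<le> c * (x \<bullet> (G *\<^sub>v x))"
proof -
  have Gc: "G \<in> carrier_mat n n" using G by (simp add: pd_mat_def sym_mat_def)
  have nn: "0 \<le> x \<bullet> (G *\<^sub>v x)" if "x \<in> carrier_vec n" for x
    using pd_imp_psd[OF G] that by (simp add: psd_mat_def)
  have "\<exists>N::nat. \<exists>c>0. \<forall>x\<in>carrier_vec n. x \<bullet> x \<le> c * (\<Sum>j<N. x \<bullet> (G *\<^sub>v x))"
  proof (rule coercive_sum_quadratic_forms[of "\<lambda>_. G", OF Gc nn])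
    fix x :: "real vec" assume x: "x \<in> carrier_vec n" and "\<And>j :: nat. x \<bullet> (G *\<^sub>v x) = 0"
    then have "\<not> 0 < x \<bullet> (G *\<^sub>v x)" by simp
    then show "x = 0\<^sub>v n" using G x unfolding pd_mat_def by blast
  qed
  then obtain N c where c: "c > 0" and b: "\<And>x. x \<in> carrier_vec n \<Longrightarrow> x \<bullet> x \<le> c * (\<Sum>j<(N::nat). x \<bullet> (G *\<^sub>v x))"
    by blast
  \<comment> \<open>The number of copies may be 0; \<open>N + 1\<close> keeps the constant
    positive.\<close>
  have "x \<bullet> x \<le> (c * (real N + 1)) * (x \<bullet> (G *\<^sub>v x))" if x: "x \<in> carrier_vec n" for x
  proof -
    have "c * (\<Sum>j<N. x \<bullet> (G *\<^sub>v x)) \<le> (c * (real N + 1)) * (x \<bullet> (G *\<^sub>v x))"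
      using nn[OF x] c by (simp add: algebra_simps)
    with b[OF x] show ?thesis by linarith
  qed
  then show ?thesis
    using c by (intro exI[of _ "c * (real N + 1)"]) (simp add: add_nonneg_pos)
qed

section \<open>Matrix identities of a subsystem\<close>

locale lqg_subsystem =
  fixes S :: subsystem
  assumes ok: "subsystem_ok S"
begin

abbreviation "n \<equiv> dim_x S"
abbreviation "d \<equiv> dim_u S"
abbreviation "dy \<equiv> dim_y S"
abbreviation "A \<equiv> mA S"
abbreviation "B \<equiv> mB S"
abbreviation "C \<equiv> mC S"
abbreviation "Q \<equiv> mQ S"
abbreviation "R \<equiv> mR S"
abbreviation "P \<equiv> mP S"
abbreviation "K \<equiv> control_gain S"
abbreviation "L \<equiv> kalman_gain S"
abbreviation "\<Theta> \<equiv> mTheta S"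

text \<open>The weight of the control in the one-step cost plus cost-to-go; the excess cost of a
  policy is measured in it.\<close>

definition "\<Lambda> = transpose_mat B * P * B + R"

lemma dims [simp, intro]:
  "A \<in> carrier_mat n n" "B \<in> carrier_mat n d" "C \<in> carrier_mat dy n"
  "Q \<in> carrier_mat n n" "R \<in> carrier_mat d d" "P \<in> carrier_mat n n" "\<Theta> \<in> carrier_mat n n"
  "mW S \<in> carrier_mat n n" "mV S \<in> carrier_mat dy dy"
  using ok by (auto simp: subsystem_ok_def pd_mat_def psd_mat_def sym_mat_def)

lemma mat_dims [simp]:
  "dim_row A = n" "dim_col A = n" "dim_row B = n" "dim_col B = d" "dim_row C = dy" "dim_col C = n"
  "dim_row Q = n" "dim_col Q = n" "dim_row R = d" "dim_col R = d" "dim_row P = n" "dim_col P = n"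
  by (simp_all add: carrier_matD[OF dims(1)] carrier_matD[OF dims(2)] carrier_matD[OF dims(3)] carrier_matD[OF dims(4)] carrier_matD[OF dims(5)] carrier_matD[OF dims(6)])

declare mult_mat_vec_carrier [intro] mult_carrier_mat [intro] transpose_carrier_mat [THEN iffD2, intro]

lemma pds:
  "pd_mat n (mW S)" "pd_mat dy (mV S)" "psd_mat n Q" "pd_mat d R" "pd_mat n P" "psd_mat n \<Theta>"
  using ok by (auto simp: subsystem_ok_def)

lemma transposes: "transpose_mat P = P" "transpose_mat R = R" "transpose_mat Q = Q" "transpose_mat \<Theta> = \<Theta>"
  using pds by (auto simp: pd_mat_def psd_mat_def sym_mat_def)

lemma Lambda_pd: "pd_mat d \<Lambda>"
proof -
  have "psd_mat d (transpose_mat B * P * transpose_mat (transpose_mat B))"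
    using psd_congruence[of "transpose_mat B" d n P] pd_imp_psd[OF pds(5)] by simp
  then show ?thesis
    unfolding \<Lambda>_def using psd_add_pd pds(4) by simp
qed

lemma Lambda_carrier [simp, intro]: "\<Lambda> \<in> carrier_mat d d"
  using Lambda_pd by (simp add: pd_mat_def sym_mat_def)

lemma K_def': "K = - (mat_inv \<Lambda> * (transpose_mat B * P * A))"
  by (simp add: control_gain_def \<Lambda>_def)

lemma K_carrier [simp, intro]: "K \<in> carrier_mat d n"
proof -
  have "mat_inv \<Lambda> \<in> carrier_mat d d"
    using mat_inv_correct(3)[OF Lambda_carrier pd_mat_det[OF Lambda_pd]] .
  then show ?thesis unfolding K_def' by (subst uminus_carrier_iff_mat) blast
qed

text \<open>The stationarity condition of the one-step minimisation. It replaces the explicit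
  inverse in what follows.\<close>

lemma Lambda_K: "\<Lambda> * K = - (transpose_mat B * P * A)"
proof -
  note inv = mat_inv_correct[OF Lambda_carrier pd_mat_det[OF Lambda_pd]]
  have X: "transpose_mat B * P * A \<in> carrier_mat d n" by blast
  have "\<Lambda> * K = - (\<Lambda> * (mat_inv \<Lambda> * (transpose_mat B * P * A)))"
    unfolding K_def' using inv X by (intro uminus_mult_right_mat) (simp add: carrier_matD(2)[OF Lambda_carrier] carrier_matD(1)[OF inv(3)])
  also have "\<Lambda> * (mat_inv \<Lambda> * (transpose_mat B * P * A)) = transpose_mat B * P * A"
    using inv X by (simp add: assoc_mult_mat[OF Lambda_carrier inv(3) X, symmetric])
  finally show ?thesis .
qed

lemma riccati: "P = transpose_mat A * P * A + Q - transpose_mat K * \<Lambda> * K"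
  using ok unfolding subsystem_ok_def \<Lambda>_def[symmetric] by blast

text \<open>The dynamic programming step for the cost-to-go \<open>P\<close>: the terms quadratic in
  \<open>u\<close> give \<open>\<Lambda>\<close>, the mixed terms are matched by
  \<open>Lambda_K\<close>, and the Riccati equation accounts for what is left in
  \<open>x\<close>.\<close>

lemma completion_of_squares:
  assumes x: "x \<in> carrier_vec n" and u: "u \<in> carrier_vec d"
  shows "x \<bullet> (Q *\<^sub>v x) + u \<bullet> (R *\<^sub>v u) + (A *\<^sub>v x + B *\<^sub>v u) \<bullet> (P *\<^sub>v (A *\<^sub>v x + B *\<^sub>v u))
    = x \<bullet> (P *\<^sub>v x) + (u - K *\<^sub>v x) \<bullet> (\<Lambda> *\<^sub>v (u - K *\<^sub>v x))"
proof -
  have Kx: "K *\<^sub>v x \<in> carrier_vec d" and mKx: "- (K *\<^sub>v x) \<in> carrier_vec d"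
    using x by (blast intro: uminus_carrier_vec[THEN iffD2])+
  have Ax: "A *\<^sub>v x \<in> carrier_vec n" and Bu: "B *\<^sub>v u \<in> carrier_vec n" using x u by blast+
  have sL: "sym_mat d \<Lambda>" and sP: "sym_mat n P" using Lambda_pd pds by (auto simp: pd_mat_def)
  have c1: "transpose_mat A * P * A \<in> carrier_mat n n" "transpose_mat K * \<Lambda> * K \<in> carrier_mat n n"
    by blast+
  have PAx: "P *\<^sub>v (A *\<^sub>v x) \<in> carrier_vec n" and PBu: "P *\<^sub>v (B *\<^sub>v u) \<in> carrier_vec n" using Ax Bu by blast+
  have cross: "u \<bullet> (\<Lambda> *\<^sub>v (K *\<^sub>v x)) = - ((B *\<^sub>v u) \<bullet> (P *\<^sub>v (A *\<^sub>v x)))"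
  proof -
    have "\<Lambda> *\<^sub>v (K *\<^sub>v x) = - ((transpose_mat B * P * A) *\<^sub>v x)"
      using x by (simp add: assoc_mult_mat_vec[OF Lambda_carrier K_carrier x, symmetric] Lambda_K carrier_matD(2)[OF dims(1)])
    also have "(transpose_mat B * P * A) *\<^sub>v x = transpose_mat B *\<^sub>v (P *\<^sub>v (A *\<^sub>v x))"
      by (subst assoc_mult_mat_vec[of _ d n _ n], blast, blast, rule x, rule assoc_mult_mat_vec[of _ d n _ n], blast, blast, rule Ax)
    finally have "\<Lambda> *\<^sub>v (K *\<^sub>v x) = - (transpose_mat B *\<^sub>v (P *\<^sub>v (A *\<^sub>v x)))" .
    moreover have "transpose_mat B *\<^sub>v (P *\<^sub>v (A *\<^sub>v x)) \<in> carrier_vec d" using PAx by blast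
    ultimately have "u \<bullet> (\<Lambda> *\<^sub>v (K *\<^sub>v x)) = - (u \<bullet> (transpose_mat B *\<^sub>v (P *\<^sub>v (A *\<^sub>v x))))"
      using u by (metis carrier_vecD scalar_prod_uminus_right)
    also have "u \<bullet> (transpose_mat B *\<^sub>v (P *\<^sub>v (A *\<^sub>v x))) = (B *\<^sub>v u) \<bullet> (P *\<^sub>v (A *\<^sub>v x))"
      using scalar_prod_mult_mat_vec[OF dims(2) u PAx] by simp
    finally show ?thesis .
  qed
  have uLu: "u \<bullet> (\<Lambda> *\<^sub>v u) = (B *\<^sub>v u) \<bullet> (P *\<^sub>v (B *\<^sub>v u)) + u \<bullet> (R *\<^sub>v u)"
  proof -
    have BPB: "transpose_mat B * P * B \<in> carrier_mat d d"
      by blast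
    have "\<Lambda> *\<^sub>v u = transpose_mat B *\<^sub>v (P *\<^sub>v (B *\<^sub>v u)) + R *\<^sub>v u"
      unfolding \<Lambda>_def add_mult_distrib_mat_vec[OF BPB dims(5) u]
      by (subst assoc_mult_mat_vec[of _ d n _ d], blast, blast, rule u, subst assoc_mult_mat_vec[of _ d n _ n], blast, blast, rule Bu, rule refl)
    then show ?thesis
      using scalar_prod_mult_mat_vec[OF dims(2) u PBu]
        scalar_prod_add_distrib[OF u, of "transpose_mat B *\<^sub>v (P *\<^sub>v (B *\<^sub>v u))" "R *\<^sub>v u"] PBu u
      by (metis dims(2,5) mult_mat_vec_carrier transpose_carrier_mat)
  qed
  have xPx: "x \<bullet> (P *\<^sub>v x) = (A *\<^sub>v x) \<bullet> (P *\<^sub>v (A *\<^sub>v x)) + x \<bullet> (Q *\<^sub>v x) - (K *\<^sub>v x) \<bullet> (\<Lambda> *\<^sub>v (K *\<^sub>v x))"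
  proof -
    have v: "transpose_mat A *\<^sub>v (P *\<^sub>v (A *\<^sub>v x)) \<in> carrier_vec n" "Q *\<^sub>v x \<in> carrier_vec n"
      "transpose_mat K *\<^sub>v (\<Lambda> *\<^sub>v (K *\<^sub>v x)) \<in> carrier_vec n"
      using x Kx PAx by blast+
    have "P *\<^sub>v x = (transpose_mat A * P * A + Q - transpose_mat K * \<Lambda> * K) *\<^sub>v x"
      by (subst riccati) simp
    also have "\<dots> = (transpose_mat A * P * A) *\<^sub>v x + Q *\<^sub>v x - (transpose_mat K * \<Lambda> * K) *\<^sub>v x"
      by (subst minus_mult_distrib_mat_vec[OF add_carrier_mat[OF dims(4)] c1(2) x], subst add_mult_distrib_mat_vec[OF c1(1) dims(4) x], rule refl)
    also have "(transpose_mat A * P * A) *\<^sub>v x = transpose_mat A *\<^sub>v (P *\<^sub>v (A *\<^sub>v x))"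
      by (subst assoc_mult_mat_vec[of _ n n _ n], blast, blast, rule x, rule assoc_mult_mat_vec[of _ n n _ n], blast, blast, rule Ax)
    also have "(transpose_mat K * \<Lambda> * K) *\<^sub>v x = transpose_mat K *\<^sub>v (\<Lambda> *\<^sub>v (K *\<^sub>v x))"
      by (subst assoc_mult_mat_vec[of _ n d _ n], blast, blast, rule x, rule assoc_mult_mat_vec[of _ n d _ d], blast, blast, rule Kx)
    finally have "x \<bullet> (P *\<^sub>v x) = x \<bullet> (transpose_mat A *\<^sub>v (P *\<^sub>v (A *\<^sub>v x)) + Q *\<^sub>v x) - x \<bullet> (transpose_mat K *\<^sub>v (\<Lambda> *\<^sub>v (K *\<^sub>v x)))"
      using scalar_prod_minus_distrib[OF x add_carrier_vec[OF v(1,2)] v(3)] by simp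
    also have "\<dots> = x \<bullet> (transpose_mat A *\<^sub>v (P *\<^sub>v (A *\<^sub>v x))) + x \<bullet> (Q *\<^sub>v x) - x \<bullet> (transpose_mat K *\<^sub>v (\<Lambda> *\<^sub>v (K *\<^sub>v x)))"
      using scalar_prod_add_distrib[OF x v(1,2)] by simp
    also have "x \<bullet> (transpose_mat A *\<^sub>v (P *\<^sub>v (A *\<^sub>v x))) = (A *\<^sub>v x) \<bullet> (P *\<^sub>v (A *\<^sub>v x))"
      using scalar_prod_mult_mat_vec[OF dims(1) x PAx] by (rule sym)
    also have "x \<bullet> (transpose_mat K *\<^sub>v (\<Lambda> *\<^sub>v (K *\<^sub>v x))) = (K *\<^sub>v x) \<bullet> (\<Lambda> *\<^sub>v (K *\<^sub>v x))"
      using scalar_prod_mult_mat_vec[OF K_carrier x mult_mat_vec_carrier[OF Lambda_carrier Kx]] by (rule sym)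
    finally show ?thesis .
  qed
  have "u - K *\<^sub>v x = u + - (K *\<^sub>v x)"
    using u Kx by (intro eq_vecI) auto
  then have "(u - K *\<^sub>v x) \<bullet> (\<Lambda> *\<^sub>v (u - K *\<^sub>v x))
      = u \<bullet> (\<Lambda> *\<^sub>v u) + 2 * ((- (K *\<^sub>v x)) \<bullet> (\<Lambda> *\<^sub>v u)) + (K *\<^sub>v x) \<bullet> (\<Lambda> *\<^sub>v (K *\<^sub>v x))"
    by (simp only: quadratic_form_add[OF sL u mKx] quadratic_form_uminus[OF Lambda_carrier Kx])
  also have "(- (K *\<^sub>v x)) \<bullet> (\<Lambda> *\<^sub>v u) = - (u \<bullet> (\<Lambda> *\<^sub>v (K *\<^sub>v x)))"
  proof -
    have Lu: "\<Lambda> *\<^sub>v u \<in> carrier_vec d" and LKx: "\<Lambda> *\<^sub>v (K *\<^sub>v x) \<in> carrier_vec d"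
      using u Kx by (blast intro: mult_mat_vec_carrier[OF Lambda_carrier])+
    have "(- (K *\<^sub>v x)) \<bullet> (\<Lambda> *\<^sub>v u) = - ((K *\<^sub>v x) \<bullet> (\<Lambda> *\<^sub>v u))"
      using Lu Kx by (intro scalar_prod_uminus_left) (metis carrier_vecD)
    also have "(K *\<^sub>v x) \<bullet> (\<Lambda> *\<^sub>v u) = (\<Lambda> *\<^sub>v u) \<bullet> (K *\<^sub>v x)"
      by (rule comm_scalar_prod[OF Kx Lu])
    also have "\<dots> = u \<bullet> (\<Lambda> *\<^sub>v (K *\<^sub>v x))"
      using scalar_prod_mult_mat_vec[OF Lambda_carrier u Kx] sL by (simp add: sym_mat_def)
    finally show ?thesis .
  qed
  finally show ?thesis
    using xPx uLu cross quadratic_form_add[OF sP Ax Bu] by linarith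
qed

section \<open>The Kalman gain and the stationary error covariance\<close>

definition "\<Sigma> = innov_cov S"

lemma Theta_bar_psd: "psd_mat n (mTheta_bar S)"
  using psd_add_pd[OF psd_congruence[OF dims(1) pds(6)] pds(1)] pd_imp_psd by (simp add: mTheta_bar_def)

lemma Theta_bar_carrier [simp, intro]: "mTheta_bar S \<in> carrier_mat n n"
  and Theta_bar_sym: "transpose_mat (mTheta_bar S) = mTheta_bar S"
  using Theta_bar_psd by (auto simp: psd_mat_def sym_mat_def)

lemma Sigma_pd: "pd_mat dy \<Sigma>"
  unfolding \<Sigma>_def innov_cov_def by (rule psd_add_pd[OF psd_congruence[OF dims(3) Theta_bar_psd] pds(2)])

lemma Sigma_carrier [simp, intro]: "\<Sigma> \<in> carrier_mat dy dy" and Sigma_sym: "transpose_mat \<Sigma> = \<Sigma>"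
  using Sigma_pd by (auto simp: pd_mat_def sym_mat_def)

lemma L_carrier [simp, intro]: "L \<in> carrier_mat n dy"
  using mat_inv_correct(3)[OF Sigma_carrier pd_mat_det[OF Sigma_pd]]
  unfolding kalman_gain_def \<Sigma>_def by blast

text \<open>In terms of covariances, this equation says that the updated error is uncorrelated with
  the innovation.\<close>

lemma L_Sigma: "L * \<Sigma> = mTheta_bar S * transpose_mat C"
proof -
  note inv = mat_inv_correct[OF Sigma_carrier pd_mat_det[OF Sigma_pd]]
  have X: "mTheta_bar S * transpose_mat C \<in> carrier_mat n dy" by blast
  show ?thesis
    unfolding kalman_gain_def \<Sigma>_def[symmetric]
    using assoc_mult_mat[OF X inv(3) Sigma_carrier] inv(2) right_mult_one_mat[OF X] by simp
qed

text \<open>The transpose of \<open>L_Sigma\<close> rewrites the subtracted term. In this form the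
  right-hand side is the covariance of the updated error with the predicted one.\<close>

lemma Theta_eq: "\<Theta> = mTheta_bar S - L * (C * mTheta_bar S)"
proof -
  have "transpose_mat (L * \<Sigma>) = transpose_mat (mTheta_bar S * transpose_mat C)"
    by (simp add: L_Sigma)
  then have "\<Sigma> * transpose_mat L = C * mTheta_bar S"
    by (simp add: transpose_mult[OF L_carrier Sigma_carrier] transpose_mult[where nr=n and n=n and nc=dy] Sigma_sym Theta_bar_sym)
  moreover have "L * \<Sigma> * transpose_mat L = L * (\<Sigma> * transpose_mat L)"
    by (rule assoc_mult_mat[where n\<^sub>1=n and n\<^sub>2=dy and n\<^sub>3=dy and n\<^sub>4=n]) auto
  moreover have "\<Theta> = mTheta_bar S - L * \<Sigma> * transpose_mat L"
    using ok unfolding subsystem_ok_def \<Sigma>_def by blast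
  ultimately show ?thesis by simp
qed

section \<open>Observability: the state is bounded by the cost over a fixed horizon\<close>

lemma pow_carrier [simp, intro]: "A ^\<^sub>m j \<in> carrier_mat n n"
  by (rule pow_carrier_mat) simp

text \<open>\<open>^\<^sub>m\<close> multiplies on the right, the dynamics multiply on the
  left.\<close>

lemma pow_Suc_left: "A ^\<^sub>m Suc j = A * A ^\<^sub>m j"
proof (induction j)
  case 0
  have "1\<^sub>m n * A = A * 1\<^sub>m n" using left_mult_one_mat[OF dims(1)] right_mult_one_mat[OF dims(1)] by metis
  then show ?case by (simp add: carrier_matD(1)[OF dims(1)])
next
  case (Suc j)
  have "A ^\<^sub>m Suc (Suc j) = A * A ^\<^sub>m j * A"
    using Suc by simp
  also have "\<dots> = A * A ^\<^sub>m Suc j"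
    using assoc_mult_mat[OF dims(1) pow_carrier dims(1)] by simp
  finally show ?case .
qed

text \<open>If all forms vanish at \<open>x\<close>, then \<open>Qh\<close> annihilates every
  \<open>A^j x\<close>, so observability through the square root leaves only \<open>x = 0\<close>;
  compactness then yields a finite horizon.\<close>

lemma observability_bound:
  "\<exists>N. \<exists>c>0. \<forall>x\<in>carrier_vec n. x \<bullet> x \<le> c * (\<Sum>j<N. ((A ^\<^sub>m j) *\<^sub>v x) \<bullet> (Q *\<^sub>v ((A ^\<^sub>m j) *\<^sub>v x)))"
proof -
  obtain Qh where Qh: "psd_mat n Qh" "Qh * Qh = Q" "observable n A Qh"
    using ok by (auto simp: subsystem_ok_def)
  then have Qc: "Qh \<in> carrier_mat n n" "transpose_mat Qh = Qh" by (auto simp: psd_mat_def sym_mat_def)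
  define G where "G j = transpose_mat (A ^\<^sub>m j) * (Q * (A ^\<^sub>m j))" for j
  have G: "G j \<in> carrier_mat n n" for j
    unfolding G_def by (intro mult_carrier_mat[where n=n]) auto
  have form: "x \<bullet> (G j *\<^sub>v x) = ((A ^\<^sub>m j) *\<^sub>v x) \<bullet> (Q *\<^sub>v ((A ^\<^sub>m j) *\<^sub>v x))" if x: "x \<in> carrier_vec n" for x j
  proof -
    have Ajx: "(A ^\<^sub>m j) *\<^sub>v x \<in> carrier_vec n" using x by (rule mult_mat_vec_carrier[OF pow_carrier])
    have "G j *\<^sub>v x = transpose_mat (A ^\<^sub>m j) *\<^sub>v (Q *\<^sub>v ((A ^\<^sub>m j) *\<^sub>v x))"
      unfolding G_def
      by (subst assoc_mult_mat_vec[of _ n n _ n], blast, blast, rule x, subst assoc_mult_mat_vec[of _ n n _ n], blast, blast, rule x, rule refl)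
    then show ?thesis
      using scalar_prod_mult_mat_vec[OF pow_carrier x mult_mat_vec_carrier[OF dims(4) Ajx], of j] by simp
  qed
  have nonneg: "0 \<le> x \<bullet> (G j *\<^sub>v x)" if x: "x \<in> carrier_vec n" for x j
    using pds(3) mult_mat_vec_carrier[OF pow_carrier x] unfolding form[OF x] psd_mat_def by blast
  have "\<exists>N. \<exists>c>0. \<forall>x\<in>carrier_vec n. x \<bullet> x \<le> c * (\<Sum>j<N. x \<bullet> (G j *\<^sub>v x))"
  proof (rule coercive_sum_quadratic_forms[OF G nonneg])
    fix x assume x: "x \<in> carrier_vec n" and zero: "\<And>j. x \<bullet> (G j *\<^sub>v x) = 0"
    have "Qh *\<^sub>v ((A ^\<^sub>m j) *\<^sub>v x) = 0\<^sub>v n" for j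
    proof (rule nsq_eq_0)
      let ?y = "(A ^\<^sub>m j) *\<^sub>v x"
      have y: "?y \<in> carrier_vec n" using x by (rule mult_mat_vec_carrier[OF pow_carrier])
      show Qy: "Qh *\<^sub>v ?y \<in> carrier_vec n" using Qc(1) y by (rule mult_mat_vec_carrier)
      have "(Qh *\<^sub>v ?y) \<bullet> (Qh *\<^sub>v ?y) = ?y \<bullet> (Qh *\<^sub>v (Qh *\<^sub>v ?y))"
        using scalar_prod_mult_mat_vec[OF Qc(1) y Qy] Qc(2) by simp
      also have "Qh *\<^sub>v (Qh *\<^sub>v ?y) = Q *\<^sub>v ?y"
        using assoc_mult_mat_vec[OF Qc(1) Qc(1) y] Qh(2) by simp
      finally show "(Qh *\<^sub>v ?y) \<bullet> (Qh *\<^sub>v ?y) = 0"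
        using zero[of j] form[OF x] by simp
    qed
    moreover have "Qh *\<^sub>v ((A ^\<^sub>m j) *\<^sub>v 0\<^sub>v n) = 0\<^sub>v n" for j
    proof -
      have "(H :: real mat) *\<^sub>v 0\<^sub>v n = 0\<^sub>v n" if "H \<in> carrier_mat n n" for H
        using that by (intro eq_vecI) auto
      then show ?thesis using Qc(1) pow_carrier by simp
    qed
    ultimately show "x = 0\<^sub>v n"
      using Qh(3) x unfolding observable_def by (metis zero_carrier_vec)
  qed
  then show ?thesis
    by (simp add: form cong: ball_cong)
qed

definition noisy_traj :: "(nat \<Rightarrow> real vec) \<Rightarrow> (nat \<Rightarrow> real vec) \<Rightarrow> (nat \<Rightarrow> real vec) \<Rightarrow> bool" where
  "noisy_traj x u w \<longleftrightarrow> (\<forall>k. x k \<in> carrier_vec n \<and> u k \<in> carrier_vec d \<and> w k \<in> carrier_vec n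
      \<and> x (Suc k) = A *\<^sub>v x k + B *\<^sub>v u k + w k)"

lemma noisy_trajD:
  assumes "noisy_traj x u w"
  shows "x k \<in> carrier_vec n" "u k \<in> carrier_vec d" "w k \<in> carrier_vec n" "x (Suc k) = A *\<^sub>v x k + B *\<^sub>v u k + w k"
  using assms unfolding noisy_traj_def by blast+

text \<open>The free response and the controlled noisy state differ by a linear function of past
  controls and noises, so the square of the difference is bounded by their energy.\<close>

lemma deviation_bound:
  "\<exists>c\<ge>0. \<forall>x u w. noisy_traj x u w \<longrightarrow>
    (\<exists>e\<in>carrier_vec n. (A ^\<^sub>m j) *\<^sub>v x 0 = x j + e \<and> e \<bullet> e \<le> c * (\<Sum>l<j. u l \<bullet> u l + w l \<bullet> w l))"
proof (induction j)
  case 0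
  show ?case
  proof (intro exI[of _ 0] conjI allI impI order_refl)
    fix x u w :: "nat \<Rightarrow> real vec"
    assume *: "noisy_traj x u w"
    then have x0: "x 0 \<in> carrier_vec n" by (rule noisy_trajD)
    show "\<exists>e\<in>carrier_vec n. (A ^\<^sub>m 0) *\<^sub>v x 0 = x 0 + e \<and> e \<bullet> e \<le> 0 * (\<Sum>l<0. u l \<bullet> u l + w l \<bullet> w l)"
      using x0 by (intro bexI[of _ "0\<^sub>v n"]) simp_all
  qed
next
  case (Suc j)
  then obtain c where c: "c \<ge> 0" and IH: "\<forall>x u w. noisy_traj x u w \<longrightarrow>
    (\<exists>e\<in>carrier_vec n. (A ^\<^sub>m j) *\<^sub>v x 0 = x j + e \<and> e \<bullet> e \<le> c * (\<Sum>l<j. u l \<bullet> u l + w l \<bullet> w l))"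
    by (elim exE conjE)
  obtain \<alpha> where \<alpha>: "\<alpha> \<ge> 0" "\<forall>x\<in>carrier_vec n. (A *\<^sub>v x) \<bullet> (A *\<^sub>v x) \<le> \<alpha> * (x \<bullet> x)"
    using nsq_mult_mat_vec_bound[OF dims(1)] by (elim exE conjE)
  obtain \<beta> where \<beta>: "\<beta> \<ge> 0" "\<forall>x\<in>carrier_vec d. (B *\<^sub>v x) \<bullet> (B *\<^sub>v x) \<le> \<beta> * (x \<bullet> x)"
    using nsq_mult_mat_vec_bound[OF dims(2)] by (elim exE conjE)
  show ?case
  \<comment> \<open>\<open>|a + b|^2 \<le> 2 |a|^2 + 2 |b|^2\<close> is used twice, which puts 2 on
    the propagated deviation and 4 on control and noise. The sum serves as a common
    constant.\<close>
  proof (intro exI[of _ "2 * \<alpha> * c + 4 * \<beta> + 4"] conjI allI impI)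
    show "0 \<le> 2 * \<alpha> * c + 4 * \<beta> + 4" using \<alpha> \<beta> c by simp
    fix x u w :: "nat \<Rightarrow> real vec"
    assume *: "noisy_traj x u w"
    note carr = noisy_trajD(1-3)[OF *] and step = noisy_trajD(4)[OF *]
    from IH[rule_format, OF *] obtain e where e: "e \<in> carrier_vec n" "(A ^\<^sub>m j) *\<^sub>v x 0 = x j + e"
      "e \<bullet> e \<le> c * (\<Sum>l<j. u l \<bullet> u l + w l \<bullet> w l)" by blast
    have Bu: "B *\<^sub>v u j \<in> carrier_vec n" using carr by (intro mult_mat_vec_carrier[OF dims(2)])
    have Ae: "A *\<^sub>v e \<in> carrier_vec n" using e by (intro mult_mat_vec_carrier[OF dims(1)])
    have Ax: "A *\<^sub>v x j \<in> carrier_vec n" using carr by (intro mult_mat_vec_carrier[OF dims(1)])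
    define f where "f = B *\<^sub>v u j + w j"
    have f: "f \<in> carrier_vec n" and mf: "- f \<in> carrier_vec n" using Bu carr by (auto simp: f_def)
    have "(A ^\<^sub>m Suc j) *\<^sub>v x 0 = A *\<^sub>v ((A ^\<^sub>m j) *\<^sub>v x 0)"
      using assoc_mult_mat_vec[OF dims(1) pow_carrier carr(1)] by (simp only: pow_Suc_left)
    also have "\<dots> = A *\<^sub>v x j + A *\<^sub>v e"
      unfolding e(2) using mult_add_distrib_mat_vec[OF dims(1) carr(1) e(1)] .
    also have "\<dots> = x (Suc j) + (A *\<^sub>v e + - f)"
      using Ax Ae Bu carr(3)[of j] unfolding step f_def by (intro eq_vecI) (simp_all del: index_mult_mat_vec dim_mult_mat_vec add: carrier_vecD)
    finally have 1: "(A ^\<^sub>m Suc j) *\<^sub>v x 0 = x (Suc j) + (A *\<^sub>v e + - f)" .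
    let ?s = "\<Sum>l<j. u l \<bullet> u l + w l \<bullet> w l"
    have ff: "(- f) \<bullet> (- f) = f \<bullet> f"
      using f by simp
    have "(A *\<^sub>v e + - f) \<bullet> (A *\<^sub>v e + - f) \<le> 2 * ((A *\<^sub>v e) \<bullet> (A *\<^sub>v e)) + 2 * (f \<bullet> f)"
      using nsq_add_le[OF Ae mf] unfolding ff .
    also have "f \<bullet> f \<le> 2 * ((B *\<^sub>v u j) \<bullet> (B *\<^sub>v u j)) + 2 * (w j \<bullet> w j)"
      unfolding f_def by (rule nsq_add_le[OF Bu carr(3)])
    also have "(B *\<^sub>v u j) \<bullet> (B *\<^sub>v u j) \<le> \<beta> * (u j \<bullet> u j)" by (rule \<beta>(2)[rule_format, OF carr(2)])
    also have "(A *\<^sub>v e) \<bullet> (A *\<^sub>v e) \<le> \<alpha> * (c * ?s)"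
      using \<alpha>(2)[rule_format, OF e(1)] mult_left_mono[OF e(3) \<alpha>(1)] by linarith
    finally have "(A *\<^sub>v e + - f) \<bullet> (A *\<^sub>v e + - f) \<le> 2 * (\<alpha> * (c * ?s)) + 4 * (\<beta> * (u j \<bullet> u j)) + 4 * (w j \<bullet> w j)"
      by simp
    also have "\<dots> \<le> (2 * \<alpha> * c + 4 * \<beta> + 4) * (?s + (u j \<bullet> u j + w j \<bullet> w j))"
    proof -
      have nn: "0 \<le> \<alpha> * c * (u j \<bullet> u j)" "0 \<le> \<alpha> * c * (w j \<bullet> w j)" "0 \<le> \<beta> * ?s" "0 \<le> ?s" "0 \<le> \<beta> * (w j \<bullet> w j)" "0 \<le> u j \<bullet> u j"
        using \<alpha>(1) \<beta>(1) c by (auto intro!: mult_nonneg_nonneg sum_nonneg add_nonneg_nonneg)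
      have "(2 * \<alpha> * c + 4 * \<beta> + 4) * (?s + (u j \<bullet> u j + w j \<bullet> w j))
        = 2 * (\<alpha> * (c * ?s)) + 4 * (\<beta> * (u j \<bullet> u j)) + 4 * (w j \<bullet> w j) + 2 * (\<alpha> * c * (u j \<bullet> u j)) + 2 * (\<alpha> * c * (w j \<bullet> w j))
          + 4 * (\<beta> * ?s) + 4 * ?s + 4 * (\<beta> * (w j \<bullet> w j)) + 4 * (u j \<bullet> u j)"
        by (simp only: distrib_left distrib_right mult.assoc)
      with nn show ?thesis by linarith
    qed
    finally show "\<exists>e\<in>carrier_vec n. (A ^\<^sub>m Suc j) *\<^sub>v x 0 = x (Suc j) + e
        \<and> e \<bullet> e \<le> (2 * \<alpha> * c + 4 * \<beta> + 4) * (\<Sum>l<Suc j. u l \<bullet> u l + w l \<bullet> w l)"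
      using 1 Ae mf by (intro bexI[of _ "A *\<^sub>v e + - f"]) auto
  qed
qed

text \<open>Observability bounds the initial state by the free response, which is replaced by the
  actual states at the price of control and noise energy. Horizon and constant are uniform in the
  trajectory, so the bound can be restarted at any time.\<close>

lemma state_bound:
  "\<exists>N. \<exists>c\<ge>0. \<forall>x u w. noisy_traj x u w \<longrightarrow>
    x 0 \<bullet> x 0 \<le> c * (\<Sum>j<N. x j \<bullet> (Q *\<^sub>v x j) + u j \<bullet> (R *\<^sub>v u j) + w j \<bullet> w j)"
proof -
  obtain N c0 where c0: "c0 > 0" and obs: "\<forall>x\<in>carrier_vec n.
      x \<bullet> x \<le> c0 * (\<Sum>j<N. ((A ^\<^sub>m j) *\<^sub>v x) \<bullet> (Q *\<^sub>v ((A ^\<^sub>m j) *\<^sub>v x)))"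
    using observability_bound by (elim exE conjE)
  define dev where "dev j c \<longleftrightarrow> 0 \<le> c \<and> (\<forall>x u w. noisy_traj x u w \<longrightarrow>
    (\<exists>e\<in>carrier_vec n. (A ^\<^sub>m j) *\<^sub>v x 0 = x j + e \<and> e \<bullet> e \<le> c * (\<Sum>l<j. u l \<bullet> u l + w l \<bullet> w l)))" for j c
  have "\<forall>j. \<exists>c. dev j c"
    unfolding dev_def by (rule allI) (rule deviation_bound)
  then obtain c1 where c1': "\<And>j. dev j (c1 j)" by metis
  then have c1: "c1 j \<ge> 0" for j by (simp add: dev_def)
  obtain q where q: "q \<ge> 0" "\<forall>x\<in>carrier_vec n. x \<bullet> (Q *\<^sub>v x) \<le> q * (x \<bullet> x)"
    using quadratic_form_bound[OF dims(4)] by (elim exE conjE)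
  obtain r where r: "r > 0" "\<forall>x\<in>carrier_vec d. x \<bullet> x \<le> r * (x \<bullet> (R *\<^sub>v x))"
    using pd_coercive[OF pds(4)] by (elim exE conjE)
  \<comment> \<open>The leading 2 stems from replacing \<open>A^j x 0\<close> by \<open>x j\<close>,
    the rest from the deviation; \<open>r\<close> turns control energy into control cost.\<close>
  define c2 where "c2 j = 2 + 2 * q * c1 j * (r + 1)" for j
  have c2: "0 \<le> c2 j" for j using q c1 r by (simp add: c2_def)
  define c where "c = c0 * (\<Sum>j<N. c2 j)"
  show ?thesis
  proof (intro exI[of _ N] exI[of _ c] conjI allI impI)
    show "0 \<le> c" using c0 c2 by (simp add: c_def sum_nonneg)
    fix x u w :: "nat \<Rightarrow> real vec"
    assume *: "noisy_traj x u w"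
    note carr = noisy_trajD(1-3)[OF *]
    let ?t = "\<lambda>j. x j \<bullet> (Q *\<^sub>v x j) + u j \<bullet> (R *\<^sub>v u j) + w j \<bullet> w j"
    let ?T = "\<Sum>j<N. ?t j"
    have Qn: "0 \<le> x j \<bullet> (Q *\<^sub>v x j)" and Rn: "0 \<le> u j \<bullet> (R *\<^sub>v u j)" for j
      using pds(3) pd_imp_psd[OF pds(4)] carr by (auto simp: psd_mat_def)
    have tn: "0 \<le> ?t j" for j using Qn[of j] Rn[of j] by simp
    have each: "((A ^\<^sub>m j) *\<^sub>v x 0) \<bullet> (Q *\<^sub>v ((A ^\<^sub>m j) *\<^sub>v x 0)) \<le> c2 j * ?T" if j: "j < N" for j
    proof -
      obtain e where e: "e \<in> carrier_vec n" "(A ^\<^sub>m j) *\<^sub>v x 0 = x j + e" "e \<bullet> e \<le> c1 j * (\<Sum>l<j. u l \<bullet> u l + w l \<bullet> w l)"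
        using c1'[of j] * unfolding dev_def by blast
      have "(\<Sum>l<j. u l \<bullet> u l + w l \<bullet> w l) \<le> (\<Sum>l<j. (r + 1) * ?t l)"
      proof (rule sum_mono)
        fix l
        have "0 \<le> r * (w l \<bullet> w l)" "0 \<le> r * (x l \<bullet> (Q *\<^sub>v x l))" using r Qn[of l] by (auto intro!: mult_nonneg_nonneg)
        then show "u l \<bullet> u l + w l \<bullet> w l \<le> (r + 1) * ?t l"
          using r(2)[rule_format, OF carr(2), of l] Qn[of l] Rn[of l] by (simp add: algebra_simps)
      qed
      also have "\<dots> \<le> (\<Sum>l<N. (r + 1) * ?t l)"
        using j tn r by (intro sum_mono2) (auto intro!: mult_nonneg_nonneg simp del: distrib_left_numeral)
      finally have "e \<bullet> e \<le> c1 j * ((r + 1) * ?T)"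
        using e(3) mult_left_mono[OF _ c1[of j]] unfolding sum_distrib_left[symmetric] by (meson order_trans)
      then have "e \<bullet> (Q *\<^sub>v e) \<le> q * (c1 j * ((r + 1) * ?T))"
        using q(2)[rule_format, OF e(1)] mult_left_mono[OF _ q(1)] by (meson order_trans)
      moreover have "x j \<bullet> (Q *\<^sub>v x j) \<le> ?T"
      proof -
        have "x j \<bullet> (Q *\<^sub>v x j) \<le> ?t j" using Rn[of j] by simp
        also have "\<dots> \<le> ?T" using j tn by (intro member_le_sum) auto
        finally show ?thesis .
      qed
      moreover have "c2 j * ?T = 2 * ?T + 2 * (q * (c1 j * ((r + 1) * ?T)))"
        by (simp add: c2_def algebra_simps)
      ultimately show ?thesis
        unfolding e(2) using psd_quadratic_form_add_le[OF pds(3) carr(1) e(1), of j] by linarith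
    qed
    have "x 0 \<bullet> x 0 \<le> c0 * (\<Sum>j<N. ((A ^\<^sub>m j) *\<^sub>v x 0) \<bullet> (Q *\<^sub>v ((A ^\<^sub>m j) *\<^sub>v x 0)))"
      by (rule obs[rule_format, OF carr(1)])
    also have "\<dots> \<le> c0 * (\<Sum>j<N. c2 j * ?T)"
      using c0 each by (intro mult_left_mono sum_mono) auto
    also have "\<dots> = c * ?T"
      by (simp only: c_def sum_distrib_right mult.assoc)
    finally show "x 0 \<bullet> x 0 \<le> c * ?T" .
  qed
qed

end

section \<open>The Gaussian primitives of a loop\<close>

locale lqg_loop = prob_space M for M :: "'w measure" +
  fixes m i :: nat and S :: "nat \<Rightarrow> subsystem" and \<xi> :: "prim \<Rightarrow> 'w \<Rightarrow> real vec"
  assumes loop: "i \<in> {1..m}" and subsystems: "\<And>j. j \<in> {1..m} \<Longrightarrow> subsystem_ok (S j)"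
    and prims: "primitives_ok M m S \<xi>"
begin

sublocale lqg_subsystem "S i"
  using subsystems[OF loop] by unfold_locales

definition gprims :: "prim set" where
  "gprims = {Init i} \<union> range (Proc_Noise i) \<union> range (Meas_Noise i)"

text \<open>Primitives without information about the Gaussian noise of loop \<open>i\<close>: its
  internal variables and everything in the other loops.\<close>

definition oprims :: "prim set" where
  "oprims = {q. prim_loop q \<in> {1..m}} - gprims"

abbreviation "prim_space q \<equiv> vec_borel (prim_dim S q)"

lemma indep_prims: "indep_vars prim_space \<xi> {q. prim_loop q \<in> {1..m}}"
  using prims by (simp add: primitives_ok_def)

lemma gprims_subset: "gprims \<subseteq> {q. prim_loop q \<in> {1..m}}"
  using loop by (auto simp: gprims_def)

lemma prim_measurable: "prim_loop q \<in> {1..m} \<Longrightarrow> \<xi> q \<in> measurable M (prim_space q)"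
  using indep_prims by (auto simp: indep_vars_def)

lemma gprim_measurable: "q \<in> gprims \<Longrightarrow> \<xi> q \<in> measurable M (prim_space q)"
  using gprims_subset prim_measurable by blast

lemma noise_gaussian:
  "gaussian_vec M n (mW (S i)) (\<xi> (Proc_Noise i k))" "gaussian_vec M dy (mV (S i)) (\<xi> (Meas_Noise i k))"
  "\<exists>V. gaussian_vec M n V (\<xi> (Init i))"
  using bspec[OF conjunct2[OF prims[unfolded primitives_ok_def]] loop] by blast+

lemma gprim_gaussian: "q \<in> gprims \<Longrightarrow> \<exists>V. gaussian_vec M (prim_dim S q) V (\<xi> q)"
  using noise_gaussian unfolding gprims_def by force

text \<open>Equality is asked on \<open>space M\<close> only, because the primitives are known to
  have the right dimension only there.\<close>

definition gspan :: "('w \<Rightarrow> real) set" where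
  "gspan = {f. \<exists>I c. finite I \<and> I \<subseteq> gprims \<and> (\<forall>q. c q \<in> carrier_vec (prim_dim S q)) \<and>
     (\<forall>\<omega>\<in>space M. f \<omega> = (\<Sum>q\<in>I. c q \<bullet> \<xi> q \<omega>))}"

lemma gspanD:
  "f \<in> gspan \<Longrightarrow> \<exists>I c. finite I \<and> I \<subseteq> gprims \<and> (\<forall>q. c q \<in> carrier_vec (prim_dim S q)) \<and>
     (\<forall>\<omega>\<in>space M. f \<omega> = (\<Sum>q\<in>I. c q \<bullet> \<xi> q \<omega>))"
  unfolding gspan_def by (erule CollectD)

lemma gspanI:
  assumes "finite I" "I \<subseteq> gprims" "\<And>q. c q \<in> carrier_vec (prim_dim S q)"
    "\<And>\<omega>. \<omega> \<in> space M \<Longrightarrow> f \<omega> = (\<Sum>q\<in>I. c q \<bullet> \<xi> q \<omega>)"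
  shows "f \<in> gspan"
  using assms unfolding gspan_def by blast

lemma prim_carrier: "q \<in> gprims \<Longrightarrow> \<omega> \<in> space M \<Longrightarrow> \<xi> q \<omega> \<in> carrier_vec (prim_dim S q)"
  by (rule measurable_vec_borel_carrier[OF gprim_measurable])

text \<open>Independence turns the characteristic function of the sum into a product of normal ones,
  so the variances add up, degenerate summands included.\<close>

lemma linear_combination_normal:
  assumes I: "finite I" "I \<subseteq> gprims" and c: "\<And>q. c q \<in> carrier_vec (prim_dim S q)"
  shows "(\<lambda>\<omega>. \<Sum>q\<in>I. c q \<bullet> \<xi> q \<omega>) \<in> borel_measurable M"
    and "\<exists>v\<ge>0. distr M borel (\<lambda>\<omega>. \<Sum>q\<in>I. c q \<bullet> \<xi> q \<omega>) = normal_law v"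
proof -
  let ?X = "\<lambda>q \<omega>. c q \<bullet> \<xi> q \<omega>"
  have comp: "(\<lambda>x. c q \<bullet> x) \<in> borel_measurable (prim_space q)" for q
    by (rule measurable_scalar_prod[OF measurable_vec_const[OF c] measurable_ident_sets[OF refl]])
  have meas: "?X q \<in> borel_measurable M" if "q \<in> I" for q
    using that I by (intro measurable_compose[OF gprim_measurable comp]) auto
  show sum: "(\<lambda>\<omega>. \<Sum>q\<in>I. ?X q \<omega>) \<in> borel_measurable M"
    by (intro borel_measurable_sum meas)
  have indep: "indep_vars (\<lambda>_. borel) ?X I"
    using indep_vars_compose2[OF indep_vars_subset[OF indep_prims], of I "\<lambda>q x. c q \<bullet> x" "\<lambda>_. borel"]
      comp I gprims_subset by auto
  have "\<exists>v\<ge>0. distr M borel (?X q) = normal_law v" if "q \<in> I" for q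
  proof -
    have "q \<in> gprims" using that I by blast
    from gprim_gaussian[OF this] obtain V where V: "gaussian_vec M (prim_dim S q) V (\<xi> q)" ..
    then show ?thesis
      using c[of q] unfolding gaussian_vec_def psd_mat_def by blast
  qed
  then obtain v where v: "\<And>q. q \<in> I \<Longrightarrow> 0 \<le> v q" "\<And>q. q \<in> I \<Longrightarrow> distr M borel (?X q) = normal_law (v q)"
    by metis
  have vs: "0 \<le> (\<Sum>q\<in>I. v q)" using v(1) by (rule sum_nonneg)
  have "distr M borel (\<lambda>\<omega>. \<Sum>q\<in>I. ?X q \<omega>) = normal_law (\<Sum>q\<in>I. v q)"
  proof (rule Levy_uniqueness)
    show "real_distribution (distr M borel (\<lambda>\<omega>. \<Sum>q\<in>I. ?X q \<omega>))"
      using sum by (rule real_distribution_distr)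
    show "real_distribution (normal_law (\<Sum>q\<in>I. v q))"
      using vs by (rule real_distribution_normal_law)
    show "char (distr M borel (\<lambda>\<omega>. \<Sum>q\<in>I. ?X q \<omega>)) = char (normal_law (\<Sum>q\<in>I. v q))"
    proof
      fix t
      have "char (distr M borel (\<lambda>\<omega>. \<Sum>q\<in>I. ?X q \<omega>)) t = (\<Prod>q\<in>I. char (distr M borel (?X q)) t)"
        by (rule char_distr_sum[OF indep])
      also have "\<dots> = (\<Prod>q\<in>I. complex_of_real (exp (- v q * t\<^sup>2 / 2)))"
        by (intro prod.cong refl) (simp add: v char_normal_law)
      also have "\<dots> = complex_of_real (exp (\<Sum>q\<in>I. - v q * t\<^sup>2 / 2))"
        using I by (simp add: exp_sum)
      also have "(\<Sum>q\<in>I. - v q * t\<^sup>2 / 2) = - (\<Sum>q\<in>I. v q) * t\<^sup>2 / 2"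
        by (simp add: sum_distrib_right sum_divide_distrib sum_negf)
      also have "complex_of_real (exp \<dots>) = char (normal_law (\<Sum>q\<in>I. v q)) t"
        using vs by (simp add: char_normal_law)
      finally show "char (distr M borel (\<lambda>\<omega>. \<Sum>q\<in>I. ?X q \<omega>)) t = char (normal_law (\<Sum>q\<in>I. v q)) t" .
    qed
  qed
  with vs show "\<exists>v\<ge>0. distr M borel (\<lambda>\<omega>. \<Sum>q\<in>I. ?X q \<omega>) = normal_law v" by blast
qed

sublocale gaussian_space M gspan
proof
  show "(\<lambda>_. 0) \<in> gspan"
    by (rule gspanI[of "{}" "\<lambda>q. 0\<^sub>v (prim_dim S q)"]) auto
next
  fix f g assume fg: "f \<in> gspan" "g \<in> gspan"
  from gspanD[OF fg(1)] obtain I c where I: "finite I" "I \<subseteq> gprims"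
    and c0: "\<forall>q. c q \<in> carrier_vec (prim_dim S q)" and f0: "\<forall>\<omega>\<in>space M. f \<omega> = (\<Sum>q\<in>I. c q \<bullet> \<xi> q \<omega>)"
    by (elim exE conjE)
  note c = c0[rule_format] and f = f0[rule_format]
  from gspanD[OF fg(2)] obtain I' c' where I': "finite I'" "I' \<subseteq> gprims"
    and c1: "\<forall>q. c' q \<in> carrier_vec (prim_dim S q)" and g1: "\<forall>\<omega>\<in>space M. g \<omega> = (\<Sum>q\<in>I'. c' q \<bullet> \<xi> q \<omega>)"
    by (elim exE conjE)
  note c' = c1[rule_format] and g = g1[rule_format]
  \<comment> \<open>Coefficients are extended by 0 to a common index set.\<close>
  let ?e = "\<lambda>I c q. if q \<in> I then c q else 0\<^sub>v (prim_dim S q)"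
  have e: "?e I c q \<in> carrier_vec (prim_dim S q)" if "\<And>q. c q \<in> carrier_vec (prim_dim S q)" for I c q
    using that by auto
  show "(\<lambda>\<omega>. f \<omega> + g \<omega>) \<in> gspan"
  proof (rule gspanI[of "I \<union> I'" "\<lambda>q. ?e I c q + ?e I' c' q"])
    fix \<omega> assume \<omega>: "\<omega> \<in> space M"
    have ext: "(\<Sum>q\<in>J. c q \<bullet> \<xi> q \<omega>) = (\<Sum>q\<in>I \<union> I'. ?e J c q \<bullet> \<xi> q \<omega>)"
      if "J \<subseteq> I \<union> I'" for J c
    proof (rule sum.mono_neutral_cong_left)
      show "\<forall>q\<in>I \<union> I' - J. ?e J c q \<bullet> \<xi> q \<omega> = 0"
      proof
        fix q assume q: "q \<in> I \<union> I' - J"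
        then have "\<xi> q \<omega> \<in> carrier_vec (prim_dim S q)" using I I' \<omega> by (intro prim_carrier) auto
        then show "?e J c q \<bullet> \<xi> q \<omega> = 0" using q by simp
      qed
    qed (use that I I' in auto)
    have "f \<omega> + g \<omega> = (\<Sum>q\<in>I \<union> I'. ?e I c q \<bullet> \<xi> q \<omega>) + (\<Sum>q\<in>I \<union> I'. ?e I' c' q \<bullet> \<xi> q \<omega>)"
      unfolding f[OF \<omega>] g[OF \<omega>] using ext[of I c] ext[of I' c'] by simp
    also have "\<dots> = (\<Sum>q\<in>I \<union> I'. (?e I c q + ?e I' c' q) \<bullet> \<xi> q \<omega>)"
      unfolding sum.distrib[symmetric]
    proof (rule sum.cong[OF refl])
      fix q assume "q \<in> I \<union> I'"
      then have "\<xi> q \<omega> \<in> carrier_vec (prim_dim S q)" using I I' \<omega> by (intro prim_carrier) auto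
      then show "?e I c q \<bullet> \<xi> q \<omega> + ?e I' c' q \<bullet> \<xi> q \<omega> = (?e I c q + ?e I' c' q) \<bullet> \<xi> q \<omega>"
        by (rule add_scalar_prod_distrib[OF e[of c, OF c] e[of c', OF c'], symmetric])
    qed
    finally show "f \<omega> + g \<omega> = (\<Sum>q\<in>I \<union> I'. (?e I c q + ?e I' c' q) \<bullet> \<xi> q \<omega>)" .
  next
    show "finite (I \<union> I')" "I \<union> I' \<subseteq> gprims" using I I' by auto
    show "?e I c q + ?e I' c' q \<in> carrier_vec (prim_dim S q)" for q
      by (rule add_carrier_vec[OF e[of c, OF c] e[of c', OF c']])
  qed
next
  fix f and a :: real assume fs: "f \<in> gspan"
  from gspanD[OF fs] obtain I c where I: "finite I" "I \<subseteq> gprims"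
    and c0: "\<forall>q. c q \<in> carrier_vec (prim_dim S q)" and f0: "\<forall>\<omega>\<in>space M. f \<omega> = (\<Sum>q\<in>I. c q \<bullet> \<xi> q \<omega>)"
    by (elim exE conjE)
  note c = c0[rule_format] and f = f0[rule_format]
  show "(\<lambda>\<omega>. a * f \<omega>) \<in> gspan"
  proof (rule gspanI[OF I, of "\<lambda>q. a \<cdot>\<^sub>v c q"])
    fix \<omega> assume \<omega>: "\<omega> \<in> space M"
    have "a * f \<omega> = (\<Sum>q\<in>I. a * (c q \<bullet> \<xi> q \<omega>))"
      by (simp add: f[OF \<omega>] sum_distrib_left)
    also have "\<dots> = (\<Sum>q\<in>I. (a \<cdot>\<^sub>v c q) \<bullet> \<xi> q \<omega>)"
    proof (rule sum.cong[OF refl])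
      fix q assume "q \<in> I"
      then have "\<xi> q \<omega> \<in> carrier_vec (prim_dim S q)" using I \<omega> by (intro prim_carrier) auto
      then show "a * (c q \<bullet> \<xi> q \<omega>) = (a \<cdot>\<^sub>v c q) \<bullet> \<xi> q \<omega>"
        by (rule smult_scalar_prod_distrib[OF c, symmetric])
    qed
    finally show "a * f \<omega> = (\<Sum>q\<in>I. (a \<cdot>\<^sub>v c q) \<bullet> \<xi> q \<omega>)" .
  qed (use c in auto)
next
  fix f assume fs: "f \<in> gspan"
  from gspanD[OF fs] obtain I c where I: "finite I" "I \<subseteq> gprims"
    and c0: "\<forall>q. c q \<in> carrier_vec (prim_dim S q)" and f0: "\<forall>\<omega>\<in>space M. f \<omega> = (\<Sum>q\<in>I. c q \<bullet> \<xi> q \<omega>)"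
    by (elim exE conjE)
  note c = c0[rule_format] and f = f0[rule_format]
  have "f \<in> borel_measurable M \<longleftrightarrow> (\<lambda>\<omega>. \<Sum>q\<in>I. c q \<bullet> \<xi> q \<omega>) \<in> borel_measurable M"
    by (rule measurable_cong) (rule f)
  moreover have "distr M borel f = distr M borel (\<lambda>\<omega>. \<Sum>q\<in>I. c q \<bullet> \<xi> q \<omega>)"
    by (rule distr_cong) (simp_all add: f)
  ultimately show "f \<in> borel_measurable M \<and> (\<exists>v\<ge>0. distr M borel f = normal_law v)"
    using linear_combination_normal[OF I c] by simp
qed

section \<open>Gaussian random vectors and their covariance matrices\<close>

lemma gspan_cong:
  assumes "f \<in> gspan" "\<And>\<omega>. \<omega> \<in> space M \<Longrightarrow> g \<omega> = f \<omega>"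
  shows "g \<in> gspan"
  using assms unfolding gspan_def by simp

definition gvec :: "nat \<Rightarrow> ('w \<Rightarrow> real vec) \<Rightarrow> bool" where
  "gvec k X \<longleftrightarrow> (\<forall>\<omega>\<in>space M. X \<omega> \<in> carrier_vec k) \<and> (\<forall>a<k. (\<lambda>\<omega>. X \<omega> $ a) \<in> gspan)"

lemma gvec_carrier: "gvec k X \<Longrightarrow> \<omega> \<in> space M \<Longrightarrow> X \<omega> \<in> carrier_vec k"
  and gvec_index: "gvec k X \<Longrightarrow> a < k \<Longrightarrow> (\<lambda>\<omega>. X \<omega> $ a) \<in> gspan"
  by (auto simp: gvec_def)

lemma gvecI:
  "(\<And>\<omega>. \<omega> \<in> space M \<Longrightarrow> X \<omega> \<in> carrier_vec k) \<Longrightarrow> (\<And>a. a < k \<Longrightarrow> (\<lambda>\<omega>. X \<omega> $ a) \<in> gspan) \<Longrightarrow> gvec k X"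
  by (simp add: gvec_def)

lemma gvec_measurable: "gvec k X \<Longrightarrow> X \<in> measurable M (vec_borel k)"
  by (intro measurable_vec_borelI gvec_carrier gauss_measurable gvec_index)

lemma gvec_prim:
  assumes q: "q \<in> gprims"
  shows "gvec (prim_dim S q) (\<xi> q)"
proof (rule gvecI)
  fix a assume a: "a < prim_dim S q"
  show "(\<lambda>\<omega>. \<xi> q \<omega> $ a) \<in> gspan"
  proof (rule gspanI[of "{q}" "\<lambda>q'. unit_vec (prim_dim S q') a"])
    fix \<omega> assume "\<omega> \<in> space M"
    then have "\<xi> q \<omega> \<in> carrier_vec (prim_dim S q)" using q by (intro prim_carrier)
    then show "\<xi> q \<omega> $ a = (\<Sum>q\<in>{q}. unit_vec (prim_dim S q) a \<bullet> \<xi> q \<omega>)"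
      using a by simp
  qed (use q in auto)
qed (rule prim_carrier[OF q])

lemma gvec_add:
  assumes X: "gvec k X" and Y: "gvec k Y"
  shows "gvec k (\<lambda>\<omega>. X \<omega> + Y \<omega>)"
proof (rule gvecI)
  fix a assume a: "a < k"
  show "(\<lambda>\<omega>. (X \<omega> + Y \<omega>) $ a) \<in> gspan"
  proof (rule gspan_cong[OF gauss_add[OF gvec_index[OF X a] gvec_index[OF Y a]]])
    fix \<omega> assume "\<omega> \<in> space M"
    then show "(X \<omega> + Y \<omega>) $ a = X \<omega> $ a + Y \<omega> $ a" using a gvec_carrier[OF Y, of \<omega>] by simp
  qed
qed (rule add_carrier_vec[OF gvec_carrier[OF X] gvec_carrier[OF Y]])

lemma gvec_mult:
  assumes H: "H \<in> carrier_mat l k" and X: "gvec k X"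
  shows "gvec l (\<lambda>\<omega>. H *\<^sub>v X \<omega>)"
proof (rule gvecI)
  fix a assume a: "a < l"
  have "(\<lambda>\<omega>. \<Sum>b<k. H $$ (a, b) * X \<omega> $ b) \<in> gspan"
    by (intro gauss_sum gauss_cmult gvec_index[OF X]) simp
  then show "(\<lambda>\<omega>. (H *\<^sub>v X \<omega>) $ a) \<in> gspan"
    by (rule gspan_cong) (rule mult_mat_vec_index[OF H gvec_carrier[OF X] a])
qed (rule mult_mat_vec_carrier[OF H gvec_carrier[OF X]])

lemma minus_vec_mult:
  assumes "x \<in> carrier_vec k" "y \<in> carrier_vec k"
  shows "x - y = x + (- 1\<^sub>m k) *\<^sub>v (y :: real vec)"
proof -
  have "(- 1\<^sub>m k) *\<^sub>v y = - (1\<^sub>m k *\<^sub>v y)"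
    using assms by (intro uminus_mult_mat_vec) simp
  then show ?thesis
    using assms by (simp add: minus_add_uminus_vec[OF assms])
qed

lemma gvec_minus:
  assumes "gvec k X" "gvec k Y"
  shows "gvec k (\<lambda>\<omega>. X \<omega> - Y \<omega>)"
proof -
  have 1: "gvec k (\<lambda>\<omega>. X \<omega> + (- 1\<^sub>m k) *\<^sub>v Y \<omega>)"
    by (rule gvec_add[OF assms(1) gvec_mult[OF _ assms(2)]]) simp
  have eq: "X \<omega> - Y \<omega> = X \<omega> + (- 1\<^sub>m k) *\<^sub>v Y \<omega>" if "\<omega> \<in> space M" for \<omega>
    by (rule minus_vec_mult[OF gvec_carrier[OF assms(1) that] gvec_carrier[OF assms(2) that]])
  show ?thesis
  proof (rule gvecI)
    show "(\<lambda>\<omega>. (X \<omega> - Y \<omega>) $ a) \<in> gspan" if "a < k" for a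
      by (rule gspan_cong[OF gvec_index[OF 1 that]]) (simp only: eq)
    show "X \<omega> - Y \<omega> \<in> carrier_vec k" if "\<omega> \<in> space M" for \<omega>
      using gvec_carrier[OF 1 that] by (simp only: eq[OF that])
  qed
qed

text \<open>Elements of \<open>gspan\<close> have mean 0, so second moments are covariances.\<close>

definition cov :: "nat \<Rightarrow> nat \<Rightarrow> ('w \<Rightarrow> real vec) \<Rightarrow> ('w \<Rightarrow> real vec) \<Rightarrow> real mat" where
  "cov k l X Y = mat k l (\<lambda>(a, b). expectation (\<lambda>\<omega>. X \<omega> $ a * Y \<omega> $ b))"

lemma cov_carrier [simp]: "cov k l X Y \<in> carrier_mat k l"
  by (simp add: cov_def)

lemma cov_index [simp]: "a < k \<Longrightarrow> b < l \<Longrightarrow> cov k l X Y $$ (a, b) = expectation (\<lambda>\<omega>. X \<omega> $ a * Y \<omega> $ b)"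
  and cov_dim [simp]: "dim_row (cov k l X Y) = k" "dim_col (cov k l X Y) = l"
  by (simp_all add: cov_def)

lemma cov_transpose: "cov k l X Y = transpose_mat (cov l k Y X)"
  by (intro eq_matI) (simp_all add: mult.commute)

lemma cov_add_left:
  assumes "gvec k X" "gvec k Y" "gvec l Z"
  shows "cov k l (\<lambda>\<omega>. X \<omega> + Y \<omega>) Z = cov k l X Z + cov k l Y Z"
proof (intro eq_matI)
  fix a b assume "a < dim_row (cov k l X Z + cov k l Y Z)" "b < dim_col (cov k l X Z + cov k l Y Z)"
  then have ab: "a < k" "b < l" by auto
  have "expectation (\<lambda>\<omega>. (X \<omega> + Y \<omega>) $ a * Z \<omega> $ b) = expectation (\<lambda>\<omega>. X \<omega> $ a * Z \<omega> $ b + Y \<omega> $ a * Z \<omega> $ b)"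
    using ab by (intro Bochner_Integration.integral_cong refl) (auto simp: carrier_vecD[OF gvec_carrier[OF assms(2)]] distrib_right)
  also have "\<dots> = expectation (\<lambda>\<omega>. X \<omega> $ a * Z \<omega> $ b) + expectation (\<lambda>\<omega>. Y \<omega> $ a * Z \<omega> $ b)"
    by (intro Bochner_Integration.integral_add gauss_mult_integrable gvec_index[OF assms(1) ab(1)] gvec_index[OF assms(2) ab(1)]
        gvec_index[OF assms(3) ab(2)])
  finally show "cov k l (\<lambda>\<omega>. X \<omega> + Y \<omega>) Z $$ (a, b) = (cov k l X Z + cov k l Y Z) $$ (a, b)"
    using ab by simp
qed simp_all

lemma cov_mult_left:
  assumes H: "H \<in> carrier_mat j k" and X: "gvec k X" and Z: "gvec l Z"
  shows "cov j l (\<lambda>\<omega>. H *\<^sub>v X \<omega>) Z = H * cov k l X Z"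
proof (intro eq_matI)
  fix a b assume "a < dim_row (H * cov k l X Z)" "b < dim_col (H * cov k l X Z)"
  then have ab: "a < j" "b < l" using H by auto
  have "expectation (\<lambda>\<omega>. (H *\<^sub>v X \<omega>) $ a * Z \<omega> $ b) = expectation (\<lambda>\<omega>. \<Sum>c<k. H $$ (a, c) * (X \<omega> $ c * Z \<omega> $ b))"
    using ab by (intro Bochner_Integration.integral_cong refl)
      (simp add: mult_mat_vec_index[OF H gvec_carrier[OF X]] sum_distrib_right mult.assoc del: index_mult_mat_vec)
  also have "\<dots> = (\<Sum>c<k. expectation (\<lambda>\<omega>. H $$ (a, c) * (X \<omega> $ c * Z \<omega> $ b)))"
    using ab by (intro Bochner_Integration.integral_sum integrable_mult_right gauss_mult_integrable gvec_index[OF X] gvec_index[OF Z]) auto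
  also have "\<dots> = (H * cov k l X Z) $$ (a, b)"
    using ab H by (auto simp: scalar_prod_def atLeast0LessThan intro!: sum.cong)
  finally show "cov j l (\<lambda>\<omega>. H *\<^sub>v X \<omega>) Z $$ (a, b) = (H * cov k l X Z) $$ (a, b)"
    using ab by simp
qed (use H in simp_all)

lemma cov_cong:
  assumes "\<And>\<omega>. \<omega> \<in> space M \<Longrightarrow> X \<omega> = X' \<omega>" "\<And>\<omega>. \<omega> \<in> space M \<Longrightarrow> Y \<omega> = Y' \<omega>"
  shows "cov k l X Y = cov k l X' Y'"
  by (intro eq_matI) (auto simp: assms intro!: Bochner_Integration.integral_cong)

lemma cov_minus_left:
  assumes "gvec k X" "gvec k Y" "gvec l Z"
  shows "cov k l (\<lambda>\<omega>. X \<omega> - Y \<omega>) Z = cov k l X Z - cov k l Y Z"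
proof -
  have one: "- 1\<^sub>m k \<in> carrier_mat k k" by simp
  have "cov k l (\<lambda>\<omega>. X \<omega> - Y \<omega>) Z = cov k l (\<lambda>\<omega>. X \<omega> + (- 1\<^sub>m k) *\<^sub>v Y \<omega>) Z"
    by (rule cov_cong) (auto intro!: minus_vec_mult gvec_carrier assms)
  also have "\<dots> = cov k l X Z + (- 1\<^sub>m k) * cov k l Y Z"
    using cov_add_left[OF assms(1) gvec_mult[OF one assms(2)] assms(3)] cov_mult_left[OF one assms(2,3)] by simp
  also have "\<dots> = cov k l X Z - cov k l Y Z"
    by (intro eq_matI) auto
  finally show ?thesis .
qed

lemma cov_prims_zero:
  assumes "q \<in> gprims" "q' \<in> gprims" "q \<noteq> q'"
  shows "cov (prim_dim S q) (prim_dim S q') (\<xi> q) (\<xi> q') = 0\<^sub>m (prim_dim S q) (prim_dim S q')"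
proof (intro eq_matI)
  fix a b assume "a < dim_row (0\<^sub>m (prim_dim S q) (prim_dim S q'))" "b < dim_col (0\<^sub>m (prim_dim S q) (prim_dim S q'))"
  then have ab: "a < prim_dim S q" "b < prim_dim S q'" by auto
  note g = gvec_index[OF gvec_prim[OF assms(1)] ab(1)] gvec_index[OF gvec_prim[OF assms(2)] ab(2)]
  have "indep_vars prim_space \<xi> {q, q'}"
    using assms gprims_subset by (intro indep_vars_subset[OF indep_prims]) auto
  then have "indep_vars (\<lambda>_. borel) (\<lambda>p \<omega>. \<xi> p \<omega> $ (if p = q then a else b)) {q, q'}"
    by (rule indep_vars_compose2) measurable
  then have "expectation (\<lambda>\<omega>. \<Prod>p\<in>{q, q'}. \<xi> p \<omega> $ (if p = q then a else b)) = (\<Prod>p\<in>{q, q'}. expectation (\<lambda>\<omega>. \<xi> p \<omega> $ (if p = q then a else b)))"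
    using assms(3) gauss_moments(1)[OF g(1)] gauss_moments(1)[OF g(2)] by (intro indep_vars_lebesgue_integral) auto
  then have "expectation (\<lambda>\<omega>. \<xi> q \<omega> $ a * \<xi> q' \<omega> $ b) = 0"
    using assms(3) gauss_moments(4)[OF g(1)] by simp
  then show "cov (prim_dim S q) (prim_dim S q') (\<xi> q) (\<xi> q') $$ (a, b) = 0\<^sub>m (prim_dim S q) (prim_dim S q') $$ (a, b)"
    using ab by simp
qed simp_all

text \<open>\<open>gaussian_vec\<close> speaks of linear functionals only. The entries are recovered
  by polarisation from the variances at unit vectors and at their sums.\<close>

lemma cov_gaussian_vec:
  assumes X: "gvec k X" and V: "gaussian_vec M k V X"
  shows "cov k k X X = V"
proof -
  have Vc: "V \<in> carrier_mat k k" "transpose_mat V = V" and Vs: "sym_mat k V"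
    and nonneg: "\<And>c. c \<in> carrier_vec k \<Longrightarrow> 0 \<le> c \<bullet> (V *\<^sub>v c)"
    and law: "\<And>c. c \<in> carrier_vec k \<Longrightarrow> distr M borel (\<lambda>\<omega>. c \<bullet> X \<omega>) = normal_law (c \<bullet> (V *\<^sub>v c))"
    using V by (auto simp: gaussian_vec_def psd_mat_def sym_mat_def)
  have sq: "expectation (\<lambda>\<omega>. (c \<bullet> X \<omega>)\<^sup>2) = c \<bullet> (V *\<^sub>v c)" if c: "c \<in> carrier_vec k" for c
  proof -
    have m: "(\<lambda>\<omega>. c \<bullet> X \<omega>) \<in> borel_measurable M"
      using gvec_measurable[OF X] measurable_vec_const[OF c] by (rule measurable_scalar_prod[rotated])
    have "expectation (\<lambda>\<omega>. (c \<bullet> X \<omega>)\<^sup>2) = (LINT x|distr M borel (\<lambda>\<omega>. c \<bullet> X \<omega>). x\<^sup>2)"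
      by (rule integral_distr[OF m, symmetric]) measurable
    also have "\<dots> = c \<bullet> (V *\<^sub>v c)"
      using normal_law_moments(4)[OF nonneg[OF c]] by (simp only: law[OF c])
    finally show ?thesis .
  qed
  have entry: "unit_vec k b \<bullet> (V *\<^sub>v unit_vec k a) = V $$ (b, a)" if "a < k" "b < k" for a b
    using that Vc by simp
  show ?thesis
  proof (intro eq_matI)
    fix a b assume "a < dim_row V" "b < dim_col V"
    then have ab: "a < k" "b < k" using Vc by auto
    let ?f = "\<lambda>\<omega>. X \<omega> $ a" and ?g = "\<lambda>\<omega>. X \<omega> $ b"
    note f = gvec_index[OF X ab(1)] and g = gvec_index[OF X ab(2)]
    have u: "unit_vec k a \<bullet> X \<omega> = X \<omega> $ a" "unit_vec k b \<bullet> X \<omega> = X \<omega> $ b"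
      "(unit_vec k a + unit_vec k b) \<bullet> X \<omega> = X \<omega> $ a + 1 * X \<omega> $ b" if "\<omega> \<in> space M" for \<omega>
      using ab gvec_carrier[OF X that] by (auto simp: add_scalar_prod_distrib[where n=k])
    have "expectation (\<lambda>\<omega>. (?f \<omega>)\<^sup>2) = V $$ (a, a)" "expectation (\<lambda>\<omega>. (?g \<omega>)\<^sup>2) = V $$ (b, b)"
      using sq[of "unit_vec k a"] sq[of "unit_vec k b"] entry ab by (simp_all add: u cong: Bochner_Integration.integral_cong)
    moreover have "expectation (\<lambda>\<omega>. (?f \<omega> + 1 * ?g \<omega>)\<^sup>2) = V $$ (a, a) + 2 * V $$ (b, a) + V $$ (b, b)"
      using sq[of "unit_vec k a + unit_vec k b"] quadratic_form_add[OF Vs, of "unit_vec k a" "unit_vec k b"] entry ab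
      by (simp add: u cong: Bochner_Integration.integral_cong)
    moreover have "V $$ (b, a) = V $$ (a, b)"
      using Vc ab by (metis carrier_matD index_transpose_mat(1))
    ultimately show "cov k k X X $$ (a, b) = V $$ (a, b)"
      using gauss_square_add[OF f g, of 1] ab by simp
  qed (use Vc in simp_all)
qed

end

section \<open>Innovations of the Kalman filter\<close>

context lqg_loop
begin

text \<open>
  \<open>eta\<close> and \<open>theta\<close> are the prediction and estimation errors \<open>x\<^sub>k - xhat\<^sub>k\<^sub>|\<^sub>k\<^sub>-\<^sub>1\<close> and \<open>x\<^sub>k - xhat\<^sub>k\<^sub>|\<^sub>k\<close>.
  They do not depend on the controls.
\<close>

primrec eta :: "nat \<Rightarrow> 'w \<Rightarrow> real vec" where
  "eta 0 \<omega> = \<xi> (Init i) \<omega>"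
| "eta (Suc k) \<omega> = A *\<^sub>v (eta k \<omega> - L *\<^sub>v (C *\<^sub>v eta k \<omega> + \<xi> (Meas_Noise i k) \<omega>)) + \<xi> (Proc_Noise i k) \<omega>"

definition innov :: "nat \<Rightarrow> 'w \<Rightarrow> real vec" where
  "innov k \<omega> = C *\<^sub>v eta k \<omega> + \<xi> (Meas_Noise i k) \<omega>"

definition theta :: "nat \<Rightarrow> 'w \<Rightarrow> real vec" where
  "theta k \<omega> = eta k \<omega> - L *\<^sub>v innov k \<omega>"

lemma innov_fun: "innov k = (\<lambda>\<omega>. C *\<^sub>v eta k \<omega> + \<xi> (Meas_Noise i k) \<omega>)"
  and theta_fun: "theta k = (\<lambda>\<omega>. eta k \<omega> - L *\<^sub>v innov k \<omega>)"
  by (simp_all add: fun_eq_iff innov_def theta_def)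

lemma eta_Suc: "eta (Suc k) = (\<lambda>\<omega>. A *\<^sub>v theta k \<omega> + \<xi> (Proc_Noise i k) \<omega>)"
  by (simp add: fun_eq_iff theta_def innov_def)

lemma gvec_noise: "gvec n (\<xi> (Init i))" "gvec n (\<xi> (Proc_Noise i k))" "gvec dy (\<xi> (Meas_Noise i k))"
  using gvec_prim[of "Init i"] gvec_prim[of "Proc_Noise i k"] gvec_prim[of "Meas_Noise i k"]
  by (simp_all add: gprims_def)

lemma gvec_eta: "gvec n (eta k)" and gvec_innov: "gvec dy (innov k)" and gvec_theta: "gvec n (theta k)"
proof -
  have innov: "gvec dy (innov k)" if "gvec n (eta k)" for k
    unfolding innov_def by (intro gvec_add gvec_mult[OF dims(3)] gvec_noise that)
  have theta: "gvec n (theta k)" if "gvec n (eta k)" for k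
    unfolding theta_def by (intro gvec_minus gvec_mult[OF L_carrier] innov that)
  have "gvec n (eta k)" for k
  proof (induction k)
    case 0
    have "eta 0 = \<xi> (Init i)" by (simp add: fun_eq_iff)
    then show ?case using gvec_noise(1) by simp
  next
    case (Suc k)
    then show ?case
      unfolding eta_Suc by (intro gvec_add gvec_mult[OF dims(1)] gvec_noise theta)
  qed
  with innov theta show "gvec n (eta k)" "gvec dy (innov k)" "gvec n (theta k)" by blast+
qed

lemma uncorrelated_add:
  assumes "gvec k X" "gvec k Y" "gvec l Z" "cov k l X Z = 0\<^sub>m k l" "cov k l Y Z = 0\<^sub>m k l"
  shows "cov k l (\<lambda>\<omega>. X \<omega> + Y \<omega>) Z = 0\<^sub>m k l"
  using cov_add_left[OF assms(1-3)] assms(4,5) by simp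

lemma uncorrelated_minus:
  assumes "gvec k X" "gvec k Y" "gvec l Z" "cov k l X Z = 0\<^sub>m k l" "cov k l Y Z = 0\<^sub>m k l"
  shows "cov k l (\<lambda>\<omega>. X \<omega> - Y \<omega>) Z = 0\<^sub>m k l"
  unfolding cov_minus_left[OF assms(1-3)] assms(4,5) by (intro eq_matI) auto

lemma uncorrelated_mult:
  assumes "H \<in> carrier_mat j k" "gvec k X" "gvec l Z" "cov k l X Z = 0\<^sub>m k l"
  shows "cov j l (\<lambda>\<omega>. H *\<^sub>v X \<omega>) Z = 0\<^sub>m j l"
  unfolding cov_mult_left[OF assms(1-3)] assms(4) by (rule right_mult_zero_mat[OF assms(1)])

lemma uncorrelated_sym: "cov k l X Z = 0\<^sub>m k l \<Longrightarrow> cov l k Z X = 0\<^sub>m l k"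
  using cov_transpose[of l k Z X] by simp

text \<open>\<open>eta k\<close> is linear in the initial state and in noises before time
  \<open>k\<close>; the hypotheses exclude exactly these.\<close>

lemma uncorrelated_future:
  assumes q: "q \<in> gprims" and "q \<noteq> Init i" "\<And>l. l < k \<Longrightarrow> q \<noteq> Proc_Noise i l" "\<And>l. l < k \<Longrightarrow> q \<noteq> Meas_Noise i l"
  shows "cov n (prim_dim S q) (eta k) (\<xi> q) = 0\<^sub>m n (prim_dim S q)"
  using assms(3,4)
proof (induction k)
  case 0
  have "eta 0 = \<xi> (Init i)" by (simp add: fun_eq_iff)
  then show ?case
    using cov_prims_zero[of "Init i" q] assms(1,2) by (simp add: gprims_def)
next
  case (Suc k)
  note Z = gvec_prim[OF q]
  have v: "cov dy (prim_dim S q) (\<xi> (Meas_Noise i k)) (\<xi> q) = 0\<^sub>m dy (prim_dim S q)"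
    using cov_prims_zero[of "Meas_Noise i k" q] Suc.prems(2)[of k] q by (auto simp: gprims_def)
  have w: "cov n (prim_dim S q) (\<xi> (Proc_Noise i k)) (\<xi> q) = 0\<^sub>m n (prim_dim S q)"
    using cov_prims_zero[of "Proc_Noise i k" q] Suc.prems(1)[of k] q by (auto simp: gprims_def)
  have e: "cov n (prim_dim S q) (eta k) (\<xi> q) = 0\<^sub>m n (prim_dim S q)"
    using Suc.IH Suc.prems by simp
  have "cov dy (prim_dim S q) (innov k) (\<xi> q) = 0\<^sub>m dy (prim_dim S q)"
    unfolding innov_def
    by (rule uncorrelated_add[OF gvec_mult[OF dims(3) gvec_eta] gvec_noise(3) Z uncorrelated_mult[OF dims(3) gvec_eta Z e] v])
  then have "cov n (prim_dim S q) (theta k) (\<xi> q) = 0\<^sub>m n (prim_dim S q)"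
    unfolding theta_def
    by (intro uncorrelated_minus uncorrelated_mult[OF L_carrier] gvec_mult[OF L_carrier] gvec_eta gvec_innov Z e)
  then show ?case
    unfolding eta_Suc
    by (intro uncorrelated_add uncorrelated_mult[OF dims(1)] gvec_mult[OF dims(1)] gvec_theta gvec_noise Z w)
qed

lemma eta_meas: "k \<le> l \<Longrightarrow> cov n dy (eta k) (\<xi> (Meas_Noise i l)) = 0\<^sub>m n dy"
  and eta_proc: "k \<le> l \<Longrightarrow> cov n n (eta k) (\<xi> (Proc_Noise i l)) = 0\<^sub>m n n"
  using uncorrelated_future[of "Meas_Noise i l" k] uncorrelated_future[of "Proc_Noise i l" k]
  by (auto simp: gprims_def)

lemma meas_proc: "cov dy n (\<xi> (Meas_Noise i k)) (\<xi> (Proc_Noise i l)) = 0\<^sub>m dy n"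
  using cov_prims_zero[of "Meas_Noise i k" "Proc_Noise i l"] by (simp add: gprims_def)

lemma meas_meas: "k \<noteq> l \<Longrightarrow> cov dy dy (\<xi> (Meas_Noise i k)) (\<xi> (Meas_Noise i l)) = 0\<^sub>m dy dy"
  using cov_prims_zero[of "Meas_Noise i k" "Meas_Noise i l"] by (simp add: gprims_def)

lemma innov_proc: "k \<le> l \<Longrightarrow> cov dy n (innov k) (\<xi> (Proc_Noise i l)) = 0\<^sub>m dy n"
  unfolding innov_def
  by (intro uncorrelated_add uncorrelated_mult[OF dims(3)] gvec_mult[OF dims(3)] gvec_eta gvec_noise eta_proc meas_proc)

lemma innov_meas: "k < l \<Longrightarrow> cov dy dy (innov k) (\<xi> (Meas_Noise i l)) = 0\<^sub>m dy dy"
  unfolding innov_def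
  by (intro uncorrelated_add uncorrelated_mult[OF dims(3)] gvec_mult[OF dims(3)] gvec_eta gvec_noise eta_meas meas_meas) auto

lemma theta_proc: "k \<le> l \<Longrightarrow> cov n n (theta k) (\<xi> (Proc_Noise i l)) = 0\<^sub>m n n"
  unfolding theta_def
  by (intro uncorrelated_minus uncorrelated_mult[OF L_carrier] gvec_mult[OF L_carrier] gvec_eta gvec_innov gvec_noise eta_proc innov_proc)

text \<open>
  The initial condition prescribes the conditional second moment of \<open>theta 0\<close> given \<open>innov 0\<close> as a
  constant. Then \<open>E[theta\<^sup>2 innov\<^sup>2] = E[theta\<^sup>2] E[innov\<^sup>2]\<close>, which by Isserlis' formula means that the two are uncorrelated.
\<close>

lemma initial_covariances:
  "cov n n (theta 0) (theta 0) = \<Theta>" "cov n dy (theta 0) (innov 0) = 0\<^sub>m n dy"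
proof -
  let ?F = "vimage_algebra (space M) (innov 0) (vec_borel dy)"
  have y0: "(\<lambda>\<omega>. C *\<^sub>v \<xi> (Init i) \<omega> + \<xi> (Meas_Noise i 0) \<omega>) = innov 0"
    and err: "(\<lambda>\<omega>. \<xi> (Init i) \<omega> - L *\<^sub>v innov 0 \<omega>) = theta 0"
    by (simp_all add: fun_eq_iff innov_def theta_def)
  have AE: "AE \<omega> in M. cond_second_moment M ?F n (theta 0) \<omega> = \<Theta>"
    using bspec[OF conjunct2[OF prims[unfolded primitives_ok_def]] loop]
    unfolding Let_def y0 err[symmetric] by (simp only: innov_def eta.simps)
  note innovM = gvec_measurable[OF gvec_innov, of 0]
  have F: "subalgebra M ?F"
    using measurable_vimageI[OF innovM] by (simp add: subalgebra_def)
  interpret finite_measure_subalgebra M ?F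
    by unfold_locales (rule F)
  have innovF: "innov 0 \<in> measurable ?F (vec_borel dy)"
    using measurable_space[OF innovM] by (intro measurable_vimage_algebra1) auto
  have ce: "AE \<omega> in M. real_cond_exp M ?F (\<lambda>\<omega>. theta 0 \<omega> $ a * theta 0 \<omega> $ b) \<omega> = \<Theta> $$ (a, b)"
    if ab: "a < n" "b < n" for a b
    using AE
  proof eventually_elim
    case (elim \<omega>)
    have "cond_second_moment M ?F n (theta 0) \<omega> $$ (a, b) = \<Theta> $$ (a, b)"
      using elim by simp
    then show ?case using ab by (simp add: cond_second_moment_def)
  qed
  have tt: "expectation (\<lambda>\<omega>. theta 0 \<omega> $ a * theta 0 \<omega> $ b) = \<Theta> $$ (a, b)" if ab: "a < n" "b < n" for a b
  proof -
    have "integrable M (\<lambda>\<omega>. theta 0 \<omega> $ a * theta 0 \<omega> $ b)"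
      by (intro gauss_mult_integrable gvec_index[OF gvec_theta] ab)
    from real_cond_exp_int(2)[OF this]
    have "expectation (\<lambda>\<omega>. theta 0 \<omega> $ a * theta 0 \<omega> $ b)
        = expectation (real_cond_exp M ?F (\<lambda>\<omega>. theta 0 \<omega> $ a * theta 0 \<omega> $ b))"
      by simp
    also have "\<dots> = expectation (\<lambda>_. \<Theta> $$ (a, b))"
      using ce[OF ab] borel_measurable_cond_exp2 by (intro integral_cong_AE) auto
    finally show ?thesis by (simp add: prob_space)
  qed
  show "cov n n (theta 0) (theta 0) = \<Theta>"
    by (intro eq_matI) (auto simp: tt carrier_matD[OF dims(7)])
  show "cov n dy (theta 0) (innov 0) = 0\<^sub>m n dy"
  proof (intro eq_matI)
    fix a b assume "a < dim_row (0\<^sub>m n dy :: real mat)" "b < dim_col (0\<^sub>m n dy :: real mat)"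
    then have ab: "a < n" "b < dy" by auto
    let ?f = "\<lambda>\<omega>. theta 0 \<omega> $ a" and ?g = "\<lambda>\<omega>. innov 0 \<omega> $ b"
    note f = gvec_index[OF gvec_theta ab(1), of 0] and g = gvec_index[OF gvec_innov ab(2), of 0]
    have gF: "(\<lambda>\<omega>. (?g \<omega>)\<^sup>2) \<in> borel_measurable ?F"
      using measurable_compose[OF innovF measurable_vec_index[of b dy]] by measurable
    have int: "integrable M (\<lambda>\<omega>. (?g \<omega>)\<^sup>2 * (?f \<omega> * ?f \<omega>))"
      using gauss_isserlis(1)[OF f g] by (simp add: power2_eq_square mult_ac)
    have fm: "(\<lambda>\<omega>. ?f \<omega> * ?f \<omega>) \<in> borel_measurable M"
      using gauss_measurable[OF f] by measurable
    have "expectation (\<lambda>\<omega>. (?f \<omega>)\<^sup>2 * (?g \<omega>)\<^sup>2) = expectation (\<lambda>\<omega>. (?g \<omega>)\<^sup>2 * (?f \<omega> * ?f \<omega>))"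
      by (simp add: power2_eq_square mult_ac)
    also have "\<dots> = expectation (\<lambda>\<omega>. (?g \<omega>)\<^sup>2 * real_cond_exp M ?F (\<lambda>\<omega>. ?f \<omega> * ?f \<omega>) \<omega>)"
      by (rule real_cond_exp_intg(2)[OF int gF fm, symmetric])
    also have "\<dots> = expectation (\<lambda>\<omega>. (?g \<omega>)\<^sup>2 * \<Theta> $$ (a, a))"
      using ce[OF ab(1) ab(1)] gauss_measurable[OF g] borel_measurable_cond_exp2
      by (intro integral_cong_AE) (auto elim!: eventually_mono)
    also have "\<dots> = expectation (\<lambda>\<omega>. (?f \<omega>)\<^sup>2) * expectation (\<lambda>\<omega>. (?g \<omega>)\<^sup>2)"
      using tt[OF ab(1) ab(1)] by (simp add: power2_eq_square)
    finally have "(expectation (\<lambda>\<omega>. ?f \<omega> * ?g \<omega>))\<^sup>2 = 0"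
      using gauss_isserlis(2)[OF f g] by simp
    then show "cov n dy (theta 0) (innov 0) $$ (a, b) = 0\<^sub>m n dy $$ (a, b)"
      using ab by simp
  qed simp_all
qed

text \<open>Time and measurement update of the Kalman filter as covariance identities.
  \<open>L_Sigma\<close> makes the updated error orthogonal to the innovation, and
  \<open>Theta_eq\<close> closes the recursion at the stationary \<open>\<Theta>\<close>.\<close>

lemma kalman_covariances_step:
  assumes tt: "cov n n (theta k) (theta k) = \<Theta>"
  shows "cov n n (theta (Suc k)) (theta (Suc k)) = \<Theta>" "cov n dy (theta (Suc k)) (innov (Suc k)) = 0\<^sub>m n dy"
proof -
  let ?w = "\<xi> (Proc_Noise i k)" and ?v = "\<xi> (Meas_Noise i (Suc k))" and ?e = "eta (Suc k)" and ?y = "innov (Suc k)"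
  note gv = gvec_eta[of "Suc k"] gvec_innov[of "Suc k"] gvec_theta[of k] gvec_theta[of "Suc k"]
  note gw = gvec_noise(2)[of k] and gm = gvec_noise(3)[of "Suc k"]
  have ww: "cov n n ?w ?w = mW (S i)" by (rule cov_gaussian_vec[OF gw noise_gaussian(1)])
  have vv: "cov dy dy ?v ?v = mV (S i)" by (rule cov_gaussian_vec[OF gm noise_gaussian(2)])
  have symW: "transpose_mat (mW (S i)) = mW (S i)" and symV: "transpose_mat (mV (S i)) = mV (S i)"
    using pds(1,2) by (auto simp: pd_mat_def sym_mat_def)
  have et: "cov n n ?e (theta k) = A * \<Theta>"
    using cov_add_left[OF gvec_mult[OF dims(1) gv(3)] gw gv(3)] cov_mult_left[OF dims(1) gv(3) gv(3)] tt
      uncorrelated_sym[OF theta_proc[of k k]] unfolding eta_Suc by (simp add: right_add_zero_mat[of _ n n] mult_carrier_mat[OF dims(1) dims(7)])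
  have ew: "cov n n ?e ?w = mW (S i)"
    using cov_add_left[OF gvec_mult[OF dims(1) gv(3)] gw gw] cov_mult_left[OF dims(1) gv(3) gw] ww theta_proc[of k k]
      right_mult_zero_mat[OF dims(1), of n] unfolding eta_Suc by simp
  have ee: "cov n n ?e ?e = mTheta_bar (S i)"
  proof -
    have "cov n n ?e ?e = A * cov n n (theta k) ?e + cov n n ?w ?e"
      using cov_add_left[OF gvec_mult[OF dims(1) gv(3)] gw gv(1)] cov_mult_left[OF dims(1) gv(3) gv(1)]
      unfolding eta_Suc[of k, symmetric] by (simp add: eta_Suc)
    also have "cov n n (theta k) ?e = \<Theta> * transpose_mat A"
      using cov_transpose[of n n "theta k" ?e] by (simp add: et transpose_mult[OF dims(1) dims(7)] transposes)
    also have "cov n n ?w ?e = mW (S i)"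
      using cov_transpose[of n n ?w ?e] by (simp add: ew symW)
    also have "A * (\<Theta> * transpose_mat A) = A * \<Theta> * transpose_mat A"
      by (rule assoc_mult_mat[symmetric, of _ n n _ n _ n]) auto
    finally show ?thesis unfolding mTheta_bar_def .
  qed
  have ye: "cov dy n ?y ?e = C * mTheta_bar (S i)"
    using cov_add_left[OF gvec_mult[OF dims(3) gv(1)] gm gv(1)] cov_mult_left[OF dims(3) gv(1) gv(1)] ee
      uncorrelated_sym[OF eta_meas[of "Suc k" "Suc k"]]
    by (simp add: innov_fun[of "Suc k"] right_add_zero_mat[of _ dy n] mult_carrier_mat[OF dims(3) Theta_bar_carrier] del: eta.simps)
  have ey: "cov n dy ?e ?y = mTheta_bar (S i) * transpose_mat C"
    using cov_transpose[of n dy ?e ?y] by (simp add: ye transpose_mult[OF dims(3) Theta_bar_carrier] Theta_bar_sym)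
  have yv: "cov dy dy ?y ?v = mV (S i)"
    using cov_add_left[OF gvec_mult[OF dims(3) gv(1)] gm gm] cov_mult_left[OF dims(3) gv(1) gm] vv eta_meas[of "Suc k" "Suc k"]
      right_mult_zero_mat[OF dims(3), of dy] by (simp add: innov_fun[of "Suc k"] del: eta.simps)
  have yy: "cov dy dy ?y ?y = \<Sigma>"
  proof -
    have "cov dy dy ?y ?y = C * cov n dy ?e ?y + cov dy dy ?v ?y"
      using cov_add_left[OF gvec_mult[OF dims(3) gv(1)] gm gv(2)] cov_mult_left[OF dims(3) gv(1) gv(2)]
      by (simp add: innov_fun[of "Suc k"] del: eta.simps)
    also have "cov dy dy ?v ?y = mV (S i)"
      using cov_transpose[of dy dy ?v ?y] by (simp add: yv symV)
    also have "C * cov n dy ?e ?y = C * mTheta_bar (S i) * transpose_mat C"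
      unfolding ey by (rule assoc_mult_mat[symmetric, of _ dy n _ n _ dy]) auto
    finally show ?thesis by (simp add: \<Sigma>_def innov_cov_def)
  qed
  have split: "cov n l (theta (Suc k)) Z = cov n l ?e Z - L * cov dy l ?y Z" if "gvec l Z" for l Z
    using cov_minus_left[OF gv(1) gvec_mult[OF L_carrier gv(2)] that] cov_mult_left[OF L_carrier gv(2) that]
    by (simp add: theta_fun[of "Suc k"] del: eta.simps)
  show ty: "cov n dy (theta (Suc k)) ?y = 0\<^sub>m n dy"
    unfolding split[OF gv(2)] ey yy L_Sigma by (rule minus_r_inv_mat) blast
  have te: "cov n n (theta (Suc k)) ?e = \<Theta>"
    unfolding split[OF gv(1)] ee ye by (rule Theta_eq[symmetric])
  \<comment> \<open>As the updated error is orthogonal to the innovation, its covariance with itself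
    equals that with the predicted error.\<close>
  have "cov n n (theta (Suc k)) (theta (Suc k)) = transpose_mat \<Theta> - L * 0\<^sub>m dy n"
    unfolding split[OF gv(4)] using cov_transpose[of n n ?e "theta (Suc k)"] te uncorrelated_sym[OF ty] by simp
  also have "\<dots> = \<Theta> - 0\<^sub>m n n"
    using right_mult_zero_mat[OF L_carrier, of n] by (simp add: transposes)
  also have "\<dots> = \<Theta>"
    by (intro eq_matI) (auto simp: carrier_matD[OF dims(7)])
  finally show "cov n n (theta (Suc k)) (theta (Suc k)) = \<Theta>" .
qed

lemma theta_covariance: "cov n n (theta k) (theta k) = \<Theta>"
  by (induction k) (auto intro: initial_covariances(1) kalman_covariances_step(1))

lemma theta_innov_same: "cov n dy (theta k) (innov k) = 0\<^sub>m n dy"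
  by (cases k) (auto intro: initial_covariances(2) kalman_covariances_step(2)[OF theta_covariance])

text \<open>Orthogonality at equal times comes from the Kalman step. For older innovations it is
  carried along, since the new noises are uncorrelated with them.\<close>

lemma theta_innov: "l \<le> k \<Longrightarrow> cov n dy (theta k) (innov l) = 0\<^sub>m n dy"
  and innov_innov: "l < k \<Longrightarrow> cov dy dy (innov k) (innov l) = 0\<^sub>m dy dy"
proof -
  have *: "cov n dy (eta (Suc k)) (innov l) = 0\<^sub>m n dy" if "l \<le> k" "cov n dy (theta k) (innov l) = 0\<^sub>m n dy" for k l
    unfolding eta_Suc using that
    by (intro uncorrelated_add uncorrelated_mult[OF dims(1)] gvec_mult[OF dims(1)] gvec_theta gvec_innov gvec_noise
        uncorrelated_sym[OF innov_proc])
  have **: "cov dy dy (innov (Suc k)) (innov l) = 0\<^sub>m dy dy" if "l \<le> k" "cov n dy (theta k) (innov l) = 0\<^sub>m n dy" for k l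
    unfolding innov_fun[of "Suc k"] using that
    by (intro uncorrelated_add uncorrelated_mult[OF dims(3)] gvec_mult[OF dims(3)] gvec_eta gvec_innov gvec_noise
        uncorrelated_sym[OF innov_meas] *) auto
  have t: "cov n dy (theta k) (innov l) = 0\<^sub>m n dy" if "l \<le> k" for k l
    using that
  proof (induction k)
    case 0
    then show ?case using theta_innov_same[of 0] by simp
  next
    case (Suc k)
    show ?case
    proof (cases "l = Suc k")
      case False
      then have "l \<le> k" using Suc.prems by simp
      from Suc.IH[OF this] * ** this show ?thesis
        unfolding theta_fun[of "Suc k"]
        by (intro uncorrelated_minus uncorrelated_mult[OF L_carrier] gvec_mult[OF L_carrier] gvec_eta gvec_innov)
    qed (use theta_innov_same in simp)
  qed
  then show "l \<le> k \<Longrightarrow> cov n dy (theta k) (innov l) = 0\<^sub>m n dy" by blast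
  show "cov dy dy (innov k) (innov l) = 0\<^sub>m dy dy" if "l < k"
    using that ** t by (cases k) auto
qed

end

section \<open>Independence of the innovations\<close>

context lqg_loop
begin

definition N_alg :: "'w measure" where
  "N_alg = vimage_algebra (space M) (\<lambda>\<omega>. \<lambda>q\<in>oprims. \<xi> q \<omega>) (Pi\<^sub>M oprims prim_space)"

definition innov_event :: "nat \<Rightarrow> (nat \<Rightarrow> nat \<Rightarrow> real set) \<Rightarrow> 'w set" where
  "innov_event k D = {\<omega> \<in> space M. \<forall>l<k. \<forall>a<dy. innov l \<omega> $ a \<in> D l a}"

definition G_gen :: "nat \<Rightarrow> 'w set set" where
  "G_gen k = {E \<inter> innov_event k D | E D. E \<in> sets N_alg \<and> (\<forall>l a. D l a \<in> sets borel)}"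

definition G_alg :: "nat \<Rightarrow> 'w measure" where
  "G_alg k = sigma (space M) (G_gen k)"

lemma oprims_measurable: "(\<lambda>\<omega>. \<lambda>q\<in>oprims. \<xi> q \<omega>) \<in> measurable M (Pi\<^sub>M oprims prim_space)"
  by (intro measurable_restrict prim_measurable) (simp add: oprims_def)

lemma space_N_alg [simp]: "space N_alg = space M"
  by (simp add: N_alg_def)

lemma sets_N_alg: "sets N_alg = {(\<lambda>\<omega>. \<lambda>q\<in>oprims. \<xi> q \<omega>) -` D \<inter> space M | D. D \<in> sets (Pi\<^sub>M oprims prim_space)}"
  unfolding N_alg_def by (rule sets_vimage_algebra_measurable[OF oprims_measurable])

lemma N_alg_events: "sets N_alg \<subseteq> events"
  unfolding N_alg_def by (rule measurable_vimageI[OF oprims_measurable])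

lemma innov_component_measurable: "a < dy \<Longrightarrow> (\<lambda>\<omega>. innov l \<omega> $ a) \<in> borel_measurable M"
  by (intro gauss_measurable gvec_index[OF gvec_innov])

lemma innov_event_events:
  assumes "\<forall>l a. D l a \<in> sets borel"
  shows "innov_event k D \<in> events"
proof -
  have "{\<omega> \<in> space M. \<forall>l\<in>{..<k}. \<forall>a\<in>{..<dy}. innov l \<omega> $ a \<in> D l a} \<in> events"
  proof (intro sets.sets_Collect_finite_All finite_lessThan)
    fix l a assume "a \<in> {..<dy}"
    then have "(\<lambda>\<omega>. innov l \<omega> $ a) \<in> borel_measurable M" by (intro innov_component_measurable) simp
    from measurable_sets[OF this, of "D l a"] assms
    show "{\<omega> \<in> space M. innov l \<omega> $ a \<in> D l a} \<in> events" by (simp add: vimage_def Int_def conj_commute)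
  qed
  then show ?thesis unfolding innov_event_def by (simp only: lessThan_iff Ball_def)
qed

lemma G_gen_events: "G_gen k \<subseteq> events"
  using N_alg_events innov_event_events unfolding G_gen_def by blast

lemma G_gen_Pow: "G_gen k \<subseteq> Pow (space M)"
  using G_gen_events sets.sets_into_space by blast

lemma space_G_alg [simp]: "space (G_alg k) = space M"
  by (simp add: G_alg_def space_measure_of_conv)

lemma sets_G_alg: "sets (G_alg k) = sigma_sets (space M) (G_gen k)"
  unfolding G_alg_def by (rule sets_measure_of[OF G_gen_Pow])

lemma G_alg_events: "sets (G_alg k) \<subseteq> events"
  unfolding sets_G_alg by (rule sets.sigma_sets_subset[OF G_gen_events])

lemma sub_alg_G_alg: "sub_alg M (G_alg k)"
  using G_alg_events by unfold_locales (simp add: subalgebra_def)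

lemma Int_stable_G_gen: "Int_stable (G_gen k)"
proof (rule Int_stableI)
  fix X Y assume XY: "X \<in> G_gen k" "Y \<in> G_gen k"
  from XY(1) obtain E D where X: "X = E \<inter> innov_event k D" "E \<in> sets N_alg" "\<forall>l a. D l a \<in> sets borel"
    unfolding G_gen_def by blast
  from XY(2) obtain E' D' where Y: "Y = E' \<inter> innov_event k D'" "E' \<in> sets N_alg" "\<forall>l a. D' l a \<in> sets borel"
    unfolding G_gen_def by blast
  have "X \<inter> Y = (E \<inter> E') \<inter> innov_event k (\<lambda>l a. D l a \<inter> D' l a)"
    unfolding X(1) Y(1) innov_event_def by blast
  moreover have "E \<inter> E' \<in> sets N_alg" "\<forall>l a. D l a \<inter> D' l a \<in> sets borel"
    using X Y by auto
  ultimately show "X \<inter> Y \<in> G_gen k"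
    unfolding G_gen_def by blast
qed

lemma N_alg_G_alg: "sets N_alg \<subseteq> sets (G_alg k)"
proof
  fix E assume E: "E \<in> sets N_alg"
  then have "E \<inter> space M = E" using N_alg_events sets.sets_into_space by blast
  moreover have "innov_event k (\<lambda>_ _. UNIV) = space M" by (simp add: innov_event_def)
  ultimately have "E = E \<inter> innov_event k (\<lambda>_ _. UNIV)" by simp
  then have "E \<in> G_gen k" using E unfolding G_gen_def by (intro CollectI exI[of _ E] exI[of _ "\<lambda>_ _. UNIV"]) simp
  then show "E \<in> sets (G_alg k)" unfolding sets_G_alg by (rule sigma_sets.Basic)
qed

lemma G_alg_mono:
  assumes "k \<le> k'"
  shows "sets (G_alg k) \<subseteq> sets (G_alg k')"
  unfolding sets_G_alg
proof (rule sigma_sets_mono', rule subsetI)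
  fix X assume "X \<in> G_gen k"
  then obtain E D where X: "X = E \<inter> innov_event k D" "E \<in> sets N_alg" "\<forall>l a. D l a \<in> sets borel"
    unfolding G_gen_def by blast
  have "innov_event k D = innov_event k' (\<lambda>l a. if l < k then D l a else UNIV)"
    using assms by (auto simp: innov_event_def)
  moreover have "\<forall>l a. (if l < k then D l a else UNIV) \<in> sets borel" using X(3) by auto
  ultimately show "X \<in> G_gen k'"
    using X unfolding G_gen_def by blast
qed

lemma innov_G_alg:
  assumes "l < k"
  shows "innov l \<in> measurable (G_alg k) (vec_borel dy)"
proof (rule measurable_vec_borelI)
  fix a assume a: "a < dy"
  show "(\<lambda>\<omega>. innov l \<omega> $ a) \<in> borel_measurable (G_alg k)"
  proof (rule measurableI)
    fix D :: "real set" assume D: "D \<in> sets borel"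
    have "(\<lambda>\<omega>. innov l \<omega> $ a) -` D \<inter> space (G_alg k)
        = space M \<inter> innov_event k (\<lambda>l' a'. if l' = l \<and> a' = a then D else UNIV)"
    proof (rule Set.set_eqI)
      fix \<omega>
      have "\<omega> \<in> innov_event k (\<lambda>l' a'. if l' = l \<and> a' = a then D else UNIV)
          \<longleftrightarrow> \<omega> \<in> space M \<and> (\<forall>l'<k. \<forall>a'<dy. l' = l \<and> a' = a \<longrightarrow> innov l' \<omega> $ a' \<in> D)"
        unfolding innov_event_def by (simp only: if_split_mem2 mem_Collect_eq UNIV_I) blast
      also have "\<dots> \<longleftrightarrow> \<omega> \<in> space M \<and> innov l \<omega> $ a \<in> D"
        using assms a by blast
      finally show "\<omega> \<in> (\<lambda>\<omega>. innov l \<omega> $ a) -` D \<inter> space (G_alg k) \<longleftrightarrow>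
          \<omega> \<in> space M \<inter> innov_event k (\<lambda>l' a'. if l' = l \<and> a' = a then D else UNIV)"
        by simp blast
    qed
    also have "\<dots> \<in> G_gen k"
    proof -
      have "space M \<in> sets N_alg" using sets.top[of N_alg] by simp
      moreover have "\<forall>l' a'. (if l' = l \<and> a' = a then D else UNIV) \<in> sets borel" using D by simp
      ultimately show ?thesis unfolding G_gen_def by blast
    qed
    also have "G_gen k \<subseteq> sets (G_alg k)" unfolding sets_G_alg by blast
    finally show "(\<lambda>\<omega>. innov l \<omega> $ a) -` D \<inter> space (G_alg k) \<in> sets (G_alg k)" .
  qed simp
qed (simp add: gvec_carrier[OF gvec_innov])

text \<open>Independence of blocks of primitives applies to functions of a whole block; this puts
  linear combinations into that form.\<close>

lemma gspan_factor:
  assumes "f \<in> gspan"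
  shows "\<exists>g\<in>borel_measurable (Pi\<^sub>M gprims prim_space). \<forall>\<omega>\<in>space M. f \<omega> = g (\<lambda>q\<in>gprims. \<xi> q \<omega>)"
proof -
  from gspanD[OF assms] obtain I c where I: "finite I" "I \<subseteq> gprims"
    and c: "\<forall>q. c q \<in> carrier_vec (prim_dim S q)" and f: "\<forall>\<omega>\<in>space M. f \<omega> = (\<Sum>q\<in>I. c q \<bullet> \<xi> q \<omega>)"
    by (elim exE conjE)
  show ?thesis
  proof (rule bexI[of _ "\<lambda>\<rho>. \<Sum>q\<in>I. c q \<bullet> \<rho> q"])
    show "\<forall>\<omega>\<in>space M. f \<omega> = (\<Sum>q\<in>I. c q \<bullet> (\<lambda>q\<in>gprims. \<xi> q \<omega>) q)"
    proof
      fix \<omega> assume "\<omega> \<in> space M"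
      moreover have "(\<Sum>q\<in>I. c q \<bullet> \<xi> q \<omega>) = (\<Sum>q\<in>I. c q \<bullet> (\<lambda>q\<in>gprims. \<xi> q \<omega>) q)"
        using I(2) by (intro sum.cong refl) auto
      ultimately show "f \<omega> = (\<Sum>q\<in>I. c q \<bullet> (\<lambda>q\<in>gprims. \<xi> q \<omega>) q)" using f by simp
    qed
    show "(\<lambda>\<rho>. \<Sum>q\<in>I. c q \<bullet> \<rho> q) \<in> borel_measurable (Pi\<^sub>M gprims prim_space)"
    proof (rule borel_measurable_sum)
      fix q assume "q \<in> I"
      then have "(\<lambda>\<rho>. \<rho> q) \<in> measurable (Pi\<^sub>M gprims prim_space) (prim_space q)"
        using I by (intro measurable_component_singleton) auto
      then show "(\<lambda>\<rho>. c q \<bullet> \<rho> q) \<in> borel_measurable (Pi\<^sub>M gprims prim_space)"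
        by (rule measurable_scalar_prod[OF measurable_vec_const[OF c[rule_format]]])
    qed
  qed
qed

text \<open>\<open>oprims\<close> and \<open>gprims\<close> are disjoint blocks of one independent
  family, and the event in the \<open>X j\<close> is a function of the second block.\<close>

lemma N_alg_indep:
  assumes E: "E \<in> sets N_alg" and J: "finite J" and X: "\<And>j. j \<in> J \<Longrightarrow> X j \<in> gspan"
    and D: "\<And>j. j \<in> J \<Longrightarrow> D j \<in> sets borel"
  shows "prob (E \<inter> {\<omega> \<in> space M. \<forall>j\<in>J. X j \<omega> \<in> D j}) = prob E * prob {\<omega> \<in> space M. \<forall>j\<in>J. X j \<omega> \<in> D j}"
proof -
  have "\<forall>j\<in>J. \<exists>g. g \<in> borel_measurable (Pi\<^sub>M gprims prim_space) \<and> (\<forall>\<omega>\<in>space M. X j \<omega> = g (\<lambda>q\<in>gprims. \<xi> q \<omega>))"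
    using gspan_factor[OF X] by blast
  then obtain g where g: "\<And>j. j \<in> J \<Longrightarrow> g j \<in> borel_measurable (Pi\<^sub>M gprims prim_space)"
    "\<And>j \<omega>. j \<in> J \<Longrightarrow> \<omega> \<in> space M \<Longrightarrow> X j \<omega> = g j (\<lambda>q\<in>gprims. \<xi> q \<omega>)"
    by (metis bchoice)
  obtain D1 where D1: "D1 \<in> sets (Pi\<^sub>M oprims prim_space)" and E1: "E = (\<lambda>\<omega>. \<lambda>q\<in>oprims. \<xi> q \<omega>) -` D1 \<inter> space M"
    using E unfolding sets_N_alg by blast
  define D2 where "D2 = {\<rho> \<in> space (Pi\<^sub>M gprims prim_space). \<forall>j\<in>J. g j \<rho> \<in> D j}"
  have D2: "D2 \<in> sets (Pi\<^sub>M gprims prim_space)"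
    unfolding D2_def
  proof (intro sets.sets_Collect_finite_All J)
    fix j assume "j \<in> J"
    from measurable_sets[OF g(1)[OF this] D[OF this]]
    show "{\<rho> \<in> space (Pi\<^sub>M gprims prim_space). g j \<rho> \<in> D j} \<in> sets (Pi\<^sub>M gprims prim_space)"
      by (simp add: vimage_def Int_def conj_commute)
  qed
  have mg: "(\<lambda>\<omega>. \<lambda>q\<in>gprims. \<xi> q \<omega>) \<in> measurable M (Pi\<^sub>M gprims prim_space)"
    by (intro measurable_restrict gprim_measurable)
  have E2: "{\<omega> \<in> space M. \<forall>j\<in>J. X j \<omega> \<in> D j} = (\<lambda>\<omega>. \<lambda>q\<in>gprims. \<xi> q \<omega>) -` D2 \<inter> space M"
    using measurable_space[OF mg] g(2) unfolding D2_def by auto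
  have "indep_var (Pi\<^sub>M oprims prim_space) (\<lambda>\<omega>. \<lambda>q\<in>oprims. \<xi> q \<omega>) (Pi\<^sub>M gprims prim_space) (\<lambda>\<omega>. \<lambda>q\<in>gprims. \<xi> q \<omega>)"
    by (rule indep_var_restrict[OF indep_prims]) (use gprims_subset in \<open>auto simp: oprims_def\<close>)
  from indep_varD[OF this D1 D2]
  have "prob ((\<lambda>\<omega>. (\<lambda>q\<in>oprims. \<xi> q \<omega>, \<lambda>q\<in>gprims. \<xi> q \<omega>)) -` (D1 \<times> D2) \<inter> space M) = prob E * prob {\<omega> \<in> space M. \<forall>j\<in>J. X j \<omega> \<in> D j}"
    unfolding E1 E2 .
  also have "(\<lambda>\<omega>. (\<lambda>q\<in>oprims. \<xi> q \<omega>, \<lambda>q\<in>gprims. \<xi> q \<omega>)) -` (D1 \<times> D2) \<inter> space M = E \<inter> {\<omega> \<in> space M. \<forall>j\<in>J. X j \<omega> \<in> D j}"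
    unfolding E1 E2 by blast
  finally show ?thesis .
qed

text \<open>On the generator the probability factors twice: \<open>N_alg\<close> splits off because
  it concerns other primitives, and the innovations split from \<open>Z\<close> because uncorrelated
  jointly Gaussian families are independent. Intersection-stability extends this to
  \<open>G_alg k\<close>.\<close>

lemma indep_of_G_alg:
  assumes Z: "gvec l Z" and unc: "\<And>l'. l' < k \<Longrightarrow> cov l dy Z (innov l') = 0\<^sub>m l dy"
  shows "indep_of_alg M (G_alg k) l Z"
proof -
  let ?R = "{{x \<in> carrier_vec l. \<forall>a<l. x $ a \<in> H a} | H. \<forall>a. H a \<in> sets (borel :: real measure)}"
  let ?EZ = "{Z -` R \<inter> space M | R. R \<in> ?R}"
  note ZM = gvec_measurable[OF Z]
  have R: "?R \<subseteq> sets (vec_borel l)"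
    unfolding sets_vec_borel by blast
  have pair: "prob (a \<inter> b) = prob a * prob b" if a: "a \<in> G_gen k" and b: "b \<in> ?EZ" for a b
  proof -
    from a obtain E D where aE: "a = E \<inter> innov_event k D" "E \<in> sets N_alg" "\<forall>l a. D l a \<in> sets borel"
      unfolding G_gen_def by blast
    from b obtain H where H: "\<forall>a. H a \<in> sets (borel :: real measure)" and bH: "b = Z -` {x \<in> carrier_vec l. \<forall>a<l. x $ a \<in> H a} \<inter> space M"
      by blast
    \<comment> \<open>\<open>Inl\<close> indexes the innovation components and \<open>Inr\<close>
      those of \<open>Z\<close>, so that both form one Gaussian family.\<close>
    define I1 where "I1 = (Inl ` ({..<k} \<times> {..<dy}) :: (nat \<times> nat + nat) set)"
    define I2 where "I2 = (Inr ` {..<l} :: (nat \<times> nat + nat) set)"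
    define X where "X j = (case j of Inl (l', a) \<Rightarrow> (\<lambda>\<omega>. innov l' \<omega> $ a) | Inr a \<Rightarrow> (\<lambda>\<omega>. Z \<omega> $ a))" for j :: "nat \<times> nat + nat"
    define V where "V j = (case j of Inl (l', a) \<Rightarrow> D l' a | Inr a \<Rightarrow> H a)" for j :: "nat \<times> nat + nat"
    have fin: "finite I1" "finite I2" "I1 \<inter> I2 = {}" by (auto simp: I1_def I2_def)
    have X1: "X j \<in> gspan" if "j \<in> I1 \<union> I2" for j
      using that gvec_index[OF gvec_innov] gvec_index[OF Z] by (auto simp: I1_def I2_def X_def)
    have V1: "V j \<in> sets borel" for j
      using aE(3) H by (auto simp: V_def split: sum.split)
    have e1: "innov_event k D = {\<omega> \<in> space M. \<forall>j\<in>I1. X j \<omega> \<in> V j}"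
      by (auto simp: innov_event_def I1_def X_def V_def)
    have e2: "b = {\<omega> \<in> space M. \<forall>j\<in>I2. X j \<omega> \<in> V j}"
      using gvec_carrier[OF Z] by (auto simp: bH I2_def X_def V_def)
    have e12: "innov_event k D \<inter> b = {\<omega> \<in> space M. \<forall>j\<in>I1 \<union> I2. X j \<omega> \<in> V j}"
      unfolding e1 e2 by blast
    have unc0: "expectation (\<lambda>\<omega>. X j \<omega> * X j' \<omega>) = 0" if jj: "j \<in> I1" "j' \<in> I2" for j j'
    proof -
      obtain l' a a' where j: "j = Inl (l', a)" "l' < k" "a < dy" and j': "j' = Inr a'" "a' < l"
        using jj by (auto simp: I1_def I2_def)
      have "cov l dy Z (innov l') $$ (a', a) = 0"
        using unc[OF j(2)] j(3) j'(2) by simp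
      then show ?thesis using j j' by (simp add: X_def mult.commute)
    qed
    have gi: "prob {\<omega> \<in> space M. \<forall>j\<in>I1 \<union> I2. X j \<omega> \<in> V j}
        = prob {\<omega> \<in> space M. \<forall>j\<in>I1. X j \<omega> \<in> V j} * prob {\<omega> \<in> space M. \<forall>j\<in>I2. X j \<omega> \<in> V j}"
      by (rule gauss_uncorrelated_indep[OF fin]) (rule X1 unc0 V1; assumption)+
    have N: "prob (E \<inter> {\<omega> \<in> space M. \<forall>j\<in>I1 \<union> I2. X j \<omega> \<in> V j}) = prob E * prob {\<omega> \<in> space M. \<forall>j\<in>I1 \<union> I2. X j \<omega> \<in> V j}"
      by (rule N_alg_indep[OF aE(2) finite_UnI[OF fin(1,2)] X1 V1])
    have "prob (a \<inter> b) = prob (E \<inter> {\<omega> \<in> space M. \<forall>j\<in>I1 \<union> I2. X j \<omega> \<in> V j})"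
      unfolding aE(1) e12[symmetric] by (simp only: Int_assoc)
    also have "\<dots> = prob E * (prob (innov_event k D) * prob b)"
      unfolding e1 e2 N gi ..
    also have "prob E * (prob (innov_event k D) * prob b) = prob a * prob b"
      unfolding aE(1) e1 using N_alg_indep[OF aE(2) fin(1), of X V] X1 V1 by simp
    finally show ?thesis .
  qed
  have EZ_events: "?EZ \<subseteq> events"
    using measurable_sets[OF ZM] R by blast
  have "Int_stable ?EZ"
  proof (rule Int_stableI)
    fix a b assume ab: "a \<in> ?EZ" "b \<in> ?EZ"
    then obtain r s where r: "r \<in> ?R" "a = Z -` r \<inter> space M" and s: "s \<in> ?R" "b = Z -` s \<inter> space M" by blast
    have "r \<inter> s \<in> ?R" using Int_stableD[OF Int_stable_vec_rectangles r(1) s(1)] .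
    moreover have "a \<inter> b = Z -` (r \<inter> s) \<inter> space M" using r s by blast
    ultimately show "a \<inter> b \<in> ?EZ" by blast
  qed
  then have indep: "indep_set (sigma_sets (space M) (G_gen k)) (sigma_sets (space M) ?EZ)"
    using pair by (intro indep_set_sigma_sets indep_setI G_gen_events EZ_events Int_stable_G_gen)
  have vimage: "Z -` H \<inter> space M \<in> sigma_sets (space M) ?EZ" if "H \<in> sets (vec_borel l)" for H
  proof -
    have "Z \<in> space M \<rightarrow> carrier_vec l" using gvec_carrier[OF Z] by blast
    from sigma_sets_vimage_commute[OF this, of ?R] that
    show ?thesis unfolding sets_vec_borel by blast
  qed
  show ?thesis
    unfolding indep_of_alg_def
  proof (intro conjI ballI ZM)
    fix X H assume X: "X \<in> sets (G_alg k)" and H: "H \<in> sets (vec_borel l)"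
    have eq: "{\<omega> \<in> space M. Z \<omega> \<in> H} = Z -` H \<inter> space M" by blast
    show "prob (X \<inter> {\<omega> \<in> space M. Z \<omega> \<in> H}) = prob X * prob {\<omega> \<in> space M. Z \<omega> \<in> H}"
      unfolding eq by (rule indep_setD[OF indep X[unfolded sets_G_alg] vimage[OF H]])
  qed
qed

text \<open>On a rectangle the claim is \<open>gauss_symmetric\<close> for the coordinates, and
  rectangles generate.\<close>

lemma gvec_symmetric:
  assumes Z: "gvec l Z"
  shows "symmetric_law M l Z"
proof -
  let ?R = "{{x \<in> carrier_vec l. \<forall>a<l. x $ a \<in> H a} | H. \<forall>a. H a \<in> sets (borel :: real measure)}"
  note ZM = gvec_measurable[OF Z]
  have mZM: "(\<lambda>\<omega>. - Z \<omega>) \<in> measurable M (vec_borel l)" by (rule measurable_vec_uminus[OF ZM])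
  have "distr M (vec_borel l) Z = distr M (vec_borel l) (\<lambda>\<omega>. - Z \<omega>)"
  proof (rule measure_eqI_generator_eq[OF Int_stable_vec_rectangles[of l], where \<Omega>="carrier_vec l" and A="\<lambda>_. carrier_vec l"])
    fix X assume X: "X \<in> ?R"
    then obtain H where H: "\<forall>a. H a \<in> sets (borel :: real measure)" and XH: "X = {x \<in> carrier_vec l. \<forall>a<l. x $ a \<in> H a}"
      by blast
    have Xs: "X \<in> sets (vec_borel l)" using X unfolding sets_vec_borel by (rule sigma_sets.Basic)
    have "\<omega> \<in> Z -` X \<inter> space M \<longleftrightarrow> \<omega> \<in> {\<omega> \<in> space M. \<forall>a\<in>{..<l}. Z \<omega> $ a \<in> H a}" for \<omega>
      using gvec_carrier[OF Z, of \<omega>] unfolding XH by (cases "\<omega> \<in> space M") (simp_all add: Ball_def)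
    then have 1: "Z -` X \<inter> space M = {\<omega> \<in> space M. \<forall>a\<in>{..<l}. Z \<omega> $ a \<in> H a}"
      by (rule Set.set_eqI)
    have "\<omega> \<in> (\<lambda>\<omega>. - Z \<omega>) -` X \<inter> space M \<longleftrightarrow> \<omega> \<in> {\<omega> \<in> space M. \<forall>a\<in>{..<l}. - (Z \<omega> $ a) \<in> H a}" for \<omega>
    proof (cases "\<omega> \<in> space M")
      case True
      note c = gvec_carrier[OF Z True]
      have "(- Z \<omega>) $ a = - (Z \<omega> $ a)" if "a < l" for a using that carrier_vecD[OF c] by simp
      then show ?thesis using True c unfolding XH by (simp add: Ball_def)
    qed simp
    then have 2: "(\<lambda>\<omega>. - Z \<omega>) -` X \<inter> space M = {\<omega> \<in> space M. \<forall>a\<in>{..<l}. - (Z \<omega> $ a) \<in> H a}"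
      by (rule Set.set_eqI)
    show "emeasure (distr M (vec_borel l) Z) X = emeasure (distr M (vec_borel l) (\<lambda>\<omega>. - Z \<omega>)) X"
      unfolding emeasure_distr[OF ZM Xs] emeasure_distr[OF mZM Xs] 1 2 emeasure_eq_measure
      using gauss_symmetric[of "{..<l}" "\<lambda>a \<omega>. Z \<omega> $ a" H] gvec_index[OF Z] H by simp
  next
    have "carrier_vec l = {x \<in> carrier_vec l. \<forall>a<l. x $ a \<in> (\<lambda>_. UNIV) a}" by simp
    then show "range (\<lambda>_. carrier_vec l) \<subseteq> ?R" by (intro image_subsetI CollectI exI[of _ "\<lambda>_. UNIV"]) simp
    show "emeasure (distr M (vec_borel l) Z) (carrier_vec l) \<noteq> \<infinity>"
      using finite_measure.emeasure_finite[OF finite_measure_distr[OF ZM]] by simp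
  qed (use sets_vec_borel in auto)
  then have "measure (distr M (vec_borel l) Z) H = measure (distr M (vec_borel l) (\<lambda>\<omega>. - Z \<omega>)) H" for H by simp
  then have "prob (Z -` H \<inter> space M) = prob ((\<lambda>\<omega>. - Z \<omega>) -` H \<inter> space M)" if "H \<in> sets (vec_borel l)" for H
    using measure_distr[OF ZM that] measure_distr[OF mZM that] by metis
  then have "prob {\<omega> \<in> space M. Z \<omega> \<in> H} = prob {\<omega> \<in> space M. - Z \<omega> \<in> H}" if "H \<in> sets (vec_borel l)" for H
    using that by (simp only: vimage_def Int_def mem_Collect_eq conj_commute)
  then show ?thesis
    unfolding symmetric_law_def using ZM by blast
qed

lemma innov_indep: "indep_of_alg M (G_alg k) dy (innov k)"
  by (rule indep_of_G_alg[OF gvec_innov innov_innov])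

text \<open>\<open>G_alg (Suc k)\<close> contains the innovations up to time \<open>k\<close>, all
  of which are orthogonal to \<open>theta k\<close>.\<close>

lemma theta_sym_given: "sym_given M (G_alg (Suc k)) n (theta k)"
  using sub_alg.sym_given_indep[OF sub_alg_G_alg indep_of_G_alg[OF gvec_theta theta_innov] gvec_symmetric[OF gvec_theta]]
  by simp

end

section \<open>Trajectories of the network\<close>

text \<open>\<open>real_cond_exp\<close> is a chosen version. It depends on its argument only
  through measurability and density measures, so functions that agree on \<open>space M\<close>
  receive the very same version, and decisions based on it agree at every outcome.\<close>

lemma real_cond_exp_cong_space:
  assumes "\<And>\<omega>. \<omega> \<in> space M \<Longrightarrow> f \<omega> = g \<omega>"
  shows "real_cond_exp M F f = real_cond_exp M F g"
proof -
  have "nn_cond_exp M F f = nn_cond_exp M F g" if eq: "\<And>\<omega>. \<omega> \<in> space M \<Longrightarrow> f \<omega> = g \<omega>" for f g :: "'a \<Rightarrow> ennreal"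
  proof -
    have "f \<in> borel_measurable M \<longleftrightarrow> g \<in> borel_measurable M"
      by (rule measurable_cong) (rule eq)
    moreover have "density M f = density M g"
      unfolding density_def by (rule measure_of_eq) (auto intro!: nn_integral_cong sets.space_closed simp: eq sets.sigma_sets_eq)
    ultimately show ?thesis by (simp add: nn_cond_exp_def)
  qed
  from this[of "\<lambda>x. ennreal (f x)" "\<lambda>x. ennreal (g x)"] this[of "\<lambda>x. ennreal (- f x)" "\<lambda>x. ennreal (- g x)"] assms
  show ?thesis by (simp add: real_cond_exp_def)
qed

text \<open>Both the generating data and the gap are the same functions on \<open>space M\<close>,
  so even the versions of the conditional moments coincide.\<close>

lemma Psi_cong:
  assumes gap: "\<And>\<omega>. \<omega> \<in> space M \<Longrightarrow> est_gap z i k \<omega> = est_gap z' i k \<omega>"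
    and att: "\<And>l \<omega>. l < k \<Longrightarrow> \<omega> \<in> space M \<Longrightarrow> attempt z i l \<omega> = attempt z' i l \<omega> \<and> avail m z i l \<omega> = avail m z' i l \<omega>"
  shows "Psi M m S z i k = Psi M m S z' i k"
proof -
  have T: "T_alg M m z i k = T_alg M m z' i k"
    unfolding T_alg_def
  proof (rule vimage_algebra_cong)
    fix \<omega> assume "\<omega> \<in> space M"
    then show "(\<lambda>l\<in>{..<k}. (attempt z i l \<omega>, if attempt z i l \<omega> then Some (avail m z i l \<omega>) else None))
        = (\<lambda>l\<in>{..<k}. (attempt z' i l \<omega>, if attempt z' i l \<omega> then Some (avail m z' i l \<omega>) else None))"
      using att by (intro restrict_ext) auto
  qed simp_all
  have "real_cond_exp M (T_alg M m z' i k) (\<lambda>\<omega>. est_gap z i k \<omega> $ a * est_gap z i k \<omega> $ b)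
      = real_cond_exp M (T_alg M m z' i k) (\<lambda>\<omega>. est_gap z' i k \<omega> $ a * est_gap z' i k \<omega> $ b)" for a b
    by (rule real_cond_exp_cong_space) (simp add: gap)
  then show ?thesis
    by (simp add: Psi_def T cond_second_moment_def fun_eq_iff)
qed

text \<open>The maximum and its default -1 are awkward in inductions over time; this form mentions
  successes only.\<close>

lemma last_success_less_iff:
  assumes "l < k"
  shows "last_success m z i k \<omega> < int l \<longleftrightarrow> (\<forall>l'. l \<le> l' \<and> l' < k \<longrightarrow> \<not> success m z i l' \<omega>)"
proof (cases "\<exists>l<k. success m z i l \<omega>")
  case True
  let ?S = "{l. l < k \<and> success m z i l \<omega>}"
  have fin: "finite ?S" "?S \<noteq> {}" using True by auto
  have "last_success m z i k \<omega> = int (Max ?S)" using True by (simp add: last_success_def)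
  then have "last_success m z i k \<omega> < int l \<longleftrightarrow> (\<forall>x\<in>?S. x < l)"
    using Max_less_iff[OF fin] by simp
  also have "\<dots> \<longleftrightarrow> (\<forall>l'. l \<le> l' \<and> l' < k \<longrightarrow> \<not> success m z i l' \<omega>)"
    by (metis (no_types, lifting) mem_Collect_eq not_le)
  finally show ?thesis .
next
  case False
  then have "last_success m z i k \<omega> = -1" unfolding last_success_def by (rule if_not_P)
  with False show ?thesis by auto
qed

text \<open>Trajectories carry no dimensions, so well-dimensioned controls are assumed separately;
  the control policies will provide them.\<close>

locale network_loop = lqg_loop M m i S \<xi> for M :: "'w measure" and m i S \<xi> +
  fixes sched :: "nat \<Rightarrow> scheduler" and z :: "'w trajectory"
  assumes dyn: "network_dynamics M m S \<xi> sched z"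
    and control_carrier_all: "\<And>j k \<omega>. j \<in> {1..m} \<Longrightarrow> \<omega> \<in> space M \<Longrightarrow> control z j k \<omega> \<in> carrier_vec (dim_u (S j))"
begin

lemma other_loop: "j \<in> {1..m} \<Longrightarrow> network_loop M m j S \<xi> sched z"
  using subsystems prims dyn control_carrier_all by unfold_locales auto

lemma follows: "follows_scheduler M m S \<xi> z i (sched i)"
  using dyn loop unfolding network_dynamics_def by blast

abbreviation "x k \<omega> \<equiv> state z i k \<omega>"
abbreviation "u k \<omega> \<equiv> control z i k \<omega>"
abbreviation "gap k \<omega> \<equiv> est_gap z i k \<omega>"
abbreviation "succ k \<omega> \<equiv> success m z i k \<omega>"

lemma dynamics:
  assumes "\<omega> \<in> space M"
  shows "x 0 \<omega> = \<xi> (Init i) \<omega>" "kf_pred z i 0 \<omega> = 0\<^sub>v n" "bar_pred z i 0 \<omega> = 0\<^sub>v n"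
    "x (Suc k) \<omega> = A *\<^sub>v x k \<omega> + B *\<^sub>v u k \<omega> + \<xi> (Proc_Noise i k) \<omega>"
    "outp z i k \<omega> = C *\<^sub>v x k \<omega> + \<xi> (Meas_Noise i k) \<omega>"
    "kf_est z i k \<omega> = kf_pred z i k \<omega> + L *\<^sub>v (outp z i k \<omega> - C *\<^sub>v kf_pred z i k \<omega>)"
    "kf_pred z i (Suc k) \<omega> = A *\<^sub>v kf_est z i k \<omega> + B *\<^sub>v u k \<omega>"
    "bar_est z i k \<omega> = (if succ k \<omega> then kf_est z i k \<omega> else bar_pred z i k \<omega>)"
    "bar_pred z i (Suc k) \<omega> = A *\<^sub>v bar_est z i k \<omega> + B *\<^sub>v u k \<omega>"
  using bspec[OF bspec[OF conjunct1[OF dyn[unfolded network_dynamics_def]] loop] assms] by blast+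

lemma noise_carrier:
  assumes "\<omega> \<in> space M"
  shows "\<xi> (Init i) \<omega> \<in> carrier_vec n" "\<xi> (Proc_Noise i k) \<omega> \<in> carrier_vec n" "\<xi> (Meas_Noise i k) \<omega> \<in> carrier_vec dy"
    "u k \<omega> \<in> carrier_vec d" "eta k \<omega> \<in> carrier_vec n" "innov k \<omega> \<in> carrier_vec dy" "theta k \<omega> \<in> carrier_vec n"
  using assms control_carrier_all[OF loop assms]
  by (auto intro: gvec_carrier gvec_noise gvec_eta gvec_innov gvec_theta)

text \<open>The control enters state and prediction through the same term and cancels in their
  difference, which is therefore a function of the primitives alone.\<close>

lemma state_error:
  assumes \<omega>: "\<omega> \<in> space M"
  shows "kf_pred z i k \<omega> \<in> carrier_vec n \<and> x k \<omega> = kf_pred z i k \<omega> + eta k \<omega>"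
    and "kf_est z i k \<omega> = kf_pred z i k \<omega> + L *\<^sub>v innov k \<omega>" and "x k \<omega> = kf_est z i k \<omega> + theta k \<omega>"
proof -
  note [simp del] = index_mult_mat_vec dim_mult_mat_vec
  note noise = noise_carrier[OF \<omega>]
  have est: "kf_est z i k \<omega> = kf_pred z i k \<omega> + L *\<^sub>v innov k \<omega> \<and> x k \<omega> = kf_est z i k \<omega> + theta k \<omega>"
    if h: "kf_pred z i k \<omega> \<in> carrier_vec n" "x k \<omega> = kf_pred z i k \<omega> + eta k \<omega>" for k
  proof -
    have c: "C *\<^sub>v kf_pred z i k \<omega> \<in> carrier_vec dy" "C *\<^sub>v eta k \<omega> \<in> carrier_vec dy"
      using h noise(5) by blast+
    have "outp z i k \<omega> - C *\<^sub>v kf_pred z i k \<omega> = innov k \<omega>"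
      unfolding dynamics(5)[OF \<omega>] h(2) innov_def mult_add_distrib_mat_vec[OF dims(3) h(1) noise(5)]
      using c noise(3)[of k] by (intro eq_vecI) auto
    then have 1: "kf_est z i k \<omega> = kf_pred z i k \<omega> + L *\<^sub>v innov k \<omega>"
      using dynamics(6)[OF \<omega>] by simp
    have "L *\<^sub>v innov k \<omega> \<in> carrier_vec n" using noise(6) by blast
    then have "x k \<omega> = kf_est z i k \<omega> + theta k \<omega>"
      unfolding 1 h(2) theta_def using h(1) noise(5)[of k] by (intro eq_vecI) auto
    with 1 show ?thesis ..
  qed
  have pred: "kf_pred z i k \<omega> \<in> carrier_vec n \<and> x k \<omega> = kf_pred z i k \<omega> + eta k \<omega>" for k
  proof (induction k)
    case 0
    show ?case using dynamics(1,2)[OF \<omega>] noise(1) by simp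
  next
    case (Suc k)
    have "L *\<^sub>v innov k \<omega> \<in> carrier_vec n" using noise(6) by blast
    then have e: "kf_est z i k \<omega> \<in> carrier_vec n" using est Suc.IH by simp
    have c: "A *\<^sub>v kf_est z i k \<omega> \<in> carrier_vec n" "A *\<^sub>v theta k \<omega> \<in> carrier_vec n" "B *\<^sub>v u k \<omega> \<in> carrier_vec n"
      using e noise(4,7) by blast+
    have xe: "x k \<omega> = kf_est z i k \<omega> + theta k \<omega>" using est Suc.IH by blast
    have "x (Suc k) \<omega> = kf_pred z i (Suc k) \<omega> + eta (Suc k) \<omega>"
      unfolding dynamics(4)[OF \<omega>] dynamics(7)[OF \<omega>] xe mult_add_distrib_mat_vec[OF dims(1) e noise(7)] fun_cong[OF eta_Suc]
      using c noise(2)[of k] by (intro eq_vecI) auto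
    then show ?case
      using c by (simp add: dynamics(7)[OF \<omega>])
  qed
  show "kf_pred z i k \<omega> \<in> carrier_vec n \<and> x k \<omega> = kf_pred z i k \<omega> + eta k \<omega>" by (rule pred)
  show "kf_est z i k \<omega> = kf_pred z i k \<omega> + L *\<^sub>v innov k \<omega>" "x k \<omega> = kf_est z i k \<omega> + theta k \<omega>"
    using est pred by blast+
qed

lemma kf_carrier:
  assumes "\<omega> \<in> space M"
  shows "kf_pred z i k \<omega> \<in> carrier_vec n" "kf_est z i k \<omega> \<in> carrier_vec n" "x k \<omega> \<in> carrier_vec n"
proof -
  show 1: "kf_pred z i k \<omega> \<in> carrier_vec n" using state_error(1)[OF assms] by blast
  have "L *\<^sub>v innov k \<omega> \<in> carrier_vec n" using noise_carrier[OF assms] by blast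
  with 1 show 2: "kf_est z i k \<omega> \<in> carrier_vec n" unfolding state_error(2)[OF assms] by (rule add_carrier_vec)
  from add_carrier_vec[OF 2 noise_carrier(7)[OF assms]] show "x k \<omega> \<in> carrier_vec n"
    unfolding state_error(3)[OF assms] .
qed

lemma bar_carrier:
  assumes \<omega>: "\<omega> \<in> space M"
  shows "bar_pred z i k \<omega> \<in> carrier_vec n" and "bar_est z i k \<omega> \<in> carrier_vec n" and "gap k \<omega> \<in> carrier_vec n"
proof -
  have p: "bar_pred z i k \<omega> \<in> carrier_vec n" for k
  proof (induction k)
    case 0
    show ?case using dynamics(3)[OF \<omega>] by simp
  next
    case (Suc k)
    then have "bar_est z i k \<omega> \<in> carrier_vec n" using dynamics(8)[OF \<omega>] kf_carrier[OF \<omega>] by simp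
    then show ?case unfolding dynamics(9)[OF \<omega>] using noise_carrier(4)[OF \<omega>] by (blast intro: add_carrier_vec)
  qed
  then show "bar_pred z i k \<omega> \<in> carrier_vec n" "bar_est z i k \<omega> \<in> carrier_vec n" "gap k \<omega> \<in> carrier_vec n"
    using dynamics(8)[OF \<omega>] kf_carrier[OF \<omega>] by (auto simp: est_gap_def)
qed

text \<open>What the controller still lacks after the transmission: \<open>rest k\<close> equals
  \<open>kf_est - bar_est\<close> at time \<open>k\<close>. Together with \<open>sent k\<close> it
  splits the gap.\<close>

definition rest :: "nat \<Rightarrow> 'w \<Rightarrow> real vec" where
  "rest k \<omega> = (if succ k \<omega> then 0\<^sub>v n else gap k \<omega>)"

definition sent :: "nat \<Rightarrow> 'w \<Rightarrow> real vec" where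
  "sent k \<omega> = (if succ k \<omega> then gap k \<omega> else 0\<^sub>v n)"

lemma rest_sent_carrier: "\<omega> \<in> space M \<Longrightarrow> rest k \<omega> \<in> carrier_vec n" "\<omega> \<in> space M \<Longrightarrow> sent k \<omega> \<in> carrier_vec n"
  using bar_carrier(3) by (simp_all add: rest_def sent_def)

lemma gap_0: "\<omega> \<in> space M \<Longrightarrow> gap 0 \<omega> = L *\<^sub>v innov 0 \<omega>"
proof -
  assume \<omega>: "\<omega> \<in> space M"
  have "L *\<^sub>v innov 0 \<omega> \<in> carrier_vec n" using noise_carrier[OF \<omega>] by blast
  then show ?thesis
    unfolding est_gap_def state_error(2)[OF \<omega>] dynamics(2,3)[OF \<omega>]
    by (intro eq_vecI) (auto simp del: index_mult_mat_vec dim_mult_mat_vec)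
qed

lemma gap_Suc:
  assumes \<omega>: "\<omega> \<in> space M"
  shows "gap (Suc k) \<omega> = A *\<^sub>v rest k \<omega> + L *\<^sub>v innov (Suc k) \<omega>"
proof -
  note [simp del] = index_mult_mat_vec dim_mult_mat_vec
  note cs = kf_carrier[OF \<omega>] bar_carrier[OF \<omega>]
  have r: "rest k \<omega> = kf_est z i k \<omega> - bar_est z i k \<omega>"
    using cs(2)[of k] unfolding rest_def dynamics(8)[OF \<omega>] est_gap_def by (auto intro!: eq_vecI)
  have "A *\<^sub>v kf_est z i k \<omega> \<in> carrier_vec n" "A *\<^sub>v bar_est z i k \<omega> \<in> carrier_vec n" "B *\<^sub>v u k \<omega> \<in> carrier_vec n"
    "L *\<^sub>v innov (Suc k) \<omega> \<in> carrier_vec n"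
    using cs noise_carrier[OF \<omega>] by blast+
  then show ?thesis
    unfolding r mult_minus_distrib_mat_vec[OF dims(1) cs(2) cs(5)] est_gap_def state_error(2)[OF \<omega>, of "Suc k"] dynamics(7,9)[OF \<omega>]
    by (intro eq_vecI) auto
qed

lemma bar_est_eq:
  assumes \<omega>: "\<omega> \<in> space M"
  shows "bar_est z i k \<omega> = bar_pred z i k \<omega> + sent k \<omega>" and "x k \<omega> = bar_est z i k \<omega> + (theta k \<omega> + rest k \<omega>)"
proof -
  note cs = kf_carrier[OF \<omega>, of k] bar_carrier[OF \<omega>, of k] noise_carrier(7)[OF \<omega>, of k]
  show "bar_est z i k \<omega> = bar_pred z i k \<omega> + sent k \<omega>"
    using cs unfolding dynamics(8)[OF \<omega>] sent_def est_gap_def by (auto intro!: eq_vecI)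
  show "x k \<omega> = bar_est z i k \<omega> + (theta k \<omega> + rest k \<omega>)"
    using cs unfolding state_error(3)[OF \<omega>] dynamics(8)[OF \<omega>] rest_def est_gap_def by (auto intro!: eq_vecI)
qed

text \<open>
  The definition of the phase refers to hypothetical threshold decisions. During the phase these are the
  actual attempts, so the phase can be read off the past attempts and successes.
\<close>

lemma stett_phase_iff:
  assumes cett: "sched i = CETT p \<beta> r" and \<omega>: "\<omega> \<in> space M"
  shows "stett_phase M m S \<xi> z r i k \<omega> \<longleftrightarrow> (\<forall>l<k. attempt z i l \<omega> \<longrightarrow> (\<exists>l'. l \<le> l' \<and> l' < k \<and> succ l' \<omega>))"
proof -
  let ?st = "\<lambda>l. stett_attempt M m S \<xi> z r i l \<omega>" and ?ph = "\<lambda>l. stett_phase M m S \<xi> z r i l \<omega>"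
  let ?no = "\<lambda>l k. \<forall>l'. l \<le> l' \<and> l' < k \<longrightarrow> \<not> succ l' \<omega>"
  have att: "attempt z i l \<omega> = ?st l" if "?ph l" for l
    using follows \<omega> that unfolding cett by simp
  \<comment> \<open>If \<open>k\<close> directly follows the last success, no \<open>l\<close> lies
    strictly between them, so the first disjunct of the definition is absorbed.\<close>
  have ph: "?ph k \<longleftrightarrow> (\<forall>l<k. ?no l k \<longrightarrow> \<not> ?st l)" for k
  proof -
    have "?ph k \<longleftrightarrow> (\<forall>l<k. last_success m z i k \<omega> < int l \<longrightarrow> \<not> ?st l)"
      unfolding stett_phase_def by auto
    also have "\<dots> \<longleftrightarrow> (\<forall>l<k. ?no l k \<longrightarrow> \<not> ?st l)"
      by (simp only: last_success_less_iff cong: all_cong imp_cong)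
    finally show ?thesis .
  qed
  show ?thesis
  proof
    assume k: "?ph k"
    show "\<forall>l<k. attempt z i l \<omega> \<longrightarrow> (\<exists>l'. l \<le> l' \<and> l' < k \<and> succ l' \<omega>)"
    proof (intro allI impI, rule ccontr)
      fix l assume l: "l < k" "attempt z i l \<omega>" and no: "\<nexists>l'. l \<le> l' \<and> l' < k \<and> succ l' \<omega>"
      \<comment> \<open>With no success from \<open>l\<close> to \<open>k\<close>, every
        success-free stretch ending at \<open>l\<close> extends to \<open>k\<close>. So
        \<open>l\<close> belongs to the phase and its attempt is the threshold decision.\<close>
      have "?ph l"
        unfolding ph
      proof (intro allI impI)
        fix l0 assume "l0 < l" "?no l0 l"
        then have "?no l0 k" using no by (metis not_le)
        then show "\<not> ?st l0" using k l \<open>l0 < l\<close> unfolding ph by (meson less_trans)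
      qed
      then have "?st l" using att l by simp
      moreover have "?no l k" using no by blast
      ultimately show False using k l unfolding ph by blast
    qed
  next
    assume all: "\<forall>l<k. attempt z i l \<omega> \<longrightarrow> (\<exists>l'. l \<le> l' \<and> l' < k \<and> succ l' \<omega>)"
    \<comment> \<open>Strong induction: earlier negative decisions put \<open>l\<close> into the
      phase, where the hypothetical decision is the actual attempt.\<close>
    have "?no l k \<longrightarrow> \<not> ?st l" if "l < k" for l
      using that
    proof (induction l rule: less_induct)
      case (less l)
      show ?case
      proof
        assume no: "?no l k"
        have "?ph l"
          unfolding ph
        proof (intro allI impI)
          fix l0 assume l0: "l0 < l" "?no l0 l"
          then have "?no l0 k" using no by (metis not_le)
          then show "\<not> ?st l0" using less.IH[OF l0(1)] l0 less.prems by simp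
        qed
        then show "\<not> ?st l" using att all no less.prems by blast
      qed
    qed
    then show "?ph k" unfolding ph by blast
  qed
qed

end

text \<open>The induction on time runs over all loops at once, since collisions feed the attempts of
  one loop into the others. \<open>Psi\<close> agrees as well, being computed from gaps and past
  attempts.\<close>

lemma network_policy_independent:
  assumes z: "network_loop M m i S \<xi> sched z" and z': "network_loop M m i S \<xi> sched z'"
  shows "\<forall>j\<in>{1..m}. \<forall>\<omega>\<in>space M. est_gap z j k \<omega> = est_gap z' j k \<omega> \<and> attempt z j k \<omega> = attempt z' j k \<omega>"
proof (induction k rule: less_induct)
  case (less k)
  have att: "attempt z j l \<omega> = attempt z' j l \<omega>" if "l < k" "j \<in> {1..m}" "\<omega> \<in> space M" for j l \<omega>
    using less.IH that by blast
  have av: "avail m z j l \<omega> = avail m z' j l \<omega>" if "l < k" "\<omega> \<in> space M" for j l \<omega>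
    using att that by (auto simp: avail_def)
  have su: "success m z j l \<omega> = success m z' j l \<omega>" if "l < k" "j \<in> {1..m}" "\<omega> \<in> space M" for j l \<omega>
    using att av that by (simp add: success_def)
  show ?case
  proof (intro ballI)
    fix j \<omega> assume j: "j \<in> {1..m}" and \<omega>: "\<omega> \<in> space M"
    interpret zj: network_loop M m j S \<xi> sched z by (rule network_loop.other_loop[OF z j])
    interpret zj': network_loop M m j S \<xi> sched z' by (rule network_loop.other_loop[OF z' j])
    have gap: "est_gap z j k \<omega> = est_gap z' j k \<omega>" if \<omega>: "\<omega> \<in> space M" for \<omega>
    proof (cases k)
      case 0
      then show ?thesis using zj.gap_0[OF \<omega>] zj'.gap_0[OF \<omega>] by simp
    next
      case (Suc l)
      have "est_gap z j l \<omega> = est_gap z' j l \<omega>" using less.IH[of l] Suc j \<omega> by simp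
      then have "zj.rest l \<omega> = zj'.rest l \<omega>"
        using su[of l j \<omega>] Suc j \<omega> by (simp add: zj.rest_def zj'.rest_def)
      then show ?thesis using zj.gap_Suc[OF \<omega>] zj'.gap_Suc[OF \<omega>] Suc by simp
    qed
    have Psi: "Psi M m S z j k = Psi M m S z' j k"
      by (rule Psi_cong) (use gap att av j in auto)
    have "attempt z j k \<omega> = attempt z' j k \<omega>"
    proof (cases "sched j")
      case (Open_Loop g)
      then show ?thesis using zj.follows zj'.follows \<omega> by simp
    next
      case (CETT p \<beta> r)
      have "stett_attempt M m S \<xi> z r j k \<omega> = stett_attempt M m S \<xi> z' r j k \<omega>"
        by (simp add: stett_attempt_def Psi gap[OF \<omega>])
      moreover have "stett_phase M m S \<xi> z r j k \<omega> = stett_phase M m S \<xi> z' r j k \<omega>"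
        unfolding zj.stett_phase_iff[OF CETT \<omega>] zj'.stett_phase_iff[OF CETT \<omega>]
        using att[OF _ j \<omega>] su[OF _ j \<omega>] by (meson order.strict_trans)
      ultimately show ?thesis
        using zj.follows zj'.follows \<omega> unfolding CETT by simp
    qed
    with gap[OF \<omega>] show "est_gap z j k \<omega> = est_gap z' j k \<omega> \<and> attempt z j k \<omega> = attempt z' j k \<omega>" by blast
  qed
qed

section \<open>Symmetry of the estimation gap\<close>

text \<open>A real function measurable for a generated sigma-algebra separates points only as far as
  the generating map does. Hence the chosen version of \<open>Psi\<close> is a function of the trace
  at every outcome.\<close>

lemma vimage_algebra_constant_on_fibres:
  fixes f :: "'a \<Rightarrow> real"
  assumes f: "f \<in> borel_measurable (vimage_algebra X \<tau> N)" and \<tau>: "\<tau> \<in> X \<rightarrow> space N"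
    and "\<omega> \<in> X" "\<omega>' \<in> X" "\<tau> \<omega> = \<tau> \<omega>'"
  shows "f \<omega> = f \<omega>'"
proof -
  have "f -` {f \<omega>} \<inter> X \<in> sets (vimage_algebra X \<tau> N)"
    using measurable_sets[OF f, of "{f \<omega>}"] by simp
  then obtain D where D: "f -` {f \<omega>} \<inter> X = \<tau> -` D \<inter> X"
    unfolding sets_vimage_algebra2[OF \<tau>] by blast
  have "\<omega> \<in> \<tau> -` D \<inter> X" unfolding D[symmetric] using assms(3) by simp
  then have "\<omega>' \<in> \<tau> -` D \<inter> X" using assms(4,5) by simp
  then show ?thesis unfolding D[symmetric] by simp
qed

lemma (in sub_alg) sub_alg_vimage:
  assumes f: "f \<in> measurable M N"
  shows "sub_alg M (vimage_algebra (space M) f N)"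
  using measurable_vimageI[OF f] by unfold_locales (simp add: subalgebra_def)

text \<open>Applied to the other loops with \<open>N_alg\<close>, which contains their
  noises.\<close>

lemma (in lqg_loop) innov_measurable:
  assumes "\<xi> (Init i) \<in> measurable F (vec_borel n)" "\<And>k. \<xi> (Proc_Noise i k) \<in> measurable F (vec_borel n)"
    "\<And>k. \<xi> (Meas_Noise i k) \<in> measurable F (vec_borel dy)"
  shows "innov k \<in> measurable F (vec_borel dy)"
proof -
  have eta: "eta k \<in> measurable F (vec_borel n)" for k
  proof (induction k)
    case 0
    have "eta 0 = \<xi> (Init i)" by (simp add: fun_eq_iff)
    then show ?case using assms(1) by simp
  next
    case (Suc k)
    have "innov k \<in> measurable F (vec_borel dy)"
      unfolding innov_fun by (intro measurable_vec_add measurable_mult_mat_vec[OF _ dims(3)] Suc assms)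
    then have "theta k \<in> measurable F (vec_borel n)"
      unfolding theta_fun by (intro measurable_vec_minus measurable_mult_mat_vec[OF _ L_carrier] Suc)
    then show ?case
      unfolding eta_Suc by (intro measurable_vec_add measurable_mult_mat_vec[OF _ dims(1)] assms)
  qed
  show ?thesis
    unfolding innov_fun by (intro measurable_vec_add measurable_mult_mat_vec[OF _ dims(3)] eta assms)
qed

context lqg_loop
begin

lemma oprim_measurable:
  assumes "q \<in> oprims"
  shows "\<xi> q \<in> measurable N_alg (prim_space q)"
proof -
  have "(\<lambda>\<omega>. \<lambda>q\<in>oprims. \<xi> q \<omega>) \<in> measurable N_alg (Pi\<^sub>M oprims prim_space)"
    unfolding N_alg_def using measurable_space[OF oprims_measurable] by (intro measurable_vimage_algebra1) blast
  from measurable_compose[OF this measurable_component_singleton[OF assms]] assms show ?thesis by simp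
qed

lemma loop_prims_oprims:
  "j \<in> {1..m} \<Longrightarrow> j \<noteq> i \<Longrightarrow> prim_loop q = j \<Longrightarrow> q \<in> oprims" and internal_oprims: "Internal i k \<in> oprims"
  using loop by (auto simp: oprims_def gprims_def)

end

context network_loop
begin

text \<open>The generating map of \<open>T_alg\<close>. It has finitely many values, so
  \<open>Psi\<close> becomes one of finitely many matrices.\<close>

definition trace :: "nat \<Rightarrow> 'w \<Rightarrow> nat \<Rightarrow> bool \<times> bool option" where
  "trace k \<omega> = (\<lambda>l\<in>{..<k}. (attempt z i l \<omega>, if attempt z i l \<omega> then Some (avail m z i l \<omega>) else None))"

lemma Psi_constant:
  assumes "\<omega> \<in> space M" "\<omega>' \<in> space M" "trace k \<omega> = trace k \<omega>'"
  shows "Psi M m S z i k \<omega> = Psi M m S z i k \<omega>'"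
proof -
  let ?N = "Pi\<^sub>M {..<k} (\<lambda>_. count_space UNIV) :: (nat \<Rightarrow> bool \<times> bool option) measure"
  have T: "T_alg M m z i k = vimage_algebra (space M) (trace k) ?N"
    unfolding T_alg_def trace_def ..
  have "trace k \<in> space M \<rightarrow> space ?N"
    by (auto simp: trace_def space_PiM)
  then have "real_cond_exp M (T_alg M m z i k) f \<omega> = real_cond_exp M (T_alg M m z i k) f \<omega>'" for f
    using assms borel_measurable_cond_exp[of M "T_alg M m z i k" f] unfolding T
    by (intro vimage_algebra_constant_on_fibres[where N="?N"])
  then show ?thesis by (simp add: Psi_def cond_second_moment_def)
qed

lemma Psi_carrier: "Psi M m S z i k \<omega> \<in> carrier_mat n n"
  by (simp add: Psi_def cond_second_moment_def)

lemma trace_measurable: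
  assumes F: "sub_alg M F" and att: "\<And>l. l < k \<Longrightarrow> attempt z i l \<in> measurable F (count_space UNIV)"
    and av: "\<And>l. l < k \<Longrightarrow> avail m z i l \<in> measurable F (count_space UNIV)"
  shows "trace k \<in> measurable F (count_space (PiE {..<k} (\<lambda>_. UNIV)))"
proof (subst measurable_count_space_eq_countable)
  let ?I = "PiE {..<k} (\<lambda>_. UNIV) :: (nat \<Rightarrow> bool \<times> bool option) set"
  interpret F: sub_alg M F by fact
  show "countable ?I" by (intro countable_finite finite_PiE) auto
  show "trace k \<in> space F \<rightarrow> ?I \<and> (\<forall>a\<in>?I. trace k -` {a} \<inter> space F \<in> sets F)"
  proof (intro conjI ballI)
    show "trace k \<in> space F \<rightarrow> ?I" by (auto simp: trace_def)
    fix a assume a: "a \<in> ?I"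
    have "trace k -` {a} \<inter> space F = {\<omega> \<in> space F. \<forall>l\<in>{..<k}. (attempt z i l \<omega>, if attempt z i l \<omega> then Some (avail m z i l \<omega>) else None) = a l}"
      using a by (auto simp: trace_def fun_eq_iff PiE_def extensional_def restrict_def)
    also have "\<dots> \<in> sets F"
    proof (intro sets.sets_Collect_finite_All finite_lessThan)
      fix l assume "l \<in> {..<k}"
      then have [measurable]: "attempt z i l \<in> measurable F (count_space UNIV)" "avail m z i l \<in> measurable F (count_space UNIV)"
        using att av by auto
      have "(\<lambda>\<omega>. (attempt z i l \<omega>, if attempt z i l \<omega> then Some (avail m z i l \<omega>) else None) = a l) \<in> measurable F (count_space UNIV)"
        by measurable
      then show "{\<omega> \<in> space F. (attempt z i l \<omega>, if attempt z i l \<omega> then Some (avail m z i l \<omega>) else None) = a l} \<in> sets F"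
        by (simp only: pred_def)
    qed
    finally show "trace k -` {a} \<inter> space F \<in> sets F" .
  qed
qed

text \<open>The threshold phase as read off past attempts and successes, which
  \<open>stett_phase_iff\<close> permits.\<close>

definition test_phase :: "nat \<Rightarrow> 'w \<Rightarrow> bool" where
  "test_phase k \<omega> \<longleftrightarrow> (\<forall>l<k. attempt z i l \<omega> \<longrightarrow> (\<exists>l'. l \<le> l' \<and> l' < k \<and> succ l' \<omega>))"

lemma test_phase_measurable:
  assumes F: "sub_alg M F" and att: "\<And>l. l < k \<Longrightarrow> attempt z i l \<in> measurable F (count_space UNIV)"
    and av: "\<And>l. l < k \<Longrightarrow> avail m z i l \<in> measurable F (count_space UNIV)"
  shows "test_phase k \<in> measurable F (count_space UNIV)"
proof -
  have succ: "Measurable.pred F (\<lambda>\<omega>. succ l \<omega>)" if "l < k" for l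
    unfolding success_def using att[OF that] av[OF that] by measurable
  have "Measurable.pred F (\<lambda>\<omega>. \<forall>l\<in>{..<k}. attempt z i l \<omega> \<longrightarrow> (\<exists>l'\<in>{l..<k}. succ l' \<omega>))"
  proof (intro pred_intros_finite finite_lessThan pred_intros_logic finite_atLeastLessThan)
    show "Measurable.pred F (attempt z i l)" if "l \<in> {..<k}" for l using att that by simp
    show "Measurable.pred F (succ l')" if "l' \<in> {l..<k}" for l l' using succ that by simp
  qed
  moreover have "test_phase k = (\<lambda>\<omega>. \<forall>l\<in>{..<k}. attempt z i l \<omega> \<longrightarrow> (\<exists>l'\<in>{l..<k}. succ l' \<omega>))"
    by (simp add: test_phase_def fun_eq_iff Ball_def Bex_def conj_assoc)
  ultimately show ?thesis by simp
qed

text \<open>The CETT decision with a free vector in the place of the gap. The guard \<open>c\<close>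
  on the inverse has two uses: constantly true it gives the actual rule, as a dimension check it
  makes the rule even.\<close>

definition decide :: "(real mat \<Rightarrow> bool) \<Rightarrow> (nat \<Rightarrow> real vec \<Rightarrow> bool) \<Rightarrow> (nat \<Rightarrow> real vec \<Rightarrow> ennreal) \<Rightarrow> nat \<Rightarrow> 'w \<times> real vec \<Rightarrow> bool" where
  "decide c \<beta> r k = (\<lambda>(\<omega>, y). if test_phase k \<omega>
     then c (mat_inv (Psi M m S z i k \<omega>)) \<and> ennreal (1/2 * (y \<bullet> (mat_inv (Psi M m S z i k \<omega>) *\<^sub>v y))) > r k (\<xi> (Internal i k) \<omega>)
     else \<beta> k (\<xi> (Internal i k) \<omega>))"

lemma attempt_decide:
  assumes "sched i = CETT p \<beta> r" "\<omega> \<in> space M"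
  shows "attempt z i k \<omega> = decide (\<lambda>_. True) \<beta> r k (\<omega>, gap k \<omega>)"
proof -
  have phase: "stett_phase M m S \<xi> z r i k \<omega> = test_phase k \<omega>"
    unfolding test_phase_def by (rule stett_phase_iff[OF assms])
  have "attempt z i k \<omega> = (if stett_phase M m S \<xi> z r i k \<omega> then stett_attempt M m S \<xi> z r i k \<omega> else \<beta> k (\<xi> (Internal i k) \<omega>))"
    using follows assms(2) unfolding assms(1) follows_scheduler.simps by blast
  then show ?thesis
    unfolding phase stett_attempt_def decide_def case_prod_conv simp_thms .
qed

text \<open>\<open>Psi\<close> enters only through the trace, so the rule is a finite case
  distinction over fixed matrices.\<close>

lemma decide_measurable:
  assumes F: "sub_alg M F" and att: "\<And>l. l < k \<Longrightarrow> attempt z i l \<in> measurable F (count_space UNIV)"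
    and av: "\<And>l. l < k \<Longrightarrow> avail m z i l \<in> measurable F (count_space UNIV)"
    and int: "\<xi> (Internal i k) \<in> measurable F (vec_borel (dim_a (S i)))"
    and \<beta>: "\<beta> k \<in> measurable (vec_borel (dim_a (S i))) (count_space UNIV)"
    and r: "r k \<in> borel_measurable (vec_borel (dim_a (S i)))"
  shows "decide c \<beta> r k \<in> measurable (F \<Otimes>\<^sub>M vec_borel n) (count_space UNIV)"
proof -
  interpret F: sub_alg M F by fact
  let ?I = "PiE {..<k} (\<lambda>_. UNIV) :: (nat \<Rightarrow> bool \<times> bool option) set"
  \<comment> \<open>An outcome is chosen to represent each trace; by \<open>Psi_constant\<close> the
    matrix does not depend on the choice.\<close>
  define \<Phi> where "\<Phi> t = mat_inv (Psi M m S z i k (SOME \<omega>. \<omega> \<in> space M \<and> trace k \<omega> = t))" for t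
  have \<Phi>: "mat_inv (Psi M m S z i k \<omega>) = \<Phi> (trace k \<omega>)" if "\<omega> \<in> space M" for \<omega>
  proof -
    have "(SOME \<omega>'. \<omega>' \<in> space M \<and> trace k \<omega>' = trace k \<omega>) \<in> space M \<and> trace k (SOME \<omega>'. \<omega>' \<in> space M \<and> trace k \<omega>' = trace k \<omega>) = trace k \<omega>"
      by (rule someI[of _ \<omega>]) (use that in simp)
    then show ?thesis
      unfolding \<Phi>_def using Psi_constant[OF that] by metis
  qed
  note [measurable] = test_phase_measurable[OF F att av] measurable_compose[OF int \<beta>] measurable_compose[OF int r]
  have "(\<lambda>p. c (\<Phi> t) \<and> ennreal (1/2 * (snd p \<bullet> (\<Phi> t *\<^sub>v snd p))) > r k (\<xi> (Internal i k) (fst p)))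
      \<in> measurable (F \<Otimes>\<^sub>M vec_borel n) (count_space UNIV)" for t
  proof -
    have [measurable]: "(\<lambda>p. snd p \<bullet> (\<Phi> t *\<^sub>v snd p)) \<in> borel_measurable (F \<Otimes>\<^sub>M vec_borel n)"
      by (rule measurable_compose[OF measurable_snd measurable_quadratic_form])
    show ?thesis by measurable
  qed
  moreover have "(\<lambda>p. trace k (fst p)) \<in> measurable (F \<Otimes>\<^sub>M vec_borel n) (count_space ?I)"
    by (rule measurable_compose[OF measurable_fst trace_measurable[OF F att av]])
  moreover have "countable ?I" by (intro countable_finite finite_PiE) auto
  ultimately have [measurable]: "(\<lambda>p. c (\<Phi> (trace k (fst p))) \<and> ennreal (1/2 * (snd p \<bullet> (\<Phi> (trace k (fst p)) *\<^sub>v snd p))) > r k (\<xi> (Internal i k) (fst p)))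
      \<in> measurable (F \<Otimes>\<^sub>M vec_borel n) (count_space UNIV)"
    by (rule measurable_compose_countable')
  have "(\<lambda>p. if test_phase k (fst p) then c (\<Phi> (trace k (fst p))) \<and> ennreal (1/2 * (snd p \<bullet> (\<Phi> (trace k (fst p)) *\<^sub>v snd p))) > r k (\<xi> (Internal i k) (fst p))
      else \<beta> k (\<xi> (Internal i k) (fst p))) \<in> measurable (F \<Otimes>\<^sub>M vec_borel n) (count_space UNIV)"
    by measurable
  also have "?this \<longleftrightarrow> ?thesis"
  proof (rule measurable_cong)
    fix p assume "p \<in> space (F \<Otimes>\<^sub>M vec_borel n)"
    then have "fst p \<in> space M" by (auto simp: space_pair_measure)
    note eq = \<Phi>[OF this]
    show "(if test_phase k (fst p) then c (\<Phi> (trace k (fst p))) \<and> ennreal (1/2 * (snd p \<bullet> (\<Phi> (trace k (fst p)) *\<^sub>v snd p))) > r k (\<xi> (Internal i k) (fst p))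
      else \<beta> k (\<xi> (Internal i k) (fst p))) = decide c \<beta> r k p"
      unfolding decide_def case_prod_beta eq ..
  qed
  finally show ?thesis .
qed

text \<open>Serves the loops other than the distinguished one, whose primitives and current gaps are
  known to \<open>F\<close>.\<close>

lemma attempt_measurable:
  assumes F: "sub_alg M F" and att: "\<And>l. l < k \<Longrightarrow> attempt z i l \<in> measurable F (count_space UNIV)"
    and av: "\<And>l. l < k \<Longrightarrow> avail m z i l \<in> measurable F (count_space UNIV)"
    and adm: "admissible_scheduler M S \<xi> i (sched i)"
    and prims: "\<And>q. prim_loop q = i \<Longrightarrow> \<xi> q \<in> measurable F (prim_space q)"
    and gap: "gap k \<in> measurable F (vec_borel n)"
  shows "attempt z i k \<in> measurable F (count_space UNIV)"
proof (cases "sched i")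
  case (Open_Loop g)
  have "(\<lambda>\<omega>. \<lambda>q\<in>own_prims i k. \<xi> q \<omega>) \<in> measurable F (Pi\<^sub>M (own_prims i k) prim_space)"
    by (intro measurable_restrict prims) (auto simp: own_prims_def)
  moreover have "g k \<in> measurable (Pi\<^sub>M (own_prims i k) prim_space) (count_space UNIV)"
    using adm Open_Loop by simp
  ultimately have "(\<lambda>\<omega>. g k (\<lambda>q\<in>own_prims i k. \<xi> q \<omega>)) \<in> measurable F (count_space UNIV)"
    by (rule measurable_compose)
  also have "?this \<longleftrightarrow> ?thesis"
    proof (rule measurable_cong)
    fix \<omega> assume "\<omega> \<in> space F"
    then have "\<omega> \<in> space M" using sub_alg.space_F[OF F] by simp
    then show "g k (\<lambda>q\<in>own_prims i k. \<xi> q \<omega>) = attempt z i k \<omega>"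
      using follows unfolding Open_Loop follows_scheduler.simps by blast
  qed
  finally show ?thesis .
next
  case (CETT p \<beta> r)
  have "\<beta> k \<in> measurable (vec_borel (dim_a (S i))) (count_space UNIV)" "r k \<in> borel_measurable (vec_borel (dim_a (S i)))"
    using adm CETT by simp_all
  moreover have "\<xi> (Internal i k) \<in> measurable F (vec_borel (dim_a (S i)))"
    using prims[of "Internal i k"] by simp
  ultimately have D: "decide (\<lambda>_. True) \<beta> r k \<in> measurable (F \<Otimes>\<^sub>M vec_borel n) (count_space UNIV)"
    by (intro decide_measurable[OF F att av])
  have "(\<lambda>\<omega>. (\<omega>, gap k \<omega>)) \<in> measurable F (F \<Otimes>\<^sub>M vec_borel n)"
    using gap by measurable
  from measurable_compose[OF this D] have "(\<lambda>\<omega>. decide (\<lambda>_. True) \<beta> r k (\<omega>, gap k \<omega>)) \<in> measurable F (count_space UNIV)" .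
  also have "?this \<longleftrightarrow> ?thesis"
    proof (rule measurable_cong)
    fix \<omega> assume "\<omega> \<in> space F"
    then have "\<omega> \<in> space M" using sub_alg.space_F[OF F] by simp
    then show "decide (\<lambda>_. True) \<beta> r k (\<omega>, gap k \<omega>) = attempt z i k \<omega>" by (rule attempt_decide[OF CETT, symmetric])
  qed
  finally show ?thesis .
qed

text \<open>The information of the controller, enlarged by everything that is not Gaussian noise of the loop.\<close>

primrec F_alg :: "nat \<Rightarrow> 'w measure" where
  "F_alg 0 = N_alg"
| "F_alg (Suc k) = vimage_algebra (space M) (\<lambda>\<omega>. (\<omega>, attempt z i k \<omega>, sent k \<omega>))
     (F_alg k \<Otimes>\<^sub>M count_space UNIV \<Otimes>\<^sub>M vec_borel n)"

lemma space_F_alg [simp]: "space (F_alg k) = space M"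
  by (cases k) simp_all

end

section \<open>Induction over time for the loop with the CETT scheduler\<close>

locale cett_loop = network_loop M m i S \<xi> sched z for M :: "'w measure" and m i S \<xi> sched z +
  fixes p :: "nat \<Rightarrow> real" and \<beta> :: "nat \<Rightarrow> real vec \<Rightarrow> bool" and r :: "nat \<Rightarrow> real vec \<Rightarrow> ennreal"
  assumes admissible: "\<And>j. j \<in> {1..m} \<Longrightarrow> admissible_scheduler M S \<xi> j (sched j)"
    and cett: "sched i = CETT p \<beta> r"
    and well_posed: "scheduler_well_posed M m S \<xi> z i (sched i)"
begin

text \<open>The situation at time \<open>k\<close> before the transmission. The other loops are
  known to \<open>F_alg k\<close>, because their gaps depend on loop \<open>i\<close> only through
  its past attempts. The gap of loop \<open>i\<close> is known to \<open>G_alg (Suc k)\<close>, and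
  its law given \<open>F_alg k\<close> is symmetric.\<close>

definition invariant :: "nat \<Rightarrow> bool" where
  "invariant k \<longleftrightarrow> sub_alg M (F_alg k) \<and> sets (F_alg k) \<subseteq> sets (G_alg k) \<and> sets N_alg \<subseteq> sets (F_alg k) \<and>
    (\<forall>l<k. \<forall>j\<in>{1..m}. attempt z j l \<in> measurable (F_alg k) (count_space UNIV)) \<and>
    (\<forall>j\<in>{1..m} - {i}. est_gap z j k \<in> measurable (F_alg k) (vec_borel (dim_x (S j)))) \<and>
    (\<forall>l<k. sent l \<in> measurable (F_alg k) (vec_borel n)) \<and>
    gap k \<in> measurable (G_alg (Suc k)) (vec_borel n) \<and> sym_given M (F_alg k) n (gap k)"

lemma internal_measurable:
  assumes "sub_alg M F" "sets N_alg \<subseteq> sets F"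
  shows "\<xi> (Internal i k) \<in> measurable F (vec_borel (dim_a (S i)))"
  using measurable_mono_sets[OF oprim_measurable[OF internal_oprims[of k]] assms(2)] sub_alg.space_F[OF assms(1)] by simp

lemma beta_r_measurable:
  "\<beta> k \<in> measurable (vec_borel (dim_a (S i))) (count_space UNIV)" "r k \<in> borel_measurable (vec_borel (dim_a (S i)))"
  using admissible[OF loop] cett by simp_all

lemma decide_even:
  assumes "y \<in> carrier_vec n"
  shows "decide (\<lambda>H. H \<in> carrier_mat n n) \<beta> r k (\<omega>, - y) = decide (\<lambda>H. H \<in> carrier_mat n n) \<beta> r k (\<omega>, y)"
  unfolding decide_def case_prod_conv using quadratic_form_uminus[OF _ assms] by (auto simp del: uminus_mult_mat_vec)

text \<open>With an inverse of the wrong dimension the quadratic form could read indices out of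
  range and need not be even. Well-posedness supplies the dimension guard almost surely throughout
  the threshold phase.\<close>

lemma AE_attempt_guarded: "AE \<omega> in M. attempt z i k \<omega> = decide (\<lambda>H. H \<in> carrier_mat n n) \<beta> r k (\<omega>, gap k \<omega>)"
proof -
  have "AE \<omega> in M. stett_phase M m S \<xi> z r i k \<omega> \<longrightarrow> invertible_mat (Psi M m S z i k \<omega>)"
    using well_posed cett by simp
  then show ?thesis
    using AE_space
  proof eventually_elim
    case (elim \<omega>)
    then have "mat_inv (Psi M m S z i k \<omega>) \<in> carrier_mat n n" if "test_phase k \<omega>"
      using that stett_phase_iff[OF cett elim(2)] invertible_mat_inv_dim[OF Psi_carrier] by (simp add: test_phase_def)
    then show ?case
      unfolding attempt_decide[OF cett elim(2)] decide_def case_prod_conv by auto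
  qed
qed

lemma innov_other:
  assumes "j \<in> {1..m}" "j \<noteq> i"
  shows "lqg_loop.innov j S \<xi> k \<in> measurable N_alg (vec_borel (dim_y (S j)))"
proof -
  interpret j: network_loop M m j S \<xi> sched z by (rule other_loop[OF assms(1)])
  show ?thesis
    using oprim_measurable[OF loop_prims_oprims[OF assms], of "Init j"] oprim_measurable[OF loop_prims_oprims[OF assms], of "Proc_Noise j _"]
      oprim_measurable[OF loop_prims_oprims[OF assms], of "Meas_Noise j _"]
    by (intro j.innov_measurable) simp_all
qed

text \<open>The attempts of the other loops at time \<open>k\<close> are determined by
  \<open>F_alg k\<close>, hence so is the availability. The own attempt depends on the current gap
  as well, so it is placed in \<open>G_alg (Suc k)\<close>.\<close>

lemma invariant_current:
  assumes inv: "invariant k"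
  shows "\<And>j. j \<in> {1..m} - {i} \<Longrightarrow> attempt z j k \<in> measurable (F_alg k) (count_space UNIV)"
    and "avail m z i k \<in> measurable (F_alg k) (count_space UNIV)"
    and "attempt z i k \<in> measurable (G_alg (Suc k)) (count_space UNIV)"
    and "decide c \<beta> r k \<in> measurable (F_alg k \<Otimes>\<^sub>M vec_borel n) (count_space UNIV)"
    and "\<And>l. l < k \<Longrightarrow> avail m z j l \<in> measurable (F_alg k) (count_space UNIV)"
proof -
  have F: "sub_alg M (F_alg k)" and FG: "sets (F_alg k) \<subseteq> sets (G_alg k)" and NF: "sets N_alg \<subseteq> sets (F_alg k)"
    and att: "\<And>l j. l < k \<Longrightarrow> j \<in> {1..m} \<Longrightarrow> attempt z j l \<in> measurable (F_alg k) (count_space UNIV)"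
    and gaps: "\<And>j. j \<in> {1..m} - {i} \<Longrightarrow> est_gap z j k \<in> measurable (F_alg k) (vec_borel (dim_x (S j)))"
    and gap: "gap k \<in> measurable (G_alg (Suc k)) (vec_borel n)"
    using inv unfolding invariant_def by blast+
  have avail_meas: "avail m z j l \<in> measurable H (count_space UNIV)"
    if "\<And>j'. j' \<in> {1..m} - {j} \<Longrightarrow> attempt z j' l \<in> measurable H (count_space UNIV)" for j l H
    unfolding avail_def[abs_def] by (intro pred_intros_finite pred_intros_logic that) auto
  show av: "\<And>j l. l < k \<Longrightarrow> avail m z j l \<in> measurable (F_alg k) (count_space UNIV)"
    using att by (intro avail_meas) auto
  show others: "attempt z j k \<in> measurable (F_alg k) (count_space UNIV)" if j: "j \<in> {1..m} - {i}" for j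
  proof -
    have j': "j \<in> {1..m}" "j \<noteq> i" using j by auto
    interpret j: network_loop M m j S \<xi> sched z by (rule other_loop[OF j'(1)])
    show ?thesis
    proof (rule j.attempt_measurable[OF F att[OF _ j'(1)] av admissible[OF j'(1)] _ gaps[OF j]])
      show "\<xi> q \<in> measurable (F_alg k) (prim_space q)" if "prim_loop q = j" for q
        by (rule measurable_mono_sets[OF oprim_measurable[OF loop_prims_oprims[OF j' that]] NF]) simp
    qed
  qed
  show "avail m z i k \<in> measurable (F_alg k) (count_space UNIV)"
    by (rule avail_meas[OF others])
  show D: "decide c \<beta> r k \<in> measurable (F_alg k \<Otimes>\<^sub>M vec_borel n) (count_space UNIV)" for c
    by (intro decide_measurable[OF F att[OF _ loop] av] internal_measurable[OF F NF] beta_r_measurable)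
  show "attempt z i k \<in> measurable (G_alg (Suc k)) (count_space UNIV)"
  proof -
    have sub: "sets (F_alg k) \<subseteq> sets (G_alg (Suc k))" using FG G_alg_mono[of k "Suc k"] by simp
    have "(\<lambda>\<omega>. \<omega>) \<in> measurable (F_alg k) (F_alg k)" by simp
    then have "(\<lambda>\<omega>. \<omega>) \<in> measurable (G_alg (Suc k)) (F_alg k)"
      by (rule measurable_mono_sets[OF _ sub]) simp
    then have "(\<lambda>\<omega>. (\<omega>, gap k \<omega>)) \<in> measurable (G_alg (Suc k)) (F_alg k \<Otimes>\<^sub>M vec_borel n)"
      using gap by (rule measurable_Pair)
    from measurable_compose[OF this D[of "\<lambda>_. True"]]
    have "(\<lambda>\<omega>. decide (\<lambda>_. True) \<beta> r k (\<omega>, gap k \<omega>)) \<in> measurable (G_alg (Suc k)) (count_space UNIV)" .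
    also have "?this \<longleftrightarrow> attempt z i k \<in> measurable (G_alg (Suc k)) (count_space UNIV)"
      by (rule measurable_cong, rule attempt_decide[OF cett, symmetric]) simp
    finally show ?thesis .
  qed
qed

text \<open>The transmission at time \<open>k\<close> censors the gap in the sense of
  \<open>sym_given_censored\<close>, with the availability as the condition known
  beforehand.\<close>

lemma invariant_step:
  assumes inv: "invariant k"
  shows "sub_alg M (F_alg (Suc k))" "sets (F_alg k) \<subseteq> sets (F_alg (Suc k))" "sets (F_alg (Suc k)) \<subseteq> sets (G_alg (Suc k))"
    "attempt z i k \<in> measurable (F_alg (Suc k)) (count_space UNIV)" "sent k \<in> measurable (F_alg (Suc k)) (vec_borel n)"
    "rest k \<in> measurable (G_alg (Suc k)) (vec_borel n)" "sym_given M (F_alg (Suc k)) n (rest k)"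
proof -
  note cur = invariant_current[OF inv]
  have F: "sub_alg M (F_alg k)" and FG: "sets (F_alg k) \<subseteq> sets (G_alg k)"
    and gap: "gap k \<in> measurable (G_alg (Suc k)) (vec_borel n)" and sym: "sym_given M (F_alg k) n (gap k)"
    using inv unfolding invariant_def by blast+
  interpret F: sub_alg M "F_alg k" by (rule F)
  interpret G: sub_alg M "G_alg (Suc k)" by (rule sub_alg_G_alg)
  have sub: "sets (F_alg k) \<subseteq> sets (G_alg (Suc k))" using FG G_alg_mono[of k "Suc k"] by simp
  let ?N = "F_alg k \<Otimes>\<^sub>M (count_space UNIV :: bool measure) \<Otimes>\<^sub>M vec_borel n"
  let ?\<phi> = "\<lambda>\<omega>. (\<omega>, attempt z i k \<omega>, sent k \<omega>)"
  have avG: "avail m z i k \<in> measurable (G_alg (Suc k)) (count_space UNIV)"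
    by (rule measurable_mono_sets[OF cur(2) sub]) simp
  have succ: "Measurable.pred (G_alg (Suc k)) (succ k)"
    unfolding success_def[abs_def] using avG cur(3) by measurable
  have zero: "(\<lambda>_. 0\<^sub>v n) \<in> measurable (G_alg (Suc k)) (vec_borel n)" by (rule measurable_vec_const) simp
  have sentG: "sent k \<in> measurable (G_alg (Suc k)) (vec_borel n)"
    unfolding sent_def[abs_def] using gap zero succ by (intro measurable_If) (auto simp: pred_def)
  show "rest k \<in> measurable (G_alg (Suc k)) (vec_borel n)"
    unfolding rest_def[abs_def] using gap zero succ by (intro measurable_If) (auto simp: pred_def)
  have "(\<lambda>\<omega>. \<omega>) \<in> measurable (F_alg k) (F_alg k)" by simp
  then have "(\<lambda>\<omega>. \<omega>) \<in> measurable (G_alg (Suc k)) (F_alg k)"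
    by (rule measurable_mono_sets[OF _ sub]) simp
  then have \<phi>G: "?\<phi> \<in> measurable (G_alg (Suc k)) ?N"
    by (intro measurable_Pair cur(3) sentG)
  show "sets (F_alg (Suc k)) \<subseteq> sets (G_alg (Suc k))"
    using measurable_vimageI[OF \<phi>G] by simp
  have \<phi>M: "?\<phi> \<in> measurable M ?N" by (rule G.measurable_F[OF \<phi>G])
  show "sub_alg M (F_alg (Suc k))" using F.sub_alg_vimage[OF \<phi>M] by simp
  have \<phi>F: "?\<phi> \<in> measurable (F_alg (Suc k)) ?N"
    unfolding F_alg.simps using measurable_space[OF \<phi>M] by (intro measurable_vimage_algebra1) blast
  have id: "(\<lambda>\<omega>. \<omega>) \<in> measurable (F_alg (Suc k)) (F_alg k)"
    using measurable_compose[OF \<phi>F measurable_fst] by simp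
  show "sets (F_alg k) \<subseteq> sets (F_alg (Suc k))"
  proof
    fix X assume X: "X \<in> sets (F_alg k)"
    then have "X \<subseteq> space M" using sets.sets_into_space[OF X] by simp
    then show "X \<in> sets (F_alg (Suc k))" using measurable_sets[OF id X] by (simp add: Int_absorb2 del: F_alg.simps)
  qed
  show "attempt z i k \<in> measurable (F_alg (Suc k)) (count_space UNIV)"
    using measurable_compose[OF measurable_compose[OF \<phi>F measurable_snd] measurable_fst] by simp
  show "sent k \<in> measurable (F_alg (Suc k)) (vec_borel n)"
    using measurable_compose[OF measurable_compose[OF \<phi>F measurable_snd] measurable_snd] by simp
  have "sym_given M (vimage_algebra (space M) (\<lambda>\<omega>. (\<omega>, attempt z i k \<omega>, if attempt z i k \<omega> \<and> avail m z i k \<omega> then gap k \<omega> else 0\<^sub>v n)) ?N) n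
     (\<lambda>\<omega>. if attempt z i k \<omega> \<and> avail m z i k \<omega> then 0\<^sub>v n else gap k \<omega>)"
    by (rule F.sym_given_censored[OF sym cur(4) decide_even G.measurable_F[OF cur(3)] AE_attempt_guarded cur(2)])
  moreover have "sent k = (\<lambda>\<omega>. if attempt z i k \<omega> \<and> avail m z i k \<omega> then gap k \<omega> else 0\<^sub>v n)"
    "rest k = (\<lambda>\<omega>. if attempt z i k \<omega> \<and> avail m z i k \<omega> then 0\<^sub>v n else gap k \<omega>)"
    by (simp_all add: sent_def rest_def success_def fun_eq_iff conj_commute)
  ultimately show "sym_given M (F_alg (Suc k)) n (rest k)" by simp
qed

lemma invariant: "invariant k"
proof (induction k)
  case 0
  have subN: "sub_alg M N_alg"
    using N_alg_events by unfold_locales (simp add: subalgebra_def)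
  interpret N: sub_alg M N_alg by (rule subN)
  have G0: "gap 0 \<in> measurable (G_alg (Suc 0)) (vec_borel n)"
  proof -
    have "(\<lambda>\<omega>. L *\<^sub>v innov 0 \<omega>) \<in> measurable (G_alg (Suc 0)) (vec_borel n)"
      by (rule measurable_mult_mat_vec[OF innov_G_alg L_carrier]) simp
    also have "?this \<longleftrightarrow> ?thesis" by (rule measurable_cong) (simp add: gap_0)
    finally show ?thesis .
  qed
  have zero: "(\<lambda>_. 0\<^sub>v n) \<in> measurable H (vec_borel n)" for H :: "'w measure" by (rule measurable_vec_const) simp
  have "- 0\<^sub>v n = (0\<^sub>v n :: real vec)" by (intro eq_vecI) auto
  \<comment> \<open>The first gap is the linear update of a zero remainder, so the general update
    lemma covers the base case.\<close>
  then have "sym_given M N_alg n (\<lambda>_. 0\<^sub>v n)"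
    using zero by (simp add: sym_given_def)
  from N.sym_given_linear_update[OF this sub_alg_G_alg N_alg_G_alg zero innov_indep[of 0] gvec_symmetric[OF gvec_innov] dims(1) L_carrier]
  have s: "sym_given M N_alg n (\<lambda>\<omega>. A *\<^sub>v 0\<^sub>v n + L *\<^sub>v innov 0 \<omega>)" .
  have eq: "A *\<^sub>v 0\<^sub>v n + L *\<^sub>v innov 0 \<omega> = gap 0 \<omega>" if "\<omega> \<in> space M" for \<omega>
  proof -
    have "L *\<^sub>v innov 0 \<omega> \<in> carrier_vec n" using noise_carrier[OF that] by blast
    moreover have "A *\<^sub>v 0\<^sub>v n = 0\<^sub>v n" by (intro eq_vecI) (auto simp: carrier_matD[OF dims(1)])
    ultimately show ?thesis by (simp add: gap_0[OF that])
  qed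
  have cong: "sym_given M H n Y" if "sym_given M H n X" "\<And>\<omega>. \<omega> \<in> space M \<Longrightarrow> X \<omega> = Y \<omega>" for H :: "'w measure" and X Y
  proof -
    have "X \<in> measurable M (vec_borel n) \<longleftrightarrow> Y \<in> measurable M (vec_borel n)" by (rule measurable_cong) (rule that(2))
    moreover have "distr M (H \<Otimes>\<^sub>M vec_borel n) (\<lambda>\<omega>. (\<omega>, X \<omega>)) = distr M (H \<Otimes>\<^sub>M vec_borel n) (\<lambda>\<omega>. (\<omega>, Y \<omega>))"
      "distr M (H \<Otimes>\<^sub>M vec_borel n) (\<lambda>\<omega>. (\<omega>, - X \<omega>)) = distr M (H \<Otimes>\<^sub>M vec_borel n) (\<lambda>\<omega>. (\<omega>, - Y \<omega>))"
      by (intro distr_cong refl; simp add: that(2))+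
    ultimately show ?thesis using that(1) by (simp add: sym_given_def)
  qed
  have "est_gap z j 0 \<in> measurable N_alg (vec_borel (dim_x (S j)))" if j: "j \<in> {1..m} - {i}" for j
  proof -
    have j': "j \<in> {1..m}" "j \<noteq> i" using j by auto
    interpret j: network_loop M m j S \<xi> sched z by (rule other_loop[OF j'(1)])
    have "(\<lambda>\<omega>. j.L *\<^sub>v j.innov 0 \<omega>) \<in> measurable N_alg (vec_borel j.n)"
      by (rule measurable_mult_mat_vec[OF innov_other[OF j'] j.L_carrier])
    also have "?this \<longleftrightarrow> ?thesis" by (rule measurable_cong) (simp add: j.gap_0)
    finally show ?thesis .
  qed
  then show ?case
    unfolding invariant_def F_alg.simps(1) using subN N_alg_G_alg G0 cong[OF s eq] by simp
next
  case (Suc k)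
  note cur = invariant_current[OF Suc] and step = invariant_step[OF Suc]
  have NF: "sets N_alg \<subseteq> sets (F_alg (Suc k))"
    using Suc step(2) unfolding invariant_def by blast
  have up: "f \<in> measurable (F_alg (Suc k)) H" if "f \<in> measurable (F_alg k) H" for f :: "'w \<Rightarrow> 'c" and H
    by (rule measurable_mono_sets[OF that step(2)]) (simp del: F_alg.simps)
  have att: "attempt z j l \<in> measurable (F_alg (Suc k)) (count_space UNIV)" if "l < Suc k" "j \<in> {1..m}" for l j
  proof (cases "l = k")
    case True
    then show ?thesis using that step(4) up[OF cur(1)] by (cases "j = i") auto
  next
    case False
    then have "attempt z j l \<in> measurable (F_alg k) (count_space UNIV)" using Suc that unfolding invariant_def by auto
    then show ?thesis by (rule up)
  qed
  have sent: "sent l \<in> measurable (F_alg (Suc k)) (vec_borel n)" if "l < Suc k" for l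
  proof (cases "l = k")
    case False
    then have "sent l \<in> measurable (F_alg k) (vec_borel n)" using Suc that unfolding invariant_def by auto
    then show ?thesis by (rule up)
  qed (use step(5) in simp)
  have gapG: "gap (Suc k) \<in> measurable (G_alg (Suc (Suc k))) (vec_borel n)"
  proof -
    have "rest k \<in> measurable (G_alg (Suc (Suc k))) (vec_borel n)"
      by (rule measurable_mono_sets[OF step(6) G_alg_mono]) auto
    then have "(\<lambda>\<omega>. A *\<^sub>v rest k \<omega> + L *\<^sub>v innov (Suc k) \<omega>) \<in> measurable (G_alg (Suc (Suc k))) (vec_borel n)"
      by (intro measurable_vec_add measurable_mult_mat_vec[OF _ dims(1)] measurable_mult_mat_vec[OF innov_G_alg L_carrier]) auto
    also have "?this \<longleftrightarrow> ?thesis" by (rule measurable_cong) (simp add: gap_Suc)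
    finally show ?thesis .
  qed
  have symS: "sym_given M (F_alg (Suc k)) n (gap (Suc k))"
  proof -
    have s: "sym_given M (F_alg (Suc k)) n (\<lambda>\<omega>. A *\<^sub>v rest k \<omega> + L *\<^sub>v innov (Suc k) \<omega>)"
      by (rule sub_alg.sym_given_linear_update[OF step(1) step(7) sub_alg_G_alg step(3) step(6) innov_indep gvec_symmetric[OF gvec_innov] dims(1) L_carrier])
    have "gap (Suc k) \<in> measurable M (vec_borel n)"
      by (rule sub_alg.measurable_F[OF sub_alg_G_alg gapG])
    moreover have "distr M (F_alg (Suc k) \<Otimes>\<^sub>M vec_borel n) (\<lambda>\<omega>. (\<omega>, A *\<^sub>v rest k \<omega> + L *\<^sub>v innov (Suc k) \<omega>)) = distr M (F_alg (Suc k) \<Otimes>\<^sub>M vec_borel n) (\<lambda>\<omega>. (\<omega>, gap (Suc k) \<omega>))"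
      "distr M (F_alg (Suc k) \<Otimes>\<^sub>M vec_borel n) (\<lambda>\<omega>. (\<omega>, - (A *\<^sub>v rest k \<omega> + L *\<^sub>v innov (Suc k) \<omega>))) = distr M (F_alg (Suc k) \<Otimes>\<^sub>M vec_borel n) (\<lambda>\<omega>. (\<omega>, - gap (Suc k) \<omega>))"
      by (intro distr_cong refl; simp only: gap_Suc)+
    ultimately show ?thesis using s unfolding sym_given_def by metis
  qed
  \<comment> \<open>The success of another loop at time \<open>k\<close> depends on the attempt of
    loop \<open>i\<close>, which \<open>F_alg (Suc k)\<close> records.\<close>
  have gaps: "est_gap z j (Suc k) \<in> measurable (F_alg (Suc k)) (vec_borel (dim_x (S j)))" if j: "j \<in> {1..m} - {i}" for j
  proof -
    have j': "j \<in> {1..m}" "j \<noteq> i" using j by auto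
    interpret j: network_loop M m j S \<xi> sched z by (rule other_loop[OF j'(1)])
    have gk: "est_gap z j k \<in> measurable (F_alg (Suc k)) (vec_borel j.n)"
      using Suc j unfolding invariant_def by (intro up) blast
    have avj: "Measurable.pred (F_alg (Suc k)) (avail m z j k)"
      unfolding avail_def[abs_def] by (intro pred_intros_finite pred_intros_logic att) auto
    have "Measurable.pred (F_alg (Suc k)) (success m z j k)"
      unfolding success_def[abs_def] using avj att[of k j] j' by (intro pred_intros_logic) auto
    then have "j.rest k \<in> measurable (F_alg (Suc k)) (vec_borel j.n)"
      unfolding j.rest_def[abs_def] using gk measurable_vec_const[OF zero_carrier_vec[of j.n], where M="F_alg (Suc k)"]
      by (intro measurable_If) (auto simp: pred_def)
    moreover have "j.innov (Suc k) \<in> measurable (F_alg (Suc k)) (vec_borel j.dy)"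
      by (rule measurable_mono_sets[OF innov_other[OF j'] NF]) (simp del: F_alg.simps)
    ultimately have "(\<lambda>\<omega>. j.A *\<^sub>v j.rest k \<omega> + j.L *\<^sub>v j.innov (Suc k) \<omega>) \<in> measurable (F_alg (Suc k)) (vec_borel j.n)"
      by (intro measurable_vec_add measurable_mult_mat_vec[OF _ j.dims(1)] measurable_mult_mat_vec[OF _ j.L_carrier])
    also have "?this \<longleftrightarrow> ?thesis" by (rule measurable_cong) (simp add: j.gap_Suc del: F_alg.simps)
    finally show ?thesis .
  qed
  show ?case
    unfolding invariant_def using step(1,3) NF att gaps sent gapG symS by blast
qed

end

section \<open>Square-integrable vectors\<close>

context prob_space
begin

definition sq_int :: "('a \<Rightarrow> real) set" where
  "sq_int = {f. f \<in> borel_measurable M \<and> integrable M (\<lambda>\<omega>. (f \<omega>)\<^sup>2)}"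

lemma sq_int_mult:
  "f \<in> sq_int \<Longrightarrow> g \<in> sq_int \<Longrightarrow> integrable M (\<lambda>\<omega>. f \<omega> * g \<omega>)"
  unfolding sq_int_def by (blast intro: integrable_mult_of_squares)

lemma sq_int_const: "(\<lambda>_. c) \<in> sq_int"
  by (simp add: sq_int_def)

lemma sq_int_integrable: "f \<in> sq_int \<Longrightarrow> integrable M f"
  using sq_int_mult[OF _ sq_int_const[of 1]] by simp

lemma sq_int_add: "f \<in> sq_int \<Longrightarrow> g \<in> sq_int \<Longrightarrow> (\<lambda>\<omega>. f \<omega> + g \<omega>) \<in> sq_int"
proof -
  assume fg: "f \<in> sq_int" "g \<in> sq_int"
  have "integrable M (\<lambda>\<omega>. (f \<omega>)\<^sup>2 + 2 * (f \<omega> * g \<omega>) + (g \<omega>)\<^sup>2)"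
    using fg sq_int_mult[OF fg] by (simp add: sq_int_def)
  then have "integrable M (\<lambda>\<omega>. (f \<omega> + g \<omega>)\<^sup>2)"
    by (simp add: power2_sum algebra_simps)
  moreover have "(\<lambda>\<omega>. f \<omega> + g \<omega>) \<in> borel_measurable M"
    using fg by (intro borel_measurable_add) (simp_all add: sq_int_def)
  ultimately show ?thesis by (simp add: sq_int_def)
qed

lemma sq_int_cmult: "f \<in> sq_int \<Longrightarrow> (\<lambda>\<omega>. c * f \<omega>) \<in> sq_int"
  by (auto simp: sq_int_def power_mult_distrib)

lemma sq_int_sum: "(\<And>j. j \<in> J \<Longrightarrow> f j \<in> sq_int) \<Longrightarrow> (\<lambda>\<omega>. \<Sum>j\<in>J. f j \<omega>) \<in> sq_int"
  by (induction J rule: infinite_finite_induct) (simp_all add: sq_int_const sq_int_add)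

lemma sq_int_cong:
  assumes "f \<in> sq_int" "\<And>\<omega>. \<omega> \<in> space M \<Longrightarrow> g \<omega> = f \<omega>"
  shows "g \<in> sq_int"
proof -
  have "g \<in> borel_measurable M \<longleftrightarrow> f \<in> borel_measurable M" by (rule measurable_cong) (rule assms(2))
  moreover have "integrable M (\<lambda>\<omega>. (g \<omega>)\<^sup>2) \<longleftrightarrow> integrable M (\<lambda>\<omega>. (f \<omega>)\<^sup>2)"
    by (rule Bochner_Integration.integrable_cong) (simp_all add: assms(2))
  ultimately show ?thesis using assms(1) by (simp add: sq_int_def)
qed

definition sq_vec :: "nat \<Rightarrow> ('a \<Rightarrow> real vec) \<Rightarrow> bool" where
  "sq_vec k X \<longleftrightarrow> (\<forall>\<omega>\<in>space M. X \<omega> \<in> carrier_vec k) \<and> (\<forall>a<k. (\<lambda>\<omega>. X \<omega> $ a) \<in> sq_int)"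

lemma sq_vecI:
  "(\<And>\<omega>. \<omega> \<in> space M \<Longrightarrow> X \<omega> \<in> carrier_vec k) \<Longrightarrow> (\<And>a. a < k \<Longrightarrow> (\<lambda>\<omega>. X \<omega> $ a) \<in> sq_int) \<Longrightarrow> sq_vec k X"
  by (simp add: sq_vec_def)

lemma sq_vec_carrier: "sq_vec k X \<Longrightarrow> \<omega> \<in> space M \<Longrightarrow> X \<omega> \<in> carrier_vec k"
  and sq_vec_index: "sq_vec k X \<Longrightarrow> a < k \<Longrightarrow> (\<lambda>\<omega>. X \<omega> $ a) \<in> sq_int"
  by (auto simp: sq_vec_def)

lemma sq_vec_cong:
  assumes "sq_vec k X" "\<And>\<omega>. \<omega> \<in> space M \<Longrightarrow> Y \<omega> = X \<omega>"
  shows "sq_vec k Y"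
proof (rule sq_vecI)
  show "Y \<omega> \<in> carrier_vec k" if "\<omega> \<in> space M" for \<omega>
    using sq_vec_carrier[OF assms(1) that] assms(2)[OF that] by simp
  show "(\<lambda>\<omega>. Y \<omega> $ a) \<in> sq_int" if "a < k" for a
    by (rule sq_int_cong[OF sq_vec_index[OF assms(1) that]]) (simp add: assms(2))
qed

lemma sq_vec_add:
  assumes X: "sq_vec k X" and Y: "sq_vec k Y"
  shows "sq_vec k (\<lambda>\<omega>. X \<omega> + Y \<omega>)"
proof (rule sq_vecI)
  fix a assume a: "a < k"
  show "(\<lambda>\<omega>. (X \<omega> + Y \<omega>) $ a) \<in> sq_int"
  proof (rule sq_int_cong[OF sq_int_add[OF sq_vec_index[OF X a] sq_vec_index[OF Y a]]])
    fix \<omega> assume "\<omega> \<in> space M"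
    then show "(X \<omega> + Y \<omega>) $ a = X \<omega> $ a + Y \<omega> $ a" using a sq_vec_carrier[OF Y, of \<omega>] by simp
  qed
qed (rule add_carrier_vec[OF sq_vec_carrier[OF X] sq_vec_carrier[OF Y]])

lemma sq_vec_mult:
  assumes H: "H \<in> carrier_mat l k" and X: "sq_vec k X"
  shows "sq_vec l (\<lambda>\<omega>. H *\<^sub>v X \<omega>)"
proof (rule sq_vecI)
  fix a assume a: "a < l"
  have "(\<lambda>\<omega>. \<Sum>b<k. H $$ (a, b) * X \<omega> $ b) \<in> sq_int"
    by (intro sq_int_sum sq_int_cmult sq_vec_index[OF X]) simp
  then show "(\<lambda>\<omega>. (H *\<^sub>v X \<omega>) $ a) \<in> sq_int"
    by (rule sq_int_cong) (rule mult_mat_vec_index[OF H sq_vec_carrier[OF X] a])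
qed (rule mult_mat_vec_carrier[OF H sq_vec_carrier[OF X]])

lemma sq_vec_uminus:
  assumes X: "sq_vec k X"
  shows "sq_vec k (\<lambda>\<omega>. - X \<omega>)"
proof (rule sq_vecI)
  fix a assume a: "a < k"
  show "(\<lambda>\<omega>. (- X \<omega>) $ a) \<in> sq_int"
  proof (rule sq_int_cong[OF sq_int_cmult[OF sq_vec_index[OF X a], of "-1"]])
    fix \<omega> assume "\<omega> \<in> space M"
    then show "(- X \<omega>) $ a = - 1 * X \<omega> $ a" using a sq_vec_carrier[OF X, of \<omega>] by simp
  qed
qed (use sq_vec_carrier[OF X] in simp)

lemma sq_vec_minus:
  assumes X: "sq_vec k X" and Y: "sq_vec k Y"
  shows "sq_vec k (\<lambda>\<omega>. X \<omega> - Y \<omega>)"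
  by (rule sq_vec_cong[OF sq_vec_add[OF X sq_vec_uminus[OF Y]]])
    (rule minus_add_uminus_vec[OF sq_vec_carrier[OF X] sq_vec_carrier[OF Y]])

lemma sq_vec_scalar_prod:
  assumes X: "sq_vec k X" and Y: "sq_vec k Y"
  shows "integrable M (\<lambda>\<omega>. X \<omega> \<bullet> Y \<omega>)"
    and "expectation (\<lambda>\<omega>. X \<omega> \<bullet> Y \<omega>) = (\<Sum>a<k. expectation (\<lambda>\<omega>. X \<omega> $ a * Y \<omega> $ a))"
proof -
  have eq: "X \<omega> \<bullet> Y \<omega> = (\<Sum>a<k. X \<omega> $ a * Y \<omega> $ a)" if "\<omega> \<in> space M" for \<omega>
    by (rule scalar_prod_sum[OF sq_vec_carrier[OF Y that]])
  have int: "integrable M (\<lambda>\<omega>. X \<omega> $ a * Y \<omega> $ a)" if "a < k" for a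
    by (rule sq_int_mult[OF sq_vec_index[OF X that] sq_vec_index[OF Y that]])
  have "integrable M (\<lambda>\<omega>. X \<omega> \<bullet> Y \<omega>) \<longleftrightarrow> integrable M (\<lambda>\<omega>. \<Sum>a<k. X \<omega> $ a * Y \<omega> $ a)"
    by (rule Bochner_Integration.integrable_cong) (simp_all add: eq)
  then show "integrable M (\<lambda>\<omega>. X \<omega> \<bullet> Y \<omega>)"
    using Bochner_Integration.integrable_sum[of "{..<k}" M "\<lambda>a \<omega>. X \<omega> $ a * Y \<omega> $ a"] int by simp
  have "expectation (\<lambda>\<omega>. X \<omega> \<bullet> Y \<omega>) = expectation (\<lambda>\<omega>. \<Sum>a<k. X \<omega> $ a * Y \<omega> $ a)"
    by (rule Bochner_Integration.integral_cong) (simp_all add: eq)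
  also have "\<dots> = (\<Sum>a<k. expectation (\<lambda>\<omega>. X \<omega> $ a * Y \<omega> $ a))"
    using int by (intro Bochner_Integration.integral_sum) simp
  finally show "expectation (\<lambda>\<omega>. X \<omega> \<bullet> Y \<omega>) = (\<Sum>a<k. expectation (\<lambda>\<omega>. X \<omega> $ a * Y \<omega> $ a))" .
qed

lemma sq_vec_nsqI:
  assumes X: "X \<in> measurable M (vec_borel k)" and int: "integrable M (\<lambda>\<omega>. X \<omega> \<bullet> X \<omega>)"
  shows "sq_vec k X"
proof (rule sq_vecI)
  show "X \<omega> \<in> carrier_vec k" if "\<omega> \<in> space M" for \<omega> by (rule measurable_vec_borel_carrier[OF X that])
  fix a assume a: "a < k"
  have m: "(\<lambda>\<omega>. X \<omega> $ a) \<in> borel_measurable M" by (rule measurable_compose[OF X measurable_vec_index])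
  have "integrable M (\<lambda>\<omega>. (X \<omega> $ a)\<^sup>2)"
  proof (rule Bochner_Integration.integrable_bound[OF int])
    show "(\<lambda>\<omega>. (X \<omega> $ a)\<^sup>2) \<in> borel_measurable M" using m by measurable
    show "AE \<omega> in M. norm ((X \<omega> $ a)\<^sup>2) \<le> norm (X \<omega> \<bullet> X \<omega>)"
      using index_sq_le_nsq[OF measurable_vec_borel_carrier[OF X] a] by (intro AE_I2) simp
  qed
  with m show "(\<lambda>\<omega>. X \<omega> $ a) \<in> sq_int" by (simp add: sq_int_def)
qed

end

section \<open>Certainty equivalence\<close>

lemma (in lqg_loop) gvec_sq_vec: "gvec k X \<Longrightarrow> sq_vec k X"
  by (intro sq_vecI gvec_carrier) (use gvec_index gauss_moments(2) gauss_measurable in \<open>auto simp: sq_int_def\<close>)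

context cett_loop
begin

lemma F_alg_sub: "sub_alg M (F_alg k)"
  using invariant unfolding invariant_def by blast

lemma F_alg_G_alg: "sets (F_alg k) \<subseteq> sets (G_alg k)"
  using invariant unfolding invariant_def by blast

lemma F_alg_mono: "k \<le> l \<Longrightarrow> sets (F_alg k) \<subseteq> sets (F_alg l)"
  using invariant_step(2)[OF invariant] by (rule lift_Suc_mono_le)

lemma F_alg_measurable_mono: "f \<in> measurable (F_alg k) N \<Longrightarrow> k \<le> l \<Longrightarrow> f \<in> measurable (F_alg l) N"
  by (rule measurable_mono_sets[OF _ F_alg_mono]) (simp_all del: F_alg.simps)

lemma succ_measurable: "Measurable.pred (F_alg (Suc k)) (succ k)"
  unfolding success_def[abs_def]
  using F_alg_measurable_mono[OF invariant_current(2)[OF invariant], of k "Suc k"] invariant_step(4)[OF invariant, of k]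
  by (intro pred_intros_logic) (auto simp del: F_alg.simps)

definition err :: "nat \<Rightarrow> 'w \<Rightarrow> real vec" where
  "err k \<omega> = theta k \<omega> + rest k \<omega>"

text \<open>A transmission only replaces the gap by 0, so the linear recursion keeps second moments
  finite under every control policy.\<close>

lemma sq_gap: "sq_vec n (gap k)" and sq_rest: "sq_vec n (rest k)"
proof -
  have rest: "sq_vec n (rest k)" if g: "sq_vec n (gap k)" for k
  proof (rule sq_vecI)
    show "rest k \<omega> \<in> carrier_vec n" if "\<omega> \<in> space M" for \<omega> by (rule rest_sent_carrier[OF that])
    fix a assume a: "a < n"
    have "rest k \<in> measurable M (vec_borel n)"
      by (rule sub_alg.measurable_F[OF sub_alg_G_alg invariant_step(6)[OF invariant]])
    then have m: "(\<lambda>\<omega>. rest k \<omega> $ a) \<in> borel_measurable M" by (rule measurable_compose[OF _ measurable_vec_index])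
    have "integrable M (\<lambda>\<omega>. (rest k \<omega> $ a)\<^sup>2)"
    proof (rule Bochner_Integration.integrable_bound)
      show "integrable M (\<lambda>\<omega>. (gap k \<omega> $ a)\<^sup>2)" using sq_vec_index[OF g a] by (simp add: sq_int_def)
      show "(\<lambda>\<omega>. (rest k \<omega> $ a)\<^sup>2) \<in> borel_measurable M" using m by measurable
      show "AE \<omega> in M. norm ((rest k \<omega> $ a)\<^sup>2) \<le> norm ((gap k \<omega> $ a)\<^sup>2)"
        using a by (intro AE_I2) (simp add: rest_def)
    qed
    with m show "(\<lambda>\<omega>. rest k \<omega> $ a) \<in> sq_int" by (simp add: sq_int_def)
  qed
  have gap: "sq_vec n (gap k)" for k
  proof (induction k)
    case 0
    show ?case
      by (rule sq_vec_cong[OF sq_vec_mult[OF L_carrier gvec_sq_vec[OF gvec_innov]] gap_0])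
  next
    case (Suc k)
    show ?case
      by (rule sq_vec_cong[OF sq_vec_add[OF sq_vec_mult[OF dims(1) rest[OF Suc]] sq_vec_mult[OF L_carrier gvec_sq_vec[OF gvec_innov]]] gap_Suc])
  qed
  then show "sq_vec n (gap k)" "sq_vec n (rest k)" using rest by blast+
qed

lemma sq_err: "sq_vec n (err k)"
  unfolding err_def[abs_def] by (intro sq_vec_add gvec_sq_vec gvec_theta sq_rest)

text \<open>The two parts of the error are symmetric given different sigma-algebras:
  \<open>theta k\<close> given \<open>G_alg (Suc k)\<close>, which reveals \<open>rest k\<close>,
  and \<open>rest k\<close> given the smaller \<open>F_alg (Suc k)\<close>. Orthogonality is
  therefore added up, not symmetry.\<close>

lemma err_orthogonal:
  assumes Y: "Y \<in> borel_measurable (F_alg (Suc k))" and sq: "Y \<in> sq_int" and a: "a < n"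
  shows "expectation (\<lambda>\<omega>. err k \<omega> $ a * Y \<omega>) = 0"
proof -
  have YG: "Y \<in> borel_measurable (G_alg (Suc k))"
    by (rule measurable_mono_sets[OF Y F_alg_G_alg]) (simp del: F_alg.simps)
  have t: "expectation (\<lambda>\<omega>. theta k \<omega> $ a * Y \<omega>) = 0"
    by (rule sub_alg.sym_given_integral[OF sub_alg_G_alg theta_sym_given YG a])
  have r: "expectation (\<lambda>\<omega>. rest k \<omega> $ a * Y \<omega>) = 0"
    by (rule sub_alg.sym_given_integral[OF F_alg_sub invariant_step(7)[OF invariant] Y a])
  have "expectation (\<lambda>\<omega>. err k \<omega> $ a * Y \<omega>) = expectation (\<lambda>\<omega>. theta k \<omega> $ a * Y \<omega> + rest k \<omega> $ a * Y \<omega>)"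
  proof (rule Bochner_Integration.integral_cong[OF refl])
    fix \<omega> assume "\<omega> \<in> space M"
    then show "err k \<omega> $ a * Y \<omega> = theta k \<omega> $ a * Y \<omega> + rest k \<omega> $ a * Y \<omega>"
      using carrier_vecD[OF rest_sent_carrier(1)] a by (simp add: err_def distrib_right)
  qed
  also have "\<dots> = 0"
    using sq_int_mult[OF sq_vec_index[OF gvec_sq_vec[OF gvec_theta] a] sq] sq_int_mult[OF sq_vec_index[OF sq_rest a] sq]
    by (simp add: t r)
  finally show ?thesis .
qed

lemma bar_est_err: "\<omega> \<in> space M \<Longrightarrow> x k \<omega> = bar_est z i k \<omega> + err k \<omega>"
  unfolding err_def by (rule bar_est_eq(2))

end

locale cett_policy = cett_loop M m i S \<xi> sched z p \<beta> r for M :: "'w measure" and m i S \<xi> sched z p \<beta> r +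
  fixes \<gamma> :: "nat \<Rightarrow> (nat \<Rightarrow> bool \<times> real vec) \<Rightarrow> real vec"
  assumes policy: "\<gamma> \<in> control_policies (S i)" and applies: "applies_policy M m S z i \<gamma>"
begin

text \<open>History, control and controller-side estimates determine each other recursively, hence
  one simultaneous induction. A received \<open>kf_est\<close> is measurable because at a success it
  equals \<open>bar_est\<close>, the sum of \<open>bar_pred\<close> and \<open>sent\<close>.\<close>

lemma information_measurable:
  "bar_pred z i k \<in> measurable (F_alg k) (vec_borel n) \<and>
   (\<forall>l<k. (\<lambda>\<omega>. (succ l \<omega>, if succ l \<omega> then kf_est z i l \<omega> else 0\<^sub>v n)) \<in> measurable (F_alg k) (count_space UNIV \<Otimes>\<^sub>M vec_borel n)) \<and>
   (\<forall>l<k. u l \<in> measurable (F_alg k) (vec_borel d)) \<and> (\<forall>l<k. bar_est z i l \<in> measurable (F_alg k) (vec_borel n)) \<and>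
   (\<forall>l<k. hist m S z i l \<in> measurable (F_alg k) (hist_space (S i) l))"
proof (induction k)
  case 0
  have "(\<lambda>_. 0\<^sub>v n) \<in> measurable N_alg (vec_borel n)" by (rule measurable_vec_const) simp
  also have "?this \<longleftrightarrow> bar_pred z i 0 \<in> measurable N_alg (vec_borel n)"
    by (rule measurable_cong) (simp add: dynamics(3))
  finally show ?case by simp
next
  case (Suc k)
  let ?m = "\<lambda>l \<omega>. (succ l \<omega>, if succ l \<omega> then kf_est z i l \<omega> else 0\<^sub>v n)"
  let ?F = "F_alg (Suc k)"
  have up: "f \<in> measurable ?F N" if "f \<in> measurable (F_alg k) N" for f :: "'w \<Rightarrow> 'c" and N
    by (rule F_alg_measurable_mono[OF that]) simp
  have spF: "space ?F = space M" by (rule space_F_alg)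
  have bar: "bar_pred z i k \<in> measurable ?F (vec_borel n)" using Suc.IH by (blast intro: up)
  have sent: "sent k \<in> measurable ?F (vec_borel n)" by (rule invariant_step(5)[OF invariant])
  have sum: "(\<lambda>\<omega>. bar_pred z i k \<omega> + sent k \<omega>) \<in> measurable ?F (vec_borel n)" by (rule measurable_vec_add[OF bar sent])
  have est: "bar_est z i k \<in> measurable ?F (vec_borel n)"
  proof -
    note sum
    also have "(\<lambda>\<omega>. bar_pred z i k \<omega> + sent k \<omega>) \<in> measurable ?F (vec_borel n) \<longleftrightarrow> ?thesis"
      by (rule measurable_cong) (simp only: spF bar_est_eq(1))
    finally show ?thesis .
  qed
  have "(\<lambda>\<omega>. if succ k \<omega> then bar_est z i k \<omega> else 0\<^sub>v n) \<in> measurable ?F (vec_borel n)"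
    using est measurable_vec_const[OF zero_carrier_vec[of n], where M="?F"] succ_measurable[of k]
    by (intro measurable_If) (auto simp: pred_def simp del: F_alg.simps)
  also have "?this \<longleftrightarrow> (\<lambda>\<omega>. if succ k \<omega> then kf_est z i k \<omega> else 0\<^sub>v n) \<in> measurable ?F (vec_borel n)"
  proof (rule measurable_cong)
    fix \<omega> assume "\<omega> \<in> space ?F"
    then have "\<omega> \<in> space M" by (simp only: spF)
    then show "(if succ k \<omega> then bar_est z i k \<omega> else 0\<^sub>v n) = (if succ k \<omega> then kf_est z i k \<omega> else 0\<^sub>v n)"
      using dynamics(8) by simp
  qed
  finally have "?m k \<in> measurable ?F (count_space UNIV \<Otimes>\<^sub>M vec_borel n)"
    by (rule measurable_Pair[OF succ_measurable])
  then have masked: "?m l \<in> measurable ?F (count_space UNIV \<Otimes>\<^sub>M vec_borel n)" if "l < Suc k" for l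
    using that Suc.IH by (cases "l = k") (auto intro: up simp del: F_alg.simps)
  have hist: "hist m S z i k \<in> measurable ?F (hist_space (S i) k)"
    unfolding hist_def[abs_def] hist_space_def by (rule measurable_restrict) (rule masked, simp)
  have "\<gamma> k \<in> measurable (hist_space (S i) k) (vec_borel d)" using policy by (simp add: control_policies_def)
  from measurable_compose[OF hist this]
  have "(\<lambda>\<omega>. \<gamma> k (hist m S z i k \<omega>)) \<in> measurable ?F (vec_borel d)" .
  also have "?this \<longleftrightarrow> u k \<in> measurable ?F (vec_borel d)"
  proof (rule measurable_cong)
    fix \<omega> assume "\<omega> \<in> space ?F"
    then have "\<omega> \<in> space M" by (simp only: spF)
    then show "\<gamma> k (hist m S z i k \<omega>) = u k \<omega>" using applies unfolding applies_policy_def by metis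
  qed
  finally have u: "u k \<in> measurable ?F (vec_borel d)" .
  have "(\<lambda>\<omega>. A *\<^sub>v bar_est z i k \<omega> + B *\<^sub>v u k \<omega>) \<in> measurable ?F (vec_borel n)"
    by (intro measurable_vec_add measurable_mult_mat_vec[OF _ dims(1)] measurable_mult_mat_vec[OF _ dims(2)] est u)
  also have "?this \<longleftrightarrow> bar_pred z i (Suc k) \<in> measurable ?F (vec_borel n)"
    by (rule measurable_cong) (simp only: spF dynamics(9))
  finally have pred: "bar_pred z i (Suc k) \<in> measurable ?F (vec_borel n)" .
  have all: "u l \<in> measurable ?F (vec_borel d)" "bar_est z i l \<in> measurable ?F (vec_borel n)"
      "hist m S z i l \<in> measurable ?F (hist_space (S i) l)" if "l < Suc k" for l
    using that Suc.IH u est hist by (cases "l = k"; auto intro: up simp del: F_alg.simps)+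
  show ?case
  proof (intro conjI pred)
    show "\<forall>l<Suc k. ?m l \<in> measurable ?F (count_space UNIV \<Otimes>\<^sub>M vec_borel n)" using masked by blast
    show "\<forall>l<Suc k. u l \<in> measurable ?F (vec_borel d)" "\<forall>l<Suc k. bar_est z i l \<in> measurable ?F (vec_borel n)"
      "\<forall>l<Suc k. hist m S z i l \<in> measurable ?F (hist_space (S i) l)"
      using all by blast+
  qed
qed

lemma u_measurable: "u k \<in> measurable (F_alg (Suc k)) (vec_borel d)"
  and bar_est_measurable: "bar_est z i k \<in> measurable (F_alg (Suc k)) (vec_borel n)"
  and hist_measurable: "hist m S z i k \<in> measurable (F_alg (Suc k)) (hist_space (S i) k)"
  using information_measurable[of "Suc k"] by blast+

lemma err_orthogonal_vec:
  assumes Y: "Y \<in> measurable (F_alg (Suc k)) (vec_borel n)" and sq: "sq_vec n Y"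
  shows "expectation (\<lambda>\<omega>. err k \<omega> \<bullet> Y \<omega>) = 0"
  unfolding sq_vec_scalar_prod(2)[OF sq_err sq]
  by (intro sum.neutral ballI err_orthogonal measurable_compose[OF Y measurable_vec_index] sq_vec_index[OF sq]) auto

text \<open>The information of the controller is contained in \<open>F_alg\<close>, conditionally on which the estimation error is symmetric.\<close>

lemma bar_est_is_cond_mean:
  assumes sq: "sq_vec n (bar_est z i k)" and H: "bar_est z i k \<in> measurable (H_alg M m S z i k) (vec_borel n)"
  shows "is_cond_mean M (H_alg M m S z i k) n (x k) (bar_est z i k)"
  unfolding is_cond_mean_def
proof (intro allI impI)
  fix a assume a: "a < n"
  let ?H = "H_alg M m S z i k"
  have "sets ?H \<subseteq> sets (F_alg (Suc k))"
    unfolding H_alg_def using measurable_vimageI[OF hist_measurable] by (simp only: space_F_alg)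
  also have "\<dots> \<subseteq> events" by (rule sub_alg.sets_F[OF F_alg_sub])
  finally have HM: "subalgebra M ?H" by (simp add: subalgebra_def H_alg_def)
  interpret finite_measure_subalgebra M ?H by unfold_locales (rule HM)
  note b = sq_int_integrable[OF sq_vec_index[OF sq a]] and e = sq_int_integrable[OF sq_vec_index[OF sq_err[of k] a]]
  have split: "x k \<omega> $ a = bar_est z i k \<omega> $ a + err k \<omega> $ a" if "\<omega> \<in> space M" for \<omega>
    using a sq_vec_carrier[OF sq_err that, of k] by (simp add: bar_est_err[OF that])
  have "integrable M (\<lambda>\<omega>. x k \<omega> $ a) \<longleftrightarrow> integrable M (\<lambda>\<omega>. bar_est z i k \<omega> $ a + err k \<omega> $ a)"
    by (rule Bochner_Integration.integrable_cong) (simp_all add: split)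
  then have int: "integrable M (\<lambda>\<omega>. x k \<omega> $ a)" using b e by simp
  have "AE \<omega> in M. real_cond_exp M ?H (\<lambda>\<omega>. x k \<omega> $ a) \<omega> = bar_est z i k \<omega> $ a"
  proof (rule real_cond_exp_charact[OF _ int b measurable_compose[OF H measurable_vec_index]])
    fix X assume X: "X \<in> sets ?H"
    have XF: "X \<in> sets (F_alg (Suc k))"
      using X \<open>sets ?H \<subseteq> sets (F_alg (Suc k))\<close> by (rule rev_subsetD)
    have XM: "X \<in> events" using XF sub_alg.sets_F[OF F_alg_sub] by blast
    \<comment> \<open>The test events of the conditional expectation lie in
      \<open>F_alg (Suc k)\<close>, so their indicators are orthogonal to the error.\<close>
    have ind: "indicator X \<in> borel_measurable (F_alg (Suc k))" using XF by (rule borel_measurable_indicator)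
    have "(indicator X :: 'w \<Rightarrow> real) \<in> sq_int"
      unfolding sq_int_def using XM by (auto simp: indicator_def power2_eq_square if_distrib[of "\<lambda>x. x * _"] cong: if_cong
          intro!: integrable_const_bound[where B=1] split: if_splits)
    from err_orthogonal[OF ind this a] have zero: "expectation (\<lambda>\<omega>. err k \<omega> $ a * indicator X \<omega>) = 0" .
    have "(LINT \<omega>:X|M. x k \<omega> $ a) = expectation (\<lambda>\<omega>. indicator X \<omega> *\<^sub>R (bar_est z i k \<omega> $ a) + err k \<omega> $ a * indicator X \<omega>)"
      unfolding set_lebesgue_integral_def by (rule Bochner_Integration.integral_cong) (simp_all add: split distrib_left)
    also have "\<dots> = (LINT \<omega>:X|M. bar_est z i k \<omega> $ a) + expectation (\<lambda>\<omega>. err k \<omega> $ a * indicator X \<omega>)"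
      unfolding set_lebesgue_integral_def
      by (intro Bochner_Integration.integral_add integrable_mult_indicator[OF XM] b integrable_real_mult_indicator[OF XM] e)
    finally show "(LINT \<omega>:X|M. x k \<omega> $ a) = (LINT \<omega>:X|M. bar_est z i k \<omega> $ a)" by (simp add: zero)
  qed
  then have "AE \<omega> in M. bar_est z i k \<omega> $ a = real_cond_exp M ?H (\<lambda>\<omega>. x k \<omega> $ a) \<omega>"
    by eventually_elim simp
  with int show "integrable M (\<lambda>\<omega>. x k \<omega> $ a) \<and> (AE \<omega> in M. bar_est z i k \<omega> $ a = real_cond_exp M ?H (\<lambda>\<omega>. x k \<omega> $ a) \<omega>)"
    by blast
qed

end

section \<open>The cost of a control policy\<close>

context cett_policy
begin

abbreviation "w k \<omega> \<equiv> \<xi> (Proc_Noise i k) \<omega>"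

definition stage_cost :: "nat \<Rightarrow> 'w \<Rightarrow> real" where
  "stage_cost k \<omega> = x k \<omega> \<bullet> (Q *\<^sub>v x k \<omega>) + u k \<omega> \<bullet> (R *\<^sub>v u k \<omega>)"

definition noise_cost :: "nat \<Rightarrow> real" where
  "noise_cost k = expectation (\<lambda>\<omega>. w k \<omega> \<bullet> (P *\<^sub>v w k \<omega>))"

text \<open>The price of the controller's estimation error, which no policy can influence.\<close>

definition gap_cost :: "nat \<Rightarrow> real" where
  "gap_cost k = expectation (\<lambda>\<omega>. (K *\<^sub>v err k \<omega>) \<bullet> (\<Lambda> *\<^sub>v (K *\<^sub>v err k \<omega>)))"

definition dev :: "nat \<Rightarrow> 'w \<Rightarrow> real vec" where
  "dev k \<omega> = u k \<omega> - K *\<^sub>v bar_est z i k \<omega>"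

definition excess_cost :: "nat \<Rightarrow> real" where
  "excess_cost k = expectation (\<lambda>\<omega>. dev k \<omega> \<bullet> (\<Lambda> *\<^sub>v dev k \<omega>))"

definition terminal_cost :: "nat \<Rightarrow> real" where
  "terminal_cost k = expectation (\<lambda>\<omega>. x k \<omega> \<bullet> (P *\<^sub>v x k \<omega>))"

lemma x_carrier: "\<omega> \<in> space M \<Longrightarrow> x k \<omega> \<in> carrier_vec n" and u_carrier: "\<omega> \<in> space M \<Longrightarrow> u k \<omega> \<in> carrier_vec d"
  and w_carrier: "\<omega> \<in> space M \<Longrightarrow> w k \<omega> \<in> carrier_vec n"
  by (simp_all add: kf_carrier noise_carrier)

lemma psd_quadratic_nonneg: "psd_mat k G \<Longrightarrow> y \<in> carrier_vec k \<Longrightarrow> 0 \<le> y \<bullet> (G *\<^sub>v y)"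
  by (simp add: psd_mat_def)

lemma stage_cost_nonneg: "\<omega> \<in> space M \<Longrightarrow> 0 \<le> stage_cost k \<omega>"
  and stage_cost_u: "\<omega> \<in> space M \<Longrightarrow> u k \<omega> \<bullet> (R *\<^sub>v u k \<omega>) \<le> stage_cost k \<omega>"
  using psd_quadratic_nonneg[OF pds(3) x_carrier, of \<omega> k] psd_quadratic_nonneg[OF pd_imp_psd[OF pds(4)] u_carrier, of \<omega> k]
  by (simp_all add: stage_cost_def)

lemma cost_parts_nonneg: "0 \<le> noise_cost k" "0 \<le> gap_cost k" "0 \<le> excess_cost k" "0 \<le> terminal_cost k"
proof -
  have L: "psd_mat d \<Lambda>" and PP: "psd_mat n P" using pd_imp_psd[OF Lambda_pd] pd_imp_psd[OF pds(5)] .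
  show "0 \<le> noise_cost k"
    unfolding noise_cost_def by (intro Bochner_Integration.integral_nonneg_AE AE_I2 psd_quadratic_nonneg[OF PP] w_carrier)
  show "0 \<le> terminal_cost k"
    unfolding terminal_cost_def by (intro Bochner_Integration.integral_nonneg_AE AE_I2 psd_quadratic_nonneg[OF PP] x_carrier)
  show "0 \<le> gap_cost k"
    unfolding gap_cost_def
    by (intro Bochner_Integration.integral_nonneg_AE AE_I2 psd_quadratic_nonneg[OF L] mult_mat_vec_carrier[OF K_carrier] sq_vec_carrier[OF sq_err])
  have "dev k \<omega> \<in> carrier_vec d" if "\<omega> \<in> space M" for \<omega>
    unfolding dev_def by (intro minus_carrier_vec u_carrier[OF that] mult_mat_vec_carrier[OF K_carrier] bar_carrier(2)[OF that])
  then show "0 \<le> excess_cost k"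
    unfolding excess_cost_def by (intro Bochner_Integration.integral_nonneg_AE AE_I2 psd_quadratic_nonneg[OF L])
qed

text \<open>The process noise at time \<open>k\<close> first enters the innovation at time
  \<open>k + 1\<close>, which \<open>G_alg (Suc k)\<close> does not contain.\<close>

lemma w_sym_given: "sym_given M (G_alg (Suc k)) n (w k)"
proof -
  have "indep_of_alg M (G_alg (Suc k)) n (w k)"
    by (rule indep_of_G_alg[OF gvec_noise(2)]) (rule uncorrelated_sym, rule innov_proc, simp)
  then show ?thesis
    by (rule sub_alg.sym_given_indep[OF sub_alg_G_alg _ gvec_symmetric[OF gvec_noise(2)]])
qed

section \<open>Decomposition of the cost for controls with finite second moments\<close>

context
  assumes sq_u: "\<And>k. sq_vec d (u k)"
begin

lemma sq_w: "sq_vec n (w k)" by (rule gvec_sq_vec[OF gvec_noise(2)])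

lemma sq_x: "sq_vec n (x k)"
proof (induction k)
  case 0
  show ?case by (rule sq_vec_cong[OF gvec_sq_vec[OF gvec_noise(1)]]) (rule dynamics(1))
next
  case (Suc k)
  show ?case
    by (rule sq_vec_cong[OF sq_vec_add[OF sq_vec_add[OF sq_vec_mult[OF dims(1) Suc] sq_vec_mult[OF dims(2) sq_u]] sq_w]])
      (rule dynamics(4))
qed

lemma sq_bar: "sq_vec n (bar_est z i k)"
proof (rule sq_vec_cong[OF sq_vec_minus[OF sq_x sq_err]])
  fix \<omega> assume \<omega>: "\<omega> \<in> space M"
  have "bar_est z i k \<omega> \<in> carrier_vec n" "err k \<omega> \<in> carrier_vec n"
    using bar_carrier(2)[OF \<omega>] sq_vec_carrier[OF sq_err \<omega>] by auto
  then show "bar_est z i k \<omega> = x k \<omega> - err k \<omega>"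
    unfolding bar_est_err[OF \<omega>] by (intro eq_vecI) auto
qed

lemma sq_dev: "sq_vec d (dev k)"
  unfolding dev_def[abs_def] by (intro sq_vec_minus sq_u sq_vec_mult[OF K_carrier] sq_bar)

lemma quadratic_integrable: "H \<in> carrier_mat k k \<Longrightarrow> sq_vec k X \<Longrightarrow> integrable M (\<lambda>\<omega>. X \<omega> \<bullet> (H *\<^sub>v X \<omega>))"
  by (intro sq_vec_scalar_prod(1) sq_vec_mult)

lemma stage_cost_integrable: "integrable M (stage_cost k)"
  unfolding stage_cost_def[abs_def]
  by (intro Bochner_Integration.integrable_add quadratic_integrable[OF dims(4) sq_x] quadratic_integrable[OF dims(5) sq_u])

text \<open>The predicted state splits into a part known to \<open>G_alg (Suc k)\<close>, given
  which the noise is symmetric, and the Gaussian part from \<open>theta k\<close>, with which the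
  noise is uncorrelated.\<close>

lemma noise_orthogonal: "expectation (\<lambda>\<omega>. w k \<omega> \<bullet> (P *\<^sub>v (A *\<^sub>v x k \<omega> + B *\<^sub>v u k \<omega>))) = 0"
proof -
  let ?Y1 = "\<lambda>\<omega>. P *\<^sub>v (A *\<^sub>v bar_est z i k \<omega> + B *\<^sub>v u k \<omega> + A *\<^sub>v rest k \<omega>)" and ?Y2 = "\<lambda>\<omega>. P *\<^sub>v (A *\<^sub>v theta k \<omega>)"
  have sq1: "sq_vec n ?Y1"
    by (intro sq_vec_mult[OF dims(6)] sq_vec_add sq_vec_mult[OF dims(1)] sq_vec_mult[OF dims(2)] sq_bar sq_u sq_rest)
  have g2: "gvec n ?Y2" by (intro gvec_mult[OF dims(6)] gvec_mult[OF dims(1)] gvec_theta)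
  note sq2 = gvec_sq_vec[OF g2]
  have FG: "f \<in> measurable (G_alg (Suc k)) N" if "f \<in> measurable (F_alg (Suc k)) N" for f :: "'w \<Rightarrow> 'c" and N
    by (rule measurable_mono_sets[OF that F_alg_G_alg]) (simp del: F_alg.simps)
  have m1: "?Y1 \<in> measurable (G_alg (Suc k)) (vec_borel n)"
    by (intro measurable_mult_mat_vec[OF _ dims(6)] measurable_vec_add measurable_mult_mat_vec[OF _ dims(1)]
        measurable_mult_mat_vec[OF _ dims(2)] FG[OF bar_est_measurable] FG[OF u_measurable] invariant_step(6)[OF invariant])
  have "expectation (\<lambda>\<omega>. w k \<omega> \<bullet> ?Y1 \<omega>) = 0"
    unfolding sq_vec_scalar_prod(2)[OF sq_w sq1]
    by (intro sum.neutral ballI sub_alg.sym_given_integral[OF sub_alg_G_alg w_sym_given] measurable_compose[OF m1 measurable_vec_index]) auto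
  moreover have "expectation (\<lambda>\<omega>. w k \<omega> \<bullet> ?Y2 \<omega>) = 0"
  proof -
    have "cov n n ?Y2 (w k) = 0\<^sub>m n n"
      by (intro uncorrelated_mult[OF dims(6)] uncorrelated_mult[OF dims(1)] gvec_mult[OF dims(1)] gvec_theta gvec_noise theta_proc) simp
    from uncorrelated_sym[OF this] have "expectation (\<lambda>\<omega>. w k \<omega> $ a * ?Y2 \<omega> $ a) = 0" if "a < n" for a
      using that cov_index[OF that that, of "w k" ?Y2] by simp
    then show ?thesis unfolding sq_vec_scalar_prod(2)[OF sq_w sq2] by simp
  qed
  moreover have "expectation (\<lambda>\<omega>. w k \<omega> \<bullet> (P *\<^sub>v (A *\<^sub>v x k \<omega> + B *\<^sub>v u k \<omega>))) = expectation (\<lambda>\<omega>. w k \<omega> \<bullet> ?Y1 \<omega> + w k \<omega> \<bullet> ?Y2 \<omega>)"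
  proof (rule Bochner_Integration.integral_cong[OF refl])
    fix \<omega> assume \<omega>: "\<omega> \<in> space M"
    note c = bar_carrier(2)[OF \<omega>, of k] noise_carrier(7)[OF \<omega>, of k] rest_sent_carrier(1)[OF \<omega>, of k] u_carrier[OF \<omega>, of k]
    have c': "A *\<^sub>v bar_est z i k \<omega> \<in> carrier_vec n" "A *\<^sub>v theta k \<omega> \<in> carrier_vec n" "A *\<^sub>v rest k \<omega> \<in> carrier_vec n" "B *\<^sub>v u k \<omega> \<in> carrier_vec n"
      using c by blast+
    have "A *\<^sub>v x k \<omega> = A *\<^sub>v bar_est z i k \<omega> + (A *\<^sub>v theta k \<omega> + A *\<^sub>v rest k \<omega>)"
      unfolding bar_est_eq(2)[OF \<omega>] mult_add_distrib_mat_vec[OF dims(1) c(1) add_carrier_vec[OF c(2,3)]]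
        mult_add_distrib_mat_vec[OF dims(1) c(2,3)] ..
    then have "A *\<^sub>v x k \<omega> + B *\<^sub>v u k \<omega> = (A *\<^sub>v bar_est z i k \<omega> + B *\<^sub>v u k \<omega> + A *\<^sub>v rest k \<omega>) + A *\<^sub>v theta k \<omega>"
      using c' by (simp only:) (intro eq_vecI; simp del: index_mult_mat_vec dim_mult_mat_vec)
    then have "P *\<^sub>v (A *\<^sub>v x k \<omega> + B *\<^sub>v u k \<omega>) = ?Y1 \<omega> + ?Y2 \<omega>"
      using mult_add_distrib_mat_vec[OF dims(6) add_carrier_vec[OF add_carrier_vec[OF c'(1,4)] c'(3)] c'(2)] by simp
    then show "w k \<omega> \<bullet> (P *\<^sub>v (A *\<^sub>v x k \<omega> + B *\<^sub>v u k \<omega>)) = w k \<omega> \<bullet> ?Y1 \<omega> + w k \<omega> \<bullet> ?Y2 \<omega>"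
      using scalar_prod_add_distrib[OF w_carrier[OF \<omega>] sq_vec_carrier[OF sq1 \<omega>] sq_vec_carrier[OF sq2 \<omega>]] by simp
  qed
  ultimately show ?thesis
    using sq_vec_scalar_prod(1)[OF sq_w sq1] sq_vec_scalar_prod(1)[OF sq_w sq2] by simp
qed

text \<open>Expectation of the completed square with \<open>u - K x = dev - K err\<close>. The cross
  term of \<open>dev\<close> and \<open>err\<close> vanishes because the error is orthogonal to the
  controller's information, that of noise and predicted state by
  \<open>noise_orthogonal\<close>.\<close>

lemma cost_step:
  "expectation (stage_cost k) + terminal_cost (Suc k) = terminal_cost k + (noise_cost k + gap_cost k + excess_cost k)"
proof -
  let ?v = "\<lambda>\<omega>. A *\<^sub>v x k \<omega> + B *\<^sub>v u k \<omega>" and ?e = "\<lambda>\<omega>. K *\<^sub>v err k \<omega>"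
  \<comment> \<open>Moving \<open>K\<close> to the other side turns the cross term into the product
    of \<open>err\<close> with a vector known to \<open>F_alg (Suc k)\<close>.\<close>
  let ?Y = "\<lambda>\<omega>. transpose_mat K *\<^sub>v (\<Lambda> *\<^sub>v dev k \<omega>)"
  have sP: "sym_mat n P" and sL: "sym_mat d \<Lambda>" using pds(5) Lambda_pd by (auto simp: pd_mat_def)
  have Kt: "transpose_mat K \<in> carrier_mat n d" by blast
  have sqv: "sq_vec n ?v" by (intro sq_vec_add sq_vec_mult[OF dims(1)] sq_vec_mult[OF dims(2)] sq_x sq_u)
  have sqe: "sq_vec d ?e" by (rule sq_vec_mult[OF K_carrier sq_err])
  have sqY: "sq_vec n ?Y" by (intro sq_vec_mult[OF Kt] sq_vec_mult[OF Lambda_carrier] sq_dev)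
  have mY: "?Y \<in> measurable (F_alg (Suc k)) (vec_borel n)"
    unfolding dev_def[abs_def]
    by (intro measurable_mult_mat_vec[OF _ Kt] measurable_mult_mat_vec[OF _ Lambda_carrier] measurable_vec_minus
        measurable_mult_mat_vec[OF _ K_carrier] u_measurable bar_est_measurable)
  have point: "stage_cost k \<omega> + x (Suc k) \<omega> \<bullet> (P *\<^sub>v x (Suc k) \<omega>)
      = x k \<omega> \<bullet> (P *\<^sub>v x k \<omega>) + dev k \<omega> \<bullet> (\<Lambda> *\<^sub>v dev k \<omega>) + ?e \<omega> \<bullet> (\<Lambda> *\<^sub>v ?e \<omega>) + w k \<omega> \<bullet> (P *\<^sub>v w k \<omega>)
        + 2 * (w k \<omega> \<bullet> (P *\<^sub>v ?v \<omega>)) - 2 * (err k \<omega> \<bullet> ?Y \<omega>)" if \<omega>: "\<omega> \<in> space M" for \<omega>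
  proof -
    note c = x_carrier[OF \<omega>, of k] u_carrier[OF \<omega>, of k] w_carrier[OF \<omega>, of k] bar_carrier(2)[OF \<omega>, of k]
      sq_vec_carrier[OF sq_err \<omega>, of k] sq_vec_carrier[OF sq_dev \<omega>, of k] sq_vec_carrier[OF sqe \<omega>] sq_vec_carrier[OF sqv \<omega>]
    have me: "- ?e \<omega> \<in> carrier_vec d" using c(7) by simp
    have Kb: "K *\<^sub>v bar_est z i k \<omega> \<in> carrier_vec d" using c(4) by blast
    have Ld: "\<Lambda> *\<^sub>v dev k \<omega> \<in> carrier_vec d" using c(6) by blast
    have "K *\<^sub>v x k \<omega> = K *\<^sub>v bar_est z i k \<omega> + ?e \<omega>"
      unfolding bar_est_err[OF \<omega>] by (rule mult_add_distrib_mat_vec[OF K_carrier c(4,5)])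
    then have ue: "u k \<omega> - K *\<^sub>v x k \<omega> = dev k \<omega> + - ?e \<omega>"
      using c(2,7) Kb unfolding dev_def by (simp only:) (intro eq_vecI; simp del: index_mult_mat_vec dim_mult_mat_vec)
    have "x (Suc k) \<omega> \<bullet> (P *\<^sub>v x (Suc k) \<omega>) = ?v \<omega> \<bullet> (P *\<^sub>v ?v \<omega>) + 2 * (w k \<omega> \<bullet> (P *\<^sub>v ?v \<omega>)) + w k \<omega> \<bullet> (P *\<^sub>v w k \<omega>)"
      unfolding dynamics(4)[OF \<omega>] by (rule quadratic_form_add[OF sP c(8) c(3)])
    moreover have "stage_cost k \<omega> + ?v \<omega> \<bullet> (P *\<^sub>v ?v \<omega>) = x k \<omega> \<bullet> (P *\<^sub>v x k \<omega>) + (dev k \<omega> + - ?e \<omega>) \<bullet> (\<Lambda> *\<^sub>v (dev k \<omega> + - ?e \<omega>))"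
      unfolding stage_cost_def ue[symmetric] by (rule completion_of_squares[OF c(1,2)])
    moreover have "(dev k \<omega> + - ?e \<omega>) \<bullet> (\<Lambda> *\<^sub>v (dev k \<omega> + - ?e \<omega>))
        = dev k \<omega> \<bullet> (\<Lambda> *\<^sub>v dev k \<omega>) + 2 * ((- ?e \<omega>) \<bullet> (\<Lambda> *\<^sub>v dev k \<omega>)) + ?e \<omega> \<bullet> (\<Lambda> *\<^sub>v ?e \<omega>)"
      unfolding quadratic_form_add[OF sL c(6) me] quadratic_form_uminus[OF Lambda_carrier c(7)] ..
    moreover have "(- ?e \<omega>) \<bullet> (\<Lambda> *\<^sub>v dev k \<omega>) = - (err k \<omega> \<bullet> ?Y \<omega>)"
    proof -
      have "(- ?e \<omega>) \<bullet> (\<Lambda> *\<^sub>v dev k \<omega>) = - (?e \<omega> \<bullet> (\<Lambda> *\<^sub>v dev k \<omega>))"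
        by (rule scalar_prod_uminus_left) (metis carrier_vecD c(7) Ld)
      then show ?thesis using scalar_prod_mult_mat_vec[OF K_carrier c(5) Ld] by simp
    qed
    ultimately show ?thesis by linarith
  qed
  have "expectation (stage_cost k) + terminal_cost (Suc k) = expectation (\<lambda>\<omega>. stage_cost k \<omega> + x (Suc k) \<omega> \<bullet> (P *\<^sub>v x (Suc k) \<omega>))"
    unfolding terminal_cost_def
    by (rule Bochner_Integration.integral_add[OF stage_cost_integrable quadratic_integrable[OF dims(6) sq_x], symmetric])
  also have "\<dots> = expectation (\<lambda>\<omega>. x k \<omega> \<bullet> (P *\<^sub>v x k \<omega>) + dev k \<omega> \<bullet> (\<Lambda> *\<^sub>v dev k \<omega>) + ?e \<omega> \<bullet> (\<Lambda> *\<^sub>v ?e \<omega>) + w k \<omega> \<bullet> (P *\<^sub>v w k \<omega>)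
        + 2 * (w k \<omega> \<bullet> (P *\<^sub>v ?v \<omega>)) - 2 * (err k \<omega> \<bullet> ?Y \<omega>))"
    by (rule Bochner_Integration.integral_cong[OF refl]) (rule point)
  also have "\<dots> = terminal_cost k + excess_cost k + gap_cost k + noise_cost k
      + 2 * expectation (\<lambda>\<omega>. w k \<omega> \<bullet> (P *\<^sub>v ?v \<omega>)) - 2 * expectation (\<lambda>\<omega>. err k \<omega> \<bullet> ?Y \<omega>)"
  proof -
    note ints = quadratic_integrable[OF dims(6) sq_x[of k]] quadratic_integrable[OF Lambda_carrier sq_dev[of k]]
      quadratic_integrable[OF Lambda_carrier sqe] quadratic_integrable[OF dims(6) sq_w[of k]]
      integrable_mult_right[OF sq_vec_scalar_prod(1)[OF sq_w[of k] sq_vec_mult[OF dims(6) sqv]], of 2]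
      integrable_mult_right[OF sq_vec_scalar_prod(1)[OF sq_err[of k] sqY], of 2]
    note i2 = Bochner_Integration.integrable_add[OF ints(1,2)]
    note i3 = Bochner_Integration.integrable_add[OF i2 ints(3)]
    note i4 = Bochner_Integration.integrable_add[OF i3 ints(4)]
    note i5 = Bochner_Integration.integrable_add[OF i4 ints(5)]
    show ?thesis
      unfolding terminal_cost_def excess_cost_def gap_cost_def noise_cost_def
      by (simp only: Bochner_Integration.integral_diff[OF i5 ints(6)] Bochner_Integration.integral_add[OF i4 ints(5)]
          Bochner_Integration.integral_add[OF i3 ints(4)] Bochner_Integration.integral_add[OF i2 ints(3)]
          Bochner_Integration.integral_add[OF ints(1,2)] Bochner_Integration.integral_mult_right_zero)
  qed
  also have "\<dots> = terminal_cost k + (noise_cost k + gap_cost k + excess_cost k)"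
    using noise_orthogonal[of k] err_orthogonal_vec[OF mY sqY] by simp
  finally show ?thesis .
qed

lemma total_cost:
  "(\<Sum>k<T. expectation (stage_cost k)) = terminal_cost 0 + (\<Sum>k<T. noise_cost k + gap_cost k) + (\<Sum>k<T. excess_cost k) - terminal_cost T"
proof (induction T)
  case (Suc T)
  then show ?case using cost_step[of T] by simp
qed simp

lemma cost_integral:
  "(\<integral>\<^sup>+ \<omega>. ennreal (\<Sum>k<T. stage_cost k \<omega>) \<partial>M) = ennreal (\<Sum>k<T. expectation (stage_cost k))"
proof -
  have "(\<integral>\<^sup>+ \<omega>. ennreal (\<Sum>k<T. stage_cost k \<omega>) \<partial>M) = ennreal (expectation (\<lambda>\<omega>. \<Sum>k<T. stage_cost k \<omega>))"
    by (intro nn_integral_eq_integral Bochner_Integration.integrable_sum stage_cost_integrable AE_I2 sum_nonneg stage_cost_nonneg)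
  also have "expectation (\<lambda>\<omega>. \<Sum>k<T. stage_cost k \<omega>) = (\<Sum>k<T. expectation (stage_cost k))"
    by (intro Bochner_Integration.integral_sum stage_cost_integrable)
  finally show ?thesis .
qed

definition second_moment :: "nat \<Rightarrow> real" where
  "second_moment k = expectation (\<lambda>\<omega>. x k \<omega> \<bullet> x k \<omega>)"

lemma second_moment_nonneg: "0 \<le> second_moment k"
  unfolding second_moment_def by (intro Bochner_Integration.integral_nonneg_AE AE_I2 nsq_nonneg)

lemma terminal_cost_bound: "\<exists>p\<ge>0. \<forall>k. terminal_cost k \<le> p * second_moment k"
proof -
  obtain p where p: "p \<ge> 0" "\<forall>y\<in>carrier_vec n. y \<bullet> (P *\<^sub>v y) \<le> p * (y \<bullet> y)"
    using quadratic_form_bound[OF dims(6)] by (elim exE conjE)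
  have "terminal_cost k \<le> expectation (\<lambda>\<omega>. p * (x k \<omega> \<bullet> x k \<omega>))" for k
    unfolding terminal_cost_def using p(2) x_carrier
    by (intro integral_mono quadratic_integrable[OF dims(6) sq_x] integrable_mult_right sq_vec_scalar_prod(1)[OF sq_x sq_x]) auto
  then show ?thesis
    using p(1) by (intro exI[of _ p]) (simp add: second_moment_def)
qed

text \<open>\<open>state_bound\<close> is applied to the trajectory restarted at each
  \<open>k\<close>. Every stage cost is then counted at most \<open>N\<close> times, and the noise
  contributes the trace of its covariance at each of \<open>N\<close> steps, which gives the term
  linear in \<open>T\<close>.\<close>

lemma sum_second_moment_bound:
  "\<exists>N. \<exists>c\<ge>0. \<forall>T. (\<Sum>k<T. second_moment k) \<le> c * ((\<Sum>k<T + N. expectation (stage_cost k)) + real T + 1)"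
proof -
  obtain N c where c: "c \<ge> 0" and bound: "\<forall>x u w. noisy_traj x u w \<longrightarrow>
    x 0 \<bullet> x 0 \<le> c * (\<Sum>j<N. x j \<bullet> (Q *\<^sub>v x j) + u j \<bullet> (R *\<^sub>v u j) + w j \<bullet> w j)"
    using state_bound by (elim exE conjE)
  define t where "t = (\<Sum>a<n. mW (S i) $$ (a, a))"
  have ww: "expectation (\<lambda>\<omega>. w k \<omega> \<bullet> w k \<omega>) = t" for k
  proof -
    have "expectation (\<lambda>\<omega>. w k \<omega> $ a * w k \<omega> $ a) = mW (S i) $$ (a, a)" if "a < n" for a
      using cov_index[OF that that, of "w k" "w k"] cov_gaussian_vec[OF gvec_noise(2) noise_gaussian(1), of k] by simp
    then show ?thesis unfolding sq_vec_scalar_prod(2)[OF sq_w sq_w] t_def by simp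
  qed
  have t0: "0 \<le> t"
    unfolding ww[of 0, symmetric] by (intro Bochner_Integration.integral_nonneg_AE AE_I2 nsq_nonneg)
  let ?s = "\<lambda>k. expectation (stage_cost k)"
  have s0: "0 \<le> ?s k" for k by (intro Bochner_Integration.integral_nonneg_AE AE_I2 stage_cost_nonneg)
  have each: "second_moment k \<le> c * (\<Sum>j<N. ?s (k + j) + t)" for k
  proof -
    have int: "integrable M (\<lambda>\<omega>. stage_cost (k + j) \<omega> + w (k + j) \<omega> \<bullet> w (k + j) \<omega>)" for j
      by (intro Bochner_Integration.integrable_add stage_cost_integrable sq_vec_scalar_prod(1)[OF sq_w sq_w])
    have "second_moment k \<le> expectation (\<lambda>\<omega>. c * (\<Sum>j<N. stage_cost (k + j) \<omega> + w (k + j) \<omega> \<bullet> w (k + j) \<omega>))"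
      unfolding second_moment_def
    proof (intro integral_mono sq_vec_scalar_prod(1)[OF sq_x sq_x] integrable_mult_right Bochner_Integration.integrable_sum int)
      fix \<omega> assume \<omega>: "\<omega> \<in> space M"
      have "noisy_traj (\<lambda>j. x (k + j) \<omega>) (\<lambda>j. u (k + j) \<omega>) (\<lambda>j. w (k + j) \<omega>)"
        unfolding noisy_traj_def add_Suc_right using x_carrier[OF \<omega>] u_carrier[OF \<omega>] w_carrier[OF \<omega>] dynamics(4)[OF \<omega>] by blast
      from bound[rule_format, OF this]
      show "x k \<omega> \<bullet> x k \<omega> \<le> c * (\<Sum>j<N. stage_cost (k + j) \<omega> + w (k + j) \<omega> \<bullet> w (k + j) \<omega>)"
        by (simp add: stage_cost_def)
    qed
    also have "\<dots> = c * expectation (\<lambda>\<omega>. \<Sum>j<N. stage_cost (k + j) \<omega> + w (k + j) \<omega> \<bullet> w (k + j) \<omega>)"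
      by (rule Bochner_Integration.integral_mult_right_zero)
    also have "expectation (\<lambda>\<omega>. \<Sum>j<N. stage_cost (k + j) \<omega> + w (k + j) \<omega> \<bullet> w (k + j) \<omega>)
        = (\<Sum>j<N. expectation (\<lambda>\<omega>. stage_cost (k + j) \<omega> + w (k + j) \<omega> \<bullet> w (k + j) \<omega>))"
      by (intro Bochner_Integration.integral_sum int)
    also have "\<dots> = (\<Sum>j<N. ?s (k + j) + t)"
      unfolding ww[symmetric]
      by (intro sum.cong refl Bochner_Integration.integral_add stage_cost_integrable sq_vec_scalar_prod(1)[OF sq_w sq_w] trans[OF Bochner_Integration.integral_add])
        (simp add: ww)
    finally show ?thesis .
  qed
  \<comment> \<open>\<open>t\<close> is the trace of the noise covariance; \<open>1 + t\<close>
    majorises the coefficients of cost and noise together.\<close>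
  have "(\<Sum>k<T. second_moment k) \<le> c * real N * (1 + t) * ((\<Sum>k<T + N. ?s k) + real T + 1)" for T
  proof -
    let ?J = "\<Sum>k<T + N. ?s k"
    have J0: "0 \<le> ?J" using s0 by (intro sum_nonneg)
    have shift: "(\<Sum>k<T. ?s (k + j)) \<le> ?J" if "j < N" for j
    proof -
      have "(\<Sum>k<T. ?s (k + j)) = sum ?s ((\<lambda>k. k + j) ` {..<T})"
        by (subst sum.reindex) auto
      also have "\<dots> \<le> ?J" using that s0 by (intro sum_mono2) auto
      finally show ?thesis .
    qed
    have "(\<Sum>k<T. second_moment k) \<le> (\<Sum>k<T. c * (\<Sum>j<N. ?s (k + j) + t))"
      by (intro sum_mono each)
    also have "\<dots> = c * (\<Sum>j<N. (\<Sum>k<T. ?s (k + j)) + real T * t)"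
      unfolding sum_distrib_left[symmetric] by (subst sum.swap) (simp add: sum.distrib)
    also have "\<dots> \<le> c * (\<Sum>j<N. ?J + real T * t)"
      using c shift by (intro mult_left_mono sum_mono add_right_mono) auto
    also have "\<dots> = c * real N * (?J + real T * t)" by simp
    also have "\<dots> \<le> c * real N * ((1 + t) * (?J + real T + 1))"
    proof (rule mult_left_mono)
      have "0 \<le> t * ?J" "0 \<le> real T" using t0 J0 by auto
      then show "?J + real T * t \<le> (1 + t) * (?J + real T + 1)" using t0 by (simp add: algebra_simps)
    qed (use c in simp)
    finally show ?thesis by (simp only: mult.assoc)
  qed
  moreover have "0 \<le> c * real N * (1 + t)" using c t0 by simp
  ultimately show ?thesis by blast
qed

end

text \<open>Positive definiteness of \<open>R\<close> bounds the control energy by the stage cost,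
  so finite expected costs provide the second moments under which the decomposition holds.\<close>

lemma finite_cost_sq_u:
  assumes fin: "\<And>T. (\<integral>\<^sup>+ \<omega>. ennreal (\<Sum>k<T. stage_cost k \<omega>) \<partial>M) < \<infinity>"
  shows "sq_vec d (u k)"
proof (rule sq_vec_nsqI)
  show um: "u k \<in> measurable M (vec_borel d)"
    by (rule sub_alg.measurable_F[OF F_alg_sub u_measurable])
  obtain r where r: "r > 0" "\<forall>y\<in>carrier_vec d. y \<bullet> y \<le> r * (y \<bullet> (R *\<^sub>v y))"
    using pd_coercive[OF pds(4)] by (elim exE conjE)
  show "integrable M (\<lambda>\<omega>. u k \<omega> \<bullet> u k \<omega>)"
  proof (rule integrableI_bounded)
    show "(\<lambda>\<omega>. u k \<omega> \<bullet> u k \<omega>) \<in> borel_measurable M" by (rule measurable_scalar_prod[OF um um])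
    have "(\<integral>\<^sup>+ \<omega>. ennreal (norm (u k \<omega> \<bullet> u k \<omega>)) \<partial>M) \<le> (\<integral>\<^sup>+ \<omega>. ennreal r * ennreal (\<Sum>k<Suc k. stage_cost k \<omega>) \<partial>M)"
    proof (rule nn_integral_mono)
      fix \<omega> assume \<omega>: "\<omega> \<in> space M"
      have "u k \<omega> \<bullet> u k \<omega> \<le> r * (u k \<omega> \<bullet> (R *\<^sub>v u k \<omega>))" using r(2) u_carrier[OF \<omega>] by blast
      also have "\<dots> \<le> r * stage_cost k \<omega>" using r(1) stage_cost_u[OF \<omega>] by simp
      also have "stage_cost k \<omega> \<le> (\<Sum>k<Suc k. stage_cost k \<omega>)" using stage_cost_nonneg[OF \<omega>] by (simp add: sum_nonneg)
      finally have "u k \<omega> \<bullet> u k \<omega> \<le> r * (\<Sum>k<Suc k. stage_cost k \<omega>)" using r(1) by simp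
      then have "ennreal (norm (u k \<omega> \<bullet> u k \<omega>)) \<le> ennreal (r * (\<Sum>k<Suc k. stage_cost k \<omega>))"
        by (intro ennreal_leI) simp
      then show "ennreal (norm (u k \<omega> \<bullet> u k \<omega>)) \<le> ennreal r * ennreal (\<Sum>k<Suc k. stage_cost k \<omega>)"
        using r(1) stage_cost_nonneg[OF \<omega>] by (simp only: ennreal_mult[OF less_imp_le sum_nonneg])
    qed
    also have "\<dots> = ennreal r * (\<integral>\<^sup>+ \<omega>. ennreal (\<Sum>k<Suc k. stage_cost k \<omega>) \<partial>M)"
    proof (rule nn_integral_cmult)
      have um': "u l \<in> measurable M (vec_borel d)" for l
        by (rule sub_alg.measurable_F[OF F_alg_sub u_measurable])
      have xm: "x l \<in> measurable M (vec_borel n)" for l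
      proof (induction l)
        case 0
        have "\<xi> (Init i) \<in> measurable M (vec_borel n)" by (rule gvec_measurable[OF gvec_noise(1)])
        also have "?this \<longleftrightarrow> ?case" by (rule measurable_cong) (simp add: dynamics(1))
        finally show ?case .
      next
        case (Suc l)
        have "(\<lambda>\<omega>. A *\<^sub>v x l \<omega> + B *\<^sub>v u l \<omega> + w l \<omega>) \<in> measurable M (vec_borel n)"
          by (intro measurable_vec_add measurable_mult_mat_vec[OF _ dims(1)] measurable_mult_mat_vec[OF _ dims(2)] Suc
              sub_alg.measurable_F[OF F_alg_sub u_measurable] gvec_measurable[OF gvec_noise(2)])
        also have "?this \<longleftrightarrow> ?case" by (rule measurable_cong) (simp add: dynamics(4))
        finally show ?case .
      qed
      have "stage_cost l \<in> borel_measurable M" for l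
        unfolding stage_cost_def[abs_def]
        by (intro borel_measurable_add measurable_scalar_prod[OF xm measurable_mult_mat_vec[OF xm dims(4)]]
            measurable_scalar_prod[OF um' measurable_mult_mat_vec[OF um' dims(5)]])
      then show "(\<lambda>\<omega>. ennreal (\<Sum>k<Suc k. stage_cost k \<omega>)) \<in> borel_measurable M"
        by (intro measurable_compose[OF borel_measurable_sum measurable_ennreal])
    qed
    also have "\<dots> < \<infinity>" using fin[of "Suc k"] by (simp add: ennreal_mult_less_top)
    finally show "(\<integral>\<^sup>+ \<omega>. ennreal (norm (u k \<omega> \<bullet> u k \<omega>)) \<partial>M) < \<infinity>" .
  qed
qed

lemma lqg_cost_eq:
  "lqg_cost M S z i = limsup (\<lambda>T. (\<integral>\<^sup>+ \<omega>. ennreal (\<Sum>k<T. stage_cost k \<omega>) \<partial>M) / of_nat T)"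
  unfolding lqg_cost_def stage_cost_def ..

end

section \<open>Optimality of the certainty equivalent controller\<close>

lemma kf_est_dim:
  assumes dyn: "network_dynamics M m S \<xi> sched z" and j: "j \<in> {1..m}" and ok: "subsystem_ok (S j)" and \<omega>: "\<omega> \<in> space M"
  shows "kf_est z j k \<omega> \<in> carrier_vec (dim_x (S j))"
proof -
  interpret lqg_subsystem "S j" by unfold_locales (rule ok)
  have "kf_est z j k \<omega> = kf_pred z j k \<omega> + L *\<^sub>v (outp z j k \<omega> - C *\<^sub>v kf_pred z j k \<omega>)"
    using bspec[OF bspec[OF conjunct1[OF dyn[unfolded network_dynamics_def]] j] \<omega>] by blast
  then show ?thesis
    using carrier_matD(1)[OF L_carrier] by (intro carrier_vecI) simp
qed

lemma policy_control_carrier: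
  assumes dyn: "network_dynamics M m S \<xi> sched z" and j: "j \<in> {1..m}" and ok: "subsystem_ok (S j)" and \<omega>: "\<omega> \<in> space M"
    and \<gamma>: "\<gamma> \<in> control_policies (S j)" "applies_policy M m S z j \<gamma>"
  shows "hist m S z j k \<omega> \<in> space (hist_space (S j) k)" and "control z j k \<omega> \<in> carrier_vec (dim_u (S j))"
proof -
  show h: "hist m S z j k \<omega> \<in> space (hist_space (S j) k)"
    using kf_est_dim[OF dyn j ok \<omega>] by (auto simp: hist_def hist_space_def space_PiM space_pair_measure)
  have "\<gamma> k \<in> measurable (hist_space (S j) k) (vec_borel (dim_u (S j)))"
    using \<gamma>(1) by (simp add: control_policies_def)
  from measurable_space[OF this h] show "control z j k \<omega> \<in> carrier_vec (dim_u (S j))"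
    using \<gamma>(2) \<omega> by (simp add: applies_policy_def)
qed

text \<open>Under the certainty equivalent control the estimate is a function of the history alone.
  The reconstruction exhibits this control as a policy and makes \<open>bar_est\<close> measurable
  for \<open>H_alg\<close>.\<close>

primrec bar_of_hist :: "subsystem \<Rightarrow> nat \<Rightarrow> (nat \<Rightarrow> bool \<times> real vec) \<Rightarrow> real vec" where
  "bar_of_hist S 0 h = (if fst (h 0) then snd (h 0) else 0\<^sub>v (dim_x S))"
| "bar_of_hist S (Suc k) h = (if fst (h (Suc k)) then snd (h (Suc k))
     else mA S *\<^sub>v bar_of_hist S k h + mB S *\<^sub>v (control_gain S *\<^sub>v bar_of_hist S k h))"

context lqg_subsystem
begin

lemma bar_of_hist_measurable:
  assumes "l \<le> k"
  shows "bar_of_hist S l \<in> measurable (hist_space S k) (vec_borel n)"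
  using assms
proof (induction l)
  case 0
  have c: "(\<lambda>h. h 0) \<in> measurable (hist_space S k) (count_space UNIV \<Otimes>\<^sub>M vec_borel n)"
    unfolding hist_space_def by (intro measurable_component_singleton) simp
  have "(\<lambda>h. if fst (h 0) then snd (h 0) else 0\<^sub>v n) \<in> measurable (hist_space S k) (vec_borel n)"
    using measurable_compose[OF c measurable_fst] measurable_compose[OF c measurable_snd]
      measurable_vec_const[OF zero_carrier_vec[of n], where M="hist_space S k"]
    by (intro measurable_If) (auto simp: pred_def)
  then show ?case by simp
next
  case (Suc l)
  have c: "(\<lambda>h. h (Suc l)) \<in> measurable (hist_space S k) (count_space UNIV \<Otimes>\<^sub>M vec_borel n)"
    unfolding hist_space_def using Suc.prems by (intro measurable_component_singleton) simp
  have IH: "bar_of_hist S l \<in> measurable (hist_space S k) (vec_borel n)" using Suc by simp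
  have "(\<lambda>h. A *\<^sub>v bar_of_hist S l h + B *\<^sub>v (K *\<^sub>v bar_of_hist S l h)) \<in> measurable (hist_space S k) (vec_borel n)"
    by (intro measurable_vec_add measurable_mult_mat_vec[OF _ dims(1)] measurable_mult_mat_vec[OF _ dims(2)]
        measurable_mult_mat_vec[OF _ K_carrier] IH)
  then have "(\<lambda>h. if fst (h (Suc l)) then snd (h (Suc l)) else A *\<^sub>v bar_of_hist S l h + B *\<^sub>v (K *\<^sub>v bar_of_hist S l h))
      \<in> measurable (hist_space S k) (vec_borel n)"
    using measurable_compose[OF c measurable_fst] measurable_compose[OF c measurable_snd]
    by (intro measurable_If) (auto simp: pred_def)
  then show ?case by simp
qed

lemma certainty_equivalent_policy: "(\<lambda>k h. K *\<^sub>v bar_of_hist S k h) \<in> control_policies S"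
  unfolding control_policies_def by (auto intro: measurable_mult_mat_vec[OF bar_of_hist_measurable K_carrier])

end

lemma (in network_loop) bar_of_hist_eq:
  assumes u: "\<And>k \<omega>. \<omega> \<in> space M \<Longrightarrow> u k \<omega> = K *\<^sub>v bar_est z i k \<omega>" and \<omega>: "\<omega> \<in> space M" and "l \<le> k"
  shows "bar_of_hist (S i) l (hist m S z i k \<omega>) = bar_est z i l \<omega>"
  using assms(3)
proof (induction l)
  case 0
  show ?case using dynamics(8)[OF \<omega>, of 0] dynamics(3)[OF \<omega>] by (simp add: hist_def)
next
  case (Suc l)
  then have "bar_of_hist (S i) l (hist m S z i k \<omega>) = bar_est z i l \<omega>" by simp
  moreover have "hist m S z i k \<omega> (Suc l) = (succ (Suc l) \<omega>, if succ (Suc l) \<omega> then kf_est z i (Suc l) \<omega> else 0\<^sub>v n)"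
    using Suc.prems by (simp add: hist_def)
  ultimately show ?case
    using dynamics(8)[OF \<omega>, of "Suc l"] dynamics(9)[OF \<omega>, of l] u[OF \<omega>, of l] by simp
qed

text \<open>Here second moments are not drawn from a finite cost but from the recursion itself:
  under this control it is linear and driven only by \<open>sent\<close>, whose moments are
  finite.\<close>

lemma (in cett_loop) sq_bar_certainty_equivalent:
  assumes u: "\<And>k \<omega>. \<omega> \<in> space M \<Longrightarrow> u k \<omega> = K *\<^sub>v bar_est z i k \<omega>"
  shows "sq_vec n (bar_est z i k)"
proof -
  have sent: "sq_vec n (sent k)" for k
  proof (rule sq_vec_cong[OF sq_vec_minus[OF sq_gap[of k] sq_rest[of k]]])
    fix \<omega> assume "\<omega> \<in> space M"
    then show "sent k \<omega> = gap k \<omega> - rest k \<omega>"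
      using bar_carrier(3)[of \<omega> k] by (auto simp: sent_def rest_def intro!: eq_vecI)
  qed
  have est: "sq_vec n (bar_est z i k)" if "sq_vec n (bar_pred z i k)" for k
    by (rule sq_vec_cong[OF sq_vec_add[OF that sent]]) (rule bar_est_eq(1))
  have "sq_vec n (bar_pred z i k)" for k
  proof (induction k)
    case 0
    have "sq_vec n (\<lambda>_. 0\<^sub>v n)" by (rule sq_vecI) (simp_all add: sq_int_const)
    then show ?case by (rule sq_vec_cong) (rule dynamics(3))
  next
    case (Suc k)
    note e = est[OF Suc]
    show ?case
    proof (rule sq_vec_cong[OF sq_vec_add[OF sq_vec_mult[OF dims(1) e] sq_vec_mult[OF dims(2) sq_vec_mult[OF K_carrier e]]]])
      fix \<omega> assume \<omega>: "\<omega> \<in> space M"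
      show "bar_pred z i (Suc k) \<omega> = A *\<^sub>v bar_est z i k \<omega> + B *\<^sub>v (K *\<^sub>v bar_est z i k \<omega>)"
        unfolding dynamics(9)[OF \<omega>] u[OF \<omega>] ..
    qed
  qed
  then show ?thesis by (rule est)
qed

text \<open>Phase and \<open>Psi\<close> are the same under every policy, so a competitor inherits
  well-posedness.\<close>

lemma (in network_loop) well_posed_transfer:
  assumes z': "network_loop M m i S \<xi> sched z'" and cett: "sched i = CETT p \<beta> r"
    and wp: "scheduler_well_posed M m S \<xi> z i (sched i)"
  shows "scheduler_well_posed M m S \<xi> z' i (sched i)"
proof -
  interpret z': network_loop M m i S \<xi> sched z' by (rule z')
  have eq: "est_gap z j k \<omega> = est_gap z' j k \<omega>" "attempt z j k \<omega> = attempt z' j k \<omega>"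
    if "j \<in> {1..m}" "\<omega> \<in> space M" for j k \<omega>
    using network_policy_independent[OF network_loop_axioms z', of k] that by blast+
  have av: "avail m z i k \<omega> = avail m z' i k \<omega>" and su: "succ k \<omega> = z'.succ k \<omega>" if "\<omega> \<in> space M" for k \<omega>
    using eq(2)[OF _ that] loop by (auto simp: avail_def success_def)
  have Psi: "Psi M m S z i k = Psi M m S z' i k" for k
    by (rule Psi_cong) (use eq[OF loop] av in auto)
  have phase: "stett_phase M m S \<xi> z r i k \<omega> = stett_phase M m S \<xi> z' r i k \<omega>" if \<omega>: "\<omega> \<in> space M" for k \<omega>
    unfolding stett_phase_iff[OF cett \<omega>] z'.stett_phase_iff[OF cett \<omega>] su[OF \<omega>] eq(2)[OF loop \<omega>] ..
  show ?thesis
    unfolding cett scheduler_well_posed.simps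
  proof
    fix k
    have "AE \<omega> in M. stett_phase M m S \<xi> z r i k \<omega> \<longrightarrow> invertible_mat (Psi M m S z i k \<omega>)"
      using wp unfolding cett scheduler_well_posed.simps by blast
    then show "AE \<omega> in M. stett_phase M m S \<xi> z' r i k \<omega> \<longrightarrow> invertible_mat (Psi M m S z' i k \<omega>)"
      using AE_space by eventually_elim (simp add: phase Psi)
  qed
qed

text \<open>The two decompositions share the initial, noise and gap terms. The negative terminal
  term is simply discarded for the certainty equivalent controller; for the competitor it works in
  the other direction and is handled by \<open>limsup_average_le\<close>.\<close>

lemma optimal_cost_le:
  assumes c: "cett_policy M m i S \<xi> sched z p \<beta> r \<gamma>" and c': "cett_policy M m i S \<xi> sched z' p \<beta> r \<gamma>'"
    and ce: "\<And>k \<omega>. \<omega> \<in> space M \<Longrightarrow> control z i k \<omega> = control_gain (S i) *\<^sub>v bar_est z i k \<omega>"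
  shows "lqg_cost M S z i \<le> lqg_cost M S z' i"
proof -
  interpret c: cett_policy M m i S \<xi> sched z p \<beta> r \<gamma> by (rule c)
  interpret c': cett_policy M m i S \<xi> sched z' p \<beta> r \<gamma>' by (rule c')
  show ?thesis
  proof (cases "\<forall>T. (\<integral>\<^sup>+ \<omega>. ennreal (\<Sum>k<T. c'.stage_cost k \<omega>) \<partial>M) < \<infinity>")
    \<comment> \<open>Stage costs are nonnegative, so an infinite expected cost at one horizon
      persists and the competitor has infinite average cost.\<close>
    case False
    then obtain T0 where "\<not> (\<integral>\<^sup>+ \<omega>. ennreal (\<Sum>k<T0. c'.stage_cost k \<omega>) \<partial>M) < \<infinity>"
      by blast
    then have T0: "(\<integral>\<^sup>+ \<omega>. ennreal (\<Sum>k<T0. c'.stage_cost k \<omega>) \<partial>M) = \<infinity>"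
      by (simp add: not_less top_unique)
    have "eventually (\<lambda>T. (\<integral>\<^sup>+ \<omega>. ennreal (\<Sum>k<T. c'.stage_cost k \<omega>) \<partial>M) / of_nat T = \<infinity>) sequentially"
      unfolding eventually_sequentially
    proof (intro exI allI impI)
      fix T assume T: "T0 \<le> T"
      have "(\<integral>\<^sup>+ \<omega>. ennreal (\<Sum>k<T0. c'.stage_cost k \<omega>) \<partial>M) \<le> (\<integral>\<^sup>+ \<omega>. ennreal (\<Sum>k<T. c'.stage_cost k \<omega>) \<partial>M)"
        using T by (intro nn_integral_mono ennreal_leI sum_mono2) (auto intro: c'.stage_cost_nonneg)
      then have "(\<integral>\<^sup>+ \<omega>. ennreal (\<Sum>k<T. c'.stage_cost k \<omega>) \<partial>M) = \<infinity>"
        unfolding T0 by (simp add: top_unique)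
      then show "(\<integral>\<^sup>+ \<omega>. ennreal (\<Sum>k<T. c'.stage_cost k \<omega>) \<partial>M) / of_nat T = \<infinity>"
        by (simp add: ennreal_top_divide)
    qed
    then have "limsup (\<lambda>T. (\<integral>\<^sup>+ \<omega>. ennreal (\<Sum>k<T. c'.stage_cost k \<omega>) \<partial>M) / of_nat T) = limsup (\<lambda>_. \<infinity> :: ennreal)"
      by (rule Limsup_eq)
    also have "\<dots> = \<infinity>" by (rule Limsup_const) simp
    finally show ?thesis unfolding c'.lqg_cost_eq by simp
  next
    case True
    have sq': "c.sq_vec c.d (c'.u k)" for k
      by (rule c'.finite_cost_sq_u) (use True in blast)
    have sq: "c.sq_vec c.d (c.u k)" for k
      by (rule c.sq_vec_cong[OF c.sq_vec_mult[OF c.K_carrier c.sq_bar_certainty_equivalent[OF ce]] ce])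
    have eq: "est_gap z j k \<omega> = est_gap z' j k \<omega>" "attempt z j k \<omega> = attempt z' j k \<omega>"
      if "j \<in> {1..m}" "\<omega> \<in> space M" for j k \<omega>
      using network_policy_independent[OF c.network_loop_axioms c'.network_loop_axioms, of k] that by blast+
    have "c.succ k \<omega> = c'.succ k \<omega>" if "\<omega> \<in> space M" for k \<omega>
      using eq(2)[OF _ that] c.loop by (auto simp: avail_def success_def)
    then have err: "c.err k \<omega> = c'.err k \<omega>" if "\<omega> \<in> space M" for k \<omega>
      using that eq(1)[OF c.loop that] by (simp add: c.err_def c'.err_def c.rest_def c'.rest_def)
    have gap_cost: "c.gap_cost k = c'.gap_cost k" for k
      unfolding c.gap_cost_def c'.gap_cost_def by (rule Bochner_Integration.integral_cong) (simp_all add: err)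
    have init_cost: "c.terminal_cost 0 = c'.terminal_cost 0"
      unfolding c.terminal_cost_def c'.terminal_cost_def
      by (rule Bochner_Integration.integral_cong) (simp_all add: c.dynamics(1) c'.dynamics(1))
    have no_excess: "c.excess_cost k = 0" for k
    proof -
      have "c.dev k \<omega> \<bullet> (c.\<Lambda> *\<^sub>v c.dev k \<omega>) = 0" if \<omega>: "\<omega> \<in> space M" for \<omega>
      proof -
        have Kb: "c.K *\<^sub>v bar_est z i k \<omega> \<in> carrier_vec c.d"
          by (rule mult_mat_vec_carrier[OF c.K_carrier c.bar_carrier(2)[OF \<omega>]])
        then have "c.dev k \<omega> = 0\<^sub>v c.d" unfolding c.dev_def ce[OF \<omega>] by (intro eq_vecI) auto
        then show ?thesis using mult_mat_vec_carrier[OF c.Lambda_carrier zero_carrier_vec] by simp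
      qed
      then have "c.excess_cost k = c.expectation (\<lambda>_. 0)"
        unfolding c.excess_cost_def by (intro Bochner_Integration.integral_cong) simp_all
      then show ?thesis by simp
    qed
    \<comment> \<open>\<open>a\<close> is the part common to both policies, \<open>b\<close> the
      total cost of the competitor.\<close>
    define a where "a T = c.terminal_cost 0 + (\<Sum>k<T. c.noise_cost k + c.gap_cost k)" for T
    define b where "b T = (\<Sum>k<T. c.expectation (c'.stage_cost k))" for T
    obtain p where p: "p \<ge> 0" "\<forall>k. c'.terminal_cost k \<le> p * c'.second_moment k"
      using c'.terminal_cost_bound[OF sq'] by (elim exE conjE)
    obtain N C where C: "C \<ge> 0" "\<forall>T. (\<Sum>k<T. c'.second_moment k) \<le> C * (b (T + N) + real T + 1)"
      using c'.sum_second_moment_bound[OF sq'] unfolding b_def by (elim exE conjE)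
    have zT: "(\<Sum>k<T. c.expectation (c.stage_cost k)) \<le> a T" for T
      using c.total_cost[OF sq, of T] c.cost_parts_nonneg(4)[of T] by (simp add: a_def no_excess)
    have "lqg_cost M S z i = limsup (\<lambda>T. ennreal (\<Sum>k<T. c.expectation (c.stage_cost k)) / of_nat T)"
      unfolding c.lqg_cost_eq c.cost_integral[OF sq] ..
    also have "\<dots> \<le> limsup (\<lambda>T. ennreal (a T) / of_nat T)"
      by (intro Limsup_mono always_eventually allI divide_right_mono_ennreal ennreal_leI zT)
    also have "\<dots> \<le> limsup (\<lambda>T. ennreal (b T) / of_nat T)"
    proof (rule limsup_average_le[OF _ _ c'.second_moment_nonneg[OF sq'] p(1) C(1)])
      show "mono a"
        unfolding a_def using c.cost_parts_nonneg(1,2)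
        by (intro monoI add_left_mono sum_mono2) (auto intro: add_nonneg_nonneg)
      show "0 \<le> b T" for T
        unfolding b_def by (intro sum_nonneg Bochner_Integration.integral_nonneg_AE AE_I2 c'.stage_cost_nonneg)
      \<comment> \<open>The excess cost is nonnegative; only the terminal cost can push
        \<open>b\<close> below \<open>a\<close>.\<close>
      show "a T \<le> b T + p * c'.second_moment T" for T
      proof -
        have "b T = a T + (\<Sum>k<T. c'.excess_cost k) - c'.terminal_cost T"
          unfolding b_def c'.total_cost[OF sq'] a_def init_cost gap_cost c.noise_cost_def c'.noise_cost_def ..
        moreover have "0 \<le> (\<Sum>k<T. c'.excess_cost k)" by (intro sum_nonneg c'.cost_parts_nonneg(3))
        moreover have "c'.terminal_cost T \<le> p * c'.second_moment T" using p(2) by blast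
        ultimately show ?thesis by linarith
      qed
      show "(\<Sum>k<T. c'.second_moment k) \<le> C * (b (T + N) + real T + 1)" for T using C(2) by blast
    qed
    also have "\<dots> = lqg_cost M S z' i"
      unfolding c'.lqg_cost_eq c'.cost_integral[OF sq'] b_def ..
    finally show ?thesis .
  qed
qed

theorem theorem2:
  fixes M :: "'w measure"
    and m i :: nat
    and S :: "nat \<Rightarrow> subsystem"
    and \<xi> :: "prim \<Rightarrow> 'w \<Rightarrow> real vec"
    and sched :: "nat \<Rightarrow> scheduler"
    and p :: "nat \<Rightarrow> real"
    and \<beta> :: "nat \<Rightarrow> real vec \<Rightarrow> bool"
    and r :: "nat \<Rightarrow> real vec \<Rightarrow> ennreal"
    and \<gamma> :: "nat \<Rightarrow> nat \<Rightarrow> (nat \<Rightarrow> bool \<times> real vec) \<Rightarrow> real vec"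
    and z :: "'w trajectory"
  assumes "prob_space M"
    and "i \<in> {1..m}"
    and "\<forall>j\<in>{1..m}. subsystem_ok (S j)"
    and "primitives_ok M m S \<xi>"
    and "\<forall>j\<in>{1..m}. admissible_scheduler M S \<xi> j (sched j)"
    and "sched i = CETT p \<beta> r"
    and "network_dynamics M m S \<xi> sched z"
    and "\<forall>j\<in>{1..m}. scheduler_well_posed M m S \<xi> z j (sched j)"
    and "\<forall>j\<in>{1..m} - {i}. \<gamma> j \<in> control_policies (S j) \<and> applies_policy M m S z j (\<gamma> j)"
    and "\<forall>k. \<forall>\<omega>\<in>space M. control z i k \<omega> = control_gain (S i) *\<^sub>v bar_est z i k \<omega>"
  shows "(\<exists>\<gamma>'\<in>control_policies (S i). applies_policy M m S z i \<gamma>')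
    \<and> (\<forall>k. is_cond_mean M (H_alg M m S z i k) (dim_x (S i)) (state z i k) (bar_est z i k))
    \<and> (\<forall>\<gamma>'\<in>control_policies (S i). \<forall>z' :: 'w trajectory.
          network_dynamics M m S \<xi> sched z'
          \<and> (\<forall>j\<in>{1..m} - {i}. applies_policy M m S z' j (\<gamma> j))
          \<and> applies_policy M m S z' i \<gamma>'
          \<longrightarrow> lqg_cost M S z i \<le> lqg_cost M S z' i)"
proof -
  have loops: "lqg_loop M m i S \<xi>"
    by (rule lqg_loop.intro[OF assms(1) lqg_loop_axioms.intro[OF assms(2) _ assms(4)]]) (use assms(3) in blast)
  interpret sys: lqg_subsystem "S i" by (rule lqg_subsystem.intro) (use assms(2,3) in blast)
  \<comment> \<open>The feedback law refers to the trajectory; the reconstruction from the history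
    turns it into an element of \<open>control_policies\<close>.\<close>
  define \<gamma>0 where "\<gamma>0 k h = control_gain (S i) *\<^sub>v bar_of_hist (S i) k h" for k h
  have \<gamma>0: "\<gamma>0 \<in> control_policies (S i)"
    using sys.certainty_equivalent_policy by (simp add: \<gamma>0_def[abs_def])
  have ce: "control z i k \<omega> = control_gain (S i) *\<^sub>v bar_est z i k \<omega>" if "\<omega> \<in> space M" for k \<omega>
    using assms(10) that by blast
  \<comment> \<open>The dimension comes from the gain for loop \<open>i\<close> and from the assumed
    policies for the other loops.\<close>
  have carrier_z: "control z j k \<omega> \<in> carrier_vec (dim_u (S j))" if "j \<in> {1..m}" "\<omega> \<in> space M" for j k \<omega>
  proof (cases "j = i")
    case True
    then show ?thesis using ce[OF that(2)] carrier_matD(1)[OF sys.K_carrier] by (intro carrier_vecI) simp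
  next
    case False
    then show ?thesis
      using policy_control_carrier(2)[OF assms(7) that(1) _ that(2)] assms(3,9) that by blast
  qed
  have nz: "network_loop M m i S \<xi> sched z"
    by (rule network_loop.intro[OF loops network_loop_axioms.intro[OF assms(7) carrier_z]])
  interpret z: network_loop M m i S \<xi> sched z by (rule nz)
  have cz: "cett_loop M m i S \<xi> sched z p \<beta> r"
    by (rule cett_loop.intro[OF nz]) (rule cett_loop_axioms.intro; use assms(2,5,6,8) in blast)
  have applies: "applies_policy M m S z i \<gamma>0"
    unfolding applies_policy_def \<gamma>0_def using z.bar_of_hist_eq[OF ce] ce by simp
  have pz: "cett_policy M m i S \<xi> sched z p \<beta> r \<gamma>0"
    by (rule cett_policy.intro[OF cz cett_policy_axioms.intro[OF \<gamma>0 applies]])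
  interpret z: cett_policy M m i S \<xi> sched z p \<beta> r \<gamma>0 by (rule pz)
  have "is_cond_mean M (H_alg M m S z i k) (dim_x (S i)) (state z i k) (bar_est z i k)" for k
  proof (rule z.bar_est_is_cond_mean[OF z.sq_bar_certainty_equivalent[OF ce]])
    \<comment> \<open>Measurability has to hold for \<open>H_alg\<close> itself, not just for the
      larger \<open>F_alg (Suc k)\<close>.\<close>
    have "hist m S z i k \<in> measurable (H_alg M m S z i k) (hist_space (S i) k)"
      unfolding H_alg_def
      using policy_control_carrier(1)[OF assms(7,2) sys.ok _ \<gamma>0 applies] by (intro measurable_vimage_algebra1) blast
    from measurable_compose[OF this sys.bar_of_hist_measurable[OF order_refl]]
    have "(\<lambda>\<omega>. bar_of_hist (S i) k (hist m S z i k \<omega>)) \<in> measurable (H_alg M m S z i k) (vec_borel (dim_x (S i)))" .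
    also have "?this \<longleftrightarrow> bar_est z i k \<in> measurable (H_alg M m S z i k) (vec_borel (dim_x (S i)))"
      by (rule measurable_cong) (simp add: H_alg_def z.bar_of_hist_eq[OF ce])
    finally show "bar_est z i k \<in> measurable (H_alg M m S z i k) (vec_borel (dim_x (S i)))" .
  qed
  moreover have "lqg_cost M S z i \<le> lqg_cost M S z' i"
    if \<gamma>': "\<gamma>' \<in> control_policies (S i)" and dyn': "network_dynamics M m S \<xi> sched z'"
      and others: "\<forall>j\<in>{1..m} - {i}. applies_policy M m S z' j (\<gamma> j)" and applies': "applies_policy M m S z' i \<gamma>'"
    for \<gamma>' and z' :: "'w trajectory"
  proof -
    have carrier_z': "control z' j k \<omega> \<in> carrier_vec (dim_u (S j))" if "j \<in> {1..m}" "\<omega> \<in> space M" for j k \<omega>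
    proof (cases "j = i")
      case True
      then show ?thesis
        using policy_control_carrier(2)[OF dyn' assms(2) sys.ok that(2) \<gamma>' applies'] by simp
    next
      case False
      then show ?thesis
        using policy_control_carrier(2)[OF dyn' that(1) _ that(2)] assms(3,9) others that by blast
    qed
    have nz': "network_loop M m i S \<xi> sched z'"
      by (rule network_loop.intro[OF loops network_loop_axioms.intro[OF dyn' carrier_z']])
    \<comment> \<open>Well-posedness is assumed for \<open>z\<close> and carried over to the
      competitor.\<close>
    have "scheduler_well_posed M m S \<xi> z i (sched i)" using assms(2,8) by blast
    note wp' = z.well_posed_transfer[OF nz' assms(6) this]
    have cz': "cett_loop M m i S \<xi> sched z' p \<beta> r"
      by (rule cett_loop.intro[OF nz']) (rule cett_loop_axioms.intro; use assms(5,6) wp' in blast)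
    have "cett_policy M m i S \<xi> sched z' p \<beta> r \<gamma>'"
      by (rule cett_policy.intro[OF cz' cett_policy_axioms.intro[OF \<gamma>' applies']])
    from optimal_cost_le[OF pz this ce] show ?thesis .
  qed
  ultimately show ?thesis
    using \<gamma>0 applies by blast
qed

end
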